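(* Let $D\subset\mathbb{C}$ be a domain and let $f:D\to\mathbb{C}$ be a homeomorphism (onto its image $f(D)$) with finite distortion. Then $f$ is a lower $Q$-homeomorphism at each point $z_0\in\overline{D}$ with $Q(z)=K_f(z)$.
   Context: **Finite distortion.** A homeomorphism $f$ between domains $D$ and $D'$ in $\mathbb{C}$ is of (with) finite distortion if $f\in W^{1,1}_{\mathrm{loc}}(D)$ and $\|f'(z)\|^2\le K(z)\,J_f(z)$ for a.e. $z\in D$ with some a.e. finite function $K$, where $\|f'(z)\|$ is the (operator) norm of the Jacobian matrix and $J_f(z)=\det f'(z)$. $K_f(z)$ denotes the minimal function $K(z)\ge 1$ in this inequality. At points of total differentiability $\|f'(z)\|=|f_z|+|f_{\bar z}|$ and $J_f=|f_z|^2-|f_{\bar z}|^2$; thus $K_f(z)=\|f'(z)\|^2/J_f(z)=(|f_z|+|f_{\bar z}|)/(|f_z|-|f_{\bar z}|)$ if $J_f(z)\ne 0$, $K_f(z)=1$ if $f'(z)=0$, and $K_f(z)=\infty$ at the remaining points (a set of measure zero; $1/\infty=0$). **Dashed lines and modulus.** A dashed line is a continuous map $\gamma$ of an open subset of $\mathbb{R}$ or of a circle into a plane domain; $\int_\gamma\varrho\,ds$ is the integral with respect to length (for injective $\gamma$, the integral of $\varrho$ over the image of $\gamma$ with respect to the 1-dimensional Hausdorff measure). For a family $\Gamma$ of dashed lines, a Borel function $\varrho:\mathbb{C}\to[0,\infty]$ is admissible, $\varrho\in\mathrm{adm}\,\Gamma$, if $\int_\gamma\varrho\,ds\ge 1$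 for every $\gamma\in\Gamma$. The modulus is $M(\Gamma)=\inf_{\varrho\in\mathrm{adm}\,\Gamma}\int_{\mathbb{C}}\varrho^2\,dm$, with $m$ Lebesgue measure. A property holds for a.e. $\gamma\in\Gamma$ if the subfamily of those $\gamma\in\Gamma$ for which it fails has modulus zero. A Lebesgue measurable $\varrho:\mathbb{C}\to[0,\infty]$ is extensively admissible, $\varrho\in\mathrm{ext\,adm}\,\Gamma$, if $\int_\gamma\varrho\,ds\ge 1$ for a.e. $\gamma\in\Gamma$. **Lower $Q$-homeomorphism.** Let $D,D'$ be domains in $\overline{\mathbb{C}}=\mathbb{C}\cup\{\infty\}$, $z_0\in\overline{D}\setminus\{\infty\}$, and $Q$ a positive (a.e. finite) measurable function on $D$. A homeomorphism $f:D\to D'$ is a lower $Q$-homeomorphism at $z_0$ if $$M(f\Sigma_\varepsilon)\ \ge\ \inf_{\varrho\in\mathrm{ext\,adm}\,\Sigma_\varepsilon}\ \int_{D\cap R_\varepsilon}\frac{\varrho^2(z)}{Q(z)}\,dm(z)$$ for every ring $R_\varepsilon=\{z\in\mathbb{C}:\varepsilon<|z-z_0|<\varepsilon_0\}$, $\varepsilon\in(0,\varepsilon_0)$, $\varepsilon_0\in(0,d_0)$, $d_0=\sup_{z\in D}|z-z_0|$, where $\Sigma_\varepsilon$ is the family of all intersections $D\cap S(z_0,r)$ of the circles $S(z_0,r)=\{|z-z_0|=r\}$, $r\in(\varepsilon,\varepsilon_0)$, with $D$, and $f\Sigma_\varepsilon$ is the family of their images. If $z_0=\infty\in\overline{D}$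 (closure in $\overline{\mathbb{C}}$), $f$ is a lower $Q$-homeomorphism at $\infty$ if $F=f\circ T$ is a lower $Q_*$-homeomorphism at $0$ with $Q_*=Q\circ T$, where $T(z)=z/|z|^2$, $T(\infty)=0$, $T(0)=\infty$. *)

theory Defs
  imports "HOL-Analysis.Analysis"
begin

section \<open>Homeomorphisms with finite distortion\<close>

text \<open>Real-linear maps of the plane, as maps \<open>complex \<Rightarrow> complex\<close>: \<open>det2 L\<close> is the determinant of the
  matrix of \<open>L\<close> in the basis \<open>1, \<i>\<close>, and \<open>lin_of a b\<close> is the map whose matrix has columns \<open>a, b\<close>.
  The operator norm is \<open>onorm\<close>.\<close>

definition det2 :: "(complex \<Rightarrow> complex) \<Rightarrow> real" where
  "det2 L = Re (L 1) * Im (L \<i>) - Im (L 1) * Re (L \<i>)"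

definition lin_of :: "complex \<Rightarrow> complex \<Rightarrow> complex \<Rightarrow> complex" where
  "lin_of a b = (\<lambda>h. Re h *\<^sub>R a + Im h *\<^sub>R b)"

text \<open>Weak derivatives are tested against compactly supported \<open>C\<^sup>1\<close> functions, as in the textbooks of
  Brezis and of Evans and Gariepy; by mollification this is equivalent to using smooth ones.\<close>

definition test_function :: "complex set \<Rightarrow> (complex \<Rightarrow> real) \<Rightarrow> bool" where
  "test_function D \<phi> \<longleftrightarrow>
     (\<forall>z. \<phi> differentiable (at z)) \<and>
     (\<forall>h. continuous_on UNIV (\<lambda>z. frechet_derivative \<phi> (at z) h)) \<and>
     compact (closure {z. \<phi> z \<noteq> 0}) \<and> closure {z. \<phi> z \<noteq> 0} \<subseteq> D"

definition locally_integrable :: "complex set \<Rightarrow> (complex \<Rightarrow> complex) \<Rightarrow> bool" where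
  "locally_integrable D g \<longleftrightarrow> (\<forall>C. compact C \<longrightarrow> C \<subseteq> D \<longrightarrow> g absolutely_integrable_on C)"

definition weak_derivative ::
    "complex set \<Rightarrow> complex \<Rightarrow> (complex \<Rightarrow> complex) \<Rightarrow> (complex \<Rightarrow> complex) \<Rightarrow> bool" where
  "weak_derivative D e f g \<longleftrightarrow>
     (\<forall>\<phi>. test_function D \<phi> \<longrightarrow>
        (LINT z:D|lebesgue. frechet_derivative \<phi> (at z) e *\<^sub>R f z) =
        - (LINT z:D|lebesgue. \<phi> z *\<^sub>R g z))"

text \<open>\<open>W11loc D f u v\<close>: \<open>f\<close> belongs to \<open>W\<^sup>1\<^sup>,\<^sup>1\<close> locally in \<open>D\<close>, with weak partial derivatives
  \<open>u\<close> and \<open>v\<close> in \<open>x\<close> and \<open>y\<close> (these are unique up to null sets).\<close>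

definition W11loc ::
    "complex set \<Rightarrow> (complex \<Rightarrow> complex) \<Rightarrow> (complex \<Rightarrow> complex) \<Rightarrow> (complex \<Rightarrow> complex) \<Rightarrow> bool" where
  "W11loc D f u v \<longleftrightarrow>
     locally_integrable D f \<and> locally_integrable D u \<and> locally_integrable D v \<and>
     weak_derivative D 1 f u \<and> weak_derivative D \<i> f v"

text \<open>The bound \<open>K \<ge> 1\<close> is essential: a negative \<open>K\<close> would admit orientation-reversing maps.  An a.e.\
  finite \<open>K\<close> may be taken real-valued, since the inequality is only required almost everywhere.\<close>

definition finite_distortion_homeo :: "complex set \<Rightarrow> (complex \<Rightarrow> complex) \<Rightarrow> bool" where
  "finite_distortion_homeo D f \<longleftrightarrow>
     (\<exists>g. homeomorphism D (f ` D) f g) \<and>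
     (\<exists>u v. W11loc D f u v \<and>
       (\<exists>K :: complex \<Rightarrow> real. (\<forall>z. 1 \<le> K z) \<and>
          (AE z\<in>D in lebesgue.
             (onorm (lin_of (u z) (v z)))\<^sup>2 \<le> K z * det2 (lin_of (u z) (v z)))))"

text \<open>The pointwise dilatation \<open>K\<^sub>f\<close>; the value is \<open>\<infinity>\<close> at points without a total differential and at
  points where the differential is singular but nonzero.  Points with negative Jacobian, which a map
  with finite distortion has at most on a null set, admit no \<open>K \<ge> 1\<close> and also get the value \<open>\<infinity>\<close>.\<close>

definition dilatation :: "(complex \<Rightarrow> complex) \<Rightarrow> complex \<Rightarrow> ennreal" where
  "dilatation f z =
     (if f differentiable (at z) then
        (let L = frechet_derivative f (at z) in
         if det2 L > 0 then ennreal ((onorm L)\<^sup>2 / det2 L)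
         else if L = (\<lambda>_. 0) then 1 else \<infinity>)
      else \<infinity>)"

section \<open>The extended plane\<close>

definition ext_plane :: "complex option topology" where
  "ext_plane = Alexandroff_compactification euclidean"

definition ext_domain :: "complex option set \<Rightarrow> bool" where
  "ext_domain D \<longleftrightarrow> D \<noteq> {} \<and> openin ext_plane D \<and> connectedin ext_plane D"

definition ext_dist :: "complex option \<Rightarrow> complex \<Rightarrow> ennreal" where
  "ext_dist p z0 = (case p of None \<Rightarrow> \<infinity> | Some z \<Rightarrow> ennreal (dist z z0))"

text \<open>\<open>T z = z / \<bar>z\<bar>\<^sup>2\<close>, exchanging \<open>0\<close> and \<open>\<infinity>\<close>.\<close>

definition circle_inversion :: "complex option \<Rightarrow> complex option" where
  "circle_inversion p =
     (case p of None \<Rightarrow> Some 0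
      | Some z \<Rightarrow> if z = 0 then None else Some (z /\<^sub>R (norm z)\<^sup>2))"

section \<open>One-dimensional Hausdorff measure\<close>

text \<open>Covers are required to consist of bounded sets because \<open>diameter\<close> is real-valued and meaningless
  on unbounded ones.\<close>

definition hausdorff1_pre :: "real \<Rightarrow> complex set \<Rightarrow> ennreal" where
  "hausdorff1_pre \<delta> A =
     (INF C\<in>{C :: nat \<Rightarrow> complex set.
               A \<subseteq> (\<Union>i. C i) \<and> (\<forall>i. bounded (C i) \<and> diameter (C i) \<le> \<delta>)}.
        \<Sum>i. ennreal (diameter (C i)))"

definition hausdorff1_outer :: "complex set \<Rightarrow> ennreal" where
  "hausdorff1_outer A = (SUP \<delta>\<in>{0<..}. hausdorff1_pre \<delta> A)"

definition hausdorff1 :: "complex measure" where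
  "hausdorff1 =
     measure_of UNIV (lambda_system UNIV UNIV hausdorff1_outer) hausdorff1_outer"

section \<open>Dashed lines and modulus\<close>

text \<open>A dashed line is a pair of its parameter set and its map.  The parameter set is an open subset
  either of the real line or of the unit circle, both regarded as subsets of the complex plane.\<close>

type_synonym dashed = "complex set \<times> (complex \<Rightarrow> complex option)"

definition dashed_line :: "complex option set \<Rightarrow> dashed \<Rightarrow> bool" where
  "dashed_line D = (\<lambda>(A, \<gamma>).
     (openin (top_of_set \<real>) A \<or> openin (top_of_set (sphere 0 1)) A) \<and>
     \<gamma> ` A \<subseteq> D \<and> continuous_map (top_of_set A) ext_plane \<gamma>)"

text \<open>Integral with respect to length: Hausdorff measure weighted with the multiplicity, so that for
  injective \<open>\<gamma>\<close> it is the integral over the image.  The point \<open>\<infinity>\<close> carries no length.\<close>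

definition length_integral :: "dashed \<Rightarrow> (complex \<Rightarrow> ennreal) \<Rightarrow> ennreal" where
  "length_integral = (\<lambda>(A, \<gamma>) \<rho>.
     \<integral>\<^sup>+ w. \<rho> w * emeasure (count_space UNIV) {t \<in> A. \<gamma> t = Some w} \<partial>hausdorff1)"

definition adm :: "dashed set \<Rightarrow> (complex \<Rightarrow> ennreal) set" where
  "adm \<Gamma> = {\<rho> \<in> borel_measurable borel. \<forall>\<gamma>\<in>\<Gamma>. 1 \<le> length_integral \<gamma> \<rho>}"

definition modulus :: "dashed set \<Rightarrow> ennreal" where
  "modulus \<Gamma> = (INF \<rho>\<in>adm \<Gamma>. \<integral>\<^sup>+ z. (\<rho> z)\<^sup>2 \<partial>lborel)"

definition ext_adm :: "dashed set \<Rightarrow> (complex \<Rightarrow> ennreal) set" where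
  "ext_adm \<Gamma> =
     {\<rho> \<in> borel_measurable lebesgue. modulus {\<gamma> \<in> \<Gamma>. \<not> 1 \<le> length_integral \<gamma> \<rho>} = 0}"

definition dashed_image :: "(complex option \<Rightarrow> complex option) \<Rightarrow> dashed \<Rightarrow> dashed" where
  "dashed_image f = (\<lambda>(A, \<gamma>). (A, f \<circ> \<gamma>))"

text \<open>The intersection of \<open>D\<close> with the circle of centre \<open>z0\<close> and radius \<open>r\<close>.\<close>

definition circle_in :: "complex option set \<Rightarrow> complex \<Rightarrow> real \<Rightarrow> dashed" where
  "circle_in D z0 r =
     ({t \<in> sphere 0 1. Some (z0 + of_real r * t) \<in> D}, \<lambda>t. Some (z0 + of_real r * t))"

definition circle_family :: "complex option set \<Rightarrow> complex \<Rightarrow> real \<Rightarrow> real \<Rightarrow> dashed set" where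
  "circle_family D z0 \<epsilon> \<epsilon>0 = circle_in D z0 ` {\<epsilon><..<\<epsilon>0}"

lemma dashed_line_circle_in:
  assumes "openin ext_plane D"
  shows "dashed_line D (circle_in D z0 r)"
proof -
  let ?\<gamma> = "\<lambda>t. Some (z0 + of_real r * t)"
  have "continuous_on UNIV (\<lambda>t. z0 + of_real r * t)"
    by (intro continuous_intros)
  then have "continuous_map euclidean euclidean (\<lambda>t. z0 + of_real r * t)"
    by simp
  from continuous_map_compose[OF this continuous_map_Some]
  have c: "continuous_map euclidean ext_plane ?\<gamma>"
    by (simp add: ext_plane_def o_def)
  then have "open {t. ?\<gamma> t \<in> D}"
    using openin_continuous_map_preimage[OF c assms] by simp
  then have "openin (top_of_set (sphere 0 1)) (sphere 0 1 \<inter> {t. ?\<gamma> t \<in> D})"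
    by (rule openin_open_Int)
  then have "openin (top_of_set (sphere 0 1)) {t \<in> sphere 0 1. ?\<gamma> t \<in> D}"
    by (simp add: Int_def)
  moreover have "continuous_map (top_of_set {t \<in> sphere 0 1. ?\<gamma> t \<in> D}) ext_plane ?\<gamma>"
    using c by (rule continuous_map_from_subtopology)
  ultimately show ?thesis
    unfolding dashed_line_def circle_in_def by (simp add: image_subset_iff)
qed

lemma dashed_line_image:
  assumes "dashed_line D c" and "continuous_map (subtopology ext_plane D) ext_plane f"
  shows "dashed_line (f ` D) (dashed_image f c)"
proof -
  obtain A \<gamma> where c: "c = (A, \<gamma>)" by fastforce
  have "continuous_map (top_of_set A) (subtopology ext_plane D) \<gamma>"
    using assms(1) by (simp add: c dashed_line_def continuous_map_in_subtopology image_subset_iff_funcset)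
  from continuous_map_compose[OF this assms(2)] show ?thesis
    using assms(1) by (simp add: c dashed_line_def dashed_image_def image_subset_iff)
qed

section \<open>Lower \<open>Q\<close>-homeomorphisms\<close>

definition lower_Q_homeo_finite ::
    "complex option set \<Rightarrow> (complex option \<Rightarrow> complex option) \<Rightarrow> (complex option \<Rightarrow> ennreal)
      \<Rightarrow> complex \<Rightarrow> bool" where
  "lower_Q_homeo_finite D f Q z0 \<longleftrightarrow>
     ext_domain D \<and> ext_domain (f ` D) \<and>
     homeomorphic_map (subtopology ext_plane D) (subtopology ext_plane (f ` D)) f \<and>
     Some z0 \<in> ext_plane closure_of D \<and>
     (\<forall>p\<in>D. 0 < Q p) \<and>
     (\<lambda>z. Q (Some z)) \<in> borel_measurable (lebesgue_on {z. Some z \<in> D}) \<and>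
     (AE z\<in>{z. Some z \<in> D} in lebesgue. Q (Some z) < \<infinity>) \<and>
     (\<forall>\<epsilon> \<epsilon>0. 0 < \<epsilon> \<longrightarrow> \<epsilon> < \<epsilon>0 \<longrightarrow> ennreal \<epsilon>0 < (SUP p\<in>D. ext_dist p z0) \<longrightarrow>
        (INF \<rho>\<in>ext_adm (circle_family D z0 \<epsilon> \<epsilon>0).
           \<integral>\<^sup>+ z\<in>{z. Some z \<in> D \<and> \<epsilon> < dist z z0 \<and> dist z z0 < \<epsilon>0}. ((\<rho> z)\<^sup>2 / Q (Some z)) \<partial>lebesgue)
        \<le> modulus (dashed_image f ` circle_family D z0 \<epsilon> \<epsilon>0))"

definition lower_Q_homeo ::
    "complex option set \<Rightarrow> (complex option \<Rightarrow> complex option) \<Rightarrow> (complex option \<Rightarrow> ennreal)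
      \<Rightarrow> complex option \<Rightarrow> bool" where
  "lower_Q_homeo D f Q p =
     (case p of
        Some z0 \<Rightarrow> lower_Q_homeo_finite D f Q z0
      | None \<Rightarrow> lower_Q_homeo_finite (circle_inversion -` D) (f \<circ> circle_inversion)
                  (Q \<circ> circle_inversion) 0)"

end

(* Let u, v be the weak partial derivatives of f.  By the theorem of Gehring and Lehto f is
   differentiable almost everywhere, with differential h |-> Re h u + Im h v: f is absolutely
   continuous on almost all horizontal and vertical lines, and at a Lebesgue point of u and v the
   maximum principle for open maps extends the linear approximation from good lines to the squares
   they bound.  Testing the weak derivatives in logarithmic polar coordinates about z0 shows that f
   is also absolutely continuous on almost all circles.

   Given rho' admissible for the image family, put rho = (rho' o f) |d_theta f|, where d_theta f is
   the derivative along unit tangents of the circles.  On a circle where f is absolutely continuous,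
   the Hausdorff measure of an image set is at most the integral of |d_theta f|, so rho inherits
   the length condition; the remaining radii form a null set and contribute modulus zero.  Finally
   |d_theta f|^2 <= K_f J_f, and J_f can vanish only together with the differential, so the area
   formula gives the inequality.  The point at infinity is treated in the same way after
   composition with the inversion, which maps circles about 0 to circles about 0. *)
theory Submission
  imports Defs
begin

section \<open>Fubini and change of variables in the plane\<close>

text \<open>\<open>f\<close> may map a null set to a set of positive area, so the area formula is
  applied only on the set where \<open>f\<close> is differentiable; the complement is null in the
  domain, its image is discarded, and the loss has the favourable sign. One-sided estimates suffice
  on curves as well: an upper bound for the Hausdorff measure of image curves and a lower bound for
  that of circles, joined by the angular parameter. Circles are brought back to lines by
  \<open>w \<mapsto> z0 + exp w\<close>, which carries vertical lines to circles. A chain rule for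
  Sobolev functions is bypassed: the test functions are products in logarithmic coordinates times
  the components of a divergence-free field, and against these the Cartesian weak derivatives
  combine to the angular one. Radii are written \<open>exp s\<close> in all exceptional sets, so
  that these are null sets of \<open>s\<close> and the inversion acts as
  \<open>s \<mapsto> - s\<close>. The map and its weak derivatives are replaced by Borel
  representatives, since they are integrated over curves, which are themselves plane null
  sets.\<close>

lemma measurable_Complex_pair [measurable]:
  "(\<lambda>(x, y). Complex x y) \<in> borel \<Otimes>\<^sub>M borel \<rightarrow>\<^sub>M borel"
proof -
  have "(\<lambda>p. Complex (fst p) (snd p)) \<in> borel_measurable (borel \<Otimes>\<^sub>M borel)"
    by (simp add: Complex_eq)
  then show ?thesis by (simp add: case_prod_beta')
qed

lemma lborel_complex_eq_distr:
  "(lborel :: complex measure) = distr (lborel \<Otimes>\<^sub>M lborel) borel (\<lambda>(x, y). Complex x y)"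
proof (rule lborel_eqI)
  have meas: "(\<lambda>(x, y). Complex x y) \<in> lborel \<Otimes>\<^sub>M lborel \<rightarrow>\<^sub>M borel" by measurable
  show "sets (distr (lborel \<Otimes>\<^sub>M lborel) borel (\<lambda>(x, y). Complex x y)) = sets borel"
    by simp
  fix l u :: complex assume le: "\<And>b. b \<in> Basis \<Longrightarrow> l \<bullet> b \<le> u \<bullet> b"
  have le': "Re l \<le> Re u" "Im l \<le> Im u" using le[of 1] le[of \<i>] by (auto simp: Basis_complex_def)
  have vim: "(\<lambda>(x, y). Complex x y) -` box l u \<inter> space (lborel \<Otimes>\<^sub>M lborel) = {Re l<..<Re u} \<times> {Im l<..<Im u}"
    by (auto simp: box_def Basis_complex_def space_pair_measure)
  have "emeasure (distr (lborel \<Otimes>\<^sub>M lborel) borel (\<lambda>(x, y). Complex x y)) (box l u)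
     = emeasure (lborel \<Otimes>\<^sub>M lborel) ({Re l<..<Re u} \<times> {Im l<..<Im u})"
    by (subst emeasure_distr[OF meas]) (simp_all only: vim box_borel)
  also have "\<dots> = ennreal (Re u - Re l) * ennreal (Im u - Im l)"
    using le' by (subst lborel.emeasure_pair_measure_Times) auto
  also have "\<dots> = (\<Prod>b\<in>Basis. (u - l) \<bullet> b)"
    using le' by (auto simp: Basis_complex_def ennreal_mult)
  finally show "emeasure (distr (lborel \<Otimes>\<^sub>M lborel) borel (\<lambda>(x, y). Complex x y)) (box l u)
     = (\<Prod>b\<in>Basis. (u - l) \<bullet> b)" .
qed

lemma nn_integral_complex_iterated:
  fixes f :: "complex \<Rightarrow> ennreal"
  assumes [measurable]: "f \<in> borel_measurable borel"
  shows "(\<integral>\<^sup>+z. f z \<partial>lborel) = (\<integral>\<^sup>+x. \<integral>\<^sup>+y. f (Complex x y) \<partial>lborel \<partial>lborel)"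
    and "(\<integral>\<^sup>+z. f z \<partial>lborel) = (\<integral>\<^sup>+y. \<integral>\<^sup>+x. f (Complex x y) \<partial>lborel \<partial>lborel)"
proof -
  have m: "(\<lambda>(x, y). f (Complex x y)) \<in> borel_measurable (lborel \<Otimes>\<^sub>M lborel)"
    by (auto simp: case_prod_beta' Complex_eq)
  have "(\<integral>\<^sup>+z. f z \<partial>lborel) = (\<integral>\<^sup>+p. f (case p of (x, y) \<Rightarrow> Complex x y) \<partial>(lborel \<Otimes>\<^sub>M lborel))"
    by (subst lborel_complex_eq_distr, subst nn_integral_distr) auto
  also have "\<dots> = (\<integral>\<^sup>+x. \<integral>\<^sup>+y. f (Complex x y) \<partial>lborel \<partial>lborel)"
    using lborel.nn_integral_fst[OF m] by (simp add: case_prod_beta')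
  finally show 1: "(\<integral>\<^sup>+z. f z \<partial>lborel) = (\<integral>\<^sup>+x. \<integral>\<^sup>+y. f (Complex x y) \<partial>lborel \<partial>lborel)" .
  show "(\<integral>\<^sup>+z. f z \<partial>lborel) = (\<integral>\<^sup>+y. \<integral>\<^sup>+x. f (Complex x y) \<partial>lborel \<partial>lborel)"
    unfolding 1 by (rule lborel_pair.Fubini'[symmetric]) (rule m)
qed

lemma integral_complex_iterated:
  fixes f :: "complex \<Rightarrow> complex"
  assumes f: "integrable lborel f"
  shows "(LINT z|lborel. f z) = (LINT x|lborel. LINT y|lborel. f (Complex x y))"
    and "integrable lborel (\<lambda>x. LINT y|lborel. f (Complex x y))"
    and "AE x in lborel. integrable lborel (\<lambda>y. f (Complex x y))"
proof -
  have [measurable]: "f \<in> borel_measurable borel" using f by auto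
  have i: "integrable (lborel \<Otimes>\<^sub>M lborel) (\<lambda>(x, y). f (Complex x y))"
    using f by (subst (asm) lborel_complex_eq_distr, subst (asm) integrable_distr_eq)
      (auto simp: case_prod_beta')
  have "(LINT z|lborel. f z) = (LINT p|(lborel \<Otimes>\<^sub>M lborel). f (case p of (x, y) \<Rightarrow> Complex x y))"
    by (subst lborel_complex_eq_distr, subst integral_distr) auto
  also have "\<dots> = (LINT x|lborel. LINT y|lborel. f (Complex x y))"
    using lborel_pair.integral_fst[OF i] by (simp add: case_prod_beta')
  finally show "(LINT z|lborel. f z) = (LINT x|lborel. LINT y|lborel. f (Complex x y))" .
  show "integrable lborel (\<lambda>x. LINT y|lborel. f (Complex x y))"
    using lborel_pair.integrable_fst[OF i] by simp
  show "AE x in lborel. integrable lborel (\<lambda>y. f (Complex x y))"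
    using lborel_pair.AE_integrable_fst[OF i] by simp
qed

section \<open>The area formula for injective differentiable maps\<close>

lemma emeasure_differentiable_image_vec:
  fixes f :: "real^'n::{finite,wellorder} \<Rightarrow> real^'n::_"
  assumes S: "S \<in> sets lebesgue"
    and d: "\<And>x. x \<in> S \<Longrightarrow> (f has_derivative f' x) (at x within S)"
    and inj: "inj_on f S"
  shows "emeasure lebesgue (f ` S) = (\<integral>\<^sup>+x\<in>S. ennreal \<bar>det (matrix (f' x))\<bar> \<partial>lebesgue)"
proof -
  define G where "G x = (if x \<in> S then \<bar>det (matrix (f' x))\<bar> else 0)" for x
  have "(\<lambda>x. det (matrix (f' x))) \<in> borel_measurable (lebesgue_on S)"
    by (rule borel_measurable_det_Jacobian[OF S]) (use d in auto)
  then have "(\<lambda>x. if x \<in> S then det (matrix (f' x)) else 0) \<in> borel_measurable lebesgue"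
    by (rule borel_measurable_if_I) (rule S)
  then have "(\<lambda>x. \<bar>if x \<in> S then det (matrix (f' x)) else 0\<bar>) \<in> borel_measurable lebesgue"
    by measurable
  moreover have "(\<lambda>x. \<bar>if x \<in> S then det (matrix (f' x)) else 0\<bar>) = G" by (auto simp: G_def)
  ultimately have Gm: "G \<in> borel_measurable lebesgue" by simp
  have fS: "f ` S \<in> sets lebesgue"
    by (rule differentiable_image_in_sets_lebesgue[OF S])
       (use d in \<open>auto simp: differentiable_on_def differentiable_def\<close>)
  have G0: "\<And>x. 0 \<le> G x" by (simp add: G_def)
  have eq: "(\<integral>\<^sup>+x\<in>S. ennreal \<bar>det (matrix (f' x))\<bar> \<partial>lebesgue) = (\<integral>\<^sup>+x. ennreal (G x) \<partial>lebesgue)"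
    by (intro nn_integral_cong) (auto simp: G_def indicator_def)
  \<comment> \<open>The change of variables theorem is an equivalence for each finite value
    \<open>m\<close>: the image has measure \<open>m\<close> exactly when the Jacobian has integral
    \<open>m\<close>. Hence both sides are infinite together, and the formula holds in
    \<open>[0, \<infinity>]\<close>.\<close>
  have iff: "(f ` S \<in> lmeasurable \<and> measure lebesgue (f ` S) = m) \<longleftrightarrow>
      ((\<integral>\<^sup>+x. ennreal (G x) \<partial>lebesgue) = ennreal m \<and> 0 \<le> m)" for m
  proof -
    have "((\<lambda>x. \<bar>det (matrix (f' x))\<bar>) has_integral m) S \<longleftrightarrow> (G has_integral m) UNIV"
      unfolding G_def by (rule has_integral_restrict_UNIV[symmetric])
    then show ?thesis
      using has_measure_differentiable_image[OF S d inj, of m]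
        has_integral_iff_nn_integral_lebesgue[of G m] G0 Gm by simp
  qed
  show ?thesis
  proof (cases "f ` S \<in> lmeasurable")
    case True
    then show ?thesis using iff[of "measure lebesgue (f ` S)"] eq
      by (simp add: emeasure_eq_measure2)
  next
    case False
    then have "emeasure lebesgue (f ` S) = \<infinity>" using fS by (metis fmeasurableI infinity_ennreal_def top.not_eq_extremum)
    moreover have "(\<integral>\<^sup>+x. ennreal (G x) \<partial>lebesgue) = \<infinity>"
    proof (rule ccontr)
      assume "\<not> ?thesis"
      then obtain r where "(\<integral>\<^sup>+x. ennreal (G x) \<partial>lebesgue) = ennreal r" "0 \<le> r"
        by (cases "\<integral>\<^sup>+x. ennreal (G x) \<partial>lebesgue") auto
      then show False using iff[of r] False by simp
    qed
    ultimately show ?thesis using eq by simp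
  qed
qed

text \<open>Determinants of matrices refer to \<open>real^2\<close>; the area formula is proved
  there and carried to the complex plane along this identification, which preserves Lebesgue
  measure.\<close>

definition plane_vec :: "complex \<Rightarrow> real^2" where
  "plane_vec z = (\<chi> i. if i = 1 then Re z else Im z)"

definition vec_plane :: "real^2 \<Rightarrow> complex" where
  "vec_plane v = Complex (v $ 1) (v $ 2)"

lemma plane_vec_inverse [simp]: "vec_plane (plane_vec z) = z" "plane_vec (vec_plane v) = v"
  by (auto simp: vec_plane_def plane_vec_def vec_eq_iff complex_eq_iff) (metis exhaust_2)+

lemma linear_plane_vec: "linear plane_vec" "linear vec_plane"
  by (auto intro!: linearI simp: vec_plane_def plane_vec_def vec_eq_iff complex_eq_iff)

lemma continuous_plane_vec: "continuous_on S plane_vec" "continuous_on T vec_plane"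
  using linear_plane_vec linear_continuous_on linear_conv_bounded_linear by blast+

lemma plane_vec_image: "plane_vec ` S = vec_plane -` S"
  by (metis (mono_tags, lifting) bij_def bij_image_Collect_eq bij_vimage_eq_inv_image inj_def plane_vec_inverse surj_def inv_unique_comp comp_def inv_equality)

lemma lborel_plane_eq_distr: "(lborel :: complex measure) = distr lborel borel vec_plane"
proof (rule lborel_eqI)
  have m: "vec_plane \<in> borel_measurable lborel"
    using continuous_plane_vec by (auto intro: borel_measurable_continuous_onI)
  show "sets (distr lborel borel vec_plane) = sets borel" by simp
  fix l u :: complex assume le: "\<And>b. b \<in> Basis \<Longrightarrow> l \<bullet> b \<le> u \<bullet> b"
  have le': "Re l \<le> Re u" "Im l \<le> Im u" using le[of 1] le[of \<i>] by (auto simp: Basis_complex_def)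
  have "vec_plane -` box l u = box (plane_vec l) (plane_vec u)"
    by (auto simp: box_def Basis_complex_def Basis_vec_def inner_axis forall_2 vec_plane_def plane_vec_def)
  then have "emeasure (distr lborel borel vec_plane) (box l u) = emeasure lborel (box (plane_vec l) (plane_vec u))"
    using m by (subst emeasure_distr) auto
  also have "\<dots> = ennreal (\<Prod>b\<in>Basis. (plane_vec u - plane_vec l) \<bullet> b)"
    using le' by (intro emeasure_lborel_box) (auto simp: Basis_vec_def inner_axis plane_vec_def)
  also have "(\<Prod>b\<in>Basis. (plane_vec u - plane_vec l) \<bullet> b) = (Re u - Re l) * (Im u - Im l)"
  proof -
    have B: "(Basis :: (real^2) set) = {axis 1 1, axis 2 1}" by (auto simp: Basis_vec_def UNIV_2)
    have "axis 1 1 \<noteq> (axis 2 1 :: real^2)" by (simp add: axis_eq_axis)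
    then show ?thesis by (simp add: B inner_axis plane_vec_def)
  qed
  also have "\<dots> = (\<Prod>b\<in>Basis. (u - l) \<bullet> b)"
    by (auto simp: Basis_complex_def)
  finally show "emeasure (distr lborel borel vec_plane) (box l u) = (\<Prod>b\<in>Basis. (u - l) \<bullet> b)" .
qed

text \<open>For the completed measure continuity is not enough: preimages of null sets must be null
  as well, and this follows from the preservation of \<open>lborel\<close>.\<close>

lemma measurable_vec_plane:
  "vec_plane \<in> borel \<rightarrow>\<^sub>M borel" "vec_plane \<in> lebesgue \<rightarrow>\<^sub>M lebesgue"
proof -
  show 1: "vec_plane \<in> borel \<rightarrow>\<^sub>M borel"
    using continuous_plane_vec by (auto intro: borel_measurable_continuous_onI)
  have "distr lebesgue lborel vec_plane = lborel"
    using 1 by (subst distr_completion) (auto simp: lborel_plane_eq_distr[symmetric] cong: distr_cong)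
  then show "vec_plane \<in> lebesgue \<rightarrow>\<^sub>M lebesgue"
    using 1 by (intro completion.measurable_completion2) (auto intro: measurable_completion)
qed

lemma measurable_plane_vec:
  "plane_vec \<in> borel \<rightarrow>\<^sub>M borel" "plane_vec \<in> lebesgue \<rightarrow>\<^sub>M lebesgue"
proof -
  show 1: "plane_vec \<in> borel \<rightarrow>\<^sub>M borel"
    using continuous_plane_vec by (auto intro: borel_measurable_continuous_onI)
  have "distr lborel lborel plane_vec = distr (distr lborel borel vec_plane) lborel plane_vec"
    by (simp add: lborel_plane_eq_distr[symmetric])
  also have "\<dots> = distr lborel lborel (plane_vec \<circ> vec_plane)"
    using 1 measurable_vec_plane(1) by (subst distr_distr) auto
  also have "\<dots> = lborel" by (simp add: o_def distr_id)
  finally have "distr lebesgue lborel plane_vec = lborel"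
    using 1 by (subst distr_completion) auto
  then show "plane_vec \<in> lebesgue \<rightarrow>\<^sub>M lebesgue"
    using 1 by (intro completion.measurable_completion2) (auto intro: measurable_completion)
qed

text \<open>The rule for integrals under \<open>distr\<close> concerns Borel integrands, so
  \<open>g\<close> is exchanged for a Borel function equal to it off a null set \<open>N\<close>;
  the preimage of \<open>N\<close> is null because \<open>vec_plane\<close> preserves
  measure.\<close>

lemma nn_integral_vec_plane:
  fixes g :: "complex \<Rightarrow> ennreal"
  assumes "g \<in> borel_measurable lebesgue"
  shows "(\<integral>\<^sup>+v. g (vec_plane v) \<partial>lebesgue) = (\<integral>\<^sup>+z. g z \<partial>lebesgue)"
proof -
  obtain g' where g' [measurable]: "g' \<in> borel_measurable lborel" and ae: "AE z in lborel. g z = g' z"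
    using completion_ex_borel_measurable[OF assms] by auto
  have m: "vec_plane \<in> lborel \<rightarrow>\<^sub>M borel" using measurable_vec_plane(1) by simp
  obtain N where N0: "\<And>z. z \<in> space lborel - N \<Longrightarrow> g z = g' z" "N \<in> null_sets (lborel :: complex measure)"
    using AE_E3[OF ae] by blast
  then have N: "{z. \<not> g z = g' z} \<subseteq> N" "N \<in> null_sets (lborel :: complex measure)" by auto
  then have "AE z in lborel. z \<notin> N" using AE_not_in by blast
  then have "AE z in distr lborel borel vec_plane. z \<notin> N" by (subst lborel_plane_eq_distr[symmetric])
  then have "AE v in lborel. vec_plane v \<notin> N"
    using N m by (subst (asm) AE_distr_iff) (auto simp: null_sets_def)
  then have "AE v in lborel. g (vec_plane v) = g' (vec_plane v)" using N(1) by auto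
  then have "(\<integral>\<^sup>+v. g (vec_plane v) \<partial>lebesgue) = (\<integral>\<^sup>+v. g' (vec_plane v) \<partial>lborel)"
    unfolding nn_integral_completion by (rule nn_integral_cong_AE)
  also have "\<dots> = (\<integral>\<^sup>+z. g' z \<partial>distr lborel borel vec_plane)"
    using m by (subst nn_integral_distr) auto
  also have "\<dots> = (\<integral>\<^sup>+z. g' z \<partial>lborel)" by (simp add: lborel_plane_eq_distr[symmetric])
  also have "\<dots> = (\<integral>\<^sup>+z. g z \<partial>lebesgue)"
    unfolding nn_integral_completion using ae by (intro nn_integral_cong_AE) auto
  finally show ?thesis .
qed

lemma emeasure_plane_vec:
  assumes "S \<in> sets lebesgue"
  shows "plane_vec ` S \<in> sets lebesgue" "emeasure lebesgue (plane_vec ` S) = emeasure lebesgue S"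
proof -
  show 1: "plane_vec ` S \<in> sets lebesgue"
    using measurable_sets[OF measurable_vec_plane(2) assms] by (simp add: plane_vec_image)
  have "emeasure lebesgue (plane_vec ` S) = (\<integral>\<^sup>+v. indicator S (vec_plane v) \<partial>lebesgue)"
    using nn_integral_indicator[OF 1] by (simp add: plane_vec_image indicator_def vimage_def)
  also have "\<dots> = emeasure lebesgue S" using assms by (subst nn_integral_vec_plane) auto
  finally show "emeasure lebesgue (plane_vec ` S) = emeasure lebesgue S" .
qed

lemma det_plane_vec:
  assumes "linear L"
  shows "det (matrix (plane_vec \<circ> L \<circ> vec_plane)) = det2 L"
proof -
  have "vec_plane (axis 1 1) = 1" "vec_plane (axis 2 1) = \<i>"
    by (auto simp: vec_plane_def complex_eq_iff axis_def)
  then show ?thesis by (simp add: det_2 matrix_def det2_def plane_vec_def)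
qed

lemma has_derivative_plane_conj:
  assumes d: "\<And>x. x \<in> S \<Longrightarrow> (f has_derivative f' x) (at x within S)" and v: "v \<in> plane_vec ` S"
  shows "((plane_vec \<circ> f \<circ> vec_plane) has_derivative (plane_vec \<circ> f' (vec_plane v) \<circ> vec_plane))
    (at v within plane_vec ` S)"
proof -
  let ?T = "plane_vec ` S"
  have vS: "vec_plane v \<in> S" using v by auto
  have im: "vec_plane ` ?T = S" by (auto simp: image_image)
  have 1: "(vec_plane has_derivative vec_plane) (at v within ?T)"
    using linear_plane_vec linear_imp_has_derivative by blast
  have 2: "(f has_derivative f' (vec_plane v)) (at (vec_plane v) within vec_plane ` ?T)"
    using d[OF vS] im by simp
  have 3: "(plane_vec has_derivative plane_vec) (at (f (vec_plane v)))"
    using linear_plane_vec linear_imp_has_derivative by blast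
  have "((f \<circ> vec_plane) has_derivative (f' (vec_plane v) \<circ> vec_plane)) (at v within ?T)"
    using diff_chain_within[OF 1 2] .
  from has_derivative_compose[OF this[unfolded o_def], of plane_vec plane_vec] 3
  show ?thesis unfolding o_def by blast
qed

text \<open>The indicator belongs to the integrand because \<open>f' x\<close> is a derivative, and
  hence linear, only for \<open>x\<close> in \<open>S\<close>.\<close>

lemma borel_measurable_det2:
  fixes f :: "complex \<Rightarrow> complex"
  assumes S: "S \<in> sets lebesgue"
    and d: "\<And>x. x \<in> S \<Longrightarrow> (f has_derivative f' x) (at x within S)"
  shows "(\<lambda>x. indicator S x * \<bar>det2 (f' x)\<bar>) \<in> borel_measurable lebesgue"
proof -
  let ?T = "plane_vec ` S"
  have "(\<lambda>v. det (matrix (plane_vec \<circ> f' (vec_plane v) \<circ> vec_plane))) \<in> borel_measurable (lebesgue_on ?T)"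
    by (rule borel_measurable_det_Jacobian[OF emeasure_plane_vec(1)[OF S]])
       (rule has_derivative_plane_conj[OF d])
  then have "(\<lambda>v. if v \<in> ?T then det (matrix (plane_vec \<circ> f' (vec_plane v) \<circ> vec_plane)) else 0) \<in> borel_measurable lebesgue"
    by (rule borel_measurable_if_I) (rule emeasure_plane_vec(1)[OF S])
  from measurable_compose[OF measurable_plane_vec(2) this]
  have "(\<lambda>z. if plane_vec z \<in> ?T then det (matrix (plane_vec \<circ> f' z \<circ> vec_plane)) else 0) \<in> borel_measurable lebesgue"
    by (simp only: plane_vec_inverse)
  then have "(\<lambda>z. \<bar>if plane_vec z \<in> ?T then det (matrix (plane_vec \<circ> f' z \<circ> vec_plane)) else 0\<bar>) \<in> borel_measurable lebesgue"
    by measurable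
  moreover have "(\<lambda>z. \<bar>if plane_vec z \<in> ?T then det (matrix (plane_vec \<circ> f' z \<circ> vec_plane)) else 0\<bar>)
     = (\<lambda>x. indicator S x * \<bar>det2 (f' x)\<bar>)"
  proof
    fix z
    show "\<bar>if plane_vec z \<in> ?T then det (matrix (plane_vec \<circ> f' z \<circ> vec_plane)) else 0\<bar> = indicator S z * \<bar>det2 (f' z)\<bar>"
    proof (cases "z \<in> S")
      case True
      then have "linear (f' z)" using d has_derivative_linear by blast
      then show ?thesis using True by (simp add: det_plane_vec plane_vec_image)
    qed (simp add: plane_vec_image)
  qed
  ultimately show ?thesis by simp
qed

lemma emeasure_differentiable_image:
  fixes f :: "complex \<Rightarrow> complex"
  assumes S: "S \<in> sets lebesgue"
    and d: "\<And>x. x \<in> S \<Longrightarrow> (f has_derivative f' x) (at x within S)"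
    and inj: "inj_on f S"
  shows "f ` S \<in> sets lebesgue"
    and "emeasure lebesgue (f ` S) = (\<integral>\<^sup>+x\<in>S. ennreal \<bar>det2 (f' x)\<bar> \<partial>lebesgue)"
proof -
  show fS: "f ` S \<in> sets lebesgue"
    by (rule differentiable_image_in_sets_lebesgue[OF S])
       (use d in \<open>auto simp: differentiable_on_def differentiable_def\<close>)
  define F where "F = plane_vec \<circ> f \<circ> vec_plane"
  define F' where "F' v = plane_vec \<circ> f' (vec_plane v) \<circ> vec_plane" for v
  let ?T = "plane_vec ` S"
  have dF: "(F has_derivative F' v) (at v within ?T)" if "v \<in> ?T" for v
    using has_derivative_plane_conj[OF d that] by (simp add: F_def F'_def)
  have injF: "inj_on F ?T"
    using inj by (auto simp: inj_on_def F_def) (metis plane_vec_inverse(1))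
  have "emeasure lebesgue (f ` S) = emeasure lebesgue (F ` ?T)"
    using emeasure_plane_vec(2)[OF fS] by (simp add: F_def image_image)
  also have "\<dots> = (\<integral>\<^sup>+v\<in>?T. ennreal \<bar>det (matrix (F' v))\<bar> \<partial>lebesgue)"
    by (rule emeasure_differentiable_image_vec[OF emeasure_plane_vec(1)[OF S] dF injF])
  also have "\<dots> = (\<integral>\<^sup>+v. (ennreal (indicator S (vec_plane v) * \<bar>det2 (f' (vec_plane v))\<bar>)) \<partial>lebesgue)"
  proof (intro nn_integral_cong)
    fix v
    show "ennreal \<bar>det (matrix (F' v))\<bar> * indicator ?T v = ennreal (indicator S (vec_plane v) * \<bar>det2 (f' (vec_plane v))\<bar>)"
    proof (cases "vec_plane v \<in> S")
      case True
      then have "linear (f' (vec_plane v))" using d has_derivative_linear by blast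
      then show ?thesis using True by (simp add: F'_def det_plane_vec plane_vec_image)
    qed (simp add: plane_vec_image)
  qed
  also have "\<dots> = (\<integral>\<^sup>+z. ennreal (indicator S z * \<bar>det2 (f' z)\<bar>) \<partial>lebesgue)"
    using borel_measurable_det2[OF S d] by (subst nn_integral_vec_plane) auto
  also have "\<dots> = (\<integral>\<^sup>+x\<in>S. ennreal \<bar>det2 (f' x)\<bar> \<partial>lebesgue)"
    by (intro nn_integral_cong) (auto simp: indicator_def)
  finally show "emeasure lebesgue (f ` S) = (\<integral>\<^sup>+x\<in>S. ennreal \<bar>det2 (f' x)\<bar> \<partial>lebesgue)" .
qed

text \<open>The formula for the measure of an image, applied to the part of \<open>S\<close> that
  \<open>f\<close> sends into a Borel set \<open>B\<close>, says that \<open>f\<close> pushes the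
  measure with density \<open>\<bar>det2 (f' x)\<bar>\<close> forward to Lebesgue measure on the
  image. Integrals of Borel functions follow, and the second conclusion serves Bochner integrals in
  the same way.\<close>

lemma nn_integral_differentiable_image:
  fixes f :: "complex \<Rightarrow> complex" and \<rho> :: "complex \<Rightarrow> ennreal"
  assumes S: "S \<in> sets lebesgue"
    and d: "\<And>x. x \<in> S \<Longrightarrow> (f has_derivative f' x) (at x within S)"
    and inj: "inj_on f S" and \<rho>: "\<rho> \<in> borel_measurable borel"
  shows "(\<integral>\<^sup>+x\<in>S. \<rho> (f x) * ennreal \<bar>det2 (f' x)\<bar> \<partial>lebesgue) = (\<integral>\<^sup>+y\<in>f ` S. \<rho> y \<partial>lebesgue)"
    and "distr (density (lebesgue_on S) (\<lambda>x. ennreal \<bar>det2 (f' x)\<bar>)) borel f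
           = distr (lebesgue_on (f ` S)) borel (\<lambda>y. y)"
proof -
  have cont: "continuous_on S f"
    using d by (meson continuous_on_eq_continuous_within has_derivative_continuous)
  have fm: "f \<in> borel_measurable (lebesgue_on S)"
    by (rule continuous_imp_measurable_on_sets_lebesgue[OF cont S])
  have fS: "f ` S \<in> sets lebesgue" using emeasure_differentiable_image(1)[OF S d inj] by blast
  have "(\<lambda>x. indicator S x * \<bar>det2 (f' x)\<bar>) \<in> borel_measurable (lebesgue_on S)"
    using borel_measurable_det2[OF S d] by (rule measurable_restrict_space1)
  then have dm: "(\<lambda>x. ennreal \<bar>det2 (f' x)\<bar>) \<in> borel_measurable (lebesgue_on S)"
    by (subst measurable_cong[where g="\<lambda>x. ennreal (indicator S x * \<bar>det2 (f' x)\<bar>)"]) (auto simp: S)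
  let ?M = "density (lebesgue_on S) (\<lambda>x. ennreal \<bar>det2 (f' x)\<bar>)"
  have fm': "f \<in> ?M \<rightarrow>\<^sub>M borel" using fm by simp
  have idm: "(\<lambda>y. y) \<in> lebesgue_on (f ` S) \<rightarrow>\<^sub>M borel"
    by (intro measurable_restrict_space1 measurable_completion) simp
  show eq: "distr ?M borel f = distr (lebesgue_on (f ` S)) borel (\<lambda>y. y)"
  proof (rule measure_eqI)
    fix B assume "B \<in> sets (distr ?M borel f)"
    then have B: "B \<in> sets borel" by simp
    let ?SB = "S \<inter> f -` B"
    have SBo: "?SB \<in> sets (lebesgue_on S)"
      using measurable_sets[OF fm B] S by (simp add: Int_commute)
    then have SB: "?SB \<in> sets lebesgue" using S by (auto simp: sets_restrict_space_iff)
    have "emeasure (distr ?M borel f) B = emeasure ?M ?SB"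
      using fm' B S by (subst emeasure_distr) (auto simp: Int_commute)
    also have "\<dots> = (\<integral>\<^sup>+x\<in>?SB. ennreal \<bar>det2 (f' x)\<bar> \<partial>lebesgue_on S)"
      using dm SBo by (subst emeasure_density) auto
    also have "\<dots> = (\<integral>\<^sup>+x\<in>?SB. ennreal \<bar>det2 (f' x)\<bar> \<partial>lebesgue)"
      using S by (subst nn_integral_restrict_space) (auto intro!: nn_integral_cong simp: indicator_def)
    also have "\<dots> = emeasure lebesgue (f ` ?SB)"
      by (rule emeasure_differentiable_image(2)[OF SB, symmetric])
         (auto intro: inj_on_subset[OF inj] has_derivative_subset[OF d])
    also have "f ` ?SB = f ` S \<inter> B" by auto
    also have "emeasure lebesgue (f ` S \<inter> B) = emeasure (distr (lebesgue_on (f ` S)) borel (\<lambda>y. y)) B"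
      using idm B fS by (subst emeasure_distr) (auto simp: emeasure_restrict_space Int_commute)
    finally show "emeasure (distr ?M borel f) B = emeasure (distr (lebesgue_on (f ` S)) borel (\<lambda>y. y)) B" .
  qed simp
  have "(\<integral>\<^sup>+x\<in>S. \<rho> (f x) * ennreal \<bar>det2 (f' x)\<bar> \<partial>lebesgue) = (\<integral>\<^sup>+x. ennreal \<bar>det2 (f' x)\<bar> * \<rho> (f x) \<partial>lebesgue_on S)"
    using S by (subst nn_integral_restrict_space) (auto intro!: nn_integral_cong simp: mult_ac)
  also have "\<dots> = (\<integral>\<^sup>+x. \<rho> (f x) \<partial>?M)"
    using dm measurable_compose[OF fm \<rho>] by (subst nn_integral_density) auto
  also have "\<dots> = (\<integral>\<^sup>+y. \<rho> y \<partial>distr ?M borel f)"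
    using \<rho> fm' by (subst nn_integral_distr) auto
  also have "\<dots> = (\<integral>\<^sup>+y. \<rho> y \<partial>lebesgue_on (f ` S))"
    unfolding eq using \<rho> idm by (subst nn_integral_distr) auto
  also have "\<dots> = (\<integral>\<^sup>+y\<in>f ` S. \<rho> y \<partial>lebesgue)"
    using fS by (subst nn_integral_restrict_space) auto
  finally show "(\<integral>\<^sup>+x\<in>S. \<rho> (f x) * ennreal \<bar>det2 (f' x)\<bar> \<partial>lebesgue) = (\<integral>\<^sup>+y\<in>f ` S. \<rho> y \<partial>lebesgue)" .
qed

lemma integral_differentiable_image:
  fixes f :: "complex \<Rightarrow> complex" and G :: "complex \<Rightarrow> complex"
  assumes S: "S \<in> sets lebesgue"
    and d: "\<And>x. x \<in> S \<Longrightarrow> (f has_derivative f' x) (at x within S)"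
    and inj: "inj_on f S" and G: "G \<in> borel_measurable borel"
  shows "(LINT x:S|lebesgue. \<bar>det2 (f' x)\<bar> *\<^sub>R G (f x)) = (LINT y:f ` S|lebesgue. G y)"
proof -
  have cont: "continuous_on S f"
    using d by (meson continuous_on_eq_continuous_within has_derivative_continuous)
  have fm: "f \<in> borel_measurable (lebesgue_on S)"
    by (rule continuous_imp_measurable_on_sets_lebesgue[OF cont S])
  have fS: "f ` S \<in> sets lebesgue" using emeasure_differentiable_image(1)[OF S d inj] by blast
  have "(\<lambda>x. indicator S x * \<bar>det2 (f' x)\<bar>) \<in> borel_measurable (lebesgue_on S)"
    using borel_measurable_det2[OF S d] by (rule measurable_restrict_space1)
  then have dm: "(\<lambda>x. \<bar>det2 (f' x)\<bar>) \<in> borel_measurable (lebesgue_on S)"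
    by (subst measurable_cong[where g="\<lambda>x. (indicator S x * \<bar>det2 (f' x)\<bar>)"]) (auto simp: S)
  let ?M = "density (lebesgue_on S) (\<lambda>x. ennreal \<bar>det2 (f' x)\<bar>)"
  have fm': "f \<in> ?M \<rightarrow>\<^sub>M borel" using fm by simp
  have idm: "(\<lambda>y. y) \<in> lebesgue_on (f ` S) \<rightarrow>\<^sub>M borel"
    by (intro measurable_restrict_space1 measurable_completion) simp
  note eq = nn_integral_differentiable_image(2)[OF S d inj borel_measurable_const]
  have "(LINT x:S|lebesgue. \<bar>det2 (f' x)\<bar> *\<^sub>R G (f x)) = (LINT x|lebesgue_on S. \<bar>det2 (f' x)\<bar> *\<^sub>R G (f x))"
    using S by (simp add: integral_restrict_space set_lebesgue_integral_def)
  also have "\<dots> = (LINT x|?M. G (f x))"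
    using dm measurable_compose[OF fm G] by (subst integral_density) auto
  also have "\<dots> = (LINT y|distr ?M borel f. G y)"
    using G fm' by (subst integral_distr) auto
  also have "\<dots> = (LINT y|lebesgue_on (f ` S). G y)"
    using G idm by (subst eq, (assumption | simp)?, subst integral_distr) auto
  also have "\<dots> = (LINT y:f ` S|lebesgue. G y)"
    using fS by (simp add: integral_restrict_space set_lebesgue_integral_def)
  finally show ?thesis .
qed

section \<open>Hausdorff measure of curves\<close>

lemma hausdorff1_pre_le:
  assumes "A \<subseteq> (\<Union>i. C i)" "\<And>i::nat. bounded (C i)" "\<And>i. diameter (C i) \<le> \<delta>"
  shows "hausdorff1_pre \<delta> A \<le> (\<Sum>i. ennreal (diameter (C i)))"
  unfolding hausdorff1_pre_def using assms by (intro INF_lower) auto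

lemma le_hausdorff1_preI:
  assumes "\<And>C :: nat \<Rightarrow> complex set. A \<subseteq> (\<Union>i. C i) \<Longrightarrow> (\<And>i. bounded (C i)) \<Longrightarrow> (\<And>i. diameter (C i) \<le> \<delta>)
      \<Longrightarrow> x \<le> (\<Sum>i. ennreal (diameter (C i)))"
  shows "x \<le> hausdorff1_pre \<delta> A"
  unfolding hausdorff1_pre_def using assms by (intro INF_greatest) auto

lemma hausdorff1_pre_mono: "A \<subseteq> B \<Longrightarrow> \<delta> \<le> \<delta>' \<Longrightarrow> hausdorff1_pre \<delta>' A \<le> hausdorff1_pre \<delta> B"
  by (rule le_hausdorff1_preI, rule hausdorff1_pre_le) (auto, meson order_trans)

lemma hausdorff1_pre_le_outer: "0 < \<delta> \<Longrightarrow> hausdorff1_pre \<delta> A \<le> hausdorff1_outer A"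
  unfolding hausdorff1_outer_def by (intro SUP_upper) auto

lemma hausdorff1_outer_leI: "(\<And>\<delta>. 0 < \<delta> \<Longrightarrow> hausdorff1_pre \<delta> A \<le> x) \<Longrightarrow> hausdorff1_outer A \<le> x"
  unfolding hausdorff1_outer_def by (intro SUP_least) auto

lemma hausdorff1_outer_mono: "A \<subseteq> B \<Longrightarrow> hausdorff1_outer A \<le> hausdorff1_outer B"
  by (meson hausdorff1_outer_leI hausdorff1_pre_le_outer hausdorff1_pre_mono order_refl order_trans)

lemma hausdorff1_outer_empty [simp]: "hausdorff1_outer {} = 0"
proof -
  have "hausdorff1_outer {} \<le> 0"
  proof (rule hausdorff1_outer_leI)
    fix \<delta> :: real assume "0 < \<delta>"
    then show "hausdorff1_pre \<delta> {} \<le> 0"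
      using hausdorff1_pre_le[of "{}" "\<lambda>_. {}" \<delta>] by simp
  qed
  then show ?thesis by simp
qed

text \<open>Covers of the \<open>A i\<close> that are optimal up to \<open>e * (1/2) ^ Suc i\<close>
  are merged into a single sequence by \<open>prod_decode\<close>; the errors add up to
  \<open>e\<close>.\<close>

lemma hausdorff1_pre_subadditive:
  fixes A :: "nat \<Rightarrow> complex set"
  shows "hausdorff1_pre \<delta> (\<Union>i. A i) \<le> (\<Sum>i. hausdorff1_pre \<delta> (A i))"
proof (cases "\<exists>i. hausdorff1_pre \<delta> (A i) = top")
  case True
  then obtain i where "hausdorff1_pre \<delta> (A i) = top" by blast
  then have "(\<Sum>i. hausdorff1_pre \<delta> (A i)) = top"
    by (metis ennreal_suminf_lessD less_irrefl top.not_eq_extremum)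
  then show ?thesis by simp
next
  case False
  show ?thesis
  proof (rule ennreal_le_epsilon)
    fix e :: real assume e: "0 < e"
    have "\<exists>C. A i \<subseteq> (\<Union>j. C j) \<and> (\<forall>j. bounded (C j) \<and> diameter (C j) \<le> \<delta>) \<and>
        (\<Sum>j::nat. ennreal (diameter (C j))) < hausdorff1_pre \<delta> (A i) + ennreal (e * (1/2) ^ Suc i)" for i
    proof -
      have "hausdorff1_pre \<delta> (A i) < hausdorff1_pre \<delta> (A i) + ennreal (e * (1/2) ^ Suc i)"
        using False e by (simp add: less_top ennreal_zero_less_mult_iff)
      then obtain C where "A i \<subseteq> (\<Union>j. C j)" "\<forall>j. bounded (C j) \<and> diameter (C j) \<le> \<delta>"
        "(\<Sum>j::nat. ennreal (diameter (C j))) < hausdorff1_pre \<delta> (A i) + ennreal (e * (1/2) ^ Suc i)"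
        unfolding hausdorff1_pre_def[of \<delta> "A i"] INF_less_iff by blast
      then show ?thesis by blast
    qed
    then obtain C where C: "\<And>i. A i \<subseteq> (\<Union>j. C i j)" "\<And>i j. bounded (C i j) \<and> diameter (C i j) \<le> \<delta>"
      "\<And>i. (\<Sum>j::nat. ennreal (diameter (C i j))) < hausdorff1_pre \<delta> (A i) + ennreal (e * (1/2) ^ Suc i)"
      by metis
    define D where "D n = (case prod_decode n of (i, j) \<Rightarrow> C i j)" for n
    have "(\<Union>i. A i) \<subseteq> (\<Union>n. D n)"
    proof
      fix x assume "x \<in> (\<Union>i. A i)"
      then obtain i where "x \<in> A i" by blast
      then obtain j where "x \<in> C i j" using C(1) by blast
      then have "x \<in> D (prod_encode (i, j))" by (simp add: D_def)
      then show "x \<in> (\<Union>n. D n)" by blast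
    qed
    then have "hausdorff1_pre \<delta> (\<Union>i. A i) \<le> (\<Sum>n. ennreal (diameter (D n)))"
      using C(2) by (intro hausdorff1_pre_le) (auto simp: D_def split: prod.split)
    also have "\<dots> = (\<Sum>i. \<Sum>j. ennreal (diameter (C i j)))"
    proof -
      have "(\<Sum>n. (\<lambda>p. ennreal (diameter (case p of (i, j) \<Rightarrow> C i j))) (prod_decode n)) = (\<Sum>i. \<Sum>j. ennreal (diameter (C i j)))"
        by (rule suminf_ennreal_2dimen) simp
      then show ?thesis by (simp add: D_def)
    qed
    also have "\<dots> \<le> (\<Sum>i. hausdorff1_pre \<delta> (A i) + ennreal (e * (1/2) ^ Suc i))"
      by (intro suminf_le less_imp_le[OF C(3)]) auto
    also have "\<dots> = (\<Sum>i. hausdorff1_pre \<delta> (A i)) + (\<Sum>i. ennreal (e * (1/2) ^ Suc i))"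
      by (rule suminf_add[symmetric]) auto
    also have "(\<Sum>i. ennreal (e * (1/2) ^ Suc i)) = ennreal e"
      using e power_half_series[THEN sums_mult, of e] by (intro suminf_ennreal_eq) auto
    finally show "hausdorff1_pre \<delta> (\<Union>i. A i) \<le> (\<Sum>i. hausdorff1_pre \<delta> (A i)) + ennreal e" .
  qed
qed

lemma hausdorff1_outer_subadditive:
  fixes A :: "nat \<Rightarrow> complex set"
  shows "hausdorff1_outer (\<Union>i. A i) \<le> (\<Sum>i. hausdorff1_outer (A i))"
proof (rule hausdorff1_outer_leI)
  fix \<delta> :: real assume "0 < \<delta>"
  then have "(\<Sum>i. hausdorff1_pre \<delta> (A i)) \<le> (\<Sum>i. hausdorff1_outer (A i))"
    by (intro suminf_le hausdorff1_pre_le_outer) auto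
  then show "hausdorff1_pre \<delta> (\<Union>i. A i) \<le> (\<Sum>i. hausdorff1_outer (A i))"
    using hausdorff1_pre_subadditive order_trans by blast
qed

lemma outer_measure_space_hausdorff1: "outer_measure_space UNIV hausdorff1_outer"
  unfolding outer_measure_space_def positive_def increasing_def countably_subadditive_def
  using hausdorff1_outer_mono hausdorff1_outer_subadditive by auto

lemma hausdorff1_outer_Un: "hausdorff1_outer (A \<union> B) \<le> hausdorff1_outer A + hausdorff1_outer B"
proof -
  have "A \<union> B \<subseteq> (\<Union>i. case i of 0 \<Rightarrow> A | Suc 0 \<Rightarrow> B | _ \<Rightarrow> {})"
  proof
    fix x assume "x \<in> A \<union> B"
    then show "x \<in> (\<Union>i. case i of 0 \<Rightarrow> A | Suc 0 \<Rightarrow> B | _ \<Rightarrow> {})"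
      using UN_I[of "0::nat" UNIV x "\<lambda>i. case i of 0 \<Rightarrow> A | Suc 0 \<Rightarrow> B | _ \<Rightarrow> {}"]
        UN_I[of "1::nat" UNIV x "\<lambda>i. case i of 0 \<Rightarrow> A | Suc 0 \<Rightarrow> B | _ \<Rightarrow> {}"] by auto
  qed
  then have "hausdorff1_outer (A \<union> B) \<le> hausdorff1_outer (\<Union>i. case i of 0 \<Rightarrow> A | Suc 0 \<Rightarrow> B | _ \<Rightarrow> {})"
    by (rule hausdorff1_outer_mono)
  also have "\<dots> \<le> (\<Sum>i. hausdorff1_outer (case i of 0 \<Rightarrow> A | Suc 0 \<Rightarrow> B | _ \<Rightarrow> {}))"
    by (rule hausdorff1_outer_subadditive)
  also have "\<dots> = (\<Sum>i<2. hausdorff1_outer (case i of 0 \<Rightarrow> A | Suc 0 \<Rightarrow> B | _ \<Rightarrow> {}))"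
    by (rule suminf_finite) (auto split: nat.split)
  also have "\<dots> = hausdorff1_outer A + hausdorff1_outer B" by (simp add: numeral_2_eq_2)
  finally show ?thesis .
qed

text \<open>At scales below \<open>d\<close> no covering set can meet both \<open>A\<close> and
  \<open>B\<close>, so every cover of the union splits into a cover of \<open>A\<close> and a cover
  of \<open>B\<close>.\<close>

lemma hausdorff1_outer_separated:
  assumes d: "0 < d" and sep: "\<And>a b. a \<in> A \<Longrightarrow> b \<in> B \<Longrightarrow> d \<le> dist a b"
  shows "hausdorff1_outer A + hausdorff1_outer B \<le> hausdorff1_outer (A \<union> B)"
proof -
  have pre: "hausdorff1_pre \<delta> A + hausdorff1_pre \<delta> B \<le> hausdorff1_pre \<delta> (A \<union> B)" if \<delta>: "0 < \<delta>" "\<delta> < d" for \<delta>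
  proof (rule le_hausdorff1_preI)
    fix C :: "nat \<Rightarrow> complex set"
    assume C: "A \<union> B \<subseteq> (\<Union>i. C i)" "\<And>i. bounded (C i)" "\<And>i. diameter (C i) \<le> \<delta>"
    define CA where "CA i = (if C i \<inter> A = {} then {} else C i)" for i
    define CB where "CB i = (if C i \<inter> B = {} then {} else C i)" for i
    have one: "C i \<inter> A = {} \<or> C i \<inter> B = {}" for i
    proof (rule ccontr)
      assume "\<not> ?thesis"
      then obtain a b where ab: "a \<in> C i" "a \<in> A" "b \<in> C i" "b \<in> B" by blast
      then have "dist a b \<le> \<delta>" using diameter_bounded_bound[OF C(2)] C(3) order_trans by blast
      then show False using sep[OF ab(2,4)] \<delta> by simp
    qed
    have "hausdorff1_pre \<delta> A \<le> (\<Sum>i. ennreal (diameter (CA i)))"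
      using C \<delta> by (intro hausdorff1_pre_le) (auto simp: CA_def, blast?)
    moreover have "hausdorff1_pre \<delta> B \<le> (\<Sum>i. ennreal (diameter (CB i)))"
      using C \<delta> by (intro hausdorff1_pre_le) (auto simp: CB_def, blast?)
    ultimately have "hausdorff1_pre \<delta> A + hausdorff1_pre \<delta> B \<le> (\<Sum>i. ennreal (diameter (CA i))) + (\<Sum>i. ennreal (diameter (CB i)))"
      by (rule add_mono)
    also have "\<dots> = (\<Sum>i. ennreal (diameter (CA i)) + ennreal (diameter (CB i)))"
      by (rule suminf_add) auto
    also have "\<dots> \<le> (\<Sum>i. ennreal (diameter (C i)))"
      using one by (intro suminf_le) (auto simp: CA_def CB_def)
    finally show "hausdorff1_pre \<delta> A + hausdorff1_pre \<delta> B \<le> (\<Sum>i. ennreal (diameter (C i)))" .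
  qed
  \<comment> \<open>The two outer measures are suprema over independent scales; since the premeasure
    grows as the scale shrinks, both are compared with a common scale, and \<open>d/2\<close> keeps
    it below \<open>d\<close>.\<close>
  have pre': "hausdorff1_pre \<delta>1 A + hausdorff1_pre \<delta>2 B \<le> hausdorff1_outer (A \<union> B)" if "0 < \<delta>1" "0 < \<delta>2" for \<delta>1 \<delta>2
  proof -
    let ?\<delta> = "min (min \<delta>1 \<delta>2) (d/2)"
    have \<delta>: "0 < ?\<delta>" "?\<delta> < d" "?\<delta> \<le> \<delta>1" "?\<delta> \<le> \<delta>2" using that d by (auto simp: min_def)
    have "hausdorff1_pre \<delta>1 A + hausdorff1_pre \<delta>2 B \<le> hausdorff1_pre ?\<delta> A + hausdorff1_pre ?\<delta> B"
      by (intro add_mono hausdorff1_pre_mono order_refl \<delta>)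
    also have "\<dots> \<le> hausdorff1_outer (A \<union> B)"
      using pre[OF \<delta>(1,2)] hausdorff1_pre_le_outer[OF \<delta>(1)] order_trans by blast
    finally show ?thesis .
  qed
  have "hausdorff1_outer A + hausdorff1_outer B = (SUP \<delta>1\<in>{0<..}. hausdorff1_pre \<delta>1 A + hausdorff1_outer B)"
    unfolding hausdorff1_outer_def[of A] by (rule ennreal_SUP_add_left[symmetric]) (auto intro: exI[of _ "1::real"])
  also have "\<dots> \<le> hausdorff1_outer (A \<union> B)"
  proof (rule SUP_least)
    fix \<delta>1 :: real assume "\<delta>1 \<in> {0<..}"
    then have \<delta>1: "0 < \<delta>1" by simp
    have "hausdorff1_pre \<delta>1 A + hausdorff1_outer B = (SUP \<delta>2\<in>{0<..}. hausdorff1_pre \<delta>1 A + hausdorff1_pre \<delta>2 B)"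
      unfolding hausdorff1_outer_def[of B] add.commute[of "hausdorff1_pre \<delta>1 A"]
      by (rule ennreal_SUP_add_left[symmetric]) (auto intro: exI[of _ "1::real"])
    also have "\<dots> \<le> hausdorff1_outer (A \<union> B)" using pre'[OF \<delta>1] by (intro SUP_least) auto
    finally show "hausdorff1_pre \<delta>1 A + hausdorff1_outer B \<le> hausdorff1_outer (A \<union> B)" .
  qed
  finally show ?thesis .
qed

text \<open>This is Caratheodory's criterion. \<open>B n\<close> consists of the points of
  \<open>X\<close> at distance at least \<open>1 / (n+1)\<close> from \<open>F\<close> and is
  separated from \<open>F\<close>, so additivity holds for \<open>F \<inter> X\<close> and
  \<open>B n\<close>. What \<open>X - F\<close> has beyond \<open>B n\<close> is covered by the
  shells \<open>R k\<close> with \<open>n \<le> k\<close>, whose measures form a convergent series,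
  so that their tail is negligible.\<close>

lemma closed_in_lambda_system_hausdorff1:
  assumes F: "closed F"
  shows "F \<in> lambda_system UNIV UNIV hausdorff1_outer"
proof -
  have ge: "hausdorff1_outer (F \<inter> X) + hausdorff1_outer (X - F) \<le> hausdorff1_outer X" if fin: "hausdorff1_outer X < top" and ne: "F \<noteq> {}" for X
  proof -
    let ?h = hausdorff1_outer
    define B where "B n = {z \<in> X. 1 / real (n+1) \<le> infdist z F}" for n
    define R where "R n = B (Suc n) - B n" for n
    \<comment> \<open>A gap of one shell is left between \<open>B n\<close> and \<open>R m\<close>:
      points of \<open>R m\<close> have distance less than \<open>1 / (m+1) \<le> 1 / (n+2)\<close>
      from \<open>F\<close>.\<close>
    have sep: "1 / real (n+1) - 1 / real (n+2) \<le> dist z w"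
      if "z \<in> B n" "w \<in> R m" "n < m" for n m z w
    proof -
      have "infdist w F < 1 / real (m+1)" using that by (auto simp: R_def B_def)
      also have "\<dots> \<le> 1 / real (n+2)" using that by (simp add: frac_le)
      finally have "infdist w F < 1 / real (n+2)" .
      moreover have "1 / real (n+1) \<le> infdist z F" using that by (auto simp: B_def)
      moreover have "infdist z F \<le> infdist w F + dist z w" by (rule infdist_triangle)
      ultimately show ?thesis by linarith
    qed
    have pos: "0 < 1 / real (n+1) - 1 / real (n+2)" for n
      using divide_strict_left_mono[of "real (n+1)" "real (n+2)" 1] by simp
    have Bmono: "B n \<subseteq> B m" if "n \<le> m" for n m
      using that by (auto simp: B_def elim!: order_trans[rotated] intro!: frac_le)
    have BX: "B n \<subseteq> X" for n by (auto simp: B_def)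
    have RB: "R k \<subseteq> B (Suc k)" for k by (auto simp: R_def)
    have 1: "?h (F \<inter> X) + ?h (B n) \<le> ?h X" for n
    proof -
      have "1 / real (n+1) \<le> dist a b" if "a \<in> F \<inter> X" "b \<in> B n" for a b
        using that infdist_le[of a F b] by (auto simp: B_def dist_commute)
      then have "?h (F \<inter> X) + ?h (B n) \<le> ?h (F \<inter> X \<union> B n)"
        by (intro hausdorff1_outer_separated[of "1 / real (n+1)"]) auto
      also have "\<dots> \<le> ?h X" using BX by (intro hausdorff1_outer_mono) auto
      finally show ?thesis .
    qed
    \<comment> \<open>Neighbouring shells may touch, but shells of equal parity are separated. The
      offset \<open>p\<close> selects the parity, and each parity class has total measure at most
      that of \<open>X\<close>.\<close>
    have sum: "(\<Sum>k<N. ?h (R (2*k+p))) \<le> ?h (\<Union>k<N. R (2*k+p))" for N p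
    proof (induction N)
      case (Suc N)
      show ?case
      \<comment> \<open>The index \<open>2*N+p-1\<close> is a difference of natural numbers, so it
        is the predecessor of \<open>2*N+p\<close> only for positive \<open>2*N+p\<close>; for
        \<open>N = 0\<close> there is nothing to separate.\<close>
      proof (cases "N = 0")
        case False
        have "(\<Sum>k<Suc N. ?h (R (2*k+p))) \<le> ?h (\<Union>k<N. R (2*k+p)) + ?h (R (2*N+p))"
          using Suc by (simp add: add_right_mono)
        also have "\<dots> \<le> ?h ((\<Union>k<N. R (2*k+p)) \<union> R (2*N+p))"
        proof (rule hausdorff1_outer_separated[OF pos[of "2*N+p-1"]])
          fix a b assume a: "a \<in> (\<Union>k<N. R (2*k+p))" and b: "b \<in> R (2*N+p)"
          then obtain k where "k < N" "a \<in> R (2*k+p)" by blast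
          moreover have "Suc (2*k+p) \<le> 2*N+p-1" using \<open>k < N\<close> by linarith
          ultimately have "a \<in> B (2*N+p-1)" using RB[of "2*k+p"] Bmono[of "Suc (2*k+p)" "2*N+p-1"] by blast
          then show "1 / real (2*N+p-1+1) - 1 / real (2*N+p-1+2) \<le> dist a b"
            using sep b False by (metis One_nat_def Suc_pred' add_gr_0 lessI mult_pos_pos neq0_conv zero_less_numeral)
        qed
        also have "(\<Union>k<N. R (2*k+p)) \<union> R (2*N+p) = (\<Union>k<Suc N. R (2*k+p))" by (auto simp: less_Suc_eq)
        finally show ?thesis .
      qed (simp add: lessThan_Suc)
    qed simp
    have sumX: "(\<Sum>k<N. ?h (R (2*k+p))) \<le> ?h X" for N p
      using sum[where N=N and p=p] hausdorff1_outer_mono[of "\<Union>k<N. R (2*k+p)" X] BX by (force simp: R_def intro: order_trans)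
    have split: "(\<Sum>k<2*N. f k) = (\<Sum>k<N. f (2*k)) + (\<Sum>k<N. f (2*k+1))" for f :: "nat \<Rightarrow> ennreal" and N
      by (induction N) (auto simp: algebra_simps)
    have "(\<Sum>k<N. ?h (R k)) \<le> 2 * ?h X" for N
    proof -
      have "(\<Sum>k<N. ?h (R k)) \<le> (\<Sum>k<2*N. ?h (R k))" by (intro sum_mono2) auto
      also have "\<dots> \<le> ?h X + ?h X" unfolding split using sumX[of 0 N] sumX[of 1 N] by (intro add_mono) auto
      finally show ?thesis by (simp add: mult_2)
    qed
    then have "(\<Sum>k. ?h (R k)) \<le> 2 * ?h X" by (intro suminf_le_const) auto
    also have "\<dots> < top" using fin by (simp add: ennreal_mult_less_top)
    finally have fs: "(\<Sum>k. ?h (R k)) < top" .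
    define r where "r k = enn2real (?h (R k))" for k
    have rk: "?h (R k) = ennreal (r k)" for k
      using ennreal_suminf_lessD[OF fs] by (simp add: r_def)
    have r0: "0 \<le> r k" for k by (simp add: r_def)
    have sr: "summable r" using fs r0 by (intro summable_suminf_not_top) (auto simp: rk)
    \<comment> \<open>Closedness of \<open>F\<close> enters here: a point outside \<open>F\<close>
      has positive distance from it and therefore lies in some \<open>B m\<close>; the least such
      \<open>m\<close> determines its shell.\<close>
    have XF: "X - F \<subseteq> B n \<union> (\<Union>k. R (k + n))" for n
    proof
      fix z assume z: "z \<in> X - F"
      then have "0 < infdist z F" using F ne by (metis DiffD2 in_closed_iff_infdist_zero infdist_nonneg less_eq_real_def)
      then obtain m0 where "inverse (real (Suc m0)) < infdist z F" using reals_Archimedean by blast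
      then have ex: "\<exists>m. z \<in> B m" using z by (intro exI[of _ m0]) (auto simp: B_def inverse_eq_divide)
      show "z \<in> B n \<union> (\<Union>k. R (k + n))"
      proof (cases "z \<in> B n")
        case False
        define m where "m = (LEAST m. z \<in> B m)"
        have m: "z \<in> B m" unfolding m_def using ex by (rule LeastI_ex)
        have m': "z \<notin> B k" if "k < m" for k using not_less_Least[OF that[unfolded m_def]] .
        have "n < m" using m False Bmono[of m n] by (cases "n < m") auto
        then obtain k where "m = Suc (k + n)" by (metis less_iff_Suc_add add.commute)
        then have "z \<in> R (k + n)" using m m'[of "k + n"] by (auto simp: R_def)
        then show ?thesis by blast
      qed auto
    qed
    have tail: "?h (F \<inter> X) + ?h (X - F) \<le> ?h X + ennreal (\<Sum>k. r (k + n))" for n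
    proof -
      have "?h (X - F) \<le> ?h (B n) + ?h (\<Union>k. R (k + n))"
        using hausdorff1_outer_mono[OF XF] hausdorff1_outer_Un order_trans by blast
      also have "?h (\<Union>k. R (k + n)) \<le> (\<Sum>k. ?h (R (k + n)))" by (rule hausdorff1_outer_subadditive)
      also have "\<dots> = ennreal (\<Sum>k. r (k + n))" unfolding rk
        using sr r0 by (intro suminf_ennreal2) (auto simp: summable_iff_shift)
      finally have "?h (X - F) \<le> ?h (B n) + ennreal (\<Sum>k. r (k + n))" by (simp add: add_left_mono)
      then have "?h (F \<inter> X) + ?h (X - F) \<le> ?h (F \<inter> X) + (?h (B n) + ennreal (\<Sum>k. r (k + n)))" by (rule add_left_mono)
      also have "\<dots> \<le> ?h X + ennreal (\<Sum>k. r (k + n))" unfolding add.assoc[symmetric] using 1 by (rule add_right_mono)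
      finally show ?thesis .
    qed
    show ?thesis
    proof (rule ennreal_le_epsilon)
      fix e :: real assume "0 < e"
      then obtain n where "norm (\<Sum>k. r (k + n)) < e" using suminf_exist_split[OF _ sr] by blast
      then have "ennreal (\<Sum>k. r (k + n)) \<le> ennreal e" by (intro ennreal_leI) auto
      then show "?h (F \<inter> X) + ?h (X - F) \<le> ?h X + ennreal e" using tail[of n] add_left_mono order_trans by blast
    qed
  qed
  have "hausdorff1_outer (F \<inter> X) + hausdorff1_outer ((UNIV - F) \<inter> X) = hausdorff1_outer X" for X
  proof (rule antisym)
    have eq: "(UNIV - F) \<inter> X = X - F" by auto
    show "hausdorff1_outer (F \<inter> X) + hausdorff1_outer ((UNIV - F) \<inter> X) \<le> hausdorff1_outer X"
      using ge[of X] by (cases "F = {}"; cases "hausdorff1_outer X < top") (auto simp: eq not_less top_unique)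
    have "X = (F \<inter> X) \<union> ((UNIV - F) \<inter> X)" by auto
    then show "hausdorff1_outer X \<le> hausdorff1_outer (F \<inter> X) + hausdorff1_outer ((UNIV - F) \<inter> X)"
      using hausdorff1_outer_Un by metis
  qed
  then show ?thesis by (auto simp: lambda_system_def)
qed

lemma measure_space_hausdorff1:
  "measure_space UNIV (lambda_system UNIV UNIV hausdorff1_outer) hausdorff1_outer"
proof -
  interpret sigma_algebra UNIV "UNIV :: complex set set"
    using sigma_algebra_Pow[of UNIV] by simp
  show ?thesis using caratheodory_lemma[OF outer_measure_space_hausdorff1] .
qed

lemma space_hausdorff1 [simp]: "space hausdorff1 = UNIV"
  by (simp add: hausdorff1_def space_measure_of_conv)

lemma sets_hausdorff1: "sets hausdorff1 = lambda_system UNIV UNIV hausdorff1_outer"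
  using measure_space_hausdorff1 unfolding measure_space_def hausdorff1_def
  by (metis sigma_algebra.sets_measure_of_eq)

lemma sets_borel_subset_hausdorff1: "sets borel \<subseteq> sets hausdorff1"
proof -
  have sa: "sigma_algebra UNIV (sets hausdorff1)"
    using measure_space_hausdorff1 by (simp add: sets_hausdorff1 measure_space_def)
  have "sigma_sets UNIV {S :: complex set. closed S} \<subseteq> sets hausdorff1"
    using closed_in_lambda_system_hausdorff1
    by (intro sigma_algebra.sigma_sets_subset[OF sa]) (auto simp: sets_hausdorff1)
  then show ?thesis by (simp add: borel_eq_closed sets_measure_of_conv)
qed

lemma emeasure_hausdorff1: "A \<in> sets hausdorff1 \<Longrightarrow> emeasure hausdorff1 A = hausdorff1_outer A"
  using measure_space_hausdorff1 unfolding sets_hausdorff1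
  by (simp add: measure_space_def hausdorff1_def emeasure_measure_of_sigma)

lemmas borel_imp_hausdorff1 = subsetD[OF sets_borel_subset_hausdorff1]

lemma measurable_ident_hausdorff1: "(\<lambda>x. x) \<in> hausdorff1 \<rightarrow>\<^sub>M borel"
  by (rule measurableI) (simp_all add: borel_imp_hausdorff1)

section \<open>Upper bounds for the length of a curve\<close>

lemma emeasure_density_Icc_Ioc:
  fixes a b :: real
  assumes "g \<in> borel_measurable borel"
  shows "emeasure (density lborel g) {a..b} = emeasure (density lborel g) {a<..b}"
proof -
  have "emeasure (density lborel g) {a..b} = (\<integral>\<^sup>+x\<in>{a..b}. g x \<partial>lborel)"
    using assms by (subst emeasure_density) auto
  also have "\<dots> = (\<integral>\<^sup>+x\<in>{a<..b}. g x \<partial>lborel)"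
    by (intro nn_integral_cong_AE AE_I[where N="{a}"]) (auto simp: indicator_def)
  also have "\<dots> = emeasure (density lborel g) {a<..b}"
    using assms by (subst emeasure_density) auto
  finally show ?thesis .
qed

text \<open>By uniform continuity the images of a fine partition form a cover of mesh
  \<open>\<delta>\<close>, and the bound on chords controls the diameter of each image by the mass
  of its parameter interval. The masses are added over half-open intervals, which are
  disjoint.\<close>

lemma hausdorff1_curve_Icc:
  fixes F :: "real \<Rightarrow> complex" and g :: "real \<Rightarrow> ennreal"
  assumes cont: "continuous_on {a..b} F" and g: "g \<in> borel_measurable borel"
    and le: "\<And>s t. a \<le> s \<Longrightarrow> s \<le> t \<Longrightarrow> t \<le> b \<Longrightarrow> ennreal (dist (F s) (F t)) \<le> emeasure (density lborel g) {s..t}"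
  shows "hausdorff1_outer (F ` {a..b}) \<le> emeasure (density lborel g) {a..b}"
proof (cases "a \<le> b")
  case True
  let ?M = "density lborel g"
  show ?thesis
  proof (rule hausdorff1_outer_leI)
    fix \<delta> :: real assume \<delta>: "0 < \<delta>"
    have "uniformly_continuous_on {a..b} F" using cont by (simp add: compact_uniformly_continuous)
    then obtain \<eta> where \<eta>: "0 < \<eta>" "\<And>s t. s \<in> {a..b} \<Longrightarrow> t \<in> {a..b} \<Longrightarrow> dist t s < \<eta> \<Longrightarrow> dist (F t) (F s) < \<delta>"
      unfolding uniformly_continuous_on_def using \<delta> by metis
    obtain n :: nat where n: "(b - a) / \<eta> < real n" using reals_Archimedean2 by blast
    moreover have "0 \<le> (b - a) / \<eta>" using True \<eta> by simp
    ultimately have n0: "0 < real n" by linarith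
    then have small: "(b - a) / real n < \<eta>" using n \<eta> by (simp add: field_simps)
    define t where "t i = a + (b - a) * real i / real n" for i :: nat
    have t0: "t 0 = a" and tn: "t n = b" using n0 by (auto simp: t_def)
    have tmono: "t i \<le> t j" if "i \<le> j" for i j using that True n0
      by (auto simp: t_def intro!: divide_right_mono mult_left_mono)
    have tS: "t (Suc i) - t i = (b - a) / real n" for i using n0 by (simp add: t_def field_simps)
    have tin: "a \<le> t i" "i \<le> n \<Longrightarrow> t i \<le> b" for i using tmono[of 0 i] tmono[of i n] t0 tn by auto
    define C where "C i = (if i < n then F ` {t i..t (Suc i)} else {})" for i
    have cov: "\<exists>i<k. x \<in> {t i..t (Suc i)}" if "0 < k" "x \<in> {a..t k}" for x k
      using that
    proof (induction k)
      case (Suc k)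
      show ?case
      proof (cases "x \<le> t k \<and> 0 < k")
        case True
        then show ?thesis using Suc by (auto intro: less_SucI)
      next
        case False
        then have "t k \<le> x" using Suc.prems t0 by (cases k) auto
        then show ?thesis using Suc.prems by auto
      qed
    qed simp
    have "F ` {a..b} \<subseteq> (\<Union>i. C i)"
    proof
      fix w assume "w \<in> F ` {a..b}"
      then obtain x where "x \<in> {a..t n}" "w = F x" using tn by auto
      then obtain i where "i < n" "w \<in> C i" using cov[of n x] n0 by (auto simp: C_def)
      then show "w \<in> (\<Union>i. C i)" by blast
    qed
    moreover have "bounded (C i)" for i
    proof -
      have "compact (F ` {t i..t (Suc i)})" if "i < n"
        using that tin[of i] tin[of "Suc i"]
        by (intro compact_continuous_image continuous_on_subset[OF cont]) auto
      then show ?thesis by (auto simp: C_def compact_imp_bounded)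
    qed
    moreover have "diameter (C i) \<le> \<delta>" for i
    proof (rule diameter_le)
      show "C i \<noteq> {} \<or> 0 \<le> \<delta>" using \<delta> by simp
      fix v w assume "v \<in> C i" "w \<in> C i"
      then obtain x y where xy: "i < n" "x \<in> {t i..t (Suc i)}" "y \<in> {t i..t (Suc i)}" "v = F x" "w = F y"
        by (auto simp: C_def split: if_splits)
      then have "\<bar>x - y\<bar> \<le> (b - a) / real n" using tS[of i] by auto
      then have "dist x y < \<eta>" using small by (simp add: dist_real_def)
      then have "dist (F x) (F y) < \<delta>" using xy tin[of i] tin[of "Suc i"] by (intro \<eta>(2)) auto
      then show "norm (v - w) \<le> \<delta>" using xy by (simp add: dist_norm)
    qed
    ultimately have "hausdorff1_pre \<delta> (F ` {a..b}) \<le> (\<Sum>i. ennreal (diameter (C i)))"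
      by (rule hausdorff1_pre_le)
    also have "\<dots> = (\<Sum>i<n. ennreal (diameter (C i)))"
      by (rule suminf_finite) (auto simp: C_def)
    also have "\<dots> \<le> (\<Sum>i<n. emeasure ?M {t i<..t (Suc i)})"
    proof (rule sum_mono)
      fix i assume "i \<in> {..<n}" then have i: "i < n" by simp
      show "ennreal (diameter (C i)) \<le> emeasure ?M {t i<..t (Suc i)}"
      proof (cases "emeasure ?M {t i<..t (Suc i)}")
        case (real r)
        have "diameter (C i) \<le> r"
        proof (rule diameter_le)
          show "C i \<noteq> {} \<or> 0 \<le> r" using real by simp
          have *: "dist (F x) (F y) \<le> r" if "x \<in> {t i..t (Suc i)}" "y \<in> {t i..t (Suc i)}" "x \<le> y" for x y
          proof -
            have "ennreal (dist (F x) (F y)) \<le> emeasure ?M {x..y}"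
              using that i tin[of i] tin[of "Suc i"] by (intro le) auto
            also have "\<dots> \<le> emeasure ?M {t i..t (Suc i)}" using that by (intro emeasure_mono) auto
            also have "\<dots> = ennreal r" using real emeasure_density_Icc_Ioc[OF g] by simp
            finally show ?thesis using real by (simp add: ennreal_le_iff)
          qed
          fix v w assume "v \<in> C i" "w \<in> C i"
          then obtain x y where xy: "x \<in> {t i..t (Suc i)}" "y \<in> {t i..t (Suc i)}" "v = F x" "w = F y"
            by (auto simp: C_def split: if_splits)
          then show "norm (v - w) \<le> r"
            using *[OF xy(1,2)] *[OF xy(2,1)] by (cases "x \<le> y") (auto simp: dist_norm norm_minus_commute)
        qed
        then show ?thesis using real by (simp add: ennreal_leI)
      qed simp
    qed
    also have "\<dots> = emeasure ?M {t 0<..t n}"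
    proof -
      have "(\<Sum>i<k. emeasure ?M {t i<..t (Suc i)}) = emeasure ?M {t 0<..t k}" for k
      proof (induction k)
        case (Suc k)
        have "{t 0<..t (Suc k)} = {t 0<..t k} \<union> {t k<..t (Suc k)}"
          using tmono[of 0 k] tmono[of k "Suc k"] by auto
        moreover have "emeasure ?M ({t 0<..t k} \<union> {t k<..t (Suc k)}) = emeasure ?M {t 0<..t k} + emeasure ?M {t k<..t (Suc k)}"
          by (rule plus_emeasure[symmetric]) auto
        ultimately show ?case using Suc by simp
      qed simp
      then show ?thesis .
    qed
    also have "\<dots> = emeasure ?M {a..b}" using emeasure_density_Icc_Ioc[OF g] t0 tn by simp
    finally show "hausdorff1_pre \<delta> (F ` {a..b}) \<le> emeasure ?M {a..b}" .
  qed
qed simp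

text \<open>\<open>U\<close> is exhausted by the unions \<open>V n\<close> of the closed dyadic
  intervals of level \<open>n\<close> that it contains; the sequence increases because each interval
  splits into two of the next level. On each level the bound for closed intervals is summed, and
  continuity from below passes to \<open>U\<close>.\<close>

lemma hausdorff1_curve_open:
  fixes F :: "real \<Rightarrow> complex" and g :: "real \<Rightarrow> ennreal"
  assumes U: "open U" and cont: "continuous_on U F" and g: "g \<in> borel_measurable borel"
    and le: "\<And>s t. s \<le> t \<Longrightarrow> {s..t} \<subseteq> U \<Longrightarrow> ennreal (dist (F s) (F t)) \<le> emeasure (density lborel g) {s..t}"
  shows "hausdorff1_outer (F ` U) \<le> emeasure (density lborel g) U"
proof -
  let ?M = "density lborel g"
  define K where "K n k = {of_int k / 2 ^ n .. (of_int k + 1) / 2 ^ n :: real}" for n :: nat and k :: int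
  define H where "H n k = {of_int k / 2 ^ n <.. (of_int k + 1) / 2 ^ n :: real}" for n :: nat and k :: int
  \<comment> \<open>Closed intervals have compact images, while their half-open versions
    \<open>D\<close> are disjoint and carry the same mass; both are empty when the closed interval
    is not contained in \<open>U\<close>.\<close>
  define C where "C n j = (if K n (int_decode j) \<subseteq> U then K n (int_decode j) else {})" for n j
  define D where "D n j = (if K n (int_decode j) \<subseteq> U then H n (int_decode j) else {})" for n j
  define V where "V n = (\<Union>j. C n j)" for n
  have HK: "H n k \<subseteq> K n k" for n k by (auto simp: H_def K_def)
  have K2: "K n k = K (Suc n) (2*k) \<union> K (Suc n) (2*k+1)" for n k
  proof -
    define p m q :: real where "p = of_int k / 2 ^ n" and "m = (2 * of_int k + 1) / 2 ^ Suc n" and "q = (of_int k + 1) / 2 ^ n"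
    have "p \<le> m" "m \<le> q" by (auto simp: p_def m_def q_def field_simps)
    moreover have "K n k = {p..q}" "K (Suc n) (2*k) = {p..m}" "K (Suc n) (2*k+1) = {m..q}"
      by (auto simp: K_def p_def m_def q_def field_simps)
    ultimately show ?thesis by auto
  qed
  have inc: "incseq V"
  proof (rule incseq_SucI)
    fix n show "V n \<le> V (Suc n)"
    proof
      fix x assume "x \<in> V n"
      then obtain k where k: "K n k \<subseteq> U" "x \<in> K n k" by (auto simp: V_def C_def split: if_splits)
      then obtain k' where "K (Suc n) k' \<subseteq> U" "x \<in> K (Suc n) k'" using K2[of n k] by blast
      then have "x \<in> C (Suc n) (int_encode k')" by (simp add: C_def)
      then show "x \<in> V (Suc n)" unfolding V_def by blast
    qed
  qed
  have VU: "(\<Union>n. V n) = U"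
  proof
    show "(\<Union>n. V n) \<subseteq> U" by (auto simp: V_def C_def split: if_splits)
    show "U \<subseteq> (\<Union>n. V n)"
    proof
      fix x assume "x \<in> U"
      then obtain e where e: "0 < e" "ball x e \<subseteq> U" using U open_contains_ball by blast
      obtain n where n: "(1/2::real) ^ n < e" using real_arch_pow_inv[of e "1/2"] e by auto
      let ?k = "\<lfloor>x * 2 ^ n\<rfloor>"
      have k: "of_int ?k \<le> x * 2 ^ n" "x * 2 ^ n \<le> of_int ?k + 1" by linarith+
      then have xK: "x \<in> K n ?k" by (auto simp: K_def field_simps)
      have "K n ?k \<subseteq> ball x e"
      proof
        fix y assume y: "y \<in> K n ?k"
        have "(of_int ?k + 1) / 2 ^ n - of_int ?k / 2 ^ n = (1/2::real) ^ n"
          by (simp add: diff_divide_distrib[symmetric] power_one_over)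
        then have "\<bar>x - y\<bar> \<le> (1/2) ^ n" using y xK unfolding K_def by auto
        then show "y \<in> ball x e" using n by (auto simp: dist_real_def)
      qed
      then have "x \<in> C n (int_encode ?k)" using xK e by (auto simp: C_def)
      then show "x \<in> (\<Union>n. V n)" unfolding V_def by blast
    qed
  qed
  have cC: "compact (F ` C n j)" for n j
  proof (cases "K n (int_decode j) \<subseteq> U")
    case True
    then have "continuous_on (K n (int_decode j)) F" using cont continuous_on_subset by blast
    then show ?thesis using True by (auto simp: C_def K_def intro: compact_continuous_image)
  qed (simp add: C_def)
  have "F ` V n = (\<Union>j. F ` C n j)" for n by (auto simp: V_def)
  moreover have "(\<Union>j. F ` C n j) \<in> sets borel" for n
    using cC by (intro sets.countable_UN) (auto intro: borel_compact)
  \<comment> \<open>Continuity from below requires measurable sets: the image of \<open>V n\<close>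
    is a countable union of compact sets.\<close>
  ultimately have bV: "F ` V n \<in> sets hausdorff1" for n by (simp add: borel_imp_hausdorff1)
  have disj: "disjoint_family (D n)" for n
    unfolding disjoint_family_on_def
  proof (intro ballI impI)
    fix i j :: nat assume "i \<noteq> j"
    have key: "k = \<lceil>x * 2 ^ n\<rceil> - 1" if "x \<in> H n k" for x k
    proof -
      have "of_int k < x * 2 ^ n" "x * 2 ^ n \<le> of_int k + 1" using that by (auto simp: H_def field_simps)
      then show ?thesis by linarith
    qed
    show "D n i \<inter> D n j = {}"
    proof (rule ccontr)
      assume "\<not> ?thesis"
      then obtain x where "x \<in> H n (int_decode i)" "x \<in> H n (int_decode j)" by (auto simp: D_def split: if_splits)
      then show False using key \<open>i \<noteq> j\<close> by (metis int_decode_eq)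
    qed
  qed
  have outV: "hausdorff1_outer (F ` V n) \<le> emeasure ?M U" for n
  proof -
    have "hausdorff1_outer (F ` V n) \<le> (\<Sum>j. hausdorff1_outer (F ` C n j))"
      using hausdorff1_outer_subadditive[of "\<lambda>j. F ` C n j"] by (simp add: V_def image_UN)
    also have "\<dots> \<le> (\<Sum>j. emeasure ?M (D n j))"
    proof (intro suminf_le)
      fix j
      show "hausdorff1_outer (F ` C n j) \<le> emeasure ?M (D n j)"
      proof (cases "K n (int_decode j) \<subseteq> U")
        case True
        have "hausdorff1_outer (F ` K n (int_decode j)) \<le> emeasure ?M (K n (int_decode j))"
          unfolding K_def
        proof (rule hausdorff1_curve_Icc[OF _ g])
          show "continuous_on {real_of_int (int_decode j) / 2 ^ n..(real_of_int (int_decode j) + 1) / 2 ^ n} F"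
            using True cont continuous_on_subset unfolding K_def by blast
          fix s t assume "real_of_int (int_decode j) / 2 ^ n \<le> s" "s \<le> t" "t \<le> (real_of_int (int_decode j) + 1) / 2 ^ n"
          then show "ennreal (dist (F s) (F t)) \<le> emeasure ?M {s..t}"
            using True by (intro le) (auto simp: K_def subset_eq)
        qed
        then show ?thesis using True emeasure_density_Icc_Ioc[OF g] by (simp add: C_def D_def K_def H_def)
      qed (simp add: C_def)
    qed auto
    also have "\<dots> = emeasure ?M (\<Union>j. D n j)"
      by (intro suminf_emeasure disj) (auto simp: D_def H_def)
    also have "\<dots> \<le> emeasure ?M U"
      using U HK by (intro emeasure_mono) (auto simp: D_def split: if_splits)
    finally show ?thesis .
  qed
  have FU: "F ` U = (\<Union>n. F ` V n)" using VU by blast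
  have "(SUP n. emeasure hausdorff1 (F ` V n)) = emeasure hausdorff1 (\<Union>n. F ` V n)"
    using bV inc by (intro SUP_emeasure_incseq) (auto simp: incseq_def image_mono)
  moreover have "(\<Union>n. F ` V n) \<in> sets hausdorff1" using bV by blast
  ultimately have "hausdorff1_outer (F ` U) = (SUP n. hausdorff1_outer (F ` V n))"
    using bV by (simp add: FU emeasure_hausdorff1)
  also have "\<dots> \<le> emeasure ?M U" using outV by (rule SUP_least)
  finally show ?thesis .
qed

text \<open>A Borel set of parameters is enclosed in an open one of almost the same mass, to which
  the previous bound applies. Since outer regularity asks for a finite measure, this is done inside
  compact intervals, and countably many intervals with rational ends, made disjoint, reassemble
  \<open>E\<close>.\<close>

lemma hausdorff1_curve_borel:
  fixes F :: "real \<Rightarrow> complex" and g :: "real \<Rightarrow> ennreal"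
  assumes I: "open I" and cont: "continuous_on I F" and g [measurable]: "g \<in> borel_measurable borel"
    and le: "\<And>s t. s \<le> t \<Longrightarrow> {s..t} \<subseteq> I \<Longrightarrow> ennreal (dist (F s) (F t)) \<le> emeasure (density lborel g) {s..t}"
    and fin: "\<And>s t. s \<le> t \<Longrightarrow> {s..t} \<subseteq> I \<Longrightarrow> emeasure (density lborel g) {s..t} < \<infinity>"
    and E: "E \<in> sets borel" "E \<subseteq> I"
  shows "hausdorff1_outer (F ` E) \<le> emeasure (density lborel g) E"
proof -
  let ?M = "density lborel g"
  have loc: "hausdorff1_outer (F ` E) \<le> emeasure ?M E"
    if E: "E \<in> sets borel" "E \<subseteq> {a<..<b}" and ab: "{a..b} \<subseteq> I" "a \<le> b" for E a b
  proof (rule ennreal_le_epsilon)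
    fix e :: real assume e: "0 < e"
    \<comment> \<open>Restricting the density to \<open>{a..b}\<close> makes the measure finite by
      \<open>fin\<close> and leaves the mass of \<open>E\<close> unchanged.\<close>
    let ?N = "density lborel (\<lambda>x. g x * indicator {a..b} x)"
    have NM: "emeasure ?N A = emeasure ?M (A \<inter> {a..b})" if "A \<in> sets borel" for A
      using that by (subst (1 2) emeasure_density) (auto intro!: nn_integral_cong simp: indicator_def)
    have fN: "emeasure ?N (space ?N) < \<infinity>" using fin[OF ab(2,1)] NM[of UNIV] by simp
    have "E \<inter> {a..b} = E" using E by force
    then have EN: "emeasure ?N E = emeasure ?M E" using E NM[of E] by simp
    have "emeasure ?M E < \<infinity>" unfolding EN[symmetric] by (rule le_less_trans[OF emeasure_space fN])
    then have "emeasure ?N E < emeasure ?M E + ennreal e"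
      using e by (simp add: EN less_top)
    moreover have "emeasure ?N E = (INF U\<in>{U. E \<subseteq> U \<and> open U}. emeasure ?N U)"
      using E fN by (intro outer_regular) auto
    ultimately have "(INF U\<in>{U. E \<subseteq> U \<and> open U}. emeasure ?N U) < emeasure ?M E + ennreal e"
      by (simp only:)
    then obtain U where U: "E \<subseteq> U" "open U" "emeasure ?N U < emeasure ?M E + ennreal e"
      unfolding INF_less_iff by blast
    let ?U = "U \<inter> {a<..<b}"
    have "hausdorff1_outer (F ` E) \<le> hausdorff1_outer (F ` ?U)"
      using E U by (intro hausdorff1_outer_mono) auto
    also have "\<dots> \<le> emeasure ?M ?U"
    proof (rule hausdorff1_curve_open[OF _ _ g])
      show "open ?U" using U by auto
      show "continuous_on ?U F" using cont ab by (rule_tac continuous_on_subset) auto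
      show "ennreal (dist (F s) (F t)) \<le> emeasure ?M {s..t}" if "s \<le> t" "{s..t} \<subseteq> ?U" for s t
        using that ab by (intro le) force+
    qed
    also have "\<dots> \<le> emeasure ?M (U \<inter> {a..b})" using U by (intro emeasure_mono) auto
    also have "\<dots> \<le> emeasure ?M E + ennreal e" using U NM[of U] by simp
    finally show "hausdorff1_outer (F ` E) \<le> emeasure ?M E + ennreal e" .
  qed
  define P where "P = {(p, q) \<in> \<rat> \<times> \<rat>. p \<le> q \<and> {p..q} \<subseteq> I}"
  have cP: "countable (insert (1, 0) P)"
  proof -
    have "P \<subseteq> \<rat> \<times> \<rat>" by (auto simp: P_def)
    then have "countable P" by (rule countable_subset) (intro countable_SIGMA countable_rat)
    then show ?thesis by simp
  qed
  \<comment> \<open>The dummy pair \<open>(1, 0)\<close> keeps the enumerated set nonempty; it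
    stands for an empty interval.\<close>
  define c where "c = from_nat_into (insert (1::real, 0) P)"
  have rc: "range c = insert (1, 0) P" using cP by (simp add: c_def range_from_nat_into)
  define A where "A n = {fst (c n)<..<snd (c n)}" for n
  have cov: "I \<subseteq> (\<Union>n. A n)"
  proof
    fix x assume "x \<in> I"
    then obtain e where e: "0 < e" "ball x e \<subseteq> I" using I open_contains_ball by blast
    obtain p where p: "p \<in> \<rat>" "x - e < p" "p < x" using Rats_dense_in_real[of "x - e" x] e by auto
    obtain q where q: "q \<in> \<rat>" "x < q" "q < x + e" using Rats_dense_in_real[of x "x + e"] e by auto
    have "{p..q} \<subseteq> ball x e" using p q by (auto simp: dist_real_def)
    then have "(p, q) \<in> P" using p q e by (auto simp: P_def)
    then obtain n where "c n = (p, q)" using rc by (metis insertI2 imageE)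
    then have "x \<in> A n" using p q by (simp add: A_def)
    then show "x \<in> (\<Union>n. A n)" by blast
  qed
  define En where "En n = E \<inter> disjointed A n" for n
  have AB: "A n \<in> sets borel" for n by (simp add: A_def)
  have EnB: "En n \<in> sets borel" for n
    unfolding En_def using sets.range_disjointed_sets[of A borel] AB E by auto
  have Eeq: "(\<Union>n. En n) = E" using cov E UN_disjointed_eq[of A] by (auto simp: En_def)
  have "hausdorff1_outer (F ` E) \<le> (\<Sum>n. hausdorff1_outer (F ` En n))"
    using hausdorff1_outer_subadditive[of "\<lambda>n. F ` En n"] Eeq by (metis image_UN)
  also have "\<dots> \<le> (\<Sum>n. emeasure ?M (En n))"
  proof (intro suminf_le)
    fix n
    have sub: "En n \<subseteq> A n" using disjointed_subset[of A n] by (auto simp: En_def)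
    show "hausdorff1_outer (F ` En n) \<le> emeasure ?M (En n)"
    proof (cases "A n = {}")
      case False
      then have "c n \<noteq> (1, 0)" by (auto simp: A_def)
      then have "c n \<in> P" using rc by (metis insertE rangeI)
      then show ?thesis using sub EnB by (intro loc[of _ "fst (c n)" "snd (c n)"]) (auto simp: P_def A_def)
    qed (use sub in auto)
  qed auto
  also have "\<dots> = emeasure ?M (\<Union>n. En n)"
    using EnB disjoint_family_disjointed[of A]
    by (intro suminf_emeasure) (auto simp: En_def disjoint_family_on_def)
  finally show ?thesis using Eeq by simp
qed

text \<open>The bound for Borel sets of parameters is an inequality between two measures on the
  plane, Hausdorff measure on the curve and the push-forward of the density \<open>g\<close>; it
  therefore extends to integrals of Borel functions.\<close>

lemma nn_integral_hausdorff1_curve_le: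
  fixes F :: "real \<Rightarrow> complex" and g :: "real \<Rightarrow> ennreal"
  assumes I: "open I" and cont: "continuous_on I F" and g [measurable]: "g \<in> borel_measurable borel"
    and le: "\<And>s t. s \<le> t \<Longrightarrow> {s..t} \<subseteq> I \<Longrightarrow> ennreal (dist (F s) (F t)) \<le> (\<integral>\<^sup>+x\<in>{s..t}. g x \<partial>lborel)"
    and fin: "\<And>s t. s \<le> t \<Longrightarrow> {s..t} \<subseteq> I \<Longrightarrow> (\<integral>\<^sup>+x\<in>{s..t}. g x \<partial>lborel) < \<infinity>"
    and \<rho> [measurable]: "\<rho> \<in> borel_measurable borel"
  shows "F ` I \<in> sets borel"
    and "(\<integral>\<^sup>+w\<in>F ` I. \<rho> w \<partial>hausdorff1) \<le> (\<integral>\<^sup>+t\<in>I. \<rho> (F t) * g t \<partial>lborel)"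
proof -
  let ?M = "density lborel g"
  have em: "emeasure ?M A = (\<integral>\<^sup>+x\<in>A. g x \<partial>lborel)" if "A \<in> sets borel" for A
    using that by (subst emeasure_density) auto
  \<comment> \<open>An open subset of the line is a countable union of compact intervals, so its
    image is a countable union of compact sets and thus Borel.\<close>
  obtain \<D> where \<D>: "countable \<D>" "\<D> \<subseteq> Pow I" "\<And>X. X \<in> \<D> \<Longrightarrow> \<exists>a b. X = cbox a b" "\<Union>\<D> = I"
    using open_countable_Union_open_cbox[OF I] by metis
  have "F ` I = (\<Union>X\<in>\<D>. F ` X)" using \<D>(4) by blast
  moreover have "F ` X \<in> sets borel" if X: "X \<in> \<D>" for X
  proof -
    have "compact X" using \<D>(3)[OF X] by (auto simp: compact_cbox)
    moreover have "continuous_on X F" using X \<D>(2) cont continuous_on_subset by blast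
    ultimately show ?thesis by (intro borel_compact compact_continuous_image)
  qed
  ultimately show FI: "F ` I \<in> sets borel" using \<D>(1) by auto
  define \<nu> where "\<nu> = distr (density hausdorff1 (indicator (F ` I))) borel (\<lambda>x. x)"
  have Ib: "I \<in> sets lborel" using I by simp
  define \<mu> where "\<mu> = distr (density (restrict_space lborel I) g) borel F"
  note idm = measurable_ident_hausdorff1
  have indm: "indicator (F ` I) \<in> borel_measurable hausdorff1"
    by (intro borel_measurable_indicator borel_imp_hausdorff1 FI)
  have Fm: "F \<in> borel_measurable (restrict_space lborel I)"
    using borel_measurable_continuous_on_restrict[OF cont] by (simp add: measurable_def sets_restrict_space space_restrict_space)
  have gm: "g \<in> borel_measurable (restrict_space lborel I)" by (intro measurable_restrict_space1) simp
  have "\<nu> \<le> \<mu>"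
  proof (subst le_measure)
    show "sets \<nu> = sets \<mu>" by (simp add: \<nu>_def \<mu>_def)
    show "\<forall>A\<in>sets \<nu>. emeasure \<nu> A \<le> emeasure \<mu> A"
    proof
      fix A assume "A \<in> sets \<nu>" then have A: "A \<in> sets borel" by (simp add: \<nu>_def)
      let ?E = "I \<inter> F -` A"
      have Ao: "A \<inter> F ` I \<in> sets hausdorff1" by (intro borel_imp_hausdorff1 sets.Int A FI)
      have Ah: "A \<in> sets hausdorff1" by (intro borel_imp_hausdorff1 A)
      have EI: "?E \<in> sets (restrict_space lborel I)"
        using measurable_sets[OF Fm A] by (simp add: space_restrict_space Int_commute)
      then have E: "?E \<in> sets borel" using Ib by (simp add: sets_restrict_space_iff)
      have "emeasure \<nu> A = emeasure (density hausdorff1 (indicator (F ` I))) A"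
        unfolding \<nu>_def using A idm by (subst emeasure_distr) auto
      also have "\<dots> = (\<integral>\<^sup>+x. indicator (A \<inter> F ` I) x \<partial>hausdorff1)"
        using indm Ah by (subst emeasure_density) (auto intro!: nn_integral_cong simp: indicator_def)
      also have "\<dots> = hausdorff1_outer (A \<inter> F ` I)"
        using Ao by (simp add: emeasure_hausdorff1)
      also have "A \<inter> F ` I = F ` ?E" by auto
      also have "hausdorff1_outer (F ` ?E) \<le> emeasure ?M ?E"
        using le fin E by (intro hausdorff1_curve_borel[OF I cont g]) (auto simp: em)
      also have "\<dots> = (\<integral>\<^sup>+x\<in>?E. g x \<partial>lborel)" using E by (rule em)
      also have "\<dots> = (\<integral>\<^sup>+x\<in>?E. g x \<partial>restrict_space lborel I)"
        using Ib by (subst nn_integral_restrict_space) (auto intro!: nn_integral_cong simp: indicator_def)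
      also have "\<dots> = emeasure (density (restrict_space lborel I) g) ?E"
        using gm EI by (subst emeasure_density) auto
      also have "\<dots> = emeasure \<mu> A"
        unfolding \<mu>_def using A Fm by (subst emeasure_distr) (auto simp: space_restrict_space Int_commute)
      finally show "emeasure \<nu> A \<le> emeasure \<mu> A" .
    qed
  qed
  then have "(\<integral>\<^sup>+w. \<rho> w \<partial>\<nu>) \<le> (\<integral>\<^sup>+w. \<rho> w \<partial>\<mu>)"
    by (intro nn_integral_mono_measure) (simp_all add: \<nu>_def \<mu>_def)
  also have "(\<integral>\<^sup>+w. \<rho> w \<partial>\<nu>) = (\<integral>\<^sup>+w. \<rho> w \<partial>density hausdorff1 (indicator (F ` I)))"
    unfolding \<nu>_def using idm by (subst nn_integral_distr) auto
  also have "\<dots> = (\<integral>\<^sup>+w\<in>F ` I. \<rho> w \<partial>hausdorff1)"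
    using indm measurable_compose[OF idm \<rho>] by (subst nn_integral_density) (auto simp: mult.commute)
  also have "(\<integral>\<^sup>+w. \<rho> w \<partial>\<mu>) = (\<integral>\<^sup>+t. \<rho> (F t) \<partial>density (restrict_space lborel I) g)"
    unfolding \<mu>_def using Fm by (subst nn_integral_distr) auto
  also have "\<dots> = (\<integral>\<^sup>+t. g t * \<rho> (F t) \<partial>restrict_space lborel I)"
    using gm measurable_compose[OF Fm \<rho>] by (subst nn_integral_density) auto
  also have "\<dots> = (\<integral>\<^sup>+t\<in>I. \<rho> (F t) * g t \<partial>lborel)"
    using Ib by (subst nn_integral_restrict_space) (auto simp: mult.commute)
  finally show "(\<integral>\<^sup>+w\<in>F ` I. \<rho> w \<partial>hausdorff1) \<le> (\<integral>\<^sup>+t\<in>I. \<rho> (F t) * g t \<partial>lborel)" .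
qed

section \<open>Lower bounds for the length of circular arcs\<close>

lemma hausdorff1_outer_expanding:
  fixes \<gamma> :: "real \<Rightarrow> complex"
  assumes k: "0 < k" and exp: "\<And>x y. x \<in> E \<Longrightarrow> y \<in> E \<Longrightarrow> k * \<bar>x - y\<bar> \<le> dist (\<gamma> x) (\<gamma> y)"
    and E: "E \<in> sets borel"
  shows "ennreal k * emeasure lborel E \<le> hausdorff1_outer (\<gamma> ` E)"
proof -
  \<comment> \<open>One scale is enough, since each premeasure is below the Hausdorff measure. A
    covering set pulls back to a set of parameters whose diameter is at most \<open>1 / k\<close>
    times its own, hence to a subset of an interval of that length.\<close>
  have "ennreal k * emeasure lborel E \<le> hausdorff1_pre 1 (\<gamma> ` E)"
  proof (rule le_hausdorff1_preI)
    fix C :: "nat \<Rightarrow> complex set"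
    assume C: "\<gamma> ` E \<subseteq> (\<Union>i. C i)" "\<And>i. bounded (C i)"
    define Ei where "Ei i = E \<inter> \<gamma> -` C i" for i
    have close: "\<bar>x - y\<bar> \<le> diameter (C i) / k" if "x \<in> Ei i" "y \<in> Ei i" for x y i
    proof -
      have "k * \<bar>x - y\<bar> \<le> dist (\<gamma> x) (\<gamma> y)" using that by (intro exp) (auto simp: Ei_def)
      also have "\<dots> \<le> diameter (C i)" using that C(2) by (intro diameter_bounded_bound) (auto simp: Ei_def)
      finally show ?thesis using k by (simp add: field_simps)
    qed
    have d0: "0 \<le> diameter (C i)" for i using C(2) by (rule diameter_ge_0)
    have "\<exists>J. J \<in> sets lborel \<and> Ei i \<subseteq> J \<and> emeasure lborel J \<le> ennreal (diameter (C i) / k)" for i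
    proof (cases "Ei i = {}")
      case True
      then show ?thesis by (intro exI[of _ "{}"]) auto
    next
      case False
      then obtain x0 where x0: "x0 \<in> Ei i" by blast
      have bb: "x \<in> {x0 - diameter (C i) / k .. x0 + diameter (C i) / k}" if "x \<in> Ei i" for x
        using close[OF that x0] by auto
      have bdd: "bdd_below (Ei i)" "bdd_above (Ei i)" using bb by (meson atLeastAtMost_iff bdd_belowI bdd_aboveI)+
      have sub: "Ei i \<subseteq> {Inf (Ei i)..Sup (Ei i)}" using bdd by (auto intro: cInf_lower cSup_upper)
      have "Sup (Ei i) \<le> Inf (Ei i) + diameter (C i) / k"
      proof (rule cSup_least[OF False])
        fix x assume x: "x \<in> Ei i"
        have "x - diameter (C i) / k \<le> Inf (Ei i)"
          using close[OF x] by (intro cInf_greatest[OF False]) (force simp: abs_le_iff)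
        then show "x \<le> Inf (Ei i) + diameter (C i) / k" by simp
      qed
      then have "emeasure lborel {Inf (Ei i)..Sup (Ei i)} \<le> ennreal (diameter (C i) / k)"
        using sub False by (subst emeasure_lborel_Icc) (auto intro!: ennreal_leI)
      then show ?thesis using sub by (intro exI[of _ "{Inf (Ei i)..Sup (Ei i)}"]) auto
    qed
    then obtain J where J: "\<And>i. J i \<in> sets lborel" "\<And>i. Ei i \<subseteq> J i" "\<And>i. emeasure lborel (J i) \<le> ennreal (diameter (C i) / k)"
      by metis
    have "E \<subseteq> (\<Union>i. J i)" using J(2) C(1) by (force simp: Ei_def)
    then have "emeasure lborel E \<le> emeasure lborel (\<Union>i. J i)" using J(1) by (intro emeasure_mono) auto
    also have "\<dots> \<le> (\<Sum>i. emeasure lborel (J i))" using J(1) by (intro emeasure_subadditive_countably) auto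
    also have "\<dots> \<le> (\<Sum>i. ennreal (diameter (C i) / k))" using J(3) by (intro suminf_le) auto
    finally have "ennreal k * emeasure lborel E \<le> ennreal k * (\<Sum>i. ennreal (diameter (C i) / k))" by (rule mult_left_mono) simp
    also have "\<dots> = (\<Sum>i. ennreal k * ennreal (diameter (C i) / k))" by (rule ennreal_suminf_cmult[symmetric])
    also have "\<dots> = (\<Sum>i. ennreal (diameter (C i)))"
      using k d0 by (intro arg_cong[where f=suminf] ext) (simp add: ennreal_mult[symmetric])
    finally show "ennreal k * emeasure lborel E \<le> (\<Sum>i. ennreal (diameter (C i)))" .
  qed
  also have "\<dots> \<le> hausdorff1_outer (\<gamma> ` E)" by (rule hausdorff1_pre_le_outer) simp
  finally show ?thesis .
qed

lemma dist_circle_points: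
  assumes "0 < r"
  shows "dist (z0 + of_real r * cis x) (z0 + of_real r * cis y) = 2 * r * \<bar>sin ((x - y) / 2)\<bar>"
proof -
  have c: "cis x - cis y = (cis (x - y) - 1) * cis y" by (simp add: left_diff_distrib cis_mult)
  have "of_real r * cis x - of_real r * cis y = of_real r * ((cis (x - y) - 1) * cis y)"
    unfolding c[symmetric] by (simp add: right_diff_distrib)
  then have "dist (z0 + of_real r * cis x) (z0 + of_real r * cis y) = r * norm (cis (x - y) - 1)"
    using assms by (simp add: dist_norm norm_mult)
  also have "norm (cis (x - y) - 1) = 2 * \<bar>sin ((x - y) / 2)\<bar>"
    using dist_exp_i_1[of "x - y"] by (simp add: cis_conv_exp)
  finally show ?thesis by simp
qed

text \<open>\<open>sin v - v * cos v\<close> vanishes at \<open>0\<close> and has the derivative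
  \<open>v * sin v\<close>. For chords this means that an arc of angle \<open>2 * v\<close> is
  longer than its chord by a factor of at most \<open>1 / cos \<eta>\<close>, for
  \<open>\<eta> < pi / 2\<close>.\<close>

lemma sin_ge_mult_cos:
  assumes "0 \<le> v" "v \<le> \<eta>" "\<eta> \<le> pi / 2"
  shows "v * cos \<eta> \<le> sin v"
proof -
  have "0 \<le> sin v - v * cos v"
  proof -
    have "sin 0 - 0 * cos 0 \<le> sin v - v * cos v"
    proof (rule DERIV_nonneg_imp_nondecreasing[OF assms(1)])
      fix x assume x: "0 \<le> x" "x \<le> v"
      have "((\<lambda>v. sin v - v * cos v) has_real_derivative x * sin x) (at x)"
        by (auto intro!: derivative_eq_intros)
      moreover have "0 \<le> x * sin x" using x assms by (intro mult_nonneg_nonneg sin_ge_zero) auto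
      ultimately show "\<exists>y. ((\<lambda>v. sin v - v * cos v) has_real_derivative y) (at x) \<and> 0 \<le> y" by blast
    qed
    then show ?thesis by simp
  qed
  moreover have "cos \<eta> \<le> cos v" using assms by (intro cos_monotone_0_pi_le) auto
  ultimately show ?thesis using assms by (smt (verit) mult_left_mono)
qed

text \<open>The parametrisation by angle does not expand distances globally, because angles near
  \<open>-pi\<close> and \<open>pi\<close> give nearby points. On an arc of angle
  \<open>2 * pi / n\<close> it expands by \<open>r * cos (pi / n)\<close>; the bounds for
  \<open>n\<close> disjoint arcs are added, and \<open>n\<close> tends to infinity.\<close>

lemma hausdorff1_circle_ge:
  assumes r: "0 < r" and B: "B \<in> sets borel"
  shows "ennreal r * emeasure lborel ({-pi<..pi} \<inter> (\<lambda>t. z0 + of_real r * cis t) -` B)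
    \<le> hausdorff1_outer (B \<inter> sphere z0 r)"
proof -
  define \<gamma> where "\<gamma> t = z0 + of_real r * cis t" for t
  have cont: "continuous_on S \<gamma>" for S unfolding \<gamma>_def by (intro continuous_intros)
  have [measurable]: "\<gamma> \<in> borel_measurable borel" using cont by (rule borel_measurable_continuous_onI)
  define E where "E = {-pi<..pi} \<inter> \<gamma> -` B"
  have Eb: "E \<in> sets borel" using B measurable_sets[of \<gamma> borel borel B] by (auto simp: E_def)
  have inj: "inj_on \<gamma> {-pi<..pi}"
  proof (rule inj_onI)
    fix x y assume xy: "x \<in> {-pi<..pi}" "y \<in> {-pi<..pi}" "\<gamma> x = \<gamma> y"
    then have "Arg (cis x) = Arg (cis y)" using r by (simp add: \<gamma>_def)
    then show "x = y" using xy by (simp add: Arg_cis)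
  qed
  define h where "h = hausdorff1_outer (B \<inter> sphere z0 r)"
  \<comment> \<open>\<open>2 < n\<close> makes \<open>pi / n\<close> smaller than
    \<open>pi / 2\<close>, so that the expansion factor is positive.\<close>
  have main: "ennreal (r * cos (pi / real n)) * emeasure lborel E \<le> h" if n: "2 < n" for n :: nat
  proof -
    define t where "t i = -pi + 2 * pi * real i / real n" for i :: nat
    define J where "J i = {t i<..t (Suc i)}" for i
    have tmono: "t i \<le> t j" if "i \<le> j" for i j using that n
      by (auto simp: t_def intro!: divide_right_mono mult_left_mono)
    have t0: "t 0 = -pi" and tn: "t n = pi" using n by (auto simp: t_def)
    have tS: "t (Suc i) - t i = 2 * pi / real n" for i using n by (simp add: t_def field_simps)
    have disjJ: "J i \<inter> J j = {}" if "i < j" for i j using tmono[of "Suc i" j] that by (auto simp: J_def)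
    have Jsub: "J i \<subseteq> {-pi<..pi}" if "i < n" for i
      using tmono[of 0 i] tmono[of "Suc i" n] that t0 tn by (auto simp: J_def)
    have cov: "(\<Union>i<k. J i) = {-pi<..t k}" for k
    proof (induction k)
      case (Suc k)
      then show ?case using tmono[of 0 k] tmono[of k "Suc k"] t0 by (auto simp: lessThan_Suc J_def)
    qed (simp add: t0)
    have JB: "\<gamma> ` J i \<in> sets borel" for i
    proof -
      \<comment> \<open>The half-open arc is a countable union of compact arcs, which shows that it
        is Borel; measurability is needed to add the measures of the pieces.\<close>
      have "J i = (\<Union>m::nat. {t i + 1 / real (Suc m)..t (Suc i)})"
      proof
        show "J i \<subseteq> (\<Union>m::nat. {t i + 1 / real (Suc m)..t (Suc i)})"
        proof
          fix x assume x: "x \<in> J i"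
          then have "0 < x - t i" by (simp add: J_def)
          then obtain m where "inverse (real (Suc m)) < x - t i" using reals_Archimedean by blast
          then show "x \<in> (\<Union>m::nat. {t i + 1 / real (Suc m)..t (Suc i)})"
            using x by (intro UN_I[of m]) (auto simp: J_def inverse_eq_divide)
        qed
        show "(\<Union>m::nat. {t i + 1 / real (Suc m)..t (Suc i)}) \<subseteq> J i"
          by (auto simp: J_def) (smt (verit) divide_pos_pos of_nat_0_less_iff zero_less_Suc of_nat_Suc)
      qed
      then have "\<gamma> ` J i = (\<Union>m::nat. \<gamma> ` {t i + 1 / real (Suc m)..t (Suc i)})" by blast
      moreover have "\<gamma> ` {t i + 1 / real (Suc m)..t (Suc i)} \<in> sets borel" for m
        using cont by (intro borel_compact compact_continuous_image) auto
      ultimately show ?thesis by auto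
    qed
    have piece: "ennreal (r * cos (pi / real n)) * emeasure lborel (E \<inter> J i) \<le> hausdorff1_outer (\<gamma> ` (E \<inter> J i))" for i
    proof (rule hausdorff1_outer_expanding)
      have c0: "0 < cos (pi / real n)" using n by (intro cos_gt_zero) (auto simp: field_simps)
      then show "0 < r * cos (pi / real n)" using r by simp
      show "E \<inter> J i \<in> sets borel" using Eb by (auto simp: J_def)
      fix x y assume "x \<in> E \<inter> J i" "y \<in> E \<inter> J i"
      then have xy: "\<bar>x - y\<bar> \<le> 2 * pi / real n" using tS[of i] by (auto simp: J_def)
      have "\<bar>x - y\<bar> / 2 * cos (pi / real n) \<le> sin (\<bar>x - y\<bar> / 2)"
        using xy n by (intro sin_ge_mult_cos) (auto simp: field_simps)
      also have "\<dots> \<le> \<bar>sin ((x - y) / 2)\<bar>"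
        by (cases "x \<le> y") (auto simp: abs_if minus_diff_eq[symmetric, of x y] simp del: minus_diff_eq)
      finally have "\<bar>x - y\<bar> * cos (pi / real n) \<le> 2 * \<bar>sin ((x - y) / 2)\<bar>" by simp
      then have "r * (\<bar>x - y\<bar> * cos (pi / real n)) \<le> r * (2 * \<bar>sin ((x - y) / 2)\<bar>)" using r by (intro mult_left_mono) auto
      then show "r * cos (pi / real n) * \<bar>x - y\<bar> \<le> dist (\<gamma> x) (\<gamma> y)"
        unfolding \<gamma>_def dist_circle_points[OF r] by (simp add: mult_ac)
    qed
    have im: "\<gamma> ` (E \<inter> J i) = B \<inter> \<gamma> ` J i" if "i < n" for i using Jsub[OF that] by (auto simp: E_def)
    have ims: "B \<inter> \<gamma> ` J i \<in> sets hausdorff1" for i by (intro borel_imp_hausdorff1 sets.Int B JB)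
    have "emeasure lborel E = emeasure lborel (\<Union>i<n. E \<inter> J i)"
      using cov[of n] tn by (intro arg_cong[where f="emeasure lborel"]) (auto simp: E_def)
    also have "\<dots> = (\<Sum>i<n. emeasure lborel (E \<inter> J i))"
    proof (rule sum_emeasure[symmetric])
      show "disjoint_family_on (\<lambda>i. E \<inter> J i) {..<n}"
        unfolding disjoint_family_on_def
      proof (intro ballI impI)
        fix i j :: nat assume "i \<noteq> j"
        then have "J i \<inter> J j = {}" using disjJ[of i j] disjJ[of j i] by (cases "i < j") auto
        then show "E \<inter> J i \<inter> (E \<inter> J j) = {}" by blast
      qed
    qed (use Eb in \<open>auto simp: J_def\<close>)
    finally have "ennreal (r * cos (pi / real n)) * emeasure lborel E = (\<Sum>i<n. ennreal (r * cos (pi / real n)) * emeasure lborel (E \<inter> J i))"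
      by (simp add: sum_distrib_left)
    also have "\<dots> \<le> (\<Sum>i<n. emeasure hausdorff1 (B \<inter> \<gamma> ` J i))"
    proof (rule sum_mono)
      fix i assume "i \<in> {..<n}"
      then show "ennreal (r * cos (pi / real n)) * emeasure lborel (E \<inter> J i) \<le> emeasure hausdorff1 (B \<inter> \<gamma> ` J i)"
        using piece[of i] im[of i] emeasure_hausdorff1[OF ims[of i]] by simp
    qed
    also have "\<dots> = emeasure hausdorff1 (\<Union>i<n. B \<inter> \<gamma> ` J i)"
    proof (rule sum_emeasure)
      show "disjoint_family_on (\<lambda>i. B \<inter> \<gamma> ` J i) {..<n}"
        unfolding disjoint_family_on_def
      proof (intro ballI impI)
        fix i j assume ij: "i \<in> {..<n}" "j \<in> {..<n}" "i \<noteq> j"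
        then have "J i \<inter> J j = {}" using disjJ[of i j] disjJ[of j i] by (cases "i < j") auto
        then have "\<gamma> ` J i \<inter> \<gamma> ` J j = {}"
          using inj_on_image_Int[OF inj Jsub Jsub, of i j] ij by auto
        then show "B \<inter> \<gamma> ` J i \<inter> (B \<inter> \<gamma> ` J j) = {}" by blast
      qed
    qed (use ims in auto)
    also have "\<dots> = hausdorff1_outer (\<Union>i<n. B \<inter> \<gamma> ` J i)"
      by (intro emeasure_hausdorff1 sets.finite_UN ims) simp
    also have "\<dots> \<le> h" unfolding h_def
      using r by (intro hausdorff1_outer_mono) (auto simp: \<gamma>_def dist_norm norm_mult)
    finally show ?thesis .
  qed
  have "ennreal r * emeasure lborel E \<le> h"
  proof (cases h)
    case (real h')
    have "emeasure lborel E \<le> emeasure lborel {-pi<..pi}" by (intro emeasure_mono) (auto simp: E_def)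
    also have "\<dots> < \<infinity>" by simp
    finally obtain e where e: "emeasure lborel E = ennreal e" "0 \<le> e" by (cases "emeasure lborel E") auto
    have "(\<lambda>n. r * cos (pi / real n) * e) \<longlonglongrightarrow> r * cos 0 * e"
      by (intro tendsto_intros lim_const_over_n)
    moreover have "r * cos (pi / real n) * e \<le> h'" if n: "2 < n" for n :: nat
    proof -
      have "0 < cos (pi / real n)" using n by (intro cos_gt_zero) (auto simp: field_simps)
      then show ?thesis using main[OF n] e real r by (simp add: ennreal_mult[symmetric] ennreal_le_iff)
    qed
    ultimately have "r * cos 0 * e \<le> h'"
      by (intro LIMSEQ_le_const2[where X="\<lambda>n. r * cos (pi / real n) * e"]) (auto intro!: exI[of _ 3])
    then show ?thesis using e real r by (simp add: ennreal_mult[symmetric] ennreal_leI)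
  qed simp
  then show ?thesis by (simp add: E_def h_def \<gamma>_def[abs_def])
qed

text \<open>This is the comparison of measures again, with the inequality reversed. It leads from an
  integral over the angle back to an integral over the circle itself.\<close>

lemma nn_integral_hausdorff1_circle_ge:
  assumes r: "0 < r" and \<rho> [measurable]: "\<rho> \<in> borel_measurable borel"
  shows "(\<integral>\<^sup>+t\<in>{-pi<..pi}. \<rho> (z0 + of_real r * cis t) * ennreal r \<partial>lborel)
     \<le> (\<integral>\<^sup>+w\<in>sphere z0 r. \<rho> w \<partial>hausdorff1)"
proof -
  define \<gamma> where "\<gamma> t = z0 + of_real r * cis t" for t
  have cont: "continuous_on S \<gamma>" for S unfolding \<gamma>_def by (intro continuous_intros)
  have \<gamma>m [measurable]: "\<gamma> \<in> borel_measurable borel" using cont by (rule borel_measurable_continuous_onI)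
  define \<nu> where "\<nu> = distr (density hausdorff1 (indicator (sphere z0 r))) borel (\<lambda>x. x)"
  define \<mu> where "\<mu> = distr (density lborel (\<lambda>t. ennreal r * indicator {-pi<..pi} t)) borel \<gamma>"
  note idm = measurable_ident_hausdorff1
  have indm: "indicator (sphere z0 r) \<in> borel_measurable hausdorff1"
    by (intro borel_measurable_indicator borel_imp_hausdorff1) simp
  have "\<mu> \<le> \<nu>"
  proof (subst le_measure)
    show "sets \<mu> = sets \<nu>" by (simp add: \<nu>_def \<mu>_def)
    show "\<forall>A\<in>sets \<mu>. emeasure \<mu> A \<le> emeasure \<nu> A"
    proof
      fix A assume "A \<in> sets \<mu>" then have A: "A \<in> sets borel" by (simp add: \<mu>_def)
      have gA: "\<gamma> -` A \<in> sets borel" using A measurable_sets[OF \<gamma>m A] by simp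
      have Ao: "A \<inter> sphere z0 r \<in> sets hausdorff1" by (intro borel_imp_hausdorff1 sets.Int A) simp
      have Ah: "A \<in> sets hausdorff1" by (intro borel_imp_hausdorff1 A)
      have "emeasure \<mu> A = emeasure (density lborel (\<lambda>t. ennreal r * indicator {-pi<..pi} t)) (\<gamma> -` A)"
        unfolding \<mu>_def using A by (subst emeasure_distr) auto
      also have "\<dots> = (\<integral>\<^sup>+t. ennreal r * indicator ({-pi<..pi} \<inter> \<gamma> -` A) t \<partial>lborel)"
        using gA by (subst emeasure_density) (auto intro!: nn_integral_cong simp: indicator_def)
      also have "\<dots> = ennreal r * emeasure lborel ({-pi<..pi} \<inter> \<gamma> -` A)"
        using gA by (subst nn_integral_cmult_indicator) auto
      also have "\<dots> \<le> hausdorff1_outer (A \<inter> sphere z0 r)"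
        unfolding \<gamma>_def by (rule hausdorff1_circle_ge[OF r A])
      also have "\<dots> = (\<integral>\<^sup>+x. indicator (A \<inter> sphere z0 r) x \<partial>hausdorff1)"
        using Ao by (simp add: emeasure_hausdorff1)
      also have "\<dots> = emeasure (density hausdorff1 (indicator (sphere z0 r))) A"
        using indm Ah by (subst emeasure_density) (auto intro!: nn_integral_cong simp: indicator_def)
      also have "\<dots> = emeasure \<nu> A" unfolding \<nu>_def using A idm by (subst emeasure_distr) auto
      finally show "emeasure \<mu> A \<le> emeasure \<nu> A" .
    qed
  qed
  then have "(\<integral>\<^sup>+w. \<rho> w \<partial>\<mu>) \<le> (\<integral>\<^sup>+w. \<rho> w \<partial>\<nu>)"
    by (intro nn_integral_mono_measure) (simp_all add: \<nu>_def \<mu>_def)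
  also have "(\<integral>\<^sup>+w. \<rho> w \<partial>\<nu>) = (\<integral>\<^sup>+w. \<rho> w \<partial>density hausdorff1 (indicator (sphere z0 r)))"
    unfolding \<nu>_def using idm by (subst nn_integral_distr) auto
  also have "\<dots> = (\<integral>\<^sup>+w\<in>sphere z0 r. \<rho> w \<partial>hausdorff1)"
    using indm measurable_compose[OF idm \<rho>] by (subst nn_integral_density) (auto simp: mult.commute)
  also have "(\<integral>\<^sup>+w. \<rho> w \<partial>\<mu>) = (\<integral>\<^sup>+t. \<rho> (\<gamma> t) \<partial>density lborel (\<lambda>t. ennreal r * indicator {-pi<..pi} t))"
    unfolding \<mu>_def by (subst nn_integral_distr) auto
  also have "\<dots> = (\<integral>\<^sup>+t. ennreal r * indicator {-pi<..pi} t * \<rho> (\<gamma> t) \<partial>lborel)"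
    by (subst nn_integral_density) auto
  also have "\<dots> = (\<integral>\<^sup>+t\<in>{-pi<..pi}. \<rho> (\<gamma> t) * ennreal r \<partial>lborel)"
    by (intro nn_integral_cong) (simp add: mult_ac)
  finally show ?thesis by (simp add: \<gamma>_def)
qed

section \<open>Absolute continuity on lines\<close>

lemma DERIV_pos_square:
  "((\<lambda>x::real. (max 0 x)\<^sup>2) has_real_derivative 2 * max 0 x) (at x)"
proof -
  consider "x < 0" | "x > 0" | "x = 0" by linarith
  then show ?thesis
  proof cases
    case 1
    have "((\<lambda>x::real. 0) has_real_derivative 2 * max 0 x) (at x)" using 1 by simp
    then show ?thesis by (rule has_field_derivative_transform_within_open[of _ _ _ "{..<0}"]) (use 1 in auto)
  next
    case 2
    have "((\<lambda>x::real. x\<^sup>2) has_real_derivative 2 * max 0 x) (at x)" using 2 by (auto intro!: derivative_eq_intros)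
    then show ?thesis by (rule has_field_derivative_transform_within_open[of _ _ _ "{0<..}"]) (use 2 in auto)
  next
    case 3
    have "(\<lambda>h::real. (max 0 h)\<^sup>2 / h) \<midarrow>0\<rightarrow> 0"
    proof (rule tendsto_0_le[where K=1])
      show "(\<lambda>h::real. h) \<midarrow>0\<rightarrow> 0" by (rule tendsto_ident_at)
      show "\<forall>\<^sub>F h in at 0. norm ((max 0 h)\<^sup>2 / h) \<le> norm (h::real) * 1"
        by (intro always_eventually) (auto simp: max_def power2_eq_square)
    qed
    then show ?thesis using 3 by (simp add: DERIV_def)
  qed
qed

text \<open>A \<open>C\<^sup>1\<close> transition from \<open>0\<close> to \<open>1\<close> on the unit interval; its derivative \<open>hat\<close> has
  integral \<open>1\<close> and, rescaled, serves as an approximate identity.\<close>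
definition step :: "real \<Rightarrow> real" where
  "step x = 2 * (max 0 x)\<^sup>2 - 4 * (max 0 (x - 1/2))\<^sup>2 + 2 * (max 0 (x - 1))\<^sup>2"

definition hat :: "real \<Rightarrow> real" where
  "hat x = 4 * max 0 x - 8 * max 0 (x - 1/2) + 4 * max 0 (x - 1)"

lemma DERIV_step: "(step has_real_derivative hat x) (at x)"
proof -
  have *: "((\<lambda>x::real. (max 0 (x - c))\<^sup>2) has_real_derivative 2 * max 0 (x - c)) (at x)" for c
  proof -
    have "((\<lambda>x. x - c) has_real_derivative 1) (at x)" by (auto intro!: derivative_eq_intros)
    from DERIV_chain2[OF DERIV_pos_square this] show ?thesis by simp
  qed
  show ?thesis unfolding step_def[abs_def] hat_def
  proof -
    have "((\<lambda>x. 2 * (max 0 (x - 0))\<^sup>2 - 4 * (max 0 (x - 1/2))\<^sup>2 + 2 * (max 0 (x - 1))\<^sup>2) has_real_derivative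
        2 * (2 * max 0 (x - 0)) - 4 * (2 * max 0 (x - 1/2)) + 2 * (2 * max 0 (x - 1))) (at x)"
      by (intro DERIV_add DERIV_diff DERIV_cmult *)
    then show "((\<lambda>x. 2 * (max 0 x)\<^sup>2 - 4 * (max 0 (x - 1/2))\<^sup>2 + 2 * (max 0 (x - 1))\<^sup>2) has_real_derivative
        4 * max 0 x - 8 * max 0 (x - 1/2) + 4 * max 0 (x - 1)) (at x)" by simp
  qed
qed

lemma step_eq: "x \<le> 0 \<Longrightarrow> step x = 0" "1 \<le> x \<Longrightarrow> step x = 1"
  by (auto simp: step_def max_def power2_eq_square algebra_simps)

lemma hat_eq_0: "x \<le> 0 \<Longrightarrow> hat x = 0" "1 \<le> x \<Longrightarrow> hat x = 0"
  by (auto simp: hat_def max_def)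

lemma hat_bounds: "0 \<le> hat x" "hat x \<le> 2"
  by (auto simp: hat_def max_def)

lemma step_mono: "x \<le> y \<Longrightarrow> step x \<le> step y"
  by (rule DERIV_nonneg_imp_nondecreasing) (use DERIV_step hat_bounds in auto)

lemma step_bounds: "0 \<le> step x" "step x \<le> 1"
  using step_mono[of "min 0 x" x] step_mono[of x "max 1 x"] step_eq(1)[of "min 0 x"] step_eq(2)[of "max 1 x"] by auto

lemma continuous_on_hat: "continuous_on S hat" unfolding hat_def[abs_def] by (intro continuous_intros)

lemma DERIV_step_affine: "((\<lambda>x. step (n * (x - c))) has_real_derivative n * hat (n * (x - c))) (at x)"
proof -
  have "((\<lambda>x. n * (x - c)) has_real_derivative n) (at x)" by (auto intro!: derivative_eq_intros)
  from DERIV_chain2[OF DERIV_step this] show ?thesis by (simp add: mult.commute)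
qed

lemma hat_kernel:
  assumes n: "0 < n"
  shows "integrable lborel (\<lambda>y. n * hat (n * (y - a)))" "(LINT y|lborel. n * hat (n * (y - a))) = 1"
proof -
  have hb: "has_bochner_integral lborel (\<lambda>y. n * hat (n * (y - a)) * indicator {a..a + 1/n} y) (step (n * (a + 1/n - a)) - step (n * (a - a)))"
  proof (rule has_bochner_integral_FTC_Icc_real)
    show "a \<le> a + 1 / n" using n by simp
    show "((\<lambda>x. step (n * (x - a))) has_real_derivative n * hat (n * (x - a))) (at x)" for x by (rule DERIV_step_affine)
    show "isCont (\<lambda>x. n * hat (n * (x - a))) x" for x
      by (intro continuous_intros continuous_on_interior[OF continuous_on_compose2[OF continuous_on_hat[of UNIV]], of UNIV]) auto
  qed
  have eq: "(\<lambda>y. n * hat (n * (y - a)) * indicator {a..a + 1/n} y) = (\<lambda>y. n * hat (n * (y - a)))"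
  proof
    fix y
    consider "y < a" | "y > a + 1/n" | "y \<in> {a..a + 1/n}" by fastforce
    then show "n * hat (n * (y - a)) * indicator {a..a + 1/n} y = n * hat (n * (y - a))"
    proof cases
      case 1 then show ?thesis using n by (simp add: hat_eq_0 mult_nonneg_nonpos)
    next
      case 2 then have "1 \<le> n * (y - a)" using n by (simp add: field_simps)
      then show ?thesis by (simp add: hat_eq_0)
    qed simp
  qed
  have "step (n * (a + 1/n - a)) - step (n * (a - a)) = 1" using n by (simp add: step_eq)
  then have "has_bochner_integral lborel (\<lambda>y. n * hat (n * (y - a))) 1" using hb unfolding eq by simp
  then show "integrable lborel (\<lambda>y. n * hat (n * (y - a)))" "(LINT y|lborel. n * hat (n * (y - a))) = 1"
    by (auto simp: has_bochner_integral_iff)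
qed

lemma hat_kernel_support: "0 < n \<Longrightarrow> y \<notin> {a..a + 1/n} \<Longrightarrow> hat (n * (y - a)) = 0"
  by (cases "y < a") (auto simp: field_simps hat_eq_0 mult_nonneg_nonpos less_imp_le)

text \<open>The kernel is nonnegative with integral \<open>1\<close>, so it averages the values of
  \<open>G\<close> on its support; an average of values within \<open>e\<close> of \<open>c\<close>
  is within \<open>e\<close> of \<open>c\<close>.\<close>

lemma hat_kernel_approx:
  fixes G :: "real \<Rightarrow> complex"
  assumes n: "0 < n" and G [measurable]: "G \<in> borel_measurable borel"
    and le: "\<And>y. y \<in> {a..a + 1/n} \<Longrightarrow> norm (G y - c) \<le> e"
  shows "integrable lborel (\<lambda>y. (n * hat (n * (y - a))) *\<^sub>R G y)"
    and "norm ((LINT y|lborel. (n * hat (n * (y - a))) *\<^sub>R G y) - c) \<le> e"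
proof -
  let ?k = "\<lambda>y. n * hat (n * (y - a))"
  have k0: "0 \<le> ?k y" for y using n hat_bounds by simp
  have [measurable]: "hat \<in> borel_measurable borel"
    using continuous_on_hat by (rule borel_measurable_continuous_onI)
  have b: "norm (?k y *\<^sub>R (G y - c)) \<le> ?k y * e" for y
  proof (cases "y \<in> {a..a + 1/n}")
    case True
    have "norm (?k y *\<^sub>R (G y - c)) = ?k y * norm (G y - c)" using k0[of y] by simp
    also have "\<dots> \<le> ?k y * e" by (rule mult_left_mono[OF le[OF True] k0])
    finally show ?thesis .
  qed (simp add: hat_kernel_support[OF n])
  have i: "integrable lborel (\<lambda>y. ?k y *\<^sub>R (G y - c))"
  proof (rule Bochner_Integration.integrable_bound[of _ "\<lambda>y. ?k y * e"])
    show "integrable lborel (\<lambda>y. ?k y * e)" using hat_kernel(1)[OF n, of a] by (rule integrable_mult_left)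
    show "AE y in lborel. norm (?k y *\<^sub>R (G y - c)) \<le> norm (?k y * e)"
      by (rule AE_I2) (rule order_trans[OF b], simp)
  qed measurable
  have ic: "integrable lborel (\<lambda>y. ?k y *\<^sub>R c)" using hat_kernel(1)[OF n, of a] by (rule integrable_scaleR_left)
  have eq: "(\<lambda>y. ?k y *\<^sub>R G y) = (\<lambda>y. ?k y *\<^sub>R (G y - c) + ?k y *\<^sub>R c)"
    by (simp add: scaleR_add_right[symmetric])
  show "integrable lborel (\<lambda>y. ?k y *\<^sub>R G y)" unfolding eq using i ic by simp
  have "(LINT y|lborel. ?k y *\<^sub>R c) = (LINT y|lborel. ?k y) *\<^sub>R c"
    by (rule integral_scaleR_left) (rule hat_kernel(1)[OF n])
  then have ic2: "(LINT y|lborel. ?k y *\<^sub>R c) = c" by (simp only: hat_kernel(2)[OF n] scaleR_one)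
  have "(LINT y|lborel. ?k y *\<^sub>R G y) = (LINT y|lborel. ?k y *\<^sub>R (G y - c)) + c"
    unfolding eq by (subst Bochner_Integration.integral_add[OF i ic]) (simp only: ic2)
  then have "norm ((LINT y|lborel. ?k y *\<^sub>R G y) - c) = norm (LINT y|lborel. ?k y *\<^sub>R (G y - c))" by simp
  also have "\<dots> \<le> (LINT y|lborel. ?k y * e)"
  proof (rule order_trans[OF integral_norm_bound])
    show "(LINT y|lborel. norm (?k y *\<^sub>R (G y - c))) \<le> (LINT y|lborel. ?k y * e)"
      by (rule integral_mono[OF integrable_norm[OF i] _ b]) (rule integrable_mult_left[OF hat_kernel(1)[OF n]])
  qed
  also have "\<dots> = e" using hat_kernel(2)[OF n, of a] by simp
  finally show "norm ((LINT y|lborel. ?k y *\<^sub>R G y) - c) \<le> e" .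
qed

text \<open>The kernels live to the right of \<open>a\<close>, which is why continuity on
  \<open>{a..b}\<close> is the right assumption.\<close>

lemma hat_kernel_tendsto:
  fixes G :: "real \<Rightarrow> complex"
  assumes G: "G \<in> borel_measurable borel" and cont: "continuous_on {a..b} G" and ab: "a < b"
  shows "(\<lambda>n. LINT y|lborel. (real n * hat (real n * (y - a))) *\<^sub>R G y) \<longlonglongrightarrow> G a"
proof (rule LIMSEQ_I)
  fix e :: real assume e: "0 < e"
  then obtain \<delta> where \<delta>: "0 < \<delta>" "\<And>y. y \<in> {a..b} \<Longrightarrow> dist y a < \<delta> \<Longrightarrow> dist (G y) (G a) < e/2"
    using cont ab unfolding continuous_on_iff by (metis atLeastAtMost_iff half_gt_zero less_imp_le order_refl)
  obtain N :: nat where N: "1 / min \<delta> (b - a) < real N" using reals_Archimedean2 by blast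
  have m0: "0 < min \<delta> (b - a)" using \<delta> ab by simp
  then have N0: "0 < real N" using N by (smt (verit) divide_pos_pos)
  show "\<exists>N. \<forall>n\<ge>N. norm ((LINT y|lborel. (real n * hat (real n * (y - a))) *\<^sub>R G y) - G a) < e"
  proof (intro exI allI impI)
    fix n assume n: "N \<le> n"
    then have n0: "0 < real n" using N0 by linarith
    have "1 / min \<delta> (b - a) < real n" using N n by linarith
    then have "1 / real n < min \<delta> (b - a)" using m0 n0 by (simp only: divide_less_eq mult.commute split: if_splits) simp
    then have "norm (G y - G a) \<le> e/2" if "y \<in> {a..a + 1 / real n}" for y
      using \<delta>(2)[of y] that by (auto simp: dist_norm)
    then have "norm ((LINT y|lborel. (real n * hat (real n * (y - a))) *\<^sub>R G y) - G a) \<le> e/2"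
      by (rule hat_kernel_approx(2)[OF n0 G])
    then show "norm ((LINT y|lborel. (real n * hat (real n * (y - a))) *\<^sub>R G y) - G a) < e" using e by simp
  qed
qed

text \<open>A smoothed indicator of \<open>{c<..d}\<close>: it rises on \<open>[c, c + 1/n]\<close>
  and falls on \<open>[d, d + 1/n]\<close>. Both edges lean to the right, so in the limit
  \<open>c\<close> is lost and \<open>d\<close> is kept.\<close>

definition bump :: "real \<Rightarrow> real \<Rightarrow> nat \<Rightarrow> real \<Rightarrow> real" where
  "bump c d n x = step (real n * (x - c)) - step (real n * (x - d))"

definition bump' :: "real \<Rightarrow> real \<Rightarrow> nat \<Rightarrow> real \<Rightarrow> real" where
  "bump' c d n x = real n * hat (real n * (x - c)) - real n * hat (real n * (x - d))"

lemma DERIV_bump: "(bump c d n has_real_derivative bump' c d n x) (at x)"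
  unfolding bump_def[abs_def] bump'_def by (intro DERIV_diff DERIV_step_affine)

lemma continuous_on_bump': "continuous_on S (bump' c d n)"
  unfolding bump'_def[abs_def]
  by (intro continuous_intros continuous_on_compose2[OF continuous_on_hat[of UNIV]]) auto

lemma bump_abs_le: "\<bar>bump c d n x\<bar> \<le> 1"
  unfolding bump_def using step_bounds[of "real n * (x - c)"] step_bounds[of "real n * (x - d)"] by linarith

lemma bump_support:
  assumes "c \<le> d" "0 < n" "bump c d n x \<noteq> 0"
  shows "x \<in> {c..d + 1 / real n}"
proof (rule ccontr)
  assume "x \<notin> {c..d + 1 / real n}"
  then consider "x < c" | "x > d + 1 / real n" by fastforce
  then have "bump c d n x = 0"
  proof cases
    case 1
    then show ?thesis using assms by (simp add: bump_def step_eq mult_nonneg_nonpos)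
  next
    case 2
    have d: "1 \<le> real n * (x - d)" using 2 assms by (simp add: field_simps)
    have "real n * (x - d) \<le> real n * (x - c)" using assms by (intro mult_left_mono) auto
    then show ?thesis using d by (simp add: bump_def step_eq)
  qed
  then show False using assms by simp
qed

lemma step_tendsto: "(\<lambda>n. step (real n * u)) \<longlonglongrightarrow> (if 0 < u then 1 else 0)"
proof (cases "0 < u")
  case True
  obtain N :: nat where "1 / u < real N" using reals_Archimedean2 by blast
  then have "1 \<le> real n * u" if "N \<le> n" for n
    using True that by (smt (verit) divide_less_eq mult_right_mono of_nat_mono)
  then have "\<forall>\<^sub>F n in sequentially. step (real n * u) = 1" unfolding eventually_sequentially by (intro exI[of _ N]) (simp add: step_eq)
  then show ?thesis using True by (simp add: tendsto_eventually)
qed (simp add: step_eq mult_nonneg_nonpos)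

lemma bump_tendsto: "c \<le> d \<Longrightarrow> (\<lambda>n. bump c d n x) \<longlonglongrightarrow> indicator {c<..d} x"
  unfolding bump_def using tendsto_diff[OF step_tendsto[of "x - c"] step_tendsto[of "x - d"]]
  by (auto simp: indicator_def)

lemma borel_measurable_bump: "bump c d n \<in> borel_measurable borel" "bump' c d n \<in> borel_measurable borel"
  using DERIV_bump by (auto intro!: borel_measurable_continuous_onI continuous_on_bump' DERIV_continuous_on intro: has_field_derivative_at_within)

section \<open>From weak derivatives to absolute continuity on vertical lines\<close>

lemma mem_cbox_Complex: "z \<in> cbox (Complex x1 y1) (Complex x2 y2) \<longleftrightarrow> x1 \<le> Re z \<and> Re z \<le> x2 \<and> y1 \<le> Im z \<and> Im z \<le> y2"
  by (auto simp: mem_box Basis_complex_def)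

text \<open>The weak derivative in the direction \<open>\<i>\<close>, tested against products \<open>A x * B y\<close> only.\<close>
definition weak_vertical :: "complex set \<Rightarrow> (complex \<Rightarrow> complex) \<Rightarrow> (complex \<Rightarrow> complex) \<Rightarrow> bool" where
  "weak_vertical W g h \<longleftrightarrow>
     (\<forall>A A' B B' x1 x2 y1 y2.
        (\<forall>x. (A has_real_derivative A' x) (at x)) \<longrightarrow> continuous_on UNIV A' \<longrightarrow>
        (\<forall>y. (B has_real_derivative B' y) (at y)) \<longrightarrow> continuous_on UNIV B' \<longrightarrow>
        (\<forall>x. A x \<noteq> 0 \<longrightarrow> x \<in> {x1..x2}) \<longrightarrow> (\<forall>y. B y \<noteq> 0 \<longrightarrow> y \<in> {y1..y2}) \<longrightarrow>
        cbox (Complex x1 y1) (Complex x2 y2) \<subseteq> W \<longrightarrow>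
        (LINT z|lborel. (A (Re z) * B' (Im z)) *\<^sub>R g z) = - (LINT z|lborel. (A (Re z) * B (Im z)) *\<^sub>R h z))"

text \<open>The weak identity is tested with the product of a bump in \<open>x\<close> and a bump in
  \<open>y\<close>. The derivative of the latter is a difference of two kernels, which concentrate
  on the lower and the upper side of the box, while the product itself tends to the indicator of the
  box; both limits are dominated. The strict bounds \<open>d < x2\<close> and \<open>b < y2\<close>
  leave room for the falling edges.\<close>

lemma weak_vertical_box:
  fixes g h :: "complex \<Rightarrow> complex"
  assumes wv: "weak_vertical W g h"
    and gm [measurable]: "g \<in> borel_measurable borel" and hm [measurable]: "h \<in> borel_measurable borel"
    and cont: "continuous_on W g"
    and hi: "\<And>C. compact C \<Longrightarrow> C \<subseteq> W \<Longrightarrow> set_integrable lborel C h"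
    and W: "cbox (Complex x1 y1) (Complex x2 y2) \<subseteq> W"
    and x: "x1 \<le> c" "c \<le> d" "d < x2" and y: "y1 \<le> a" "a \<le> b" "b < y2"
  shows "(LINT x:{c..d}|lborel. g (Complex x b) - g (Complex x a)) = (LINT z:cbox (Complex c a) (Complex d b)|lborel. h z)"
proof -
  let ?R = "cbox (Complex x1 y1) (Complex x2 y2)"
  have "compact (g ` ?R)" using cont W by (intro compact_continuous_image compact_cbox) (rule continuous_on_subset)
  then obtain M where M: "\<And>z. z \<in> ?R \<Longrightarrow> norm (g z) \<le> M"
    by (meson bounded_iff compact_imp_bounded imageI)
  have "Complex c a \<in> ?R" using x y by (simp add: mem_cbox_Complex)
  then have M0: "0 \<le> M" using M norm_ge_zero order_trans by blast
  note [measurable] = borel_measurable_bump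
  have [measurable]: "Re \<in> borel_measurable borel" "Im \<in> borel_measurable borel" by simp_all
  obtain N :: nat where N: "1 / min (x2 - d) (y2 - b) < real N" using reals_Archimedean2 by blast
  have m0: "0 < min (x2 - d) (y2 - b)" using x y by simp
  then have N0: "0 < real N" using N by (smt (verit) divide_pos_pos)
  have nN: "0 < n" "d + 1 / real n < x2" "b + 1 / real n < y2" if "N \<le> n" for n
  proof -
    show n0: "0 < n" using that N0 by simp
    have "1 / min (x2 - d) (y2 - b) < real n" using N that by linarith
    then have "1 / real n < min (x2 - d) (y2 - b)"
      using pos_divide_less_eq[OF m0, of 1 "real n"] pos_divide_less_eq[of "real n" 1 "min (x2 - d) (y2 - b)"] n0
      by (simp add: mult.commute)
    then show "d + 1 / real n < x2" "b + 1 / real n < y2" by auto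
  qed
  have As: "x \<in> {c..x2}" if "bump c d n x \<noteq> 0" "N \<le> n" for n x
    using bump_support[OF x(2) nN(1)[OF that(2)] that(1)] nN(2)[OF that(2)] by auto
  have Bs: "y \<in> {a..y2}" if "bump a b n y \<noteq> 0" "N \<le> n" for n y
    using bump_support[OF y(2) nN(1)[OF that(2)] that(1)] nN(3)[OF that(2)] by auto
  have Bs': "y \<in> {a..y2}" if "bump' a b n y \<noteq> 0" "N \<le> n" for n y
  proof (rule ccontr)
    assume "y \<notin> {a..y2}"
    then have "y \<notin> {a..a + 1 / real n}" "y \<notin> {b..b + 1 / real n}" using nN(3)[OF that(2)] y by auto
    then show False using that nN(1)[OF that(2)] hat_kernel_support[of "real n" y] by (simp add: bump'_def)
  qed
  have id: "(LINT z|lborel. (bump c d n (Re z) * bump' a b n (Im z)) *\<^sub>R g z)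
      = - (LINT z|lborel. (bump c d n (Re z) * bump a b n (Im z)) *\<^sub>R h z)" if n: "N \<le> n" for n
  proof -
    have "cbox (Complex c a) (Complex x2 y2) \<subseteq> W" using W x y by (auto simp: mem_cbox_Complex subset_eq)
    then show ?thesis using wv As[OF _ n] Bs[OF _ n] DERIV_bump continuous_on_bump'
      unfolding weak_vertical_def by blast
  qed
  have inR: "z \<in> ?R" if "bump c d n (Re z) \<noteq> 0" "Im z \<in> {a..y2}" "N \<le> n" for n z
    using As[OF that(1,3)] that x y by (auto simp: mem_cbox_Complex)
  have hR: "integrable lborel (\<lambda>z. indicator ?R z *\<^sub>R h z)"
    using hi[OF compact_cbox W] by (simp add: set_integrable_def)
  have r1: "(\<lambda>n. LINT z|lborel. (bump c d (n + N) (Re z) * bump a b (n + N) (Im z)) *\<^sub>R h z)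
     \<longlonglongrightarrow> (LINT z|lborel. (indicator {c<..d} (Re z) * indicator {a<..b} (Im z)) *\<^sub>R h z)"
  proof (rule integral_dominated_convergence[where w="\<lambda>z. norm (indicator ?R z *\<^sub>R h z)"])
    show "integrable lborel (\<lambda>z. norm (indicator ?R z *\<^sub>R h z))" using hR by (rule integrable_norm)
    show "AE z in lborel. (\<lambda>n. (bump c d (n + N) (Re z) * bump a b (n + N) (Im z)) *\<^sub>R h z)
         \<longlonglongrightarrow> (indicator {c<..d} (Re z) * indicator {a<..b} (Im z)) *\<^sub>R h z"
      by (intro AE_I2 tendsto_intros LIMSEQ_ignore_initial_segment bump_tendsto x y)
    show "AE z in lborel. norm ((bump c d (n + N) (Re z) * bump a b (n + N) (Im z)) *\<^sub>R h z)
         \<le> norm (indicator ?R z *\<^sub>R h z)" for n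
    proof (rule AE_I2)
      fix z
      show "norm ((bump c d (n + N) (Re z) * bump a b (n + N) (Im z)) *\<^sub>R h z) \<le> norm (indicator ?R z *\<^sub>R h z)"
      proof (cases "bump c d (n + N) (Re z) = 0 \<or> bump a b (n + N) (Im z) = 0")
        case False
        then have zR: "z \<in> ?R" using inR Bs by (metis le_add2)
        have "\<bar>bump c d (n + N) (Re z)\<bar> * \<bar>bump a b (n + N) (Im z)\<bar> \<le> 1 * 1"
          by (intro mult_mono bump_abs_le) auto
        then have "\<bar>bump c d (n + N) (Re z)\<bar> * \<bar>bump a b (n + N) (Im z)\<bar> * norm (h z) \<le> 1 * norm (h z)"
          by (intro mult_right_mono) auto
        then show ?thesis using zR by (simp add: abs_mult)
      qed auto
    qed
  qed measurable
  \<comment> \<open>Integration against \<open>bump'\<close> in \<open>y\<close> is the difference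
    of an average near \<open>a\<close> and an average near \<open>b\<close>. It tends to the
    difference of the boundary values and stays below \<open>2 * M\<close>, which provides the
    dominating function in \<open>x\<close>.\<close>
  define I where "I n x = (LINT y|lborel. bump' a b n y *\<^sub>R g (Complex x y))" for n x
  have Cm [measurable]: "(\<lambda>y. Complex x y) \<in> borel_measurable borel" for x
    by (simp add: Complex_eq)
  have Iapprox: "(\<lambda>n. I n x) \<longlonglongrightarrow> g (Complex x a) - g (Complex x b)"
    and Ibound: "\<And>n. N \<le> n \<Longrightarrow> norm (I n x) \<le> 2 * M"
    if xx: "x \<in> {x1..x2}" for x
  proof -
    have Gm: "(\<lambda>y. g (Complex x y)) \<in> borel_measurable borel" by measurable
    have Gc: "continuous_on {y1..y2} (\<lambda>y. g (Complex x y))"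
    proof (rule continuous_on_compose2[OF cont])
      show "continuous_on {y1..y2} (Complex x)" unfolding Complex_eq[abs_def] by (intro continuous_intros)
      show "Complex x ` {y1..y2} \<subseteq> W" using W xx by (auto simp: mem_cbox_Complex subset_eq)
    qed
    have bnd: "norm (g (Complex x y) - 0) \<le> M" if "y \<in> {y1..y2}" for y
      using M[of "Complex x y"] that xx by (simp add: mem_cbox_Complex)
    have ka: "integrable lborel (\<lambda>y. (real n * hat (real n * (y - a))) *\<^sub>R g (Complex x y))"
      "norm ((LINT y|lborel. (real n * hat (real n * (y - a))) *\<^sub>R g (Complex x y)) - 0) \<le> M"
      "integrable lborel (\<lambda>y. (real n * hat (real n * (y - b))) *\<^sub>R g (Complex x y))"
      "norm ((LINT y|lborel. (real n * hat (real n * (y - b))) *\<^sub>R g (Complex x y)) - 0) \<le> M" if n: "N \<le> n" for n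
      using nN[OF n] y by (intro hat_kernel_approx[OF _ Gm bnd]; auto)+
    have Ieq: "I n x = (LINT y|lborel. (real n * hat (real n * (y - a))) *\<^sub>R g (Complex x y))
        - (LINT y|lborel. (real n * hat (real n * (y - b))) *\<^sub>R g (Complex x y))" if n: "N \<le> n" for n
      unfolding I_def bump'_def scaleR_left_diff_distrib by (rule Bochner_Integration.integral_diff) (rule ka[OF n])+
    show "norm (I n x) \<le> 2 * M" if n: "N \<le> n" for n
      unfolding Ieq[OF n] using ka(2,4)[OF n] norm_triangle_ineq4 by (smt (verit) diff_zero)
    have "(\<lambda>n. (LINT y|lborel. (real n * hat (real n * (y - a))) *\<^sub>R g (Complex x y))
        - (LINT y|lborel. (real n * hat (real n * (y - b))) *\<^sub>R g (Complex x y))) \<longlonglongrightarrow> g (Complex x a) - g (Complex x b)"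
      using y by (intro tendsto_diff hat_kernel_tendsto[OF Gm, of _ y2])
        (auto intro: continuous_on_subset[OF Gc])
    then show "(\<lambda>n. I n x) \<longlonglongrightarrow> g (Complex x a) - g (Complex x b)"
      by (rule Lim_transform_eventually) (unfold eventually_sequentially, intro exI[of _ N], simp add: Ieq)
  qed
  have Im [measurable]: "I n \<in> borel_measurable borel" for n
  proof -
    have "(\<lambda>(x, y). bump' a b n y *\<^sub>R g (Complex x y)) \<in> borel_measurable (borel \<Otimes>\<^sub>M lborel)"
      using measurable_compose[OF measurable_Complex_pair gm] by (auto simp: case_prod_beta')
    then show ?thesis unfolding I_def[abs_def] by (rule lborel.borel_measurable_lebesgue_integral)
  qed
  have left: "(LINT z|lborel. (bump c d n (Re z) * bump' a b n (Im z)) *\<^sub>R g z)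
     = (LINT x|lborel. bump c d n x *\<^sub>R I n x)" if n: "N \<le> n" for n
  proof -
    have kb: "\<bar>bump' a b n y\<bar> \<le> 4 * real n" for y
    proof -
      have "0 \<le> real n * hat (real n * (y - t))" "real n * hat (real n * (y - t)) \<le> real n * 2" for t
        using hat_bounds by (auto intro: mult_left_mono)
      from this[of a] this[of b] show ?thesis unfolding bump'_def by linarith
    qed
    have "integrable lborel (\<lambda>z. (bump c d n (Re z) * bump' a b n (Im z)) *\<^sub>R g z)"
    proof (rule Bochner_Integration.integrable_bound[of _ "\<lambda>z. indicator ?R z *\<^sub>R (4 * real n * M)"])
      show "integrable lborel (\<lambda>z. indicator ?R z *\<^sub>R (4 * real n * M))"
        using emeasure_bounded_finite[OF bounded_cbox, of "Complex x1 y1" "Complex x2 y2"]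
        by (intro integrable_scaleR_left integrable_real_indicator) auto
      show "AE z in lborel. norm ((bump c d n (Re z) * bump' a b n (Im z)) *\<^sub>R g z) \<le> norm (indicator ?R z *\<^sub>R (4 * real n * M))"
      proof (rule AE_I2)
        fix z
        show "norm ((bump c d n (Re z) * bump' a b n (Im z)) *\<^sub>R g z) \<le> norm (indicator ?R z *\<^sub>R (4 * real n * M))"
        proof (cases "bump c d n (Re z) = 0 \<or> bump' a b n (Im z) = 0")
          case False
          then have zR: "z \<in> ?R" using inR Bs' n by metis
          have "\<bar>bump c d n (Re z)\<bar> * \<bar>bump' a b n (Im z)\<bar> \<le> 1 * (4 * real n)"
            by (intro mult_mono bump_abs_le kb) auto
          then have "\<bar>bump c d n (Re z)\<bar> * \<bar>bump' a b n (Im z)\<bar> * norm (g z) \<le> 1 * (4 * real n) * M"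
            using M[OF zR] by (intro mult_mono[of "_ * _"]) auto
          then show ?thesis using zR M0 by (simp add: abs_mult)
        qed auto
      qed
    qed measurable
    from integral_complex_iterated(1)[OF this] show ?thesis
      by (simp add: I_def mult.commute scaleR_scaleR[symmetric] del: scaleR_scaleR)
  qed
  have r2: "(\<lambda>n. LINT x|lborel. bump c d (n + N) x *\<^sub>R I (n + N) x)
     \<longlonglongrightarrow> (LINT x|lborel. indicator {c<..d} x *\<^sub>R (g (Complex x a) - g (Complex x b)))"
  proof (rule integral_dominated_convergence[where w="\<lambda>x. indicator {x1..x2} x *\<^sub>R (2 * M)"])
    show "integrable lborel (\<lambda>x. indicator {x1..x2} x *\<^sub>R (2 * M))"
      using emeasure_bounded_finite[OF bounded_closed_interval, of x1 x2]
      by (intro integrable_scaleR_left integrable_real_indicator) auto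
    show "AE x in lborel. (\<lambda>n. bump c d (n + N) x *\<^sub>R I (n + N) x) \<longlonglongrightarrow> indicator {c<..d} x *\<^sub>R (g (Complex x a) - g (Complex x b))"
    proof (rule AE_I2)
      fix x'
      have b: "(\<lambda>n. bump c d (n + N) x') \<longlonglongrightarrow> indicator {c<..d} x'"
        by (intro LIMSEQ_ignore_initial_segment bump_tendsto x)
      show "(\<lambda>n. bump c d (n + N) x' *\<^sub>R I (n + N) x') \<longlonglongrightarrow> indicator {c<..d} x' *\<^sub>R (g (Complex x' a) - g (Complex x' b))"
      proof (cases "x' \<in> {x1..x2}")
        case True
        then show ?thesis by (intro tendsto_scaleR b LIMSEQ_ignore_initial_segment Iapprox)
      next
        case False
        then have "bump c d (n + N) x' = 0" for n using As[of "n + N" x'] x by force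
        moreover have "indicator {c<..d} x' = (0::real)" using False x by (auto simp: indicator_def)
        ultimately show ?thesis by simp
      qed
    qed
    show "AE x in lborel. norm (bump c d (n + N) x *\<^sub>R I (n + N) x) \<le> indicator {x1..x2} x *\<^sub>R (2 * M)" for n
    proof (rule AE_I2)
      fix x'
      show "norm (bump c d (n + N) x' *\<^sub>R I (n + N) x') \<le> indicator {x1..x2} x' *\<^sub>R (2 * M)"
      proof (cases "x' \<in> {x1..x2}")
        case True
        have "\<bar>bump c d (n + N) x'\<bar> * norm (I (n + N) x') \<le> 1 * (2 * M)"
          using Ibound[OF True, of "n + N"] by (intro mult_mono bump_abs_le) auto
        then show ?thesis using True by simp
      next
        case False
        then have "bump c d (n + N) x' = 0" using As[of "n + N" x'] x by force
        then show ?thesis using M0 by simp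
      qed
    qed
  qed measurable
  have feq: "(\<lambda>n. LINT x|lborel. bump c d (n + N) x *\<^sub>R I (n + N) x) = (\<lambda>n. - (LINT z|lborel. (bump c d (n + N) (Re z) * bump a b (n + N) (Im z)) *\<^sub>R h z))"
    using left id by simp
  have eq: "(LINT x|lborel. indicator {c<..d} x *\<^sub>R (g (Complex x a) - g (Complex x b)))
      = - (LINT z|lborel. (indicator {c<..d} (Re z) * indicator {a<..b} (Im z)) *\<^sub>R h z)"
    using r2[unfolded feq] tendsto_minus[OF r1] by (rule LIMSEQ_unique)
  have "(LINT x:{c..d}|lborel. g (Complex x b) - g (Complex x a))
     = (LINT x|lborel. - (indicator {c<..d} x *\<^sub>R (g (Complex x a) - g (Complex x b))))"
    unfolding set_lebesgue_integral_def
  proof (intro integral_cong_AE)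
    \<comment> \<open>The limits involve half-open intervals; the closed ones differ from them by a
      null set.\<close>
    have "AE x in lborel. x \<noteq> c" by (rule AE_lborel_singleton)
    then show "AE x in lborel. indicator {c..d} x *\<^sub>R (g (Complex x b) - g (Complex x a)) = - (indicator {c<..d} x *\<^sub>R (g (Complex x a) - g (Complex x b)))"
      by eventually_elim (auto simp: indicator_def)
    have "(\<lambda>x. g (Complex x t)) \<in> borel_measurable borel" for t
      by (rule measurable_compose[OF _ gm]) (simp add: Complex_eq)
    then show "(\<lambda>x. indicator {c..d} x *\<^sub>R (g (Complex x b) - g (Complex x a))) \<in> borel_measurable lborel"
      "(\<lambda>x. - (indicator {c<..d} x *\<^sub>R (g (Complex x a) - g (Complex x b)))) \<in> borel_measurable lborel" by auto
  qed
  also have "\<dots> = (LINT z|lborel. (indicator {c<..d} (Re z) * indicator {a<..b} (Im z)) *\<^sub>R h z)"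
    using eq by simp
  also have "\<dots> = (LINT z:cbox (Complex c a) (Complex d b)|lborel. h z)"
    unfolding set_lebesgue_integral_def
  proof (intro integral_cong_AE)
    have 1: "AE z in (lborel :: complex measure). Re z \<noteq> c"
      using negligible_standard_hyperplane[of "1::complex" c]
      by (intro AE_I[where N="{z. z \<bullet> 1 = c}"]) (auto simp: negligible_iff_null_sets null_sets_def Basis_complex_def)
    have 2: "AE z in (lborel :: complex measure). Im z \<noteq> a"
      using negligible_standard_hyperplane[of "\<i>::complex" a]
      by (intro AE_I[where N="{z. z \<bullet> \<i> = a}"]) (auto simp: negligible_iff_null_sets null_sets_def Basis_complex_def)
    show "AE z in lborel. (indicator {c<..d} (Re z) * indicator {a<..b} (Im z)) *\<^sub>R h z = indicator (cbox (Complex c a) (Complex d b)) z *\<^sub>R h z"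
      using 1 2 by eventually_elim (auto simp: indicator_def mem_cbox_Complex)
  qed measurable
  finally show ?thesis .
qed

text \<open>The averages of \<open>K\<close> over \<open>{x..x+h}\<close> vanish, and by Lebesgue's
  differentiation theorem they converge to \<open>K x\<close> for almost every
  \<open>x\<close>.\<close>

lemma AE_zero_of_interval_integrals:
  fixes K :: "real \<Rightarrow> complex"
  assumes K: "integrable lborel K"
    and zero: "\<And>c d. x1 < c \<Longrightarrow> c \<le> d \<Longrightarrow> d < x2 \<Longrightarrow> (LINT x:{c..d}|lborel. K x) = 0"
  shows "AE x in lborel. x1 < x \<longrightarrow> x < x2 \<longrightarrow> K x = 0"
proof -
  have Ku: "K integrable_on UNIV" using K by (rule integrable_on_lborel)
  have "K integrable_on cbox a b" for a b by (rule integrable_on_subcbox[OF Ku]) auto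
  then obtain N where N: "negligible N"
    "\<And>x e. x \<notin> N \<Longrightarrow> 0 < e \<Longrightarrow> \<exists>d>0. \<forall>h. 0 < h \<and> h < d \<longrightarrow>
       norm (integral (cbox x (x + h *\<^sub>R One)) K /\<^sub>R h ^ DIM(real) - K x) < e"
    using integrable_ccontinuous_explicit[of K] by blast
  have "AE x in lebesgue. x \<notin> N" using N(1) by (simp add: AE_not_in negligible_iff_null_sets)
  then have "AE x in lborel. x \<notin> N" by (simp add: AE_completion_iff)
  then show ?thesis
  proof eventually_elim
    case (elim x)
    show ?case
    proof (intro impI)
      assume x: "x1 < x" "x < x2"
      have "norm (K x) < e" if e: "0 < e" for e
      proof -
        obtain d where d: "0 < d" "\<And>h. 0 < h \<Longrightarrow> h < d \<Longrightarrow> norm (integral (cbox x (x + h *\<^sub>R One)) K /\<^sub>R h ^ DIM(real) - K x) < e"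
          using N(2)[OF elim e] by blast
        define h where "h = min (d/2) ((x2 - x)/2)"
        have h: "0 < h" "h < d" "x + h < x2" using d x by (auto simp: h_def min_def field_simps)
        have "set_integrable lborel {x..x+h} K"
          unfolding set_integrable_def using K by (intro integrable_mult_indicator) auto
        then have "integral {x..x+h} K = 0"
          using set_borel_integral_eq_integral(2)[of "{x..x+h}" K] zero[of x "x+h"] x h by simp
        then show "norm (K x) < e" using d(2)[OF h(1,2)] by simp
      qed
      then show "K x = 0" by (metis less_irrefl zero_less_norm_iff)
    qed
  qed
qed

text \<open>With \<open>a\<close> and \<open>b\<close> fixed and \<open>c\<close>, \<open>d\<close>
  varying, the identity on boxes says that the increment of \<open>g\<close> minus the vertical
  integral of \<open>h\<close> has integral zero over every interval of \<open>x\<close>. The null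
  set obtained in this way still depends on \<open>a\<close> and \<open>b\<close>.\<close>

lemma weak_vertical_AE_box:
  fixes g h :: "complex \<Rightarrow> complex"
  assumes wv: "weak_vertical W g h"
    and gm [measurable]: "g \<in> borel_measurable borel" and hm [measurable]: "h \<in> borel_measurable borel"
    and cont: "continuous_on W g"
    and hi: "\<And>C. compact C \<Longrightarrow> C \<subseteq> W \<Longrightarrow> set_integrable lborel C h"
    and W: "cbox (Complex x1 y1) (Complex x2 y2) \<subseteq> W"
    and y: "y1 \<le> a" "a \<le> b" "b < y2"
  shows "AE x in lborel. x1 < x \<longrightarrow> x < x2 \<longrightarrow> set_integrable lborel {a..b} (\<lambda>y. h (Complex x y)) \<and>
     g (Complex x b) - g (Complex x a) = (LINT y:{a..b}|lborel. h (Complex x y))"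
proof (cases "x1 < x2")
  case True
  have Cm [measurable]: "(\<lambda>y. Complex x y) \<in> borel_measurable borel" for x by (simp add: Complex_eq)
  have Cm2 [measurable]: "(\<lambda>x. Complex x y) \<in> borel_measurable borel" for y by (simp add: Complex_eq)
  define H where "H z = indicator (cbox (Complex x1 a) (Complex x2 b)) z *\<^sub>R h z" for z
  have "cbox (Complex x1 a) (Complex x2 b) \<subseteq> W" using W y by (auto simp: mem_cbox_Complex subset_eq)
  then have Hi: "integrable lborel H" using hi[OF compact_cbox] by (simp add: H_def[abs_def] set_integrable_def)
  have Heq: "H (Complex x y) = indicator {x1..x2} x *\<^sub>R indicator {a..b} y *\<^sub>R h (Complex x y)" for x y
    by (auto simp: H_def indicator_def mem_cbox_Complex)
  define P where "P x = (LINT y|lborel. H (Complex x y))" for x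
  have Pi: "integrable lborel P" unfolding P_def by (rule integral_complex_iterated(2)[OF Hi])
  define k where "k x = g (Complex x b) - g (Complex x a)" for x
  have inW: "Complex x t \<in> W" if "x \<in> {x1..x2}" "t \<in> {y1..y2}" for x t
    using W that by (auto simp: mem_cbox_Complex subset_eq)
  have "continuous_on {x1..x2} (\<lambda>x. g (Complex x t))" if "t \<in> {y1..y2}" for t
  proof (rule continuous_on_compose2[OF cont])
    show "continuous_on {x1..x2} (\<lambda>x. Complex x t)" unfolding Complex_eq by (intro continuous_intros)
    show "(\<lambda>x. Complex x t) ` {x1..x2} \<subseteq> W" using inW that by auto
  qed
  then have "continuous_on {x1..x2} k" unfolding k_def using y by (intro continuous_on_diff) auto
  then have ki: "set_integrable lborel {x1..x2} k" by (rule borel_integrable_atLeastAtMost')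
  define K where "K x = indicator {x1..x2} x *\<^sub>R k x - P x" for x
  have Ki: "integrable lborel K" unfolding K_def using ki Pi by (simp add: set_integrable_def)
  have "AE x in lborel. x1 < x \<longrightarrow> x < x2 \<longrightarrow> K x = 0"
  proof (rule AE_zero_of_interval_integrals[OF Ki])
    fix c d assume cd: "x1 < c" "c \<le> d" "d < x2"
    let ?H = "\<lambda>z. indicator (cbox (Complex c a) (Complex d b)) z *\<^sub>R h z"
    have "cbox (Complex c a) (Complex d b) \<subseteq> W" using W y cd by (auto simp: mem_cbox_Complex subset_eq)
    then have Hi': "integrable lborel ?H" using hi[OF compact_cbox] by (simp add: set_integrable_def)
    have "(LINT z:cbox (Complex c a) (Complex d b)|lborel. h z) = (LINT x|lborel. LINT y|lborel. ?H (Complex x y))"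
      unfolding set_lebesgue_integral_def by (rule integral_complex_iterated(1)[OF Hi'])
    also have "\<dots> = (LINT x|lborel. LINT y|lborel. indicator {c..d} x *\<^sub>R H (Complex x y))"
      using cd by (intro arg_cong[where f="integral\<^sup>L lborel"] ext) (auto simp: Heq indicator_def mem_cbox_Complex)
    also have "\<dots> = (LINT x:{c..d}|lborel. P x)" by (simp add: P_def set_lebesgue_integral_def)
    finally have P: "(LINT x:{c..d}|lborel. P x) = (LINT x:{c..d}|lborel. k x)"
      unfolding k_def using weak_vertical_box[OF wv gm hm cont hi W _ cd(2,3) y] cd by simp
    have ik: "set_integrable lborel {c..d} k" using ki by (rule set_integrable_subset) (use cd in auto)
    have iP: "set_integrable lborel {c..d} P"
      unfolding set_integrable_def using Pi by (intro integrable_mult_indicator) auto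
    have "(LINT x:{c..d}|lborel. K x) = (LINT x:{c..d}|lborel. k x - P x)"
      using cd by (intro set_lebesgue_integral_cong) (auto simp: K_def)
    also have "\<dots> = 0" using set_integral_diff(2)[OF ik iP] P by simp
    finally show "(LINT x:{c..d}|lborel. K x) = 0" .
  qed
  then show ?thesis using integral_complex_iterated(3)[OF Hi]
  proof eventually_elim
    case (elim x)
    show ?case
    proof (intro impI conjI)
      assume x: "x1 < x" "x < x2"
      then have eq: "(\<lambda>y. H (Complex x y)) = (\<lambda>y. indicator {a..b} y *\<^sub>R h (Complex x y))" by (auto simp: Heq)
      show "set_integrable lborel {a..b} (\<lambda>y. h (Complex x y))" using elim(2) by (simp add: set_integrable_def eq)
      have "k x = P x" using elim(1) x by (simp add: K_def)
      then show "g (Complex x b) - g (Complex x a) = (LINT y:{a..b}|lborel. h (Complex x y))"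
        by (simp add: k_def P_def eq set_lebesgue_integral_def)
    qed
  qed
qed auto

text \<open>Countably many boxes with rational data share one null set of abscissas. On any other
  vertical line both sides of the identity depend continuously on the endpoint, which extends it
  from rational to real endpoints.\<close>

lemma weak_vertical_ACL:
  fixes g h :: "complex \<Rightarrow> complex"
  assumes W: "open W" and wv: "weak_vertical W g h"
    and gm: "g \<in> borel_measurable borel" and hm: "h \<in> borel_measurable borel"
    and cont: "continuous_on W g"
    and hi: "\<And>C. compact C \<Longrightarrow> C \<subseteq> W \<Longrightarrow> set_integrable lborel C h"
  shows "AE x in lborel. \<forall>a b. a \<le> b \<longrightarrow> (\<forall>t\<in>{a..b}. Complex x t \<in> W) \<longrightarrow>
     set_integrable lborel {a..b} (\<lambda>y. h (Complex x y)) \<and>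
     g (Complex x b) - g (Complex x a) = (LINT y:{a..b}|lborel. h (Complex x y))"
proof -
  define Q where "Q = {(x1, x2, y1, y2, b). x1 \<in> \<rat> \<and> x2 \<in> \<rat> \<and> y1 \<in> \<rat> \<and> y2 \<in> \<rat> \<and> b \<in> \<rat> \<and>
     y1 \<le> b \<and> b < y2 \<and> cbox (Complex x1 y1) (Complex x2 y2) \<subseteq> W}"
  have "Q \<subseteq> \<rat> \<times> \<rat> \<times> \<rat> \<times> \<rat> \<times> \<rat>" by (auto simp: Q_def)
  then have cQ: "countable Q" by (rule countable_subset) (intro countable_SIGMA countable_rat)
  have "AE x in lborel. \<forall>q\<in>Q. case q of (x1, x2, y1, y2, b) \<Rightarrow> x1 < x \<longrightarrow> x < x2 \<longrightarrow>
     set_integrable lborel {y1..b} (\<lambda>y. h (Complex x y)) \<and>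
     g (Complex x b) - g (Complex x y1) = (LINT y:{y1..b}|lborel. h (Complex x y))"
  proof (subst AE_ball_countable[OF cQ], intro ballI)
    fix q assume "q \<in> Q"
    then obtain x1 x2 y1 y2 b where q: "q = (x1, x2, y1, y2, b)" "y1 \<le> b" "b < y2" "cbox (Complex x1 y1) (Complex x2 y2) \<subseteq> W"
      by (auto simp: Q_def)
    show "AE x in lborel. case q of (x1, x2, y1, y2, b) \<Rightarrow> x1 < x \<longrightarrow> x < x2 \<longrightarrow>
     set_integrable lborel {y1..b} (\<lambda>y. h (Complex x y)) \<and>
     g (Complex x b) - g (Complex x y1) = (LINT y:{y1..b}|lborel. h (Complex x y))"
      using weak_vertical_AE_box[OF wv gm hm cont hi q(4) order_refl q(2,3)] by (simp add: q(1))
  qed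
  then show ?thesis
  proof eventually_elim
    case (elim x)
    show ?case
    proof (intro allI impI)
      fix a b :: real assume ab: "a \<le> b" and seg: "\<forall>t\<in>{a..b}. Complex x t \<in> W"
      have "compact (Complex x ` {a..b})"
        unfolding Complex_eq[abs_def] by (intro compact_continuous_image continuous_intros) auto
      then obtain e where e: "0 < e" "(\<Union>z\<in>Complex x ` {a..b}. ball z e) \<subseteq> W"
        using compact_subset_open_imp_ball_epsilon_subset[of "Complex x ` {a..b}" W] W seg by blast
      have near: "Complex x' t \<in> W" if "\<bar>x' - x\<bar> < e/2" "a - e/2 < t" "t < b + e/2" for x' t
      proof -
        define s where "s = max a (min b t)"
        have s: "s \<in> {a..b}" "\<bar>t - s\<bar> < e/2" using that ab e by (auto simp: s_def max_def min_def)
        have "dist (Complex x s) (Complex x' t) \<le> \<bar>x - x'\<bar> + \<bar>s - t\<bar>"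
          using cmod_le[of "Complex x s - Complex x' t"] by (simp add: dist_norm)
        also have "\<dots> < e" using s that by linarith
        finally show ?thesis using e s by force
      qed
      obtain x1 where x1: "x1 \<in> \<rat>" "x - e/2 < x1" "x1 < x" using Rats_dense_in_real[of "x - e/2" x] e by auto
      obtain x2 where x2: "x2 \<in> \<rat>" "x < x2" "x2 < x + e/2" using Rats_dense_in_real[of x "x + e/2"] e by auto
      obtain y1 where y1: "y1 \<in> \<rat>" "a - e/2 < y1" "y1 < a" using Rats_dense_in_real[of "a - e/2" a] e by auto
      \<comment> \<open>The rational identity requires the top \<open>y2\<close> of the box to lie
        strictly above the endpoint. The spare level \<open>y3\<close> between \<open>b\<close> and
        \<open>y2\<close> bounds all endpoints used and leaves room above \<open>b\<close> for the
        continuity argument.\<close>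
      obtain y3 where y3: "y3 \<in> \<rat>" "b < y3" "y3 < b + e/2" using Rats_dense_in_real[of b "b + e/2"] e by auto
      obtain y2 where y2: "y2 \<in> \<rat>" "y3 < y2" "y2 < b + e/2" using Rats_dense_in_real[of y3 "b + e/2"] y3 by auto
      have box: "cbox (Complex x1 y1) (Complex x2 y2) \<subseteq> W"
      proof
        fix z assume "z \<in> cbox (Complex x1 y1) (Complex x2 y2)"
        then have z: "x1 \<le> Re z" "Re z \<le> x2" "y1 \<le> Im z" "Im z \<le> y2" by (auto simp: mem_cbox_Complex)
        have "\<bar>Re z - x\<bar> < e/2" using z(1,2) x1 x2 by linarith
        then have "Complex (Re z) (Im z) \<in> W" by (rule near) (use z y1 y2 in linarith)+
        then show "z \<in> W" by simp
      qed
      have rat: "set_integrable lborel {y1..t} (\<lambda>y. h (Complex x y))"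
        "g (Complex x t) - g (Complex x y1) = (LINT y:{y1..t}|lborel. h (Complex x y))"
        if "t \<in> \<rat>" "y1 \<le> t" "t \<le> y3" for t
      proof -
        have "(x1, x2, y1, y2, t) \<in> Q" using that x1 x2 y1 y2 box by (auto simp: Q_def)
        then show "set_integrable lborel {y1..t} (\<lambda>y. h (Complex x y))"
          "g (Complex x t) - g (Complex x y1) = (LINT y:{y1..t}|lborel. h (Complex x y))"
          using elim x1 x2 by fastforce+
      qed
      let ?h = "\<lambda>y. h (Complex x y)"
      have y13: "y1 < y3" using y1 y3 ab by linarith
      have int3: "set_integrable lborel {y1..y3} ?h" by (rule rat(1)) (use y3 y13 in auto)
      have sub: "set_integrable lborel {s..t} ?h" if "y1 \<le> s" "t \<le> y3" for s t
        using int3 by (rule set_integrable_subset) (use that in auto)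
      have hk3: "?h integrable_on {y1..y3}" using set_borel_integral_eq_integral(1)[OF int3] .
      \<comment> \<open>\<open>E\<close> is the defect of the identity with lower endpoint
        \<open>y1\<close>. It is continuous and vanishes at rational points, hence vanishes between
        \<open>y1\<close> and \<open>y3\<close>; the case of \<open>a\<close> and \<open>b\<close>
        is a difference of two such identities.\<close>
      define E where "E t = g (Complex x t) - g (Complex x y1) - integral {y1..t} ?h" for t
      have contE: "continuous_on {y1..y3} E"
        unfolding E_def
      proof (intro continuous_on_diff continuous_on_const indefinite_integral_continuous_1 hk3 continuous_on_compose2[OF cont])
        show "continuous_on {y1..y3} (Complex x)" unfolding Complex_eq[abs_def] by (intro continuous_intros)
        show "Complex x ` {y1..y3} \<subseteq> W" using box x1 x2 y2 by (auto simp: mem_cbox_Complex subset_eq)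
      qed
      have E0: "E t = 0" if "t \<in> \<rat>" "y1 \<le> t" "t \<le> y3" for t
        using rat[OF that] set_borel_integral_eq_integral(2) by (simp add: E_def)
      have "E t = 0" if t: "y1 < t" "t < y3" for t
      proof (rule ccontr)
        assume "E t \<noteq> 0"
        have "isCont E t" using contE t by (intro continuous_on_interior[of "{y1..y3}"]) auto
        then obtain d where d: "0 < d" "\<And>s. dist s t < d \<Longrightarrow> dist (E s) (E t) < norm (E t)"
          unfolding continuous_at_eps_delta using \<open>E t \<noteq> 0\<close> by (metis zero_less_norm_iff)
        obtain s where "s \<in> \<rat>" "t < s" "s < min y3 (t + d)"
          using Rats_dense_in_real[of t "min y3 (t + d)"] t d by auto
        then have "E s = 0" "dist s t < d" using E0 t by (auto simp: dist_real_def)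
        then show False using d(2)[of s] by simp
      qed
      then have E: "E a = 0" "E b = 0" using y1 y3 ab by auto
      show "set_integrable lborel {a..b} ?h \<and> g (Complex x b) - g (Complex x a) = (LINT y:{a..b}|lborel. ?h y)"
      proof
        show i: "set_integrable lborel {a..b} ?h" by (rule sub) (use y1 y3 in auto)
        have "integral {y1..a} ?h + integral {a..b} ?h = integral {y1..b} ?h"
          using y1 y3 ab by (intro Henstock_Kurzweil_Integration.integral_combine)
            (auto intro: set_borel_integral_eq_integral(1)[OF sub])
        then show "g (Complex x b) - g (Complex x a) = (LINT y:{a..b}|lborel. ?h y)"
          using E set_borel_integral_eq_integral(2)[OF i] by (simp add: E_def algebra_simps)
      qed
    qed
  qed
qed

section \<open>Lebesgue points and total differentiability\<close>

lemma nn_integral_reflect_real: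
  fixes f :: "real \<Rightarrow> ennreal"
  assumes "f \<in> borel_measurable borel" "\<sigma> \<in> {1, -1}"
  shows "(\<integral>\<^sup>+x. f (\<sigma> * x) \<partial>lborel) = (\<integral>\<^sup>+x. f x \<partial>lborel)"
  using nn_integral_real_affine[OF assms(1), of \<sigma> 0] assms(2) by auto

text \<open>The differentiation theorem concerns squares with the point as their lower left corner.
  Reflections in the axes provide the other three corner squares that make up a square centred at
  the point.\<close>

definition flip :: "real \<Rightarrow> real \<Rightarrow> complex \<Rightarrow> complex" where
  "flip \<sigma> \<tau> z = Complex (\<sigma> * Re z) (\<tau> * Im z)"

lemma flip_simps [simp]: "Re (flip \<sigma> \<tau> z) = \<sigma> * Re z" "Im (flip \<sigma> \<tau> z) = \<tau> * Im z"
  by (auto simp: flip_def)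

lemma flip_flip: "\<sigma> \<in> {1, -1} \<Longrightarrow> \<tau> \<in> {1, -1} \<Longrightarrow> flip \<sigma> \<tau> (flip \<sigma> \<tau> z) = z"
  by (auto simp: complex_eq_iff)

lemma borel_measurable_flip [measurable]: "flip \<sigma> \<tau> \<in> borel_measurable borel"
  unfolding flip_def[abs_def] Complex_eq by measurable

lemma nn_integral_flip:
  fixes f :: "complex \<Rightarrow> ennreal"
  assumes f [measurable]: "f \<in> borel_measurable borel" and s: "\<sigma> \<in> {1, -1}" "\<tau> \<in> {1, -1}"
  shows "(\<integral>\<^sup>+z. f (flip \<sigma> \<tau> z) \<partial>lborel) = (\<integral>\<^sup>+z. f z \<partial>lborel)"
proof -
  have m: "(\<lambda>y. f (Complex x y)) \<in> borel_measurable borel" for x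
    by (rule measurable_compose[OF _ f]) (simp add: Complex_eq)
  have m2: "(\<lambda>x. \<integral>\<^sup>+y. f (Complex x y) \<partial>lborel) \<in> borel_measurable borel"
    using lborel.borel_measurable_nn_integral[of "\<lambda>x y. f (Complex x y)" borel]
      measurable_compose[OF measurable_Complex_pair f] by (simp add: case_prod_beta')
  have "(\<integral>\<^sup>+z. f (flip \<sigma> \<tau> z) \<partial>lborel) = (\<integral>\<^sup>+x. \<integral>\<^sup>+y. f (Complex (\<sigma> * x) (\<tau> * y)) \<partial>lborel \<partial>lborel)"
    by (subst nn_integral_complex_iterated(1)) (auto simp: flip_def)
  also have "\<dots> = (\<integral>\<^sup>+x. \<integral>\<^sup>+y. f (Complex (\<sigma> * x) y) \<partial>lborel \<partial>lborel)"
    using nn_integral_reflect_real[OF m s(2)] by simp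
  also have "\<dots> = (\<integral>\<^sup>+x. \<integral>\<^sup>+y. f (Complex x y) \<partial>lborel \<partial>lborel)"
    by (rule nn_integral_reflect_real[OF m2 s(1)])
  also have "\<dots> = (\<integral>\<^sup>+z. f z \<partial>lborel)" by (rule nn_integral_complex_iterated(1)[OF f, symmetric])
  finally show ?thesis .
qed

lemma distr_lborel_eqI:
  fixes T :: "complex \<Rightarrow> complex"
  assumes [measurable]: "T \<in> borel_measurable borel"
    and eq: "\<And>f :: complex \<Rightarrow> ennreal. f \<in> borel_measurable borel \<Longrightarrow> (\<integral>\<^sup>+z. f (T z) \<partial>lborel) = (\<integral>\<^sup>+z. f z \<partial>lborel)"
  shows "distr lborel borel T = lborel"
proof (rule measure_eqI)
  fix A assume "A \<in> sets (distr lborel borel T)"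
  then have A [measurable]: "A \<in> sets borel" by simp
  have TA: "T -` A \<in> sets borel" using measurable_sets[of T borel borel A] by simp
  have "emeasure (distr lborel borel T) A = emeasure lborel (T -` A)" by (subst emeasure_distr) auto
  also have "\<dots> = (\<integral>\<^sup>+z. indicator A (T z) \<partial>lborel)"
    using nn_integral_indicator[of "T -` A" lborel] TA by (simp add: indicator_def vimage_def)
  also have "\<dots> = (\<integral>\<^sup>+z. indicator A z \<partial>lborel)" by (rule eq) measurable
  finally show "emeasure (distr lborel borel T) A = emeasure lborel A" by simp
qed simp

lemma AE_lborel_transfer:
  fixes T :: "complex \<Rightarrow> complex"
  assumes T: "distr lborel borel T = lborel" "T \<in> borel_measurable borel" and ae: "AE w in lborel. P w"
  shows "AE z in lborel. P (T z)"
proof -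
  have "AE z in distr lborel borel T. P z" using ae unfolding T(1) .
  then show ?thesis by (rule AE_distrD[rotated]) (simp add: T(2))
qed

abbreviation square :: "complex \<Rightarrow> real \<Rightarrow> complex set" where
  "square z R \<equiv> cbox (Complex (Re z - R) (Im z - R)) (Complex (Re z + R) (Im z + R))"

text \<open>A centred square of side \<open>2 * R\<close> is the union of four corner squares of
  side \<open>R\<close>, and on each of them the average of \<open>k\<close> is eventually at most
  \<open>k z + e\<close>.\<close>

lemma AE_square_average_le:
  fixes k :: "complex \<Rightarrow> real"
  assumes km [measurable]: "k \<in> borel_measurable borel" and ki: "integrable lborel k" and k0: "\<And>z. 0 \<le> k z"
  shows "AE z in lborel. \<forall>e>0. \<exists>\<delta>>0. \<forall>R. 0 < R \<and> R < \<delta> \<longrightarrow>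
     (\<integral>\<^sup>+w\<in>square z R. ennreal (k w) \<partial>lborel) \<le> ennreal (4 * (k z + e) * R\<^sup>2)"
proof -
  define q where "q \<sigma> \<tau> z R = {w. 0 \<le> \<sigma> * (Re w - Re z) \<and> \<sigma> * (Re w - Re z) \<le> R \<and> 0 \<le> \<tau> * (Im w - Im z) \<and> \<tau> * (Im w - Im z) \<le> R}"
    for \<sigma> \<tau> z and R :: real
  have quad: "AE z in lborel. \<forall>e>0. \<exists>\<delta>>0. \<forall>R. 0 < R \<and> R < \<delta> \<longrightarrow>
     (\<integral>\<^sup>+w\<in>q \<sigma> \<tau> z R. ennreal (k w) \<partial>lborel) \<le> ennreal ((k z + e) * R\<^sup>2)" if s: "\<sigma> \<in> {1, -1}" "\<tau> \<in> {1, -1}" for \<sigma> \<tau>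
  proof -
    let ?T = "flip \<sigma> \<tau>"
    define kT where "kT z = k (?T z)" for z
    have dT: "distr lborel borel ?T = lborel"
      by (rule distr_lborel_eqI) (auto intro: nn_integral_flip[OF _ s])
    have "integrable (distr lborel borel ?T) k" unfolding dT by (rule ki)
    then have kTi: "integrable lborel kT" unfolding kT_def[abs_def] by (subst (asm) integrable_distr_eq) auto
    have kTm [measurable]: "kT \<in> borel_measurable borel" unfolding kT_def[abs_def] by measurable
    have ku: "kT integrable_on UNIV" using kTi by (rule integrable_on_lborel)
    have kb: "kT integrable_on cbox a b" for a b by (rule integrable_on_subcbox[OF ku]) auto
    then obtain N where N: "negligible N"
      "\<And>x e. x \<notin> N \<Longrightarrow> 0 < e \<Longrightarrow> \<exists>d>0. \<forall>h. 0 < h \<and> h < d \<longrightarrow>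
         norm (integral (cbox x (x + h *\<^sub>R One)) kT /\<^sub>R h ^ DIM(complex) - kT x) < e"
      using integrable_ccontinuous_explicit[of kT] by blast
    have "AE x in lebesgue. x \<notin> N" using N(1) by (simp add: AE_not_in negligible_iff_null_sets)
    then have "AE x in lborel. x \<notin> N" by (simp add: AE_completion_iff)
    then have "AE x in lborel. \<forall>e>0. \<exists>\<delta>>0. \<forall>R. 0 < R \<and> R < \<delta> \<longrightarrow>
       (\<integral>\<^sup>+w\<in>q \<sigma> \<tau> (?T x) R. ennreal (k w) \<partial>lborel) \<le> ennreal ((k (?T x) + e) * R\<^sup>2)"
    proof eventually_elim
      case (elim x)
      show ?case
      proof (intro allI impI)
        fix e :: real assume e: "0 < e"
        obtain d where d: "0 < d" "\<And>h. 0 < h \<Longrightarrow> h < d \<Longrightarrow> norm (integral (cbox x (x + h *\<^sub>R One)) kT /\<^sub>R h ^ DIM(complex) - kT x) < e"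
          using N(2)[OF elim e] by blast
        have "(\<integral>\<^sup>+w\<in>q \<sigma> \<tau> (?T x) R. ennreal (k w) \<partial>lborel) \<le> ennreal ((k (?T x) + e) * R\<^sup>2)" if R: "0 < R" "R < d" for R
        proof -
          let ?B = "cbox x (x + R *\<^sub>R One)"
          have xB: "w \<in> ?B \<longleftrightarrow> Re x \<le> Re w \<and> Re w \<le> Re x + R \<and> Im x \<le> Im w \<and> Im w \<le> Im x + R" for w
            by (auto simp: mem_box Basis_complex_def)
          have qm [measurable]: "q \<sigma> \<tau> (?T x) R \<in> sets borel" unfolding q_def by measurable
          have ki2: "integrable lborel (\<lambda>w. indicator ?B w *\<^sub>R kT w)"
            by (rule integrable_mult_indicator[OF _ kTi]) simp
          have "(\<integral>\<^sup>+w\<in>q \<sigma> \<tau> (?T x) R. ennreal (k w) \<partial>lborel)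
              = (\<integral>\<^sup>+w. ennreal (k (?T w)) * indicator (q \<sigma> \<tau> (?T x) R) (?T w) \<partial>lborel)"
            by (rule nn_integral_flip[OF _ s, symmetric]) measurable
          also have "\<dots> = (\<integral>\<^sup>+w\<in>?B. ennreal (kT w) \<partial>lborel)"
            using s by (intro nn_integral_cong) (auto simp: q_def indicator_def kT_def xB algebra_simps)
          also have "\<dots> = (\<integral>\<^sup>+w. ennreal (indicator ?B w *\<^sub>R kT w) \<partial>lborel)"
            by (intro nn_integral_cong) (auto simp: indicator_def)
          also have "\<dots> = ennreal (LINT w:?B|lborel. kT w)"
            unfolding set_lebesgue_integral_def
            using ki2 k0 by (intro nn_integral_eq_integral) (simp_all add: kT_def)
          also have "\<dots> = ennreal (integral ?B kT)"
            using ki2 by (subst set_borel_integral_eq_integral(2)) (simp_all only: set_integrable_def)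
          also have "\<dots> \<le> ennreal ((k (?T x) + e) * R\<^sup>2)"
          proof (rule ennreal_leI)
            have "\<bar>integral ?B kT / R\<^sup>2 - kT x\<bar> < e" using d(2)[OF R] by (simp add: divide_inverse mult.commute)
            then have "integral ?B kT / R\<^sup>2 \<le> kT x + e" by linarith
            then show "integral ?B kT \<le> (k (?T x) + e) * R\<^sup>2" using R by (simp add: kT_def field_simps)
          qed
          finally show ?thesis .
        qed
        then show "\<exists>\<delta>>0. \<forall>R. 0 < R \<and> R < \<delta> \<longrightarrow>
          (\<integral>\<^sup>+w\<in>q \<sigma> \<tau> (?T x) R. ennreal (k w) \<partial>lborel) \<le> ennreal ((k (?T x) + e) * R\<^sup>2)" using d(1) by blast
      qed
    qed
    \<comment> \<open>The estimate is known at \<open>?T x\<close> for almost every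
      \<open>x\<close>; as \<open>?T\<close> is a measure-preserving involution, it holds at almost
      every point.\<close>
    from AE_lborel_transfer[OF dT _ this] show ?thesis by (simp add: flip_flip[OF s])
  qed
  have 1: "1 \<in> {1, -1::real}" and m1: "-1 \<in> {1, -1::real}" by auto
  show ?thesis using quad[OF 1 1] quad[OF 1 m1] quad[OF m1 1] quad[OF m1 m1]
  proof eventually_elim
    case (elim z)
    show ?case
    proof (intro allI impI)
      fix e :: real assume e: "0 < e"
      obtain d1 where d1: "0 < d1" "\<And>R. 0 < R \<Longrightarrow> R < d1 \<Longrightarrow> (\<integral>\<^sup>+w\<in>q 1 1 z R. ennreal (k w) \<partial>lborel) \<le> ennreal ((k z + e) * R\<^sup>2)"
        by (rule exE[OF elim(1)[rule_format, OF e]]) blast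
      obtain d2 where d2: "0 < d2" "\<And>R. 0 < R \<Longrightarrow> R < d2 \<Longrightarrow> (\<integral>\<^sup>+w\<in>q 1 (-1) z R. ennreal (k w) \<partial>lborel) \<le> ennreal ((k z + e) * R\<^sup>2)"
        by (rule exE[OF elim(2)[rule_format, OF e]]) blast
      obtain d3 where d3: "0 < d3" "\<And>R. 0 < R \<Longrightarrow> R < d3 \<Longrightarrow> (\<integral>\<^sup>+w\<in>q (-1) 1 z R. ennreal (k w) \<partial>lborel) \<le> ennreal ((k z + e) * R\<^sup>2)"
        by (rule exE[OF elim(3)[rule_format, OF e]]) blast
      obtain d4 where d4: "0 < d4" "\<And>R. 0 < R \<Longrightarrow> R < d4 \<Longrightarrow> (\<integral>\<^sup>+w\<in>q (-1) (-1) z R. ennreal (k w) \<partial>lborel) \<le> ennreal ((k z + e) * R\<^sup>2)"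
        by (rule exE[OF elim(4)[rule_format, OF e]]) blast
      define d where "d = min (min d1 d2) (min d3 d4)"
      have d0: "0 < d" using d1 d2 d3 d4 by (simp add: d_def)
      have "(\<integral>\<^sup>+w\<in>square z R. ennreal (k w) \<partial>lborel) \<le> ennreal (4 * (k z + e) * R\<^sup>2)" if R: "0 < R" "R < d" for R
      proof -
        let ?I = "\<lambda>\<sigma> \<tau>. \<integral>\<^sup>+w\<in>q \<sigma> \<tau> z R. ennreal (k w) \<partial>lborel"
        have qm [measurable]: "q \<sigma> \<tau> z R \<in> sets borel" for \<sigma> \<tau> unfolding q_def by measurable
        have Rd: "R < d1" "R < d2" "R < d3" "R < d4" using R by (auto simp: d_def)
        have "(\<integral>\<^sup>+w\<in>square z R. ennreal (k w) \<partial>lborel) \<le>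
          (\<integral>\<^sup>+w. ennreal (k w) * indicator (q 1 1 z R) w + ennreal (k w) * indicator (q 1 (-1) z R) w
            + (ennreal (k w) * indicator (q (-1) 1 z R) w + ennreal (k w) * indicator (q (-1) (-1) z R) w) \<partial>lborel)"
        proof (rule nn_integral_mono)
          fix w
          have "w \<in> square z R \<Longrightarrow> w \<in> q 1 1 z R \<or> w \<in> q 1 (-1) z R \<or> w \<in> q (-1) 1 z R \<or> w \<in> q (-1) (-1) z R"
            by (auto simp: q_def mem_cbox_Complex)
          then show "ennreal (k w) * indicator (square z R) w \<le> ennreal (k w) * indicator (q 1 1 z R) w + ennreal (k w) * indicator (q 1 (-1) z R) w
            + (ennreal (k w) * indicator (q (-1) 1 z R) w + ennreal (k w) * indicator (q (-1) (-1) z R) w)"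
            by (auto simp: indicator_def)
        qed
        also have "\<dots> =
          (\<integral>\<^sup>+w. ennreal (k w) * indicator (q 1 1 z R) w + ennreal (k w) * indicator (q 1 (-1) z R) w \<partial>lborel)
          + (\<integral>\<^sup>+w. ennreal (k w) * indicator (q (-1) 1 z R) w + ennreal (k w) * indicator (q (-1) (-1) z R) w \<partial>lborel)"
          by (rule nn_integral_add) measurable
        also have "\<dots> = ?I 1 1 + ?I 1 (-1) + (?I (-1) 1 + ?I (-1) (-1))"
          by (intro arg_cong2[where f="(+)"] nn_integral_add) measurable
        also have "\<dots> \<le> ennreal ((k z + e) * R\<^sup>2) + ennreal ((k z + e) * R\<^sup>2) + (ennreal ((k z + e) * R\<^sup>2) + ennreal ((k z + e) * R\<^sup>2))"
          using R Rd by (intro add_mono d1(2) d2(2) d3(2) d4(2))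
        also have "\<dots> = ennreal (4 * (k z + e) * R\<^sup>2)"
          using k0[of z] e by (simp add: ennreal_plus[symmetric] del: ennreal_plus)
        finally show ?thesis .
      qed
      then show "\<exists>\<delta>>0. \<forall>R. 0 < R \<and> R < \<delta> \<longrightarrow>
         (\<integral>\<^sup>+w\<in>square z R. ennreal (k w) \<partial>lborel) \<le> ennreal (4 * (k z + e) * R\<^sup>2)" using d0 by blast
    qed
  qed
qed

text \<open>The functions \<open>norm (h w - q)\<close> with \<open>q\<close> in a countable dense
  set have their averages under control outside one null set; at a given \<open>z\<close> a value
  \<open>q\<close> close to \<open>h z\<close> is then chosen. Cutting off with a compact exhaustion
  makes these functions integrable.\<close>

lemma AE_lebesgue_point:
  fixes h :: "complex \<Rightarrow> complex"
  assumes D: "open D" and hm [measurable]: "h \<in> borel_measurable borel"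
    and hi: "\<And>C. compact C \<Longrightarrow> C \<subseteq> D \<Longrightarrow> set_integrable lborel C h"
  shows "AE z in lborel. z \<in> D \<longrightarrow> (\<forall>e>0. \<exists>\<delta>>0. \<forall>R. 0 < R \<and> R < \<delta> \<longrightarrow>
     (\<integral>\<^sup>+w\<in>square z R. ennreal (norm (h w - h z)) \<partial>lborel) \<le> ennreal (e * R\<^sup>2))"
proof -
  obtain C where C: "\<And>n. compact (C n)" "\<And>n. C n \<subseteq> D" "\<And>n. C n \<subseteq> interior (C (Suc n))" "\<Union>(range C) = D"
    using open_Union_compact_subsets[OF D] by metis
  note [measurable] = borel_compact[OF C(1)]
  obtain Q :: "complex set" where Q: "countable Q" "\<And>X. open X \<Longrightarrow> X \<noteq> {} \<Longrightarrow> \<exists>d\<in>Q. d \<in> X"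
    using countable_dense_setE by blast
  define k where "k n q w = indicator (C n) w * norm (h w - q)" for n q w
  have "AE z in lborel. \<forall>(n, q)\<in>UNIV \<times> Q. \<forall>e>0. \<exists>\<delta>>0. \<forall>R. 0 < R \<and> R < \<delta> \<longrightarrow>
     (\<integral>\<^sup>+w\<in>square z R. ennreal (k n q w) \<partial>lborel) \<le> ennreal (4 * (k n q z + e) * R\<^sup>2)"
  proof (subst AE_ball_countable, intro countable_SIGMA countableI_type Q(1), intro ballI)
    fix p :: "nat \<times> complex" assume "p \<in> UNIV \<times> Q"
    obtain n q where p: "p = (n, q)" by fastforce
    have "set_integrable lborel (C n) h" using hi C(1,2) by blast
    moreover have "set_integrable lborel (C n) (\<lambda>_. q)"
      unfolding set_integrable_def using emeasure_bounded_finite[OF compact_imp_bounded[OF C(1)]] borel_compact[OF C(1)]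
      by (intro integrable_scaleR_left integrable_real_indicator) auto
    ultimately have "set_integrable lborel (C n) (\<lambda>w. h w - q)" by (rule set_integral_diff)
    then have "integrable lborel (\<lambda>w. norm (indicator (C n) w *\<^sub>R (h w - q)))"
      unfolding set_integrable_def by (rule integrable_norm)
    moreover have "(\<lambda>w. norm (indicator (C n) w *\<^sub>R (h w - q))) = k n q" by (auto simp: k_def)
    ultimately have "integrable lborel (k n q)" by simp
    then show "AE z in lborel. case p of (n, q) \<Rightarrow> \<forall>e>0. \<exists>\<delta>>0. \<forall>R. 0 < R \<and> R < \<delta> \<longrightarrow>
      (\<integral>\<^sup>+w\<in>square z R. ennreal (k n q w) \<partial>lborel) \<le> ennreal (4 * (k n q z + e) * R\<^sup>2)"
      unfolding p split by (intro AE_square_average_le) (auto simp: k_def[abs_def] borel_compact C(1))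
  qed
  then show ?thesis
  proof eventually_elim
    case (elim z)
    show ?case
    proof (intro impI allI)
      fix e :: real assume z: "z \<in> D" and e: "0 < e"
      \<comment> \<open>The index is raised by one because \<open>C m\<close> lies in the interior
        of \<open>C (Suc m)\<close>, so that small squares about \<open>z\<close> do not notice the
        cut-off.\<close>
      obtain m where m: "z \<in> C m" using z C(4) by blast
      define n where "n = Suc m"
      obtain r where r: "0 < r" "ball z r \<subseteq> C n" using m C(3)[of m] unfolding n_def mem_interior[symmetric] by (metis mem_interior subsetD)
      \<comment> \<open>With \<open>k n q z \<le> e/16\<close> the averaged term contributes at most
        \<open>4 * (e/16 + e/16)\<close> and the constant \<open>e/16\<close>, integrated over a
        square of area \<open>4 * R\<^sup>2\<close>, another \<open>4 * (e/16)\<close>, which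
        together stay below \<open>e\<close>.\<close>
      obtain q where q: "q \<in> Q" "dist (h z) q < e/16"
        using Q(2)[of "ball (h z) (e/16)"] e by auto
      have zX: "z \<in> C n" using r by auto
      obtain \<delta> where \<delta>: "0 < \<delta>" "\<And>R. 0 < R \<Longrightarrow> R < \<delta> \<Longrightarrow>
         (\<integral>\<^sup>+w\<in>square z R. ennreal (k n q w) \<partial>lborel) \<le> ennreal (4 * (k n q z + e/16) * R\<^sup>2)"
      proof -
        have "\<forall>e>0. \<exists>\<delta>>0. \<forall>R. 0 < R \<and> R < \<delta> \<longrightarrow>
          (\<integral>\<^sup>+w\<in>square z R. ennreal (k n q w) \<partial>lborel) \<le> ennreal (4 * (k n q z + e) * R\<^sup>2)"
          using bspec[OF elim, of "(n, q)"] q(1) by simp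
        moreover have "0 < e/16" using e by simp
        ultimately show ?thesis using that by blast
      qed
      have "(\<integral>\<^sup>+w\<in>square z R. ennreal (norm (h w - h z)) \<partial>lborel) \<le> ennreal (e * R\<^sup>2)"
        if R: "0 < R" "R < min \<delta> (r/2)" for R
      proof -
        have sq: "square z R \<subseteq> C n"
        proof
          fix w assume "w \<in> square z R"
          then have "\<bar>Re (z - w)\<bar> \<le> R" "\<bar>Im (z - w)\<bar> \<le> R" by (auto simp: mem_cbox_Complex)
          then have "w \<in> ball z r" using cmod_le[of "z - w"] R by (simp add: dist_norm)
          then show "w \<in> C n" using r by blast
        qed
        have "(\<integral>\<^sup>+w\<in>square z R. ennreal (norm (h w - h z)) \<partial>lborel)
           \<le> (\<integral>\<^sup>+w. ennreal (k n q w) * indicator (square z R) w + ennreal (e/16) * indicator (square z R) w \<partial>lborel)"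
        proof (rule nn_integral_mono)
          fix w
          have "norm (h w - h z) \<le> norm (h w - q) + e/16" using q(2) norm_triangle_ineq4[of "h w - q" "h z - q"]
            by (simp add: dist_norm)
          then have "ennreal (norm (h w - h z)) \<le> ennreal (norm (h w - q)) + ennreal (e/16)"
            using e by (simp add: ennreal_plus[symmetric] ennreal_leI del: ennreal_plus)
          then show "ennreal (norm (h w - h z)) * indicator (square z R) w
            \<le> ennreal (k n q w) * indicator (square z R) w + ennreal (e/16) * indicator (square z R) w"
            using sq by (auto simp: indicator_def k_def)
        qed
        also have "\<dots> = (\<integral>\<^sup>+w\<in>square z R. ennreal (k n q w) \<partial>lborel) + ennreal (e/16) * emeasure lborel (square z R)"
          unfolding k_def[abs_def] by (subst nn_integral_add) (auto simp: nn_integral_cmult_indicator)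
        also have "\<dots> \<le> ennreal (4 * (k n q z + e/16) * R\<^sup>2) + ennreal (e/16) * ennreal (4 * R\<^sup>2)"
        proof (intro add_mono mult_left_mono \<delta>(2))
          have "emeasure lborel (square z R) = ennreal (\<Prod>b\<in>Basis. (Complex (Re z + R) (Im z + R) - Complex (Re z - R) (Im z - R)) \<bullet> b)"
            using R by (intro emeasure_lborel_cbox) (auto simp: Basis_complex_def)
          also have "\<dots> = ennreal (4 * R\<^sup>2)" by (simp add: Basis_complex_def power2_eq_square)
          finally show "emeasure lborel (square z R) \<le> ennreal (4 * R\<^sup>2)" by simp
        qed (use R in auto)
        also have "\<dots> = ennreal (4 * (k n q z + e/16) * R\<^sup>2 + e/16 * (4 * R\<^sup>2))"
          using e R by (subst ennreal_mult[symmetric], simp, simp, subst ennreal_plus[symmetric]) (auto simp: k_def)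
        also have "\<dots> \<le> ennreal (e * R\<^sup>2)"
        proof (rule ennreal_leI)
          have "k n q z \<le> e/16" using zX q by (simp add: k_def dist_norm)
          then have "4 * (k n q z + e/16) + 4 * (e/16) \<le> e" using e by (simp add: field_simps)
          then have "(4 * (k n q z + e/16) + 4 * (e/16)) * R\<^sup>2 \<le> e * R\<^sup>2" by (rule mult_right_mono) simp
          then show "4 * (k n q z + e/16) * R\<^sup>2 + e/16 * (4 * R\<^sup>2) \<le> e * R\<^sup>2" by (simp add: algebra_simps)
        qed
        finally show ?thesis .
      qed
      then show "\<exists>\<delta>>0. \<forall>R. 0 < R \<and> R < \<delta> \<longrightarrow> (\<integral>\<^sup>+w\<in>square z R. ennreal (norm (h w - h z)) \<partial>lborel) \<le> ennreal (e * R\<^sup>2)"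
        using \<delta>(1) r(1) by (intro exI[of _ "min \<delta> (r/2)"] conjI allI impI) (simp, blast)
    qed
  qed
qed

text \<open>By invariance of domain an injective continuous map is open, so its distance to a point has no
  interior maximum.\<close>
lemma max_principle_inj:
  fixes f :: "complex \<Rightarrow> complex"
  assumes cont: "continuous_on D f" and inj: "inj_on f D" and K: "cbox a b \<subseteq> D"
    and bd: "\<And>\<zeta>. \<zeta> \<in> cbox a b - box a b \<Longrightarrow> dist (f \<zeta>) q \<le> \<rho>" and \<rho>: "0 \<le> \<rho>" and p: "p \<in> cbox a b"
  shows "dist (f p) q \<le> \<rho>"
proof -
  have cK: "continuous_on (cbox a b) f" using cont K by (rule continuous_on_subset)
  have "\<exists>x\<in>cbox a b. \<forall>y\<in>cbox a b. dist (f y) q \<le> dist (f x) q"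
    using p by (intro continuous_attains_sup continuous_intros cK) auto
  then obtain z1 where z1: "z1 \<in> cbox a b" "\<And>z. z \<in> cbox a b \<Longrightarrow> dist (f z) q \<le> dist (f z1) q"
    by blast
  have "dist (f z1) q \<le> \<rho>"
  proof (cases "z1 \<in> box a b \<and> f z1 \<noteq> q")
    case True
    have "open (f ` box a b)"
      using inj K box_subset_cbox[of a b]
      by (intro invariance_of_domain continuous_on_subset[OF cK] inj_on_subset[OF inj]) auto
    then obtain e where e: "0 < e" "ball (f z1) e \<subseteq> f ` box a b" using True open_contains_ball by (metis imageI)
    \<comment> \<open>The image of the open box contains a ball about \<open>f z1\<close>, hence a
      point pushed from \<open>f z1\<close> radially away from \<open>q\<close> by
      \<open>e/2\<close>; it is farther from \<open>q\<close> than the supposed maximum.\<close>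
    define d where "d = (e/2) / norm (f z1 - q)"
    have n0: "0 < norm (f z1 - q)" using True by simp
    have d0: "0 < d" using e n0 by (simp add: d_def)
    let ?w = "f z1 + d *\<^sub>R (f z1 - q)"
    have "dist (f z1) ?w = e/2" using n0 e by (simp add: dist_norm d_def)
    then have "?w \<in> f ` box a b" using e by auto
    then obtain z where z: "z \<in> box a b" "f z = ?w" by auto
    have "?w - q = (1 + d) *\<^sub>R (f z1 - q)" by (simp add: algebra_simps)
    then have "dist (f z) q = (1 + d) * norm (f z1 - q)" using z d0 by (simp add: dist_norm)
    also have "\<dots> > norm (f z1 - q)" using d0 n0 by (simp add: algebra_simps)
    finally have "dist (f z1) q < dist (f z) q" by (simp add: dist_norm)
    then show ?thesis using z1(2)[of z] z box_subset_cbox by fastforce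
  next
    case False
    then show ?thesis using bd[of z1] z1(1) \<rho> by auto
  qed
  then show ?thesis using z1(2)[OF p] by linarith
qed

section \<open>Good lines and total differentiability\<close>

lemma exists_good_vertical_line:
  fixes k :: "complex \<Rightarrow> ennreal"
  assumes km [measurable]: "k \<in> borel_measurable borel"
    and le: "(\<integral>\<^sup>+w\<in>cbox (Complex xa ya) (Complex xb yb). k w \<partial>lborel) \<le> ennreal M"
    and pq: "xa \<le> p" "p \<le> q" "q \<le> xb" and s: "0 \<le> s" and M: "0 \<le> M" "M < s * (q - p)"
    and G: "AE x in lborel. G x"
  shows "\<exists>x. p < x \<and> x < q \<and> G x \<and> (\<integral>\<^sup>+y\<in>{ya..yb}. k (Complex x y) \<partial>lborel) \<le> ennreal s"
proof (rule ccontr)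
  \<comment> \<open>If there were no such line, almost every line over \<open>{p<..<q}\<close> would
    contribute at least \<open>s\<close>, since \<open>G\<close> fails only on a null set. By Fubini
    the integral over the rectangle would then be at least \<open>s * (q - p)\<close>, which exceeds
    \<open>M\<close>.\<close>
  assume neg: "\<not> ?thesis"
  have [measurable]: "(\<lambda>x. \<integral>\<^sup>+y\<in>{ya..yb}. k (Complex x y) \<partial>lborel) \<in> borel_measurable borel"
    using lborel.borel_measurable_nn_integral[of "\<lambda>x y. k (Complex x y) * indicator {ya..yb} y" borel]
      measurable_compose[OF measurable_Complex_pair km] by (simp add: case_prod_beta')
  have "ennreal (s * (q - p)) = ennreal s * emeasure lborel {p<..<q}"
    using s pq by (simp add: ennreal_mult)
  also have "\<dots> = (\<integral>\<^sup>+x\<in>{p<..<q}. ennreal s \<partial>lborel)" by (simp add: nn_integral_cmult_indicator)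
  also have "\<dots> \<le> (\<integral>\<^sup>+x\<in>{xa..xb}. (\<integral>\<^sup>+y\<in>{ya..yb}. k (Complex x y) \<partial>lborel) \<partial>lborel)"
  proof (rule nn_integral_mono_AE)
    show "AE x in lborel. ennreal s * indicator {p<..<q} x \<le> (\<integral>\<^sup>+y\<in>{ya..yb}. k (Complex x y) \<partial>lborel) * indicator {xa..xb} x"
      using G
    proof eventually_elim
      case (elim x)
      then have "p < x \<Longrightarrow> x < q \<Longrightarrow> ennreal s \<le> (\<integral>\<^sup>+y\<in>{ya..yb}. k (Complex x y) \<partial>lborel)"
        using neg by (meson linear)
      then show ?case using pq by (auto simp: indicator_def)
    qed
  qed
  also have "\<dots> = (\<integral>\<^sup>+x. \<integral>\<^sup>+y. k (Complex x y) * indicator (cbox (Complex xa ya) (Complex xb yb)) (Complex x y) \<partial>lborel \<partial>lborel)"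
    by (intro nn_integral_cong) (auto simp: indicator_def mem_cbox_Complex intro!: nn_integral_cong)
  also have "\<dots> = (\<integral>\<^sup>+w\<in>cbox (Complex xa ya) (Complex xb yb). k w \<partial>lborel)"
    by (rule nn_integral_complex_iterated(1)[symmetric]) measurable
  also have "\<dots> \<le> ennreal M" by (rule le)
  finally show False using M s pq by (simp add: ennreal_le_iff)
qed

text \<open>Exchanging the coordinates turns statements about vertical lines into statements about
  horizontal ones, so that only the former are proved directly.\<close>

definition swap :: "complex \<Rightarrow> complex" where "swap z = Complex (Im z) (Re z)"

lemma swap_simps [simp]: "Re (swap z) = Im z" "Im (swap z) = Re z" "swap (swap z) = z" "swap (Complex x y) = Complex y x"
  by (auto simp: swap_def)

lemma borel_measurable_swap [measurable]: "swap \<in> borel_measurable borel"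
  unfolding swap_def[abs_def] Complex_eq by measurable

lemma nn_integral_swap:
  fixes f :: "complex \<Rightarrow> ennreal"
  assumes f [measurable]: "f \<in> borel_measurable borel"
  shows "(\<integral>\<^sup>+z. f (swap z) \<partial>lborel) = (\<integral>\<^sup>+z. f z \<partial>lborel)"
proof -
  have "(\<integral>\<^sup>+z. f (swap z) \<partial>lborel) = (\<integral>\<^sup>+x. \<integral>\<^sup>+y. f (Complex y x) \<partial>lborel \<partial>lborel)"
    by (subst nn_integral_complex_iterated(1)) auto
  also have "\<dots> = (\<integral>\<^sup>+z. f z \<partial>lborel)" by (rule nn_integral_complex_iterated(2)[OF f, symmetric])
  finally show ?thesis .
qed

lemma exists_good_horizontal_line:
  fixes k :: "complex \<Rightarrow> ennreal"
  assumes km [measurable]: "k \<in> borel_measurable borel"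
    and le: "(\<integral>\<^sup>+w\<in>cbox (Complex xa ya) (Complex xb yb). k w \<partial>lborel) \<le> ennreal M"
    and pq: "ya \<le> p" "p \<le> q" "q \<le> yb" and s: "0 \<le> s" and M: "0 \<le> M" "M < s * (q - p)"
    and G: "AE y in lborel. G y"
  shows "\<exists>y. p < y \<and> y < q \<and> G y \<and> (\<integral>\<^sup>+x\<in>{xa..xb}. k (Complex x y) \<partial>lborel) \<le> ennreal s"
proof -
  have "(\<integral>\<^sup>+w\<in>cbox (Complex ya xa) (Complex yb xb). k (swap w) \<partial>lborel)
     = (\<integral>\<^sup>+w. k (swap w) * indicator (cbox (Complex xa ya) (Complex xb yb)) (swap w) \<partial>lborel)"
    by (intro nn_integral_cong) (auto simp: indicator_def mem_cbox_Complex)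
  also have "\<dots> = (\<integral>\<^sup>+w\<in>cbox (Complex xa ya) (Complex xb yb). k w \<partial>lborel)"
    by (rule nn_integral_swap) measurable
  finally have "(\<integral>\<^sup>+w\<in>cbox (Complex ya xa) (Complex yb xb). k (swap w) \<partial>lborel) \<le> ennreal M" using le by simp
  from exists_good_vertical_line[OF _ this pq s M G] show ?thesis by simp
qed

definition ACL_vertical :: "complex set \<Rightarrow> (complex \<Rightarrow> complex) \<Rightarrow> (complex \<Rightarrow> complex) \<Rightarrow> real \<Rightarrow> bool" where
  "ACL_vertical W g h x \<longleftrightarrow> (\<forall>a b. a \<le> b \<longrightarrow> (\<forall>t\<in>{a..b}. Complex x t \<in> W) \<longrightarrow>
     set_integrable lborel {a..b} (\<lambda>y. h (Complex x y)) \<and>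
     g (Complex x b) - g (Complex x a) = (LINT y:{a..b}|lborel. h (Complex x y)))"

text \<open>The constant \<open>c\<close> has two uses: with the derivative at a Lebesgue point it
  measures the deviation from the linear part, and with \<open>c = 0\<close> it bounds a chord by
  the integral of the derivative.\<close>

lemma ACL_vertical_increment:
  assumes acl: "ACL_vertical W g h x" and ab: "a \<le> b" and seg: "\<And>t. t \<in> {a..b} \<Longrightarrow> Complex x t \<in> W"
  shows "ennreal (norm (g (Complex x b) - g (Complex x a) - (b - a) *\<^sub>R c)) \<le> (\<integral>\<^sup>+y\<in>{a..b}. ennreal (norm (h (Complex x y) - c)) \<partial>lborel)"
    and "set_integrable lborel {a..b} (\<lambda>y. h (Complex x y))"
proof -
  show i: "set_integrable lborel {a..b} (\<lambda>y. h (Complex x y))"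
    using acl ab seg by (auto simp: ACL_vertical_def)
  have eq: "g (Complex x b) - g (Complex x a) = (LINT y:{a..b}|lborel. h (Complex x y))"
    using acl ab seg by (auto simp: ACL_vertical_def)
  have ic: "set_integrable lborel {a..b} (\<lambda>_. c)"
    unfolding set_integrable_def using emeasure_bounded_finite[OF bounded_closed_interval, of a b]
    by (intro integrable_scaleR_left integrable_real_indicator) auto
  have "(LINT y:{a..b}|lborel. c) = (b - a) *\<^sub>R c"
    unfolding set_lebesgue_integral_def using ab by (subst integral_scaleR_left) (auto simp: measure_def)
  then have "g (Complex x b) - g (Complex x a) - (b - a) *\<^sub>R c = (LINT y:{a..b}|lborel. h (Complex x y) - c)"
    using set_integral_diff(2)[OF i ic] eq by simp
  also have "ennreal (norm \<dots>) \<le> (\<integral>\<^sup>+y. ennreal (norm (indicator {a..b} y *\<^sub>R (h (Complex x y) - c))) \<partial>lborel)"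
    unfolding set_lebesgue_integral_def
    using set_integral_diff(1)[OF i ic] by (intro integral_norm_bound_ennreal) (simp add: set_integrable_def)
  also have "\<dots> = (\<integral>\<^sup>+y\<in>{a..b}. ennreal (norm (h (Complex x y) - c)) \<partial>lborel)"
    by (intro nn_integral_cong) (auto simp: indicator_def)
  finally show "ennreal (norm (g (Complex x b) - g (Complex x a) - (b - a) *\<^sub>R c)) \<le> (\<integral>\<^sup>+y\<in>{a..b}. ennreal (norm (h (Complex x y) - c)) \<partial>lborel)" .
qed

lemma ACL_vertical_line_osc:
  assumes acl: "ACL_vertical W g h x" and seg: "\<And>t. t \<in> {ya..yb} \<Longrightarrow> Complex x t \<in> W"
    and le: "(\<integral>\<^sup>+y\<in>{ya..yb}. ennreal (norm (h (Complex x y) - c)) \<partial>lborel) \<le> ennreal s" and s: "0 \<le> s"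
    and t: "t1 \<in> {ya..yb}" "t2 \<in> {ya..yb}"
  shows "norm (g (Complex x t2) - g (Complex x t1) - (t2 - t1) *\<^sub>R c) \<le> s"
proof -
  have *: "norm (g (Complex x b) - g (Complex x a) - (b - a) *\<^sub>R c) \<le> s" if ab: "a \<in> {ya..yb}" "b \<in> {ya..yb}" "a \<le> b" for a b
  proof -
    have "ennreal (norm (g (Complex x b) - g (Complex x a) - (b - a) *\<^sub>R c)) \<le> (\<integral>\<^sup>+y\<in>{a..b}. ennreal (norm (h (Complex x y) - c)) \<partial>lborel)"
      using ab seg by (intro ACL_vertical_increment(1)[OF acl]) auto
    also have "\<dots> \<le> (\<integral>\<^sup>+y\<in>{ya..yb}. ennreal (norm (h (Complex x y) - c)) \<partial>lborel)"
      using ab by (intro nn_integral_mono) (auto simp: indicator_def)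
    also note le
    finally show ?thesis using s by (simp add: ennreal_le_iff)
  qed
  show ?thesis
  proof (cases "t1 \<le> t2")
    case True
    then show ?thesis using * t by blast
  next
    case False
    then have "norm (g (Complex x t1) - g (Complex x t2) - (t1 - t2) *\<^sub>R c) \<le> s" using * t by auto
    moreover have "g (Complex x t1) - g (Complex x t2) - (t1 - t2) *\<^sub>R c = - (g (Complex x t2) - g (Complex x t1) - (t2 - t1) *\<^sub>R c)"
      by (simp add: algebra_simps)
    ultimately show ?thesis by (metis norm_minus_cancel)
  qed
qed

lemma norm_lin_of_le: "norm (lin_of a b h) \<le> (norm a + norm b) * norm h"
proof -
  have "norm (lin_of a b h) \<le> \<bar>Re h\<bar> * norm a + \<bar>Im h\<bar> * norm b"
    unfolding lin_of_def by (rule order_trans[OF norm_triangle_ineq]) simp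
  also have "\<dots> \<le> norm h * norm a + norm h * norm b"
    by (intro add_mono mult_right_mono abs_Re_le_cmod abs_Im_le_cmod) auto
  finally show ?thesis by (simp add: algebra_simps)
qed

lemma bounded_linear_lin_of: "bounded_linear (lin_of a b)"
  by (rule bounded_linear_intro[where K="norm a + norm b"])
    (simp_all add: norm_lin_of_le mult.commute[of "norm _" "norm a + norm b"], simp_all add: lin_of_def algebra_simps)

lemma onorm_lin_of_le: "onorm (lin_of a b) \<le> norm a + norm b"
  by (rule onorm_bound) (simp_all add: norm_lin_of_le)

text \<open>Near a Lebesgue point of \<open>u\<close> and \<open>v\<close>, Markov's inequality provides four lines, close to the
  sides of any given small square, on which \<open>f\<close> deviates little from its linear part; the maximum
  principle carries the estimate into the interior.\<close>
lemma Gehring_Lehto_at_Lebesgue_point: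
  fixes f u v :: "complex \<Rightarrow> complex"
  assumes D: "open D" and cont: "continuous_on D f" and inj: "inj_on f D"
    and um [measurable]: "u \<in> borel_measurable borel" and vm [measurable]: "v \<in> borel_measurable borel"
    and V: "AE x in lborel. ACL_vertical D f v x"
    and H: "AE y in lborel. ACL_vertical (swap -` D) (f \<circ> swap) (u \<circ> swap) y"
    and z0: "z0 \<in> D"
    and Lu: "\<And>e. 0 < e \<Longrightarrow> \<exists>\<delta>>0. \<forall>R. 0 < R \<and> R < \<delta> \<longrightarrow>
       (\<integral>\<^sup>+w\<in>square z0 R. ennreal (norm (u w - u z0)) \<partial>lborel) \<le> ennreal (e * R\<^sup>2)"
    and Lv: "\<And>e. 0 < e \<Longrightarrow> \<exists>\<delta>>0. \<forall>R. 0 < R \<and> R < \<delta> \<longrightarrow>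
       (\<integral>\<^sup>+w\<in>square z0 R. ennreal (norm (v w - v z0)) \<partial>lborel) \<le> ennreal (e * R\<^sup>2)"
  shows "(f has_derivative lin_of (u z0) (v z0)) (at z0)"
proof -
  let ?L = "lin_of (u z0) (v z0)"
  define \<Lambda> where "\<Lambda> = norm (u z0) + norm (v z0)"
  have L_diff: "?L (a - b) = ?L a - ?L b" for a b
    by (simp add: lin_of_def algebra_simps)
  have Lb: "norm (?L h) \<le> \<Lambda> * norm h" for h
    unfolding \<Lambda>_def by (rule norm_lin_of_le)
  note bl = bounded_linear_lin_of
  have \<Lambda>0: "0 \<le> \<Lambda>" by (simp add: \<Lambda>_def)
  define g where "g w = f w - ?L w" for w
  have key: "\<exists>d>0. \<forall>z. norm (z - z0) < d \<longrightarrow> norm (f z - f z0 - ?L (z - z0)) \<le> e * norm (z - z0)" if e: "0 < e" for e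
  proof -
    \<comment> \<open>\<open>1/8\<close> keeps strips of width \<open>2 * \<eta> * R\<close> next to
      a point of the concentric square of half the size inside the square itself; the second bound
      is what the final constant \<open>(8 + 16 * \<Lambda>) * \<eta>\<close> requires.\<close>
    define \<eta> where "\<eta> = min (1/8) (e / (8 + 16 * \<Lambda>))"
    have \<eta>: "0 < \<eta>" "\<eta> \<le> 1/8" "\<eta> \<le> e / (8 + 16 * \<Lambda>)"
      unfolding \<eta>_def by (use e \<Lambda>0 in simp, rule min.cobounded1, rule min.cobounded2)
    then have \<eta>e: "(8 + 16 * \<Lambda>) * \<eta> \<le> e" using \<Lambda>0 by (simp add: pos_le_divide_eq mult.commute)
    obtain \<delta>1 where \<delta>1: "0 < \<delta>1" "\<And>R. 0 < R \<Longrightarrow> R < \<delta>1 \<Longrightarrow>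
       (\<integral>\<^sup>+w\<in>square z0 R. ennreal (norm (u w - u z0)) \<partial>lborel) \<le> ennreal (\<eta>\<^sup>2 * R\<^sup>2)"
      using Lu[of "\<eta>\<^sup>2"] \<eta> by auto
    obtain \<delta>2 where \<delta>2: "0 < \<delta>2" "\<And>R. 0 < R \<Longrightarrow> R < \<delta>2 \<Longrightarrow>
       (\<integral>\<^sup>+w\<in>square z0 R. ennreal (norm (v w - v z0)) \<partial>lborel) \<le> ennreal (\<eta>\<^sup>2 * R\<^sup>2)"
      using Lv[of "\<eta>\<^sup>2"] \<eta> by auto
    obtain \<delta>3 where \<delta>3: "0 < \<delta>3" "ball z0 \<delta>3 \<subseteq> D" using D z0 open_contains_ball by blast
    \<comment> \<open>\<open>R\<close> below is less than \<open>2 * d\<close>. The bound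
      \<open>\<delta>3/2\<close> serves the inclusion in \<open>D\<close>: points of the square have
      distance at most \<open>2 * R\<close> from \<open>z0\<close>.\<close>
    define d where "d = min (min \<delta>1 \<delta>2) (\<delta>3/2) / 2"
    have d0: "0 < d" using \<delta>1 \<delta>2 \<delta>3 by (simp add: d_def)
    have "norm (f z - f z0 - ?L (z - z0)) \<le> e * norm (z - z0)" if zd: "norm (z - z0) < d" for z
    proof (cases "z = z0")
      case True
      then show ?thesis by (simp add: lin_of_def)
    next
      case False
      \<comment> \<open>Twice the distance puts \<open>z\<close> into the square of half the size,
        so that good lines can be found on all four sides of it.\<close>
      define R where "R = 2 * norm (z - z0)"
      have R: "0 < R" "R < \<delta>1" "R < \<delta>2" "R < \<delta>3/2" using False zd by (auto simp: R_def d_def)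
      define x0 y0 where "x0 = Re z0" and "y0 = Im z0"
      have sqD: "square z0 R \<subseteq> D"
      proof
        fix w assume "w \<in> square z0 R"
        then have "\<bar>Re (z0 - w)\<bar> \<le> R" "\<bar>Im (z0 - w)\<bar> \<le> R" by (auto simp: mem_cbox_Complex)
        then have "w \<in> ball z0 \<delta>3" using cmod_le[of "z0 - w"] R by (simp add: dist_norm)
        then show "w \<in> D" using \<delta>3 by blast
      qed
      have sqI: "Complex x y \<in> square z0 R" if "x \<in> {x0 - R..x0 + R}" "y \<in> {y0 - R..y0 + R}" for x y
        using that by (auto simp: mem_cbox_Complex x0_def y0_def)
      define GV where "GV x \<longleftrightarrow> x0 - R < x \<and> x < x0 + R \<and>
        (\<forall>s\<in>{y0 - R..y0 + R}. \<forall>t\<in>{y0 - R..y0 + R}. norm (g (Complex x t) - g (Complex x s)) \<le> \<eta> * R)" for x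
      define GH where "GH y \<longleftrightarrow> y0 - R < y \<and> y < y0 + R \<and>
        (\<forall>s\<in>{x0 - R..x0 + R}. \<forall>t\<in>{x0 - R..x0 + R}. norm (g (Complex t y) - g (Complex s y)) \<le> \<eta> * R)" for y
      have \<eta>R: "0 \<le> \<eta> * R" "\<eta>\<^sup>2 * R\<^sup>2 < \<eta> * R * (2 * \<eta> * R)" using \<eta> R by (auto simp: power2_eq_square)
      \<comment> \<open>The Lebesgue point gives the total \<open>\<eta>\<^sup>2 * R\<^sup>2\<close>
        over the square. Among the lines of a strip of width \<open>2 * \<eta> * R\<close> one must
        carry at most \<open>\<eta> * R\<close>, since the product of these two numbers is
        \<open>2 * \<eta>\<^sup>2 * R\<^sup>2\<close>.\<close>
      have exV: "\<exists>x. p < x \<and> x < p + 2 * \<eta> * R \<and> GV x" if p: "x0 - R \<le> p" "p + 2 * \<eta> * R \<le> x0 + R" for p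
      proof -
        have "\<exists>x. p < x \<and> x < p + 2 * \<eta> * R \<and> ACL_vertical D f v x \<and>
          (\<integral>\<^sup>+y\<in>{y0 - R..y0 + R}. ennreal (norm (v (Complex x y) - v z0)) \<partial>lborel) \<le> ennreal (\<eta> * R)"
          using \<delta>2(2)[OF R(1,3)] p \<eta>R \<eta> R(1)
          by (intro exists_good_vertical_line[where xa="x0 - R" and xb="x0 + R" and M="\<eta>\<^sup>2 * R\<^sup>2"] V)
             (auto simp: x0_def y0_def)
        then obtain x where x: "p < x" "x < p + 2 * \<eta> * R" and acl: "ACL_vertical D f v x"
          and le: "(\<integral>\<^sup>+y\<in>{y0 - R..y0 + R}. ennreal (norm (v (Complex x y) - v z0)) \<partial>lborel) \<le> ennreal (\<eta> * R)" by blast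
        have xin: "x0 - R < x" "x < x0 + R" using x p by auto
        have "norm (g (Complex x t) - g (Complex x s)) \<le> \<eta> * R" if st: "s \<in> {y0 - R..y0 + R}" "t \<in> {y0 - R..y0 + R}" for s t
        proof -
          have "norm (f (Complex x t) - f (Complex x s) - (t - s) *\<^sub>R v z0) \<le> \<eta> * R"
          proof (rule ACL_vertical_line_osc[OF acl _ le \<eta>R(1) st])
            show "\<And>t. t \<in> {y0 - R..y0 + R} \<Longrightarrow> Complex x t \<in> D" using sqI sqD xin by (meson atLeastAtMost_iff less_imp_le subsetD)
          qed
          moreover have "g (Complex x t) - g (Complex x s) = f (Complex x t) - f (Complex x s) - (t - s) *\<^sub>R v z0"
            by (simp add: g_def lin_of_def algebra_simps)
          ultimately show ?thesis by simp
        qed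
        then show ?thesis using x xin by (auto simp: GV_def)
      qed
      have exH: "\<exists>y. p < y \<and> y < p + 2 * \<eta> * R \<and> GH y" if p: "y0 - R \<le> p" "p + 2 * \<eta> * R \<le> y0 + R" for p
      proof -
        have "\<exists>y. p < y \<and> y < p + 2 * \<eta> * R \<and> ACL_vertical (swap -` D) (f \<circ> swap) (u \<circ> swap) y \<and>
          (\<integral>\<^sup>+x\<in>{x0 - R..x0 + R}. ennreal (norm (u (Complex x y) - u z0)) \<partial>lborel) \<le> ennreal (\<eta> * R)"
          using \<delta>1(2)[OF R(1,2)] p \<eta>R \<eta> R(1)
          by (intro exists_good_horizontal_line[where ya="y0 - R" and yb="y0 + R" and M="\<eta>\<^sup>2 * R\<^sup>2"] H)
             (auto simp: x0_def y0_def)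
        then obtain y where y: "p < y" "y < p + 2 * \<eta> * R" and acl: "ACL_vertical (swap -` D) (f \<circ> swap) (u \<circ> swap) y"
          and le: "(\<integral>\<^sup>+x\<in>{x0 - R..x0 + R}. ennreal (norm (u (Complex x y) - u z0)) \<partial>lborel) \<le> ennreal (\<eta> * R)" by blast
        have yin: "y0 - R < y" "y < y0 + R" using y p by auto
        have "norm (g (Complex t y) - g (Complex s y)) \<le> \<eta> * R" if st: "s \<in> {x0 - R..x0 + R}" "t \<in> {x0 - R..x0 + R}" for s t
        proof -
          have "norm ((f \<circ> swap) (Complex y t) - (f \<circ> swap) (Complex y s) - (t - s) *\<^sub>R u z0) \<le> \<eta> * R"
          proof (rule ACL_vertical_line_osc[OF acl _ _ \<eta>R(1) st])
            show "\<And>t. t \<in> {x0 - R..x0 + R} \<Longrightarrow> Complex y t \<in> swap -` D"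
              using sqI sqD yin by (metis atLeastAtMost_iff less_imp_le subsetD swap_simps(4) vimageI)
            show "(\<integral>\<^sup>+x\<in>{x0 - R..x0 + R}. ennreal (norm ((u \<circ> swap) (Complex y x) - u z0)) \<partial>lborel) \<le> ennreal (\<eta> * R)"
              using le by simp
          qed
          moreover have "g (Complex t y) - g (Complex s y) = (f \<circ> swap) (Complex y t) - (f \<circ> swap) (Complex y s) - (t - s) *\<^sub>R u z0"
            by (simp add: g_def lin_of_def algebra_simps)
          ultimately show ?thesis by simp
        qed
        then show ?thesis using y yin by (auto simp: GH_def)
      qed
      have \<eta>R4: "8 * (\<eta> * R) \<le> R" using \<eta> R by simp
      obtain xs where xs: "GV xs"
      proof -
        have "x0 - R \<le> x0" "x0 + 2 * \<eta> * R \<le> x0 + R" using \<eta>R4 R(1) by linarith+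
        from exV[OF this] show ?thesis using that by blast
      qed
      obtain ys where ys: "GH ys"
      proof -
        have "y0 - R \<le> y0" "y0 + 2 * \<eta> * R \<le> y0 + R" using \<eta>R4 R(1) by linarith+
        from exH[OF this] show ?thesis using that by blast
      qed
      \<comment> \<open>\<open>c\<close> is the value of \<open>g\<close> at the crossing of one
        good line of each direction. Every other good line meets one of these two, so each of its
        points is reached from the crossing in two moves along good lines, each changing
        \<open>g\<close> by at most \<open>\<eta> * R\<close>.\<close>
      define c where "c = g (Complex xs ys)"
      have onV: "norm (g (Complex x t) - c) \<le> 2 * \<eta> * R" if "GV x" "t \<in> {y0 - R..y0 + R}" for x t
      proof -
        have "norm (g (Complex x t) - g (Complex x ys)) \<le> \<eta> * R" using that ys by (auto simp: GV_def GH_def)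
        moreover have "norm (g (Complex x ys) - c) \<le> \<eta> * R" using that xs ys by (auto simp: GV_def GH_def c_def)
        ultimately show ?thesis using norm_triangle_ineq[of "g (Complex x t) - g (Complex x ys)" "g (Complex x ys) - c"] by simp
      qed
      have onH: "norm (g (Complex t y) - c) \<le> 2 * \<eta> * R" if "GH y" "t \<in> {x0 - R..x0 + R}" for y t
      proof -
        have "norm (g (Complex t y) - g (Complex xs y)) \<le> \<eta> * R" using that xs by (auto simp: GV_def GH_def)
        moreover have "norm (g (Complex xs y) - c) \<le> \<eta> * R" using that xs ys by (auto simp: GV_def GH_def c_def)
        ultimately show ?thesis using norm_triangle_ineq[of "g (Complex t y) - g (Complex xs y)" "g (Complex xs y) - c"] by simp
      qed
      have pt: "norm (f p - (c + ?L p)) \<le> (2 + 4 * \<Lambda>) * \<eta> * R" if p: "\<bar>Re p - x0\<bar> \<le> R/2" "\<bar>Im p - y0\<bar> \<le> R/2" for p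
      proof -
        have pp: "x0 - R/2 \<le> Re p" "Re p \<le> x0 + R/2" "y0 - R/2 \<le> Im p" "Im p \<le> y0 + R/2" using p by linarith+
        have e2: "2 * \<eta> * R \<le> R/4" using \<eta>R4 by simp
        obtain x1 where x1: "Re p - 2 * \<eta> * R < x1" "x1 < Re p" "GV x1"
        proof -
          have "x0 - R \<le> Re p - 2 * \<eta> * R" "Re p - 2 * \<eta> * R + 2 * \<eta> * R \<le> x0 + R" using pp e2 \<eta>R(1) R(1) by linarith+
          from exV[OF this] show ?thesis using that by auto
        qed
        obtain x2 where x2: "Re p < x2" "x2 < Re p + 2 * \<eta> * R" "GV x2"
        proof -
          have "x0 - R \<le> Re p" "Re p + 2 * \<eta> * R \<le> x0 + R" using pp e2 \<eta>R(1) R(1) by linarith+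
          from exV[OF this] show ?thesis using that by auto
        qed
        obtain y1 where y1: "Im p - 2 * \<eta> * R < y1" "y1 < Im p" "GH y1"
        proof -
          have "y0 - R \<le> Im p - 2 * \<eta> * R" "Im p - 2 * \<eta> * R + 2 * \<eta> * R \<le> y0 + R" using pp e2 \<eta>R(1) R(1) by linarith+
          from exH[OF this] show ?thesis using that by auto
        qed
        obtain y2 where y2: "Im p < y2" "y2 < Im p + 2 * \<eta> * R" "GH y2"
        proof -
          have "y0 - R \<le> Im p" "Im p + 2 * \<eta> * R \<le> y0 + R" using pp e2 \<eta>R(1) R(1) by linarith+
          from exH[OF this] show ?thesis using that by auto
        qed
        let ?a = "Complex x1 y1" and ?b = "Complex x2 y2"
        have inR: "x0 - R < x1" "x2 < x0 + R" "y0 - R < y1" "y2 < y0 + R" using x1 x2 y1 y2 by (auto simp: GV_def GH_def)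
        have KD: "cbox ?a ?b \<subseteq> D"
        proof -
          have "cbox ?a ?b \<subseteq> square z0 R" using inR by (auto simp: mem_cbox_Complex x0_def y0_def)
          then show ?thesis using sqD by blast
        qed
        have "dist (f p) (c + ?L p) \<le> (2 + 4 * \<Lambda>) * \<eta> * R"
        proof (rule max_principle_inj[OF cont inj KD])
          show "0 \<le> (2 + 4 * \<Lambda>) * \<eta> * R" using \<Lambda>0 \<eta> R by simp
          show "p \<in> cbox ?a ?b" using x1 x2 y1 y2 by (auto simp: mem_cbox_Complex)
          fix \<zeta> assume \<zeta>: "\<zeta> \<in> cbox ?a ?b - box ?a ?b"
          then have \<zeta>in: "x1 \<le> Re \<zeta>" "Re \<zeta> \<le> x2" "y1 \<le> Im \<zeta>" "Im \<zeta> \<le> y2" by (auto simp: mem_cbox_Complex)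
          have or: "Re \<zeta> = x1 \<or> Re \<zeta> = x2 \<or> Im \<zeta> = y1 \<or> Im \<zeta> = y2"
            using \<zeta> \<zeta>in by (auto simp: mem_box Basis_complex_def)
          have rng: "Re \<zeta> \<in> {x0 - R..x0 + R}" "Im \<zeta> \<in> {y0 - R..y0 + R}" using \<zeta>in inR by auto
          have gc: "norm (g \<zeta> - c) \<le> 2 * \<eta> * R"
            using or onV[OF x1(3) rng(2)] onV[OF x2(3) rng(2)] onH[OF y1(3) rng(1)] onH[OF y2(3) rng(1)]
            by (metis complex_surj)
          have "\<bar>Re (\<zeta> - p)\<bar> \<le> 2 * \<eta> * R" "\<bar>Im (\<zeta> - p)\<bar> \<le> 2 * \<eta> * R"
            using \<zeta>in x1 x2 y1 y2 by (auto simp: abs_le_iff)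
          then have "norm (\<zeta> - p) \<le> 4 * \<eta> * R" using cmod_le[of "\<zeta> - p"] by linarith
          then have "norm (?L (\<zeta> - p)) \<le> \<Lambda> * (4 * \<eta> * R)" using Lb[of "\<zeta> - p"] \<Lambda>0 by (meson mult_left_mono order_trans)
          moreover have "f \<zeta> - (c + ?L p) = (g \<zeta> - c) + ?L (\<zeta> - p)" by (simp add: g_def L_diff)
          ultimately show "dist (f \<zeta>) (c + ?L p) \<le> (2 + 4 * \<Lambda>) * \<eta> * R"
            using gc norm_triangle_ineq[of "g \<zeta> - c" "?L (\<zeta> - p)"] by (simp add: dist_norm algebra_simps)
        qed
        then show ?thesis by (simp add: dist_norm)
      qed
      have "\<bar>Re z - x0\<bar> \<le> R/2" "\<bar>Im z - y0\<bar> \<le> R/2"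
        using abs_Re_le_cmod[of "z - z0"] abs_Im_le_cmod[of "z - z0"] by (auto simp: R_def x0_def y0_def)
      then have 1: "norm (f z - (c + ?L z)) \<le> (2 + 4 * \<Lambda>) * \<eta> * R" by (rule pt)
      have 2: "norm (f z0 - (c + ?L z0)) \<le> (2 + 4 * \<Lambda>) * \<eta> * R" using R by (intro pt) (auto simp: x0_def y0_def)
      have "f z - f z0 - ?L (z - z0) = (f z - (c + ?L z)) - (f z0 - (c + ?L z0))" by (simp add: L_diff)
      then have "norm (f z - f z0 - ?L (z - z0)) \<le> 2 * ((2 + 4 * \<Lambda>) * \<eta> * R)"
        using 1 2 norm_triangle_ineq4[of "f z - (c + ?L z)" "f z0 - (c + ?L z0)"] by (simp only:)
      also have "\<dots> = ((8 + 16 * \<Lambda>) * \<eta>) * norm (z - z0)" by (simp add: R_def algebra_simps)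
      also have "\<dots> \<le> e * norm (z - z0)" using \<eta>e by (rule mult_right_mono) simp
      finally show ?thesis .
    qed
    then show ?thesis using d0 by blast
  qed
  show ?thesis unfolding has_derivative_at_alt
  proof (intro conjI bl allI impI)
    fix e :: real assume "0 < e"
    from key[OF this] show "\<exists>d>0. \<forall>y. norm (y - z0) < d \<longrightarrow> norm (f y - f z0 - ?L (y - z0)) \<le> e * norm (y - z0)" .
  qed
qed

theorem AE_has_derivative_ACL_homeo:
  fixes f u v :: "complex \<Rightarrow> complex"
  assumes D: "open D" and cont: "continuous_on D f" and inj: "inj_on f D"
    and um: "u \<in> borel_measurable borel" and vm: "v \<in> borel_measurable borel"
    and ui: "\<And>C. compact C \<Longrightarrow> C \<subseteq> D \<Longrightarrow> set_integrable lborel C u"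
    and vi: "\<And>C. compact C \<Longrightarrow> C \<subseteq> D \<Longrightarrow> set_integrable lborel C v"
    and V: "AE x in lborel. ACL_vertical D f v x"
    and H: "AE y in lborel. ACL_vertical (swap -` D) (f \<circ> swap) (u \<circ> swap) y"
  shows "AE z in lborel. z \<in> D \<longrightarrow> (f has_derivative lin_of (u z) (v z)) (at z)"
proof -
  have Lu: "AE z in lborel. z \<in> D \<longrightarrow> (\<forall>e>0. \<exists>\<delta>>0. \<forall>R. 0 < R \<and> R < \<delta> \<longrightarrow>
     (\<integral>\<^sup>+w\<in>square z R. ennreal (norm (u w - u z)) \<partial>lborel) \<le> ennreal (e * R\<^sup>2))"
    by (rule AE_lebesgue_point[OF D um]) (rule ui)
  have Lv: "AE z in lborel. z \<in> D \<longrightarrow> (\<forall>e>0. \<exists>\<delta>>0. \<forall>R. 0 < R \<and> R < \<delta> \<longrightarrow>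
     (\<integral>\<^sup>+w\<in>square z R. ennreal (norm (v w - v z)) \<partial>lborel) \<le> ennreal (e * R\<^sup>2))"
    by (rule AE_lebesgue_point[OF D vm]) (rule vi)
  show ?thesis using Lu Lv
  proof eventually_elim
    case (elim z)
    show ?case
    proof
      assume z: "z \<in> D"
      show "(f has_derivative lin_of (u z) (v z)) (at z)"
        using elim(1)[rule_format, OF z] elim(2)[rule_format, OF z]
        by (intro Gehring_Lehto_at_Lebesgue_point[OF D cont inj um vm V H z]) simp_all
    qed
  qed
qed

section \<open>Weak derivatives in logarithmic coordinates\<close>

lemma test_functionI:
  assumes U: "open U" and K: "compact K" "K \<subseteq> U" "K \<subseteq> D"
    and d: "\<And>z. z \<in> U \<Longrightarrow> (\<phi> has_derivative \<phi>' z) (at z)"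
    and c: "\<And>h. continuous_on U (\<lambda>z. \<phi>' z h)"
    and 0: "\<And>z. z \<notin> K \<Longrightarrow> \<phi> z = (0::real)"
  shows "test_function D \<phi>"
    and "\<And>z. z \<in> U \<Longrightarrow> frechet_derivative \<phi> (at z) = \<phi>' z"
    and "\<And>z. z \<notin> K \<Longrightarrow> frechet_derivative \<phi> (at z) = (\<lambda>_. 0)"
    and "continuous_on UNIV \<phi>"
proof -
  have oK: "open (-K)" using K by (simp add: compact_imp_closed open_Compl)
  have d0: "(\<phi> has_derivative (\<lambda>_. 0)) (at z)" if "z \<notin> K" for z
    by (rule has_derivative_transform_within_open[OF has_derivative_const[of 0] oK]) (use 0 that in auto)
  show f1: "frechet_derivative \<phi> (at z) = \<phi>' z" if "z \<in> U" for z
    using frechet_derivative_at[OF d[OF that]] by simp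
  show f0: "frechet_derivative \<phi> (at z) = (\<lambda>_. 0)" if "z \<notin> K" for z
    using frechet_derivative_at[OF d0[OF that]] by simp
  have diff: "\<phi> differentiable (at z)" for z
    using d[of z] d0[of z] K unfolding differentiable_def by blast
  show "continuous_on UNIV \<phi>"
    by (intro continuous_at_imp_continuous_on ballI differentiable_imp_continuous_within diff)
  \<comment> \<open>The formula for the derivative is valid on \<open>U\<close>, and off
    \<open>K\<close> the function vanishes. These two open sets cover the plane, so continuity is
    glued from them.\<close>
  have cont: "continuous_on UNIV (\<lambda>z. frechet_derivative \<phi> (at z) h)" for h
  proof -
    have "continuous_on U (\<lambda>z. frechet_derivative \<phi> (at z) h)"
      by (rule continuous_on_eq[OF c[of h]]) (simp add: f1)
    moreover have "continuous_on (-K) (\<lambda>z. frechet_derivative \<phi> (at z) h)"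
      by (rule continuous_on_eq[OF continuous_on_const[of _ 0]]) (simp add: f0)
    ultimately have "continuous_on (U \<union> -K) (\<lambda>z. frechet_derivative \<phi> (at z) h)"
      using U oK by (intro continuous_on_open_Un)
    moreover have "U \<union> -K = UNIV" using K by blast
    ultimately show ?thesis by simp
  qed
  have sub: "{z. \<phi> z \<noteq> 0} \<subseteq> K" using 0 by blast
  then have cl: "closure {z. \<phi> z \<noteq> 0} \<subseteq> K" using K by (intro closure_minimal) (auto intro: compact_imp_closed)
  then have "K \<inter> closure {z. \<phi> z \<noteq> 0} = closure {z. \<phi> z \<noteq> 0}" by blast
  then have cc: "compact (closure {z. \<phi> z \<noteq> 0})" using compact_Int_closed[OF K(1) closed_closure] by metis
  show "test_function D \<phi>" unfolding test_function_def
    by (intro conjI allI diff cont cc subset_trans[OF cl K(3)])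
qed

text \<open>Integrals over \<open>D\<close> for the completed measure become integrals over the
  plane for \<open>lborel\<close>, where Fubini's theorem applies directly; test functions vanish
  outside \<open>D\<close>, so the values are the same.\<close>

definition weak_borel :: "complex set \<Rightarrow> complex \<Rightarrow> (complex \<Rightarrow> complex) \<Rightarrow> (complex \<Rightarrow> complex) \<Rightarrow> bool" where
  "weak_borel D e f h \<longleftrightarrow> (\<forall>\<phi>. test_function D \<phi> \<longrightarrow>
     (LINT z|lborel. frechet_derivative \<phi> (at z) e *\<^sub>R f z) = - (LINT z|lborel. \<phi> z *\<^sub>R h z))"

lemma borel_measurable_frechet:
  assumes "test_function D \<phi>"
  shows "(\<lambda>z. frechet_derivative \<phi> (at z) e) \<in> borel_measurable borel" "\<phi> \<in> borel_measurable borel"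
proof -
  have c: "continuous_on UNIV (\<lambda>z. frechet_derivative \<phi> (at z) e)" and d: "\<phi> differentiable (at z)" for z
    using assms unfolding test_function_def by blast+
  show "(\<lambda>z. frechet_derivative \<phi> (at z) e) \<in> borel_measurable borel"
    using c by (rule borel_measurable_continuous_onI)
  have "continuous_on UNIV \<phi>"
    by (intro continuous_at_imp_continuous_on ballI differentiable_imp_continuous_within d)
  then show "\<phi> \<in> borel_measurable borel" by (rule borel_measurable_continuous_onI)
qed

lemma test_function_outside:
  assumes "test_function D \<phi>" "z \<notin> D"
  shows "\<phi> z = 0" "frechet_derivative \<phi> (at z) e = 0"
proof -
  let ?K = "closure {z. \<phi> z \<noteq> 0}"
  have K: "z \<notin> ?K" using assms by (auto simp: test_function_def)
  then show "\<phi> z = 0" using closure_subset[of "{z. \<phi> z \<noteq> 0}"] by blast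
  have "(\<phi> has_derivative (\<lambda>_. 0)) (at z)"
  proof (rule has_derivative_transform_within_open[OF has_derivative_const[of 0]])
    show "open (- ?K)" by (rule open_Compl) (rule closed_closure)
    show "z \<in> - ?K" using K by simp
    show "0 = \<phi> x" if "x \<in> - ?K" for x using that closure_subset[of "{z. \<phi> z \<noteq> 0}"] by force
  qed
  from frechet_derivative_at[OF this] show "frechet_derivative \<phi> (at z) e = 0" by metis
qed

lemma lebesgue_borel_representative:
  fixes u :: "complex \<Rightarrow> complex"
  assumes "u \<in> borel_measurable lebesgue"
  shows "\<exists>u0 \<in> borel_measurable borel. AE z in lborel. u z = u0 z"
proof -
  obtain a where a: "a \<in> borel_measurable lborel" "AE z in lborel. Re (u z) = a z"
    by (rule bexE[OF completion_ex_borel_measurable_real[OF measurable_compose[OF assms borel_measurable_Re]]])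
  obtain b where b: "b \<in> borel_measurable lborel" "AE z in lborel. Im (u z) = b z"
    by (rule bexE[OF completion_ex_borel_measurable_real[OF measurable_compose[OF assms borel_measurable_Im]]])
  show ?thesis
  proof (rule bexI)
    show "AE z in lborel. u z = Complex (a z) (b z)"
      using a(2) b(2) by eventually_elim (simp add: complex_eq_iff)
    show "(\<lambda>z. Complex (a z) (b z)) \<in> borel_measurable borel"
      using measurable_compose[OF measurable_Pair[OF a(1) b(1)] measurable_Complex_pair] by simp
  qed
qed

text \<open>Local integrability yields measurability on compact subsets only. A countable exhaustion
  of \<open>D\<close>, together with the complement, glues these pieces to a measurable extension by
  zero, which has a Borel representative.\<close>

lemma locally_integrable_borel:
  fixes u :: "complex \<Rightarrow> complex"
  assumes D: "open D" and u: "locally_integrable D u"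
  shows "\<exists>u0. u0 \<in> borel_measurable borel \<and> (AE z in lborel. z \<in> D \<longrightarrow> u z = u0 z) \<and> (\<forall>z. z \<notin> D \<longrightarrow> u0 z = 0) \<and>
     (\<forall>C. compact C \<longrightarrow> C \<subseteq> D \<longrightarrow> set_integrable lborel C u0)"
proof -
  obtain C :: "nat \<Rightarrow> complex set" where C: "\<And>n. compact (C n)" "\<And>n. C n \<subseteq> D" "\<Union>(range C) = D"
    using open_Union_compact_subsets[OF D] by metis
  define \<D> where "\<D> = range C"
  have \<D>: "countable \<D>" "\<And>X. X \<in> \<D> \<Longrightarrow> compact X \<and> X \<subseteq> D" "\<Union>\<D> = D"
    using C by (auto simp: \<D>_def)
  have Xm: "(\<lambda>z. if z \<in> X then u z else 0) \<in> borel_measurable lebesgue" if "X \<in> \<D>" for X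
  proof -
    have "u absolutely_integrable_on X" using u \<D>(2)[OF that] by (simp add: locally_integrable_def)
    then have "(\<lambda>z. indicator X z *\<^sub>R u z) \<in> borel_measurable lebesgue" by (auto simp: set_integrable_def)
    moreover have "(\<lambda>z. indicator X z *\<^sub>R u z) = (\<lambda>z. if z \<in> X then u z else 0)" by auto
    ultimately show ?thesis by simp
  qed
  have "(\<lambda>z. if z \<in> D then u z else 0) \<in> borel_measurable lebesgue"
  proof (rule measurable_piecewise_restrict[where C="insert (-D) \<D>"])
    show "countable (insert (-D) \<D>)" using \<D>(1) by simp
    show "space lebesgue \<subseteq> \<Union>(insert (-D) \<D>)" using \<D>(3) by auto
    fix X assume X: "X \<in> insert (-D) \<D>"
    show "X \<inter> space lebesgue \<in> sets lebesgue"
      using X D \<D>(2) by (auto simp: borel_closed compact_imp_closed)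
    show "(\<lambda>z. if z \<in> D then u z else 0) \<in> borel_measurable (restrict_space lebesgue X)"
    proof (cases "X = -D")
      case True
      have "(\<lambda>z. if z \<in> D then u z else 0) \<in> borel_measurable (restrict_space lebesgue X) \<longleftrightarrow> (\<lambda>_. 0::complex) \<in> borel_measurable (restrict_space lebesgue X)"
        by (rule measurable_cong) (auto simp: True space_restrict_space)
      then show ?thesis by simp
    next
      case False
      then have XD: "X \<in> \<D>" using X by simp
      have "(\<lambda>z. if z \<in> D then u z else 0) \<in> borel_measurable (restrict_space lebesgue X) \<longleftrightarrow>
          (\<lambda>z. if z \<in> X then u z else 0) \<in> borel_measurable (restrict_space lebesgue X)"
        using \<D>(2)[OF XD] by (intro measurable_cong) (auto simp: space_restrict_space)
      then show ?thesis using measurable_restrict_space1[OF Xm[OF XD]] by simp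
    qed
  qed
  then obtain u1 where u1: "u1 \<in> borel_measurable borel" "AE z in lborel. (if z \<in> D then u z else 0) = u1 z"
    using lebesgue_borel_representative by blast
  define u0 where "u0 z = indicator D z *\<^sub>R u1 z" for z
  have um [measurable]: "u0 \<in> borel_measurable borel"
    unfolding u0_def[abs_def] by (intro borel_measurable_scaleR borel_measurable_indicator borel_open D u1(1))
  have ae: "AE z in lborel. z \<in> D \<longrightarrow> u z = u0 z" using u1(2) by eventually_elim (auto simp: u0_def)
  have "set_integrable lborel C u0" if C: "compact C" "C \<subseteq> D" for C
  proof -
    have Cb [measurable]: "C \<in> sets borel" using C(1) by (rule borel_compact)
    have i: "integrable lebesgue (\<lambda>z. indicator C z *\<^sub>R u z)" using u C by (simp add: locally_integrable_def set_integrable_def)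
    have "AE z in lebesgue. indicator C z *\<^sub>R u z = indicator C z *\<^sub>R u0 z"
      unfolding AE_completion_iff using ae by eventually_elim (use C in \<open>auto simp: indicator_def\<close>)
    then have "integrable lebesgue (\<lambda>z. indicator C z *\<^sub>R u0 z)"
      by (subst integrable_cong_AE[symmetric]) (use i in \<open>auto intro: measurable_completion\<close>)
    then show ?thesis unfolding set_integrable_def by (subst (asm) integrable_completion) auto
  qed
  moreover have "\<forall>z. z \<notin> D \<longrightarrow> u0 z = 0" by (simp add: u0_def)
  ultimately show ?thesis using um ae by (intro exI[of _ u0] conjI allI impI) blast+
qed

lemma weak_derivative_borel:
  assumes D: "open D" and w: "weak_derivative D e f h"
    and fm [measurable]: "f0 \<in> borel_measurable borel" and f0: "\<And>z. z \<in> D \<Longrightarrow> f0 z = f z"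
    and hm [measurable]: "h0 \<in> borel_measurable borel" and h0: "AE z in lborel. z \<in> D \<longrightarrow> h z = h0 z"
  shows "weak_borel D e f0 h0"
  unfolding weak_borel_def
proof (intro allI impI)
  fix \<phi> assume \<phi>: "test_function D \<phi>"
  note [measurable] = borel_measurable_frechet[OF \<phi>]
  note out = test_function_outside[OF \<phi>]
  have "(LINT z|lborel. frechet_derivative \<phi> (at z) e *\<^sub>R f0 z) = (LINT z|lebesgue. frechet_derivative \<phi> (at z) e *\<^sub>R f0 z)"
    by (rule integral_completion[symmetric]) measurable
  also have "\<dots> = (LINT z:D|lebesgue. frechet_derivative \<phi> (at z) e *\<^sub>R f z)"
    unfolding set_lebesgue_integral_def
    by (intro arg_cong[where f="integral\<^sup>L lebesgue"] ext) (auto simp: indicator_def f0 out)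
  also have "\<dots> = - (LINT z:D|lebesgue. \<phi> z *\<^sub>R h z)" using w \<phi> by (simp add: weak_derivative_def)
  also have "(LINT z:D|lebesgue. \<phi> z *\<^sub>R h z) = (LINT z|lebesgue. \<phi> z *\<^sub>R h0 z)"
    unfolding set_lebesgue_integral_def
  proof (rule integral_cong_AE)
    have ae: "AE z in lebesgue. \<phi> z *\<^sub>R h0 z = indicator D z *\<^sub>R \<phi> z *\<^sub>R h z"
      unfolding AE_completion_iff using h0 by eventually_elim (auto simp: indicator_def out)
    show "(\<lambda>z. \<phi> z *\<^sub>R h0 z) \<in> borel_measurable lebesgue" by (rule measurable_completion) measurable
    then show "(\<lambda>z. indicator D z *\<^sub>R \<phi> z *\<^sub>R h z) \<in> borel_measurable lebesgue"
      using ae by (rule borel_measurable_AE)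
    show "AE z in lebesgue. indicator D z *\<^sub>R \<phi> z *\<^sub>R h z = \<phi> z *\<^sub>R h0 z" using ae by eventually_elim (rule sym)
  qed
  also have "\<dots> = (LINT z|lborel. \<phi> z *\<^sub>R h0 z)"
    by (rule integral_completion) measurable
  finally show "(LINT z|lborel. frechet_derivative \<phi> (at z) e *\<^sub>R f0 z) = - (LINT z|lborel. \<phi> z *\<^sub>R h0 z)" .
qed

lemma test_function_product:
  assumes A: "\<And>x. (A has_real_derivative A' x) (at x)" "continuous_on UNIV A'"
    and B: "\<And>y. (B has_real_derivative B' y) (at y)" "continuous_on UNIV B'"
    and sA: "\<And>x. A x \<noteq> 0 \<Longrightarrow> x \<in> {x1..x2}" and sB: "\<And>y. B y \<noteq> 0 \<Longrightarrow> y \<in> {y1..y2}"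
    and W: "cbox (Complex x1 y1) (Complex x2 y2) \<subseteq> W"
  shows "test_function W (\<lambda>z. A (Re z) * B (Im z))"
    and "frechet_derivative (\<lambda>z. A (Re z) * B (Im z)) (at z) = (\<lambda>h. A' (Re z) * Re h * B (Im z) + A (Re z) * (B' (Im z) * Im h))"
proof -
  have cA: "continuous_on UNIV A" "continuous_on UNIV B"
    by (rule DERIV_continuous_on, rule has_field_derivative_at_within, rule A B)+
  have d: "((\<lambda>z. A (Re z) * B (Im z)) has_derivative (\<lambda>h. A' (Re z) * Re h * B (Im z) + A (Re z) * (B' (Im z) * Im h))) (at z)" for z
  proof -
    have "((\<lambda>z. A (Re z)) has_derivative (\<lambda>h. A' (Re z) * Re h)) (at z)"
      using has_derivative_compose[OF _ A(1)[unfolded has_field_derivative_def], of Re Re z UNIV] by (simp add: has_derivative_Re)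
    moreover have "((\<lambda>z. B (Im z)) has_derivative (\<lambda>h. B' (Im z) * Im h)) (at z)"
      using has_derivative_compose[OF _ B(1)[unfolded has_field_derivative_def], of Im Im z UNIV] by (simp add: has_derivative_Im)
    ultimately have "((\<lambda>z. A (Re z) * B (Im z)) has_derivative
        (\<lambda>h. A (Re z) * (B' (Im z) * Im h) + A' (Re z) * Re h * B (Im z))) (at z)"
      by (rule has_derivative_mult)
    then show ?thesis by (simp only: add.commute)
  qed
  have c: "continuous_on UNIV (\<lambda>z. A' (Re z) * Re h * B (Im z) + A (Re z) * (B' (Im z) * Im h))" for h
    by (intro continuous_intros continuous_on_compose2[OF A(2)] continuous_on_compose2[OF B(2)]
        continuous_on_compose2[OF cA(1)] continuous_on_compose2[OF cA(2)]) auto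
  have 0: "A (Re z) * B (Im z) = 0" if "z \<notin> cbox (Complex x1 y1) (Complex x2 y2)" for z
    using that sA[of "Re z"] sB[of "Im z"] by (auto simp: mem_cbox_Complex)
  show "test_function W (\<lambda>z. A (Re z) * B (Im z))"
    by (rule test_functionI(1)[OF open_UNIV compact_cbox subset_UNIV W d c 0])
  show "frechet_derivative (\<lambda>z. A (Re z) * B (Im z)) (at z) = (\<lambda>h. A' (Re z) * Re h * B (Im z) + A (Re z) * (B' (Im z) * Im h))"
    by (rule test_functionI(2)[OF open_UNIV compact_cbox subset_UNIV W d c 0]) simp_all
qed

lemma weak_borel_imp_vertical:
  assumes "weak_borel D \<i> f h"
  shows "weak_vertical D f h"
  unfolding weak_vertical_def
proof (intro allI impI)
  fix A A' B B' x1 x2 y1 y2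
  assume *: "\<forall>x. (A has_real_derivative A' x) (at x)" "continuous_on UNIV A'"
    "\<forall>y. (B has_real_derivative B' y) (at y)" "continuous_on UNIV B'"
    "\<forall>x. A x \<noteq> 0 \<longrightarrow> x \<in> {x1..x2}" "\<forall>y. B y \<noteq> 0 \<longrightarrow> y \<in> {y1..y2}"
    "cbox (Complex x1 y1) (Complex x2 y2) \<subseteq> D"
  have t: "test_function D (\<lambda>z. A (Re z) * B (Im z))"
    by (rule test_function_product(1)[OF *(1)[rule_format] *(2) *(3)[rule_format] *(4) _ _ *(7)]) (use *(5,6) in blast)+
  have T2: "frechet_derivative (\<lambda>z. A (Re z) * B (Im z)) (at z) = (\<lambda>h. A' (Re z) * Re h * B (Im z) + A (Re z) * (B' (Im z) * Im h))" for z
    by (rule test_function_product(2)[OF *(1)[rule_format] *(2) *(3)[rule_format] *(4) _ _ *(7)]) (use *(5,6) in blast)+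
  have fr: "frechet_derivative (\<lambda>z. A (Re z) * B (Im z)) (at z) \<i> = A (Re z) * B' (Im z)" for z
    by (simp only: T2) simp
  from assms[unfolded weak_borel_def, rule_format, OF t]
  show "(LINT z|lborel. (A (Re z) * B' (Im z)) *\<^sub>R f z) = - (LINT z|lborel. (A (Re z) * B (Im z)) *\<^sub>R h z)"
    by (simp only: fr)
qed

lemma integral_swap:
  fixes f :: "complex \<Rightarrow> complex"
  assumes "f \<in> borel_measurable borel"
  shows "(LINT z|lborel. f (swap z)) = (LINT z|lborel. f z)"
proof -
  have "distr lborel borel swap = lborel" by (rule distr_lborel_eqI) (auto intro: nn_integral_swap)
  then have "(LINT z|lborel. f z) = (LINT z|distr lborel borel swap. f z)" by simp
  also have "\<dots> = (LINT z|lborel. f (swap z))" using assms by (subst integral_distr) auto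
  finally show ?thesis by simp
qed

lemma weak_borel_imp_horizontal:
  assumes w: "weak_borel D 1 f h" and fm [measurable]: "f \<in> borel_measurable borel" and hm [measurable]: "h \<in> borel_measurable borel"
  shows "weak_vertical (swap -` D) (f \<circ> swap) (h \<circ> swap)"
  unfolding weak_vertical_def
proof (intro allI impI)
  fix A A' B B' x1 x2 y1 y2
  assume *: "\<forall>x. (A has_real_derivative A' x) (at x)" "continuous_on UNIV A'"
    "\<forall>y. (B has_real_derivative B' y) (at y)" "continuous_on UNIV B'"
    "\<forall>x. A x \<noteq> 0 \<longrightarrow> x \<in> {x1..x2}" "\<forall>y. B y \<noteq> 0 \<longrightarrow> y \<in> {y1..y2}"
    "cbox (Complex x1 y1) (Complex x2 y2) \<subseteq> swap -` D"
  have D: "cbox (Complex y1 x1) (Complex y2 x2) \<subseteq> D"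
  proof
    fix z assume "z \<in> cbox (Complex y1 x1) (Complex y2 x2)"
    then have "swap z \<in> cbox (Complex x1 y1) (Complex x2 y2)" by (auto simp: mem_cbox_Complex)
    then have "swap z \<in> swap -` D" using *(7) by blast
    then show "z \<in> D" by simp
  qed
  have t: "test_function D (\<lambda>z. B (Re z) * A (Im z))"
    by (rule test_function_product(1)[OF *(3)[rule_format] *(4) *(1)[rule_format] *(2) _ _ D]) (use *(5,6) in blast)+
  have T2: "frechet_derivative (\<lambda>z. B (Re z) * A (Im z)) (at z) = (\<lambda>h. B' (Re z) * Re h * A (Im z) + B (Re z) * (A' (Im z) * Im h))" for z
    by (rule test_function_product(2)[OF *(3)[rule_format] *(4) *(1)[rule_format] *(2) _ _ D]) (use *(5,6) in blast)+
  have fr: "frechet_derivative (\<lambda>z. B (Re z) * A (Im z)) (at z) 1 = B' (Re z) * A (Im z)" for z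
    by (simp only: T2) simp
  note m1 = borel_measurable_frechet(1)[OF t, of 1, unfolded fr]
  note m2 = borel_measurable_frechet(2)[OF t]
  have "(LINT z|lborel. (A (Re z) * B' (Im z)) *\<^sub>R (f \<circ> swap) z) = (LINT z|lborel. (B' (Re (swap z)) * A (Im (swap z))) *\<^sub>R f (swap z))"
    by (simp add: mult.commute)
  also have "\<dots> = (LINT z|lborel. (B' (Re z) * A (Im z)) *\<^sub>R f z)"
    by (rule integral_swap) (intro borel_measurable_scaleR m1 fm)
  also have "\<dots> = - (LINT z|lborel. (B (Re z) * A (Im z)) *\<^sub>R h z)"
    using w[unfolded weak_borel_def, rule_format, OF t] by (simp only: fr)
  also have "(LINT z|lborel. (B (Re z) * A (Im z)) *\<^sub>R h z) = (LINT z|lborel. (B (Re (swap z)) * A (Im (swap z))) *\<^sub>R h (swap z))"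
    by (rule integral_swap[symmetric]) (intro borel_measurable_scaleR m2 hm)
  also have "\<dots> = (LINT z|lborel. (A (Re z) * B (Im z)) *\<^sub>R (h \<circ> swap) z)" by (simp add: mult.commute)
  finally show "(LINT z|lborel. (A (Re z) * B' (Im z)) *\<^sub>R (f \<circ> swap) z) = - (LINT z|lborel. (A (Re z) * B (Im z)) *\<^sub>R (h \<circ> swap) z)" .
qed

section \<open>The logarithmic chart of the slit plane\<close>

definition strip :: "complex set" where "strip = {w. -pi < Im w \<and> Im w < pi}"

lemma open_strip: "open strip"
proof -
  have "strip = Im -` {-pi<..<pi}" by (auto simp: strip_def)
  moreover have "open (Im -` {-pi<..<pi})" by (rule open_vimage) (simp, intro continuous_intros)
  ultimately show ?thesis by simp
qed

lemma Ln_exp_strip: "w \<in> strip \<Longrightarrow> Ln (exp w) = w"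
  by (simp add: strip_def)

lemma exp_strip_notin_nonpos: "w \<in> strip \<Longrightarrow> exp w \<notin> \<real>\<^sub>\<le>\<^sub>0"
proof
  assume w: "w \<in> strip" and "exp w \<in> \<real>\<^sub>\<le>\<^sub>0"
  then obtain x where x: "x \<le> 0" "exp w = of_real x" by (auto simp: nonpos_Reals_def)
  then have "x < 0" using exp_not_eq_zero[of w] by (cases "x = 0") auto
  then have "Im (Ln (exp w)) = pi" using x by (simp add: Im_Ln_eq_pi_half Im_Ln_eq_pi)
  then show False using w Ln_exp_strip[OF w] by (simp add: strip_def)
qed

lemma Ln_in_strip: "\<zeta> \<notin> \<real>\<^sub>\<le>\<^sub>0 \<Longrightarrow> Ln \<zeta> \<in> strip \<and> exp (Ln \<zeta>) = \<zeta>"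
proof -
  assume n: "\<zeta> \<notin> \<real>\<^sub>\<le>\<^sub>0"
  then have 0: "\<zeta> \<noteq> 0" by auto
  have "Im (Ln \<zeta>) \<noteq> pi" using n 0 Im_Ln_eq_pi[OF 0] by (auto simp: complex_nonpos_Reals_iff)
  then show ?thesis using mpi_less_Im_Ln[OF 0] Im_Ln_le_pi[OF 0] 0 by (auto simp: strip_def)
qed

text \<open>On the strip the inverse of the exponential is the principal branch \<open>Ln\<close>,
  so what is omitted is \<open>z0\<close> with the ray to its left. A vertical line of the strip
  becomes a circle about \<open>z0\<close> without its point on that ray.\<close>

lemma exp_strip_image:
  fixes z0 :: complex
  shows "(\<lambda>w. z0 + exp w) ` strip = {z. z - z0 \<notin> \<real>\<^sub>\<le>\<^sub>0}"
proof (intro antisym subsetI)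
  fix z assume "z \<in> {z. z - z0 \<notin> \<real>\<^sub>\<le>\<^sub>0}"
  then have "Ln (z - z0) \<in> strip" "z = z0 + exp (Ln (z - z0))" using Ln_in_strip[of "z - z0"] by auto
  then show "z \<in> (\<lambda>w. z0 + exp w) ` strip" by blast
qed (auto simp: exp_strip_notin_nonpos)

lemma inj_on_exp_strip:
  fixes z0 :: complex
  shows "inj_on (\<lambda>w. z0 + exp w) strip"
  by (rule inj_onI) (metis Ln_exp_strip add_left_cancel)

lemma has_derivative_shift_exp:
  fixes z0 w :: complex
  shows "((\<lambda>w. z0 + exp w) has_derivative (\<lambda>h. exp w * h)) (at w within S)"
proof -
  have "((\<lambda>w. z0 + exp w) has_field_derivative exp w) (at w within S)"
    by (auto intro!: derivative_eq_intros)
  then show ?thesis unfolding has_field_derivative_def .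
qed

lemma det2_mult: "det2 (\<lambda>h. c * h) = (norm c)\<^sup>2"
  unfolding cmod_power2 det2_def by (simp add: power2_eq_square)

lemma open_slit_plane:
  fixes z0 :: complex
  shows "open {z. z - z0 \<notin> \<real>\<^sub>\<le>\<^sub>0}"
proof -
  have "{z. z - z0 \<notin> \<real>\<^sub>\<le>\<^sub>0} = (\<lambda>z. z - z0) -` (- \<real>\<^sub>\<le>\<^sub>0)" by auto
  moreover have "open ((\<lambda>z. z - z0) -` (- \<real>\<^sub>\<le>\<^sub>0))"
    by (rule open_vimage, intro open_Compl closed_nonpos_Reals_complex) (intro continuous_intros)
  ultimately show ?thesis by simp
qed

text \<open>The derivative of \<open>exp\<close> is multiplication by \<open>exp w\<close>, with
  Jacobian \<open>(norm (exp w))\<^sup>2\<close>; as \<open>G\<close> vanishes on the slit, the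
  chart covers everything that contributes.\<close>

lemma integral_exp_strip:
  fixes G :: "complex \<Rightarrow> complex"
  assumes G [measurable]: "G \<in> borel_measurable borel" and 0: "\<And>z. z - z0 \<in> \<real>\<^sub>\<le>\<^sub>0 \<Longrightarrow> G z = 0"
  shows "(LINT z|lborel. G z) = (LINT w|lborel. indicator strip w *\<^sub>R (norm (exp w))\<^sup>2 *\<^sub>R G (z0 + exp w))"
proof -
  have [measurable]: "strip \<in> sets borel" by (rule borel_open[OF open_strip])
  have em: "(\<lambda>w. exp w) \<in> borel_measurable (borel :: complex measure)"
    by (intro borel_measurable_continuous_onI continuous_on_exp continuous_on_id)
  have [measurable]: "(\<lambda>w. G (z0 + exp w)) \<in> borel_measurable borel"
    by (rule measurable_compose[OF _ G]) (use em in measurable)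
  have "(LINT z|lborel. G z) = (LINT z|lebesgue. G z)" by (rule integral_completion[symmetric]) measurable
  also have "\<dots> = (LINT z:(\<lambda>w. z0 + exp w) ` strip|lebesgue. G z)"
    unfolding set_lebesgue_integral_def exp_strip_image
    by (intro arg_cong[where f="integral\<^sup>L lebesgue"] ext) (auto simp: indicator_def 0)
  also have "\<dots> = (LINT w:strip|lebesgue. \<bar>det2 (\<lambda>h. exp w * h)\<bar> *\<^sub>R G (z0 + exp w))"
    by (rule integral_differentiable_image[symmetric])
       (auto intro: has_derivative_shift_exp inj_on_exp_strip)
  also have "\<dots> = (LINT w|lebesgue. indicator strip w *\<^sub>R (norm (exp w))\<^sup>2 *\<^sub>R G (z0 + exp w))"
    by (simp add: set_lebesgue_integral_def det2_mult del: norm_exp_eq_Re)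
  also have "\<dots> = (LINT w|lborel. indicator strip w *\<^sub>R (norm (exp w))\<^sup>2 *\<^sub>R G (z0 + exp w))"
    by (rule integral_completion) (use em in measurable)
  finally show ?thesis .
qed

lemma integrable_continuous_mult:
  fixes h :: "complex \<Rightarrow> complex"
  assumes K: "compact K" and c: "continuous_on UNIV c" and 0: "\<And>z. z \<notin> K \<Longrightarrow> c z = (0::real)"
    and h: "set_integrable lborel K h" and hm [measurable]: "h \<in> borel_measurable borel"
  shows "integrable lborel (\<lambda>z. c z *\<^sub>R h z)"
proof -
  have "compact (c ` K)" using K c by (intro compact_continuous_image) (auto intro: continuous_on_subset)
  then obtain M where M: "\<And>z. z \<in> K \<Longrightarrow> norm (c z) \<le> M" by (meson bounded_iff compact_imp_bounded imageI)
  have [measurable]: "c \<in> borel_measurable borel" using c by (rule borel_measurable_continuous_onI)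
  show ?thesis
  proof (rule Bochner_Integration.integrable_bound[of _ "\<lambda>z. M *\<^sub>R indicator K z *\<^sub>R h z"])
    show "integrable lborel (\<lambda>z. M *\<^sub>R indicator K z *\<^sub>R h z)"
      using h unfolding set_integrable_def by (rule integrable_scaleR_right)
    show "AE z in lborel. norm (c z *\<^sub>R h z) \<le> norm (M *\<^sub>R indicator K z *\<^sub>R h z)"
    proof (rule AE_I2)
      fix z
      show "norm (c z *\<^sub>R h z) \<le> norm (M *\<^sub>R indicator K z *\<^sub>R h z)"
      proof (cases "z \<in> K")
        case True
        then have "\<bar>c z\<bar> \<le> \<bar>M\<bar>" using M[of z] by auto
        then show ?thesis using True by (simp add: mult_right_mono)
      qed (simp add: 0)
    qed
  qed measurable
qed

text \<open>The field \<open>\<i> / \<zeta>\<^sup>\<star>\<close> is the angular direction divided by the radius; it is divergence free,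
  so multiplying a test function by its components turns the two Cartesian weak derivatives into
  the angular one.\<close>
lemma angular_field_identities:
  fixes \<zeta> :: complex
  assumes "\<zeta> \<noteq> 0"
  shows "Re (1 / \<zeta>) * Re (\<i> / cnj \<zeta>) + Re (\<i> / \<zeta>) * Im (\<i> / cnj \<zeta>) = 0"
    and "Im (1 / \<zeta>) * Re (\<i> / cnj \<zeta>) + Im (\<i> / \<zeta>) * Im (\<i> / cnj \<zeta>) = 1 / (norm \<zeta>)\<^sup>2"
    and "Re (- \<i> * cnj 1 / (cnj \<zeta>)\<^sup>2) + Im (- \<i> * cnj \<i> / (cnj \<zeta>)\<^sup>2) = 0"
proof -
  define x y where "x = Re \<zeta>" and "y = Im \<zeta>"
  have \<zeta>: "\<zeta> = Complex x y" by (simp add: x_def y_def)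
  have n: "x\<^sup>2 + y\<^sup>2 \<noteq> 0" using assms unfolding \<zeta> by (simp add: sum_power2_eq_zero_iff complex_eq_iff)
  show "Re (1 / \<zeta>) * Re (\<i> / cnj \<zeta>) + Re (\<i> / \<zeta>) * Im (\<i> / cnj \<zeta>) = 0"
    unfolding \<zeta> by (simp add: Re_divide Im_divide)
  have "Im (1 / \<zeta>) * Re (\<i> / cnj \<zeta>) + Im (\<i> / \<zeta>) * Im (\<i> / cnj \<zeta>) = (y * y + x * x) / ((x\<^sup>2 + y\<^sup>2) * (x\<^sup>2 + y\<^sup>2))"
    unfolding \<zeta> by (simp add: Re_divide Im_divide add_divide_distrib)
  also have "\<dots> = 1 / (x\<^sup>2 + y\<^sup>2)" using n by (simp add: power2_eq_square add.commute)
  also have "\<dots> = 1 / (norm \<zeta>)\<^sup>2" unfolding cmod_power2 \<zeta> by simp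
  finally show "Im (1 / \<zeta>) * Re (\<i> / cnj \<zeta>) + Im (\<i> / \<zeta>) * Im (\<i> / cnj \<zeta>) = 1 / (norm \<zeta>)\<^sup>2" .
  define q where "q = 1 / (cnj \<zeta>)\<^sup>2"
  have "- \<i> * cnj 1 / (cnj \<zeta>)\<^sup>2 = - \<i> * q" "- \<i> * cnj \<i> / (cnj \<zeta>)\<^sup>2 = - q" by (auto simp: q_def)
  then show "Re (- \<i> * cnj 1 / (cnj \<zeta>)\<^sup>2) + Im (- \<i> * cnj \<i> / (cnj \<zeta>)\<^sup>2) = 0" by simp
qed

text \<open>\<open>l\<close> stands for \<open>Re\<close> and \<open>Im\<close>, which select the
  two components of the angular field.\<close>

lemma has_derivative_polar_factor:
  assumes A: "\<And>x. (A has_real_derivative A' x) (at x)" and B: "\<And>y. (B has_real_derivative B' y) (at y)"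
    and l: "bounded_linear l" and z: "z - z0 \<notin> \<real>\<^sub>\<le>\<^sub>0"
  shows "((\<lambda>z. A (Re (Ln (z - z0))) * B (Im (Ln (z - z0))) * l (\<i> / cnj (z - z0))) has_derivative
    (\<lambda>h. (A (Re (Ln (z - z0))) * (B' (Im (Ln (z - z0))) * Im (h / (z - z0)))
         + A' (Re (Ln (z - z0))) * Re (h / (z - z0)) * B (Im (Ln (z - z0)))) * l (\<i> / cnj (z - z0))
       + A (Re (Ln (z - z0))) * B (Im (Ln (z - z0))) * l (- \<i> * cnj h / (cnj (z - z0))\<^sup>2))) (at z)"
proof -
  have z0: "z - z0 \<noteq> 0" using z by auto
  have c0: "cnj (z - z0) \<noteq> 0" using z0 by simp
  have Ln: "((\<lambda>z. Ln (z - z0)) has_derivative (\<lambda>h. h / (z - z0))) (at z)"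
  proof -
    have "((\<lambda>z. Ln (z - z0)) has_field_derivative 1 / (z - z0)) (at z)"
      using z by (auto intro!: derivative_eq_intros simp: field_simps)
    moreover have "(*) (1 / (z - z0)) = (\<lambda>h. h / (z - z0))" by auto
    ultimately show ?thesis unfolding has_field_derivative_def by simp
  qed
  have a: "((\<lambda>z. A (Re (Ln (z - z0)))) has_derivative (\<lambda>h. A' (Re (Ln (z - z0))) * Re (h / (z - z0)))) (at z)"
    by (rule has_derivative_compose[OF has_derivative_Re[OF Ln] A[unfolded has_field_derivative_def]])
  have b: "((\<lambda>z. B (Im (Ln (z - z0)))) has_derivative (\<lambda>h. B' (Im (Ln (z - z0))) * Im (h / (z - z0)))) (at z)"
    by (rule has_derivative_compose[OF has_derivative_Im[OF Ln] B[unfolded has_field_derivative_def]])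
  have "((\<lambda>w. \<i> / w) has_field_derivative - \<i> / (cnj (z - z0))\<^sup>2) (at (cnj (z - z0)))"
    using c0 by (auto intro!: derivative_eq_intros simp: power2_eq_square)
  then have i: "((\<lambda>w. \<i> / w) has_derivative (\<lambda>h. - \<i> / (cnj (z - z0))\<^sup>2 * h)) (at (cnj (z - z0)))"
    by (simp only: has_field_derivative_def)
  have cn: "((\<lambda>z. cnj (z - z0)) has_derivative (\<lambda>h. cnj h)) (at z)"
    by (auto intro!: derivative_eq_intros)
  have "((\<lambda>z. l (\<i> / cnj (z - z0))) has_derivative (\<lambda>h. l (- \<i> / (cnj (z - z0))\<^sup>2 * cnj h))) (at z)"
    by (rule bounded_linear.has_derivative[OF l has_derivative_compose[OF cn i]])
  then have c: "((\<lambda>z. l (\<i> / cnj (z - z0))) has_derivative (\<lambda>h. l (- \<i> * cnj h / (cnj (z - z0))\<^sup>2))) (at z)"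
    by simp
  have "((\<lambda>z. A (Re (Ln (z - z0))) * B (Im (Ln (z - z0))) * l (\<i> / cnj (z - z0))) has_derivative
    (\<lambda>h. A (Re (Ln (z - z0))) * B (Im (Ln (z - z0))) * l (- \<i> * cnj h / (cnj (z - z0))\<^sup>2) +
      (A (Re (Ln (z - z0))) * (B' (Im (Ln (z - z0))) * Im (h / (z - z0))) + A' (Re (Ln (z - z0))) * Re (h / (z - z0)) * B (Im (Ln (z - z0)))) * l (\<i> / cnj (z - z0)))) (at z)"
    by (rule has_derivative_mult[OF has_derivative_mult[OF a b] c])
  then show ?thesis by (simp only: add.commute)
qed

text \<open>The two weak identities are tested with \<open>A(log r) * B(angle)\<close> times the
  components of the angular field, and added. The derivative of \<open>A\<close> drops out because
  the field is tangential to circles, the derivative of the field because it is divergence free.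
  There remains \<open>A * B'\<close> divided by the squared radius, and this factor is cancelled by
  the Jacobian of the chart.\<close>

lemma weak_vertical_log_polar:
  fixes f u v :: "complex \<Rightarrow> complex"
  assumes D: "open D" and fm [measurable]: "f \<in> borel_measurable borel" and cont: "continuous_on D f"
    and um [measurable]: "u \<in> borel_measurable borel" and vm [measurable]: "v \<in> borel_measurable borel"
    and ui: "\<And>C. compact C \<Longrightarrow> C \<subseteq> D \<Longrightarrow> set_integrable lborel C u"
    and vi: "\<And>C. compact C \<Longrightarrow> C \<subseteq> D \<Longrightarrow> set_integrable lborel C v"
    and wu: "weak_borel D 1 f u" and wv: "weak_borel D \<i> f v"
  shows "weak_vertical {w \<in> strip. z0 + exp w \<in> D} (\<lambda>w. f (z0 + exp w))
     (\<lambda>w. lin_of (u (z0 + exp w)) (v (z0 + exp w)) (\<i> * exp w))"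
  unfolding weak_vertical_def
proof (intro allI impI)
  let ?W = "{w \<in> strip. z0 + exp w \<in> D}"
  fix A A' B B' x1 x2 y1 y2
  assume A: "\<forall>x. (A has_real_derivative A' x) (at x)" "continuous_on UNIV A'"
    and B: "\<forall>y. (B has_real_derivative B' y) (at y)" "continuous_on UNIV B'"
    and sA: "\<forall>x. A x \<noteq> 0 \<longrightarrow> x \<in> {x1..x2}" and sB: "\<forall>y. B y \<noteq> 0 \<longrightarrow> y \<in> {y1..y2}"
    and Q: "cbox (Complex x1 y1) (Complex x2 y2) \<subseteq> ?W"
  let ?Q = "cbox (Complex x1 y1) (Complex x2 y2)"
  let ?S = "{z. z - z0 \<notin> \<real>\<^sub>\<le>\<^sub>0}"
  define K where "K = (\<lambda>w. z0 + exp w) ` ?Q"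
  have K: "compact K" unfolding K_def by (intro compact_continuous_image continuous_intros compact_cbox)
  have KS: "K \<subseteq> ?S" using Q exp_strip_image[of z0] unfolding K_def by blast
  have KD: "K \<subseteq> D" using Q unfolding K_def by blast
  have cA: "continuous_on UNIV A" "continuous_on UNIV B"
    by (rule DERIV_continuous_on, rule has_field_derivative_at_within, rule A(1)[rule_format] B(1)[rule_format])+
  define p where "p l z = A (Re (Ln (z - z0))) * B (Im (Ln (z - z0))) * l (\<i> / cnj (z - z0))" for l :: "complex \<Rightarrow> real" and z
  \<comment> \<open>\<open>Ln\<close> jumps across the slit. Off \<open>K\<close> the product
    \<open>p l\<close> already vanishes in the slit plane, so the cut to the compact set
    \<open>K\<close> changes nothing there and extends it by zero over the slit.\<close>
  define \<phi> where "\<phi> l z = (if z \<in> K then p l z else 0)" for l z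
  define \<phi>' where "\<phi>' l z h = (A (Re (Ln (z - z0))) * (B' (Im (Ln (z - z0))) * Im (h / (z - z0)))
         + A' (Re (Ln (z - z0))) * Re (h / (z - z0)) * B (Im (Ln (z - z0)))) * l (\<i> / cnj (z - z0))
       + A (Re (Ln (z - z0))) * B (Im (Ln (z - z0))) * l (- \<i> * cnj h / (cnj (z - z0))\<^sup>2)" for l :: "complex \<Rightarrow> real" and z h
  have AB0: "A (Re w) * B (Im w) = 0" if "w \<notin> ?Q" for w
    using that sA[rule_format, of "Re w"] sB[rule_format, of "Im w"] by (auto simp: mem_cbox_Complex)
  have \<phi>S: "\<phi> l z = p l z" if "z \<in> ?S" for l z
  proof (cases "z \<in> K")
    case False
    have "Ln (z - z0) \<notin> ?Q"
    proof
      assume "Ln (z - z0) \<in> ?Q"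
      then have "z0 + exp (Ln (z - z0)) \<in> K" unfolding K_def by blast
      then show False using False that Ln_in_strip[of "z - z0"] by simp
    qed
    then have "p l z = 0" using AB0 by (simp add: p_def)
    then show ?thesis using False by (simp add: \<phi>_def)
  qed (simp add: \<phi>_def)
  have d: "(\<phi> l has_derivative \<phi>' l z) (at z)" if l: "bounded_linear l" and z: "z \<in> ?S" for l z
  proof (rule has_derivative_transform_within_open[OF _ open_slit_plane z])
    show "(p l has_derivative \<phi>' l z) (at z)"
      unfolding p_def[abs_def] \<phi>'_def[abs_def]
      by (rule has_derivative_polar_factor[OF A(1)[rule_format] B(1)[rule_format] l]) (use z in simp)
    show "p l x = \<phi> l x" if "x \<in> ?S" for x using \<phi>S[OF that] by simp
  qed
  have c\<phi>: "continuous_on ?S (\<lambda>z. \<phi>' l z h)" if l: "bounded_linear l" for l h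
  proof -
    have cl: "continuous_on UNIV l" using l by (rule linear_continuous_on)
    have ne: "z - z0 \<noteq> 0" if "z \<in> ?S" for z using that by auto
    have Lnc: "continuous_on ?S (\<lambda>z. Ln (z - z0))" by (intro continuous_intros) auto
    have cm: "continuous_on ?S (\<lambda>z. k (Re (Ln (z - z0))))" "continuous_on ?S (\<lambda>z. k (Im (Ln (z - z0))))"
      if "continuous_on UNIV k" for k :: "real \<Rightarrow> real"
      by (rule continuous_on_compose2[OF that], intro continuous_intros Lnc, simp)+
    have l1: "continuous_on ?S (\<lambda>z. l (\<i> / cnj (z - z0)))"
      by (rule continuous_on_compose2[OF cl], intro continuous_intros) (use ne in auto)
    have l2: "continuous_on ?S (\<lambda>z. l (- \<i> * cnj h / (cnj (z - z0))\<^sup>2))"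
      by (rule continuous_on_compose2[OF cl], intro continuous_intros) (use ne in auto)
    have q: "continuous_on ?S (\<lambda>z. h / (z - z0))" by (intro continuous_intros) (use ne in auto)
    show ?thesis unfolding \<phi>'_def
      by (intro continuous_on_add continuous_on_mult continuous_on_Re continuous_on_Im l1 l2 q cm A B cA)
  qed
  have out: "\<phi> l z = 0" if "z \<notin> K" for l z using that by (simp add: \<phi>_def)
  note TI = test_functionI[OF open_slit_plane K KS KD, of "\<phi> l" "\<phi>' l" for l]
  have TF1: "test_function D (\<phi> l)" and TF3: "z \<notin> K \<Longrightarrow> frechet_derivative (\<phi> l) (at z) = (\<lambda>_. 0)"
    and TF2: "z \<in> ?S \<Longrightarrow> frechet_derivative (\<phi> l) (at z) = \<phi>' l z" and TF4: "continuous_on UNIV (\<phi> l)"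
    if l: "bounded_linear l" for l z
    by (rule TI; (rule d[OF l] c\<phi>[OF l] out)?; assumption?)+
  have bl: "bounded_linear Re" "bounded_linear Im" by (rule bounded_linear_Re bounded_linear_Im)+
  note tf = TF1[OF bl(1)] TF1[OF bl(2)]
  note fr = TF2[OF bl(1)] TF2[OF bl(2)]
  have fr0: "frechet_derivative (\<phi> Re) (at z) e = 0" "frechet_derivative (\<phi> Im) (at z) e = 0" if "z \<notin> K" for z e
    using TF3[OF bl(1) that] TF3[OF bl(2) that] by auto
  have frc: "continuous_on UNIV (\<lambda>z. frechet_derivative (\<phi> Re) (at z) e)" "continuous_on UNIV (\<lambda>z. frechet_derivative (\<phi> Im) (at z) e)" for e
    using tf by (auto simp: test_function_def)
  have \<phi>c: "continuous_on UNIV (\<phi> Re)" "continuous_on UNIV (\<phi> Im)" by (rule TF4[OF bl(1)], rule TF4[OF bl(2)])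
  note [measurable] = borel_measurable_frechet(1)[OF tf(1), of 1] borel_measurable_frechet(1)[OF tf(2), of \<i>]
    borel_measurable_frechet(2)[OF tf(1)] borel_measurable_frechet(2)[OF tf(2)]
  have fi: "set_integrable lborel K f"
    unfolding set_integrable_def using K continuous_on_subset[OF cont KD] by (rule borel_integrable_compact)
  have i1: "integrable lborel (\<lambda>z. frechet_derivative (\<phi> Re) (at z) 1 *\<^sub>R f z)"
    by (rule integrable_continuous_mult[OF K frc(1) fr0(1) fi fm])
  have i2: "integrable lborel (\<lambda>z. frechet_derivative (\<phi> Im) (at z) \<i> *\<^sub>R f z)"
    by (rule integrable_continuous_mult[OF K frc(2) fr0(2) fi fm])
  have i3: "integrable lborel (\<lambda>z. \<phi> Re z *\<^sub>R u z)"
    by (rule integrable_continuous_mult[OF K \<phi>c(1) out ui[OF K KD] um])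
  have i4: "integrable lborel (\<lambda>z. \<phi> Im z *\<^sub>R v z)"
    by (rule integrable_continuous_mult[OF K \<phi>c(2) out vi[OF K KD] vm])
  define H where "H z = frechet_derivative (\<phi> Re) (at z) 1 *\<^sub>R f z + frechet_derivative (\<phi> Im) (at z) \<i> *\<^sub>R f z" for z
  define M where "M z = \<phi> Re z *\<^sub>R u z + \<phi> Im z *\<^sub>R v z" for z
  have HM: "(LINT z|lborel. H z) = - (LINT z|lborel. M z)"
    unfolding H_def M_def
    using wu[unfolded weak_borel_def, rule_format, OF tf(1)] wv[unfolded weak_borel_def, rule_format, OF tf(2)]
    by (simp add: Bochner_Integration.integral_add[OF i1 i2] Bochner_Integration.integral_add[OF i3 i4])
  have Hm: "H \<in> borel_measurable borel" "M \<in> borel_measurable borel" unfolding H_def[abs_def] M_def[abs_def] by measurable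
  have zK: "z \<notin> K" if "z - z0 \<in> \<real>\<^sub>\<le>\<^sub>0" for z using that KS by blast
  have H0: "H z = 0" "M z = 0" if "z - z0 \<in> \<real>\<^sub>\<le>\<^sub>0" for z
    using zK[OF that] by (simp_all add: H_def M_def fr0 out)
  \<comment> \<open>The support condition concerns \<open>B\<close>; on the open complement of the
    interval \<open>B\<close> is constantly zero, and so is its derivative.\<close>
  have B'0: "B' y = 0" if "y \<notin> {y1..y2}" for y
  proof -
    have "(B has_real_derivative 0) (at y)"
    proof (rule has_field_derivative_transform_within_open[of "\<lambda>_. 0" 0 y "- {y1..y2}"])
      show "\<And>x. x \<in> - {y1..y2} \<Longrightarrow> 0 = B x" using sB by force
    qed (use that in auto)
    then show ?thesis using B(1) DERIV_unique by blast
  qed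
  have inS: "w \<in> strip" if "A (Re w) * B' (Im w) \<noteq> 0" for w
  proof -
    have "w \<in> ?Q" using that sA[rule_format, of "Re w"] B'0[of "Im w"] by (auto simp: mem_cbox_Complex)
    then show ?thesis using Q by blast
  qed
  have inS2: "w \<in> strip" if "A (Re w) * B (Im w) \<noteq> 0" for w
    using AB0[of w] that Q by blast
  \<comment> \<open>This sorts the divergence into three terms: the field against the radial
    derivative, the field against the angular derivative, and the divergence of the field
    itself.\<close>
  have alg: "((a * (b' * q1) + a' * p1 * b) * r1 + a * b * s1) + ((a * (b' * q2) + a' * p2 * b) * r2 + a * b * s2)
     = a' * b * (p1 * r1 + p2 * r2) + a * b' * (q1 * r1 + q2 * r2) + a * b * (s1 + s2)"
    for a a' b b' p1 p2 q1 q2 r1 r2 s1 s2 :: real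
    by (simp only: algebra_simps)
  have Hw: "indicator strip w *\<^sub>R (norm (exp w))\<^sup>2 *\<^sub>R H (z0 + exp w) = (A (Re w) * B' (Im w)) *\<^sub>R f (z0 + exp w)" for w
  proof (cases "w \<in> strip")
    case True
    let ?\<zeta> = "exp w"
    have zS: "z0 + exp w \<in> ?S" using exp_strip_notin_nonpos[OF True] by simp
    have n0: "norm ?\<zeta> \<noteq> 0" by simp
    have "\<phi>' Re (z0 + exp w) 1 + \<phi>' Im (z0 + exp w) \<i> =
       A' (Re w) * B (Im w) * (Re (1 / ?\<zeta>) * Re (\<i> / cnj ?\<zeta>) + Re (\<i> / ?\<zeta>) * Im (\<i> / cnj ?\<zeta>))
       + A (Re w) * B' (Im w) * (Im (1 / ?\<zeta>) * Re (\<i> / cnj ?\<zeta>) + Im (\<i> / ?\<zeta>) * Im (\<i> / cnj ?\<zeta>))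
       + A (Re w) * B (Im w) * (Re (- \<i> * cnj 1 / (cnj ?\<zeta>)\<^sup>2) + Im (- \<i> * cnj \<i> / (cnj ?\<zeta>)\<^sup>2))"
      unfolding \<phi>'_def add_diff_cancel_left' Ln_exp_strip[OF True] by (rule alg)
    also have "\<dots> = A (Re w) * B' (Im w) * (1 / (norm ?\<zeta>)\<^sup>2)"
      by (simp only: angular_field_identities[OF exp_not_eq_zero] mult_zero_right add_0_left add_0_right)
    finally have e: "(norm ?\<zeta>)\<^sup>2 * (\<phi>' Re (z0 + exp w) 1 + \<phi>' Im (z0 + exp w) \<i>) = A (Re w) * B' (Im w)"
      using n0 by (simp del: norm_exp_eq_Re)
    have "H (z0 + exp w) = (\<phi>' Re (z0 + exp w) 1 + \<phi>' Im (z0 + exp w) \<i>) *\<^sub>R f (z0 + exp w)"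
      unfolding H_def fr(1)[OF zS] fr(2)[OF zS] by (simp only: scaleR_left_distrib)
    then show ?thesis using True e by (simp only: indicator_simps scaleR_one scaleR_scaleR mult_1)
  next
    case False
    then have "A (Re w) * B' (Im w) = 0" using inS[of w] by blast
    then show ?thesis using False by simp
  qed
  \<comment> \<open>The field \<open>\<i> / cnj q\<close>, weighted with the Jacobian, is
    \<open>\<i> * q\<close>, the velocity of the vertical line in the chart. This is how the
    direction \<open>\<i> * exp w\<close> arises.\<close>
  have X0: "of_real ((norm q)\<^sup>2) * (\<i> / cnj q) = \<i> * q" if "q \<noteq> 0" for q :: complex
    unfolding complex_norm_square using that by simp
  have alg2: "n *\<^sub>R (c *\<^sub>R (r *\<^sub>R U + i *\<^sub>R V)) = c *\<^sub>R ((n * r) *\<^sub>R U + (n * i) *\<^sub>R V)"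
    for n c r i and U V :: complex by (simp add: algebra_simps)
  have rR: "Re (of_real r * z) = r * Re z" and rI: "Im (of_real r * z) = r * Im z" for r z by simp_all
  have Mw: "indicator strip w *\<^sub>R (norm (exp w))\<^sup>2 *\<^sub>R M (z0 + exp w)
      = (A (Re w) * B (Im w)) *\<^sub>R lin_of (u (z0 + exp w)) (v (z0 + exp w)) (\<i> * exp w)" for w
  proof (cases "w \<in> strip")
    case True
    let ?\<zeta> = "exp w"
    have zS: "z0 + exp w \<in> ?S" using exp_strip_notin_nonpos[OF True] by simp
    have X: "of_real ((norm ?\<zeta>)\<^sup>2) * (\<i> / cnj ?\<zeta>) = \<i> * ?\<zeta>"
      by (rule X0) (rule exp_not_eq_zero)
    have X1: "(norm ?\<zeta>)\<^sup>2 * Re (\<i> / cnj ?\<zeta>) = Re (\<i> * ?\<zeta>)" unfolding X[symmetric] by (rule rR[symmetric])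
    have X2: "(norm ?\<zeta>)\<^sup>2 * Im (\<i> / cnj ?\<zeta>) = Im (\<i> * ?\<zeta>)" unfolding X[symmetric] by (rule rI[symmetric])
    have ps: "p l (z0 + exp w) = A (Re w) * B (Im w) * l (\<i> / cnj ?\<zeta>)" for l
      unfolding p_def add_diff_cancel_left' Ln_exp_strip[OF True] by (rule refl)
    have M: "M (z0 + exp w) = (A (Re w) * B (Im w)) *\<^sub>R (Re (\<i> / cnj ?\<zeta>) *\<^sub>R u (z0 + exp w) + Im (\<i> / cnj ?\<zeta>) *\<^sub>R v (z0 + exp w))"
      unfolding M_def \<phi>S[OF zS] ps by (simp only: scaleR_right_distrib scaleR_scaleR)
    have "(norm ?\<zeta>)\<^sup>2 *\<^sub>R M (z0 + exp w) = (A (Re w) * B (Im w)) *\<^sub>R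
        (((norm ?\<zeta>)\<^sup>2 * Re (\<i> / cnj ?\<zeta>)) *\<^sub>R u (z0 + exp w) + ((norm ?\<zeta>)\<^sup>2 * Im (\<i> / cnj ?\<zeta>)) *\<^sub>R v (z0 + exp w))"
      unfolding M by (rule alg2)
    then show ?thesis using True unfolding X1 X2 by (simp only: indicator_simps scaleR_one lin_of_def)
  next
    case False
    then have "A (Re w) * B (Im w) = 0" using inS2[of w] by blast
    then show ?thesis using False by simp
  qed
  show "(LINT w|lborel. (A (Re w) * B' (Im w)) *\<^sub>R f (z0 + exp w))
     = - (LINT w|lborel. (A (Re w) * B (Im w)) *\<^sub>R lin_of (u (z0 + exp w)) (v (z0 + exp w)) (\<i> * exp w))"
    using HM integral_exp_strip[OF Hm(1) H0(1)] integral_exp_strip[OF Hm(2) H0(2)] by (simp only: Hw Mw)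
qed

lemma borel_measurable_shift_exp [measurable]: "(\<lambda>w. z0 + exp w) \<in> borel_measurable (borel :: complex measure)"
  by (intro borel_measurable_continuous_onI continuous_intros)

text \<open>On a compact set \<open>Re w\<close> is bounded below by some \<open>- c\<close>, so the
  Jacobian is at least \<open>exp (- 2 * c)\<close>. Inserting it at the cost of a constant turns
  the integral into one over the compact image.\<close>

lemma set_integrable_log_polar:
  fixes u :: "complex \<Rightarrow> complex"
  assumes um [measurable]: "u \<in> borel_measurable borel"
    and ui: "\<And>C. compact C \<Longrightarrow> C \<subseteq> D \<Longrightarrow> set_integrable lborel C u"
    and C: "compact C" "C \<subseteq> {w \<in> strip. z0 + exp w \<in> D}"
  shows "set_integrable lborel C (\<lambda>w. u (z0 + exp w))"
proof -
  let ?\<Phi> = "\<lambda>w. z0 + exp w"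
  have Cb [measurable]: "C \<in> sets borel" using C(1) by (rule borel_compact)
  have u\<Phi> [measurable]: "(\<lambda>w. u (?\<Phi> w)) \<in> borel_measurable borel"
    by (rule measurable_compose[OF borel_measurable_shift_exp um])
  have "compact (Re ` C)" using C(1) by (intro compact_continuous_image continuous_intros)
  then obtain c where c: "\<And>w. w \<in> C \<Longrightarrow> - c \<le> Re w"
    using compact_imp_bounded bounded_iff by (metis abs_le_iff imageI minus_le_iff real_norm_def)
  have \<Phi>C: "compact (?\<Phi> ` C)" "?\<Phi> ` C \<subseteq> D"
    using C by (auto intro!: compact_continuous_image continuous_intros)
  have \<Phi>Cb [measurable]: "?\<Phi> ` C \<in> sets borel" using \<Phi>C(1) by (rule borel_compact)
  have "(\<integral>\<^sup>+w\<in>C. ennreal (norm (u (?\<Phi> w))) \<partial>lborel)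
     \<le> (\<integral>\<^sup>+w. ennreal (exp (2 * c)) * (ennreal (norm (u (?\<Phi> w))) * ennreal \<bar>det2 (\<lambda>h. exp w * h)\<bar> * indicator C w) \<partial>lborel)"
  proof (rule nn_integral_mono)
    fix w
    show "ennreal (norm (u (?\<Phi> w))) * indicator C w
      \<le> ennreal (exp (2 * c)) * (ennreal (norm (u (?\<Phi> w))) * ennreal \<bar>det2 (\<lambda>h. exp w * h)\<bar> * indicator C w)"
    proof (cases "w \<in> C")
      case True
      have "exp (2 * c) * \<bar>det2 (\<lambda>h. exp w * h)\<bar> = exp (2 * c + 2 * Re w)"
        by (simp add: det2_mult exp_add power2_eq_square exp_double)
      then have "1 \<le> exp (2 * c) * \<bar>det2 (\<lambda>h. exp w * h)\<bar>" using c[OF True] by simp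
      then have "norm (u (?\<Phi> w)) * 1 \<le> norm (u (?\<Phi> w)) * (exp (2 * c) * \<bar>det2 (\<lambda>h. exp w * h)\<bar>)"
        by (rule mult_left_mono) simp
      then have "ennreal (norm (u (?\<Phi> w))) \<le> ennreal (exp (2 * c) * (norm (u (?\<Phi> w)) * \<bar>det2 (\<lambda>h. exp w * h)\<bar>))"
        by (intro ennreal_leI) (simp add: mult_ac)
      then show ?thesis using True by (simp add: ennreal_mult)
    qed simp
  qed
  also have "\<dots> = ennreal (exp (2 * c)) * (\<integral>\<^sup>+w\<in>C. ennreal (norm (u (?\<Phi> w))) * ennreal \<bar>det2 (\<lambda>h. exp w * h)\<bar> \<partial>lborel)"
  proof (rule nn_integral_cmult)
    have "(\<lambda>w. ennreal (norm (u (?\<Phi> w))) * ennreal ((norm (exp w))\<^sup>2) * indicator C w) \<in> borel_measurable borel"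
      using borel_measurable_shift_exp[of 0] by measurable
    then show "(\<lambda>w. ennreal (norm (u (?\<Phi> w))) * ennreal \<bar>det2 (\<lambda>h. exp w * h)\<bar> * indicator C w) \<in> borel_measurable lborel"
      by (simp add: det2_mult del: norm_exp_eq_Re)
  qed
  finally have le: "(\<integral>\<^sup>+w\<in>C. ennreal (norm (u (?\<Phi> w))) \<partial>lborel) \<le> ennreal (exp (2 * c)) *
     (\<integral>\<^sup>+w\<in>C. ennreal (norm (u (?\<Phi> w))) * ennreal \<bar>det2 (\<lambda>h. exp w * h)\<bar> \<partial>lborel)" .
  have "(\<integral>\<^sup>+w\<in>C. ennreal (norm (u (?\<Phi> w))) * ennreal \<bar>det2 (\<lambda>h. exp w * h)\<bar> \<partial>lborel)
     = (\<integral>\<^sup>+w\<in>C. ennreal (norm (u (?\<Phi> w))) * ennreal \<bar>det2 (\<lambda>h. exp w * h)\<bar> \<partial>lebesgue)"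
    by (rule nn_integral_completion[symmetric])
  also have "\<dots> = (\<integral>\<^sup>+z\<in>?\<Phi> ` C. ennreal (norm (u z)) \<partial>lebesgue)"
  proof (rule nn_integral_differentiable_image(1))
    show "inj_on ?\<Phi> C" using inj_on_exp_strip[of z0] C by (auto intro: inj_on_subset)
  qed (auto intro: has_derivative_shift_exp)
  also have "\<dots> = (\<integral>\<^sup>+z. ennreal (norm (indicator (?\<Phi> ` C) z *\<^sub>R u z)) \<partial>lborel)"
    unfolding nn_integral_completion by (intro nn_integral_cong) (auto simp: indicator_def)
  also have "\<dots> < \<infinity>"
    using ui[OF \<Phi>C] unfolding set_integrable_def by (simp add: integrable_iff_bounded)
  finally have "ennreal (exp (2 * c)) * (\<integral>\<^sup>+w\<in>C. ennreal (norm (u (?\<Phi> w))) * ennreal \<bar>det2 (\<lambda>h. exp w * h)\<bar> \<partial>lborel) < \<infinity>"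
    by (simp add: ennreal_mult_less_top)
  with le have fin: "(\<integral>\<^sup>+w\<in>C. ennreal (norm (u (?\<Phi> w))) \<partial>lborel) < \<infinity>"
    by (rule le_less_trans)
  have "(\<integral>\<^sup>+w. ennreal (norm (indicator C w *\<^sub>R u (?\<Phi> w))) \<partial>lborel) = (\<integral>\<^sup>+w\<in>C. ennreal (norm (u (?\<Phi> w))) \<partial>lborel)"
    by (intro nn_integral_cong) (auto simp: indicator_def)
  then show ?thesis unfolding set_integrable_def integrable_iff_bounded using fin by simp
qed

text \<open>Arcs are parametrised by angles in \<open>(-\<pi>, \<pi>)\<close>, so that they avoid the branch cut of the
  logarithm; the point this omits on each circle carries no length.\<close>
definition ACL_circle ::
    "complex set \<Rightarrow> (complex \<Rightarrow> complex) \<Rightarrow> (complex \<Rightarrow> ennreal) \<Rightarrow> complex \<Rightarrow> real \<Rightarrow> bool" where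
  "ACL_circle \<Omega> F g z0 r \<longleftrightarrow> (\<forall>a b. a \<le> b \<longrightarrow> (\<forall>t\<in>{a..b}. -pi < t \<and> t < pi \<and> z0 + of_real r * cis t \<in> \<Omega>) \<longrightarrow>
     ennreal (dist (F (z0 + of_real r * cis a)) (F (z0 + of_real r * cis b)))
       \<le> (\<integral>\<^sup>+t\<in>{a..b}. g (z0 + of_real r * cis t) * ennreal r \<partial>lborel) \<and>
     (\<integral>\<^sup>+t\<in>{a..b}. g (z0 + of_real r * cis t) * ennreal r \<partial>lborel) < \<infinity>)"

text \<open>The length distortion of a map with partial derivatives \<open>u, v\<close> along circles about \<open>z0\<close>.\<close>
definition tangential :: "(complex \<Rightarrow> complex) \<Rightarrow> (complex \<Rightarrow> complex) \<Rightarrow> complex \<Rightarrow> complex \<Rightarrow> ennreal" where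
  "tangential u v z0 z = ennreal (norm (lin_of (u z) (v z) (\<i> * sgn (z - z0))))"

lemma sgn_exp_cis: "sgn (of_real (exp s) * cis t) = cis t"
  by (simp add: sgn_mult sgn_of_real)

text \<open>The circle of radius \<open>exp s\<close> is the vertical line over \<open>s\<close> in
  the logarithmic chart, so the statement for almost every line is the statement for almost every
  \<open>s\<close>.\<close>

theorem circle_ACL:
  fixes f u v :: "complex \<Rightarrow> complex"
  assumes D: "open D" and fm [measurable]: "f \<in> borel_measurable borel" and cont: "continuous_on D f"
    and um [measurable]: "u \<in> borel_measurable borel" and vm [measurable]: "v \<in> borel_measurable borel"
    and ui: "\<And>C. compact C \<Longrightarrow> C \<subseteq> D \<Longrightarrow> set_integrable lborel C u"
    and vi: "\<And>C. compact C \<Longrightarrow> C \<subseteq> D \<Longrightarrow> set_integrable lborel C v"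
    and wu: "weak_borel D 1 f u" and wv: "weak_borel D \<i> f v"
  shows "AE s in lborel. ACL_circle D f (tangential u v z0) z0 (exp s)"
proof -
  let ?\<Phi> = "\<lambda>w. z0 + exp w"
  let ?W = "{w \<in> strip. ?\<Phi> w \<in> D}"
  define g where "g w = f (?\<Phi> w)" for w
  define h where "h w = lin_of (u (?\<Phi> w)) (v (?\<Phi> w)) (\<i> * exp w)" for w
  have W: "open ?W"
  proof -
    have "?W = strip \<inter> ?\<Phi> -` D" by auto
    moreover have "open (?\<Phi> -` D)" by (rule open_vimage[OF D]) (intro continuous_intros)
    ultimately show ?thesis using open_strip by (simp add: open_Int)
  qed
  have gm: "g \<in> borel_measurable borel"
    unfolding g_def[abs_def] by (rule measurable_compose[OF borel_measurable_shift_exp fm])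
  have [measurable]: "(\<lambda>w. u (?\<Phi> w)) \<in> borel_measurable borel" "(\<lambda>w. v (?\<Phi> w)) \<in> borel_measurable borel"
    by (rule measurable_compose[OF borel_measurable_shift_exp um], rule measurable_compose[OF borel_measurable_shift_exp vm])
  have e1: "continuous_on UNIV (\<lambda>w. Re (\<i> * exp w))" "continuous_on UNIV (\<lambda>w. Im (\<i> * exp w))"
    by (intro continuous_intros)+
  note [measurable] = borel_measurable_continuous_onI[OF e1(1)] borel_measurable_continuous_onI[OF e1(2)]
  have hm: "h \<in> borel_measurable borel"
    unfolding h_def[abs_def] lin_of_def by measurable
  have gc: "continuous_on ?W g"
    unfolding g_def[abs_def] by (rule continuous_on_compose2[OF cont]) (intro continuous_intros, auto)
  have hi: "set_integrable lborel C h" if C: "compact C" "C \<subseteq> ?W" for C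
  proof -
    have Cb [measurable]: "C \<in> sets borel" using C(1) by (rule borel_compact)
    have iu: "set_integrable lborel C (\<lambda>w. u (?\<Phi> w))" by (rule set_integrable_log_polar[OF um ui C])
    have iv: "set_integrable lborel C (\<lambda>w. v (?\<Phi> w))" by (rule set_integrable_log_polar[OF vm vi C])
    have "set_integrable lborel C (\<lambda>w. k w *\<^sub>R q w)"
      if k: "continuous_on UNIV k" and q: "set_integrable lborel C q" and qm [measurable]: "q \<in> borel_measurable borel"
      for k :: "complex \<Rightarrow> real" and q :: "complex \<Rightarrow> complex"
    proof -
      have "compact (k ` C)" using C(1) k by (intro compact_continuous_image) (auto intro: continuous_on_subset)
      then obtain M where M: "\<And>z. z \<in> C \<Longrightarrow> norm (k z) \<le> M" by (meson bounded_iff compact_imp_bounded imageI)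
      have [measurable]: "k \<in> borel_measurable borel" using k by (rule borel_measurable_continuous_onI)
      show ?thesis unfolding set_integrable_def
      proof (rule Bochner_Integration.integrable_bound[of _ "\<lambda>z. M *\<^sub>R indicator C z *\<^sub>R q z"])
        show "integrable lborel (\<lambda>z. M *\<^sub>R indicator C z *\<^sub>R q z)"
          using q unfolding set_integrable_def by (rule integrable_scaleR_right)
        show "AE z in lborel. norm (indicator C z *\<^sub>R k z *\<^sub>R q z) \<le> norm (M *\<^sub>R indicator C z *\<^sub>R q z)"
        proof (rule AE_I2)
          fix z
          show "norm (indicator C z *\<^sub>R k z *\<^sub>R q z) \<le> norm (M *\<^sub>R indicator C z *\<^sub>R q z)"
          proof (cases "z \<in> C")
            case True
            then have "\<bar>k z\<bar> \<le> \<bar>M\<bar>" using M[of z] by auto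
            then show ?thesis using True by (simp add: mult_right_mono)
          qed simp
        qed
      qed measurable
    qed
    from this[OF e1(1) iu] this[OF e1(2) iv] show ?thesis
      unfolding h_def[abs_def] lin_of_def by (intro set_integral_add) simp_all
  qed
  have wvert: "weak_vertical ?W g h"
    unfolding g_def[abs_def] h_def[abs_def] by (rule weak_vertical_log_polar[OF D fm cont um vm ui vi wu wv])
  have "AE s in lborel. \<forall>a b. a \<le> b \<longrightarrow> (\<forall>t\<in>{a..b}. Complex s t \<in> ?W) \<longrightarrow>
     set_integrable lborel {a..b} (\<lambda>y. h (Complex s y)) \<and>
     g (Complex s b) - g (Complex s a) = (LINT y:{a..b}|lborel. h (Complex s y))"
    by (rule weak_vertical_ACL[OF W wvert gm hm gc]) (rule hi)
  then have "AE s in lborel. ACL_vertical ?W g h s" by (simp only: ACL_vertical_def)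
  then show ?thesis
  proof eventually_elim
    case (elim s)
    have ex: "exp (Complex s t) = of_real (exp s) * cis t" for t by (simp add: exp_eq_polar)
    \<comment> \<open>\<open>\<i> * exp w\<close> is the radius \<open>exp s\<close> times the unit
      tangent; the factor pulled out here completes \<open>dt\<close> to the length element of the
      circle.\<close>
    have hn: "ennreal (norm (h (Complex s t))) = tangential u v z0 (z0 + of_real (exp s) * cis t) * ennreal (exp s)" for t
    proof -
      have l: "lin_of a b (\<i> * (of_real r * c)) = r *\<^sub>R lin_of a b (\<i> * c)" for a b c and r :: real
        by (simp add: lin_of_def algebra_simps)
      have "norm (h (Complex s t)) = norm (lin_of (u (z0 + of_real (exp s) * cis t)) (v (z0 + of_real (exp s) * cis t)) (\<i> * cis t)) * exp s"
        unfolding h_def ex l by simp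
      then show ?thesis by (simp add: ennreal_mult tangential_def sgn_exp_cis)
    qed
    show ?case
      unfolding ACL_circle_def
    proof (intro allI impI)
      fix a b :: real assume ab: "a \<le> b" and seg: "\<forall>t\<in>{a..b}. -pi < t \<and> t < pi \<and> z0 + of_real (exp s) * cis t \<in> D"
      have inW: "Complex s t \<in> ?W" if "t \<in> {a..b}" for t
        using seg that by (auto simp: strip_def ex)
      have 1: "ennreal (norm (g (Complex s b) - g (Complex s a) - (b - a) *\<^sub>R 0)) \<le> (\<integral>\<^sup>+y\<in>{a..b}. ennreal (norm (h (Complex s y) - 0)) \<partial>lborel)"
        by (rule ACL_vertical_increment(1)[OF elim ab inW])
      have 2: "set_integrable lborel {a..b} (\<lambda>y. h (Complex s y))"
        by (rule ACL_vertical_increment(2)[OF elim ab inW])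
      have "(\<integral>\<^sup>+y\<in>{a..b}. ennreal (norm (h (Complex s y))) \<partial>lborel) = (\<integral>\<^sup>+y. ennreal (norm (indicator {a..b} y *\<^sub>R h (Complex s y))) \<partial>lborel)"
        by (intro nn_integral_cong) (auto simp: indicator_def)
      also have "\<dots> < \<infinity>" using 2 unfolding set_integrable_def by (simp add: integrable_iff_bounded)
      finally have 3: "(\<integral>\<^sup>+y\<in>{a..b}. ennreal (norm (h (Complex s y))) \<partial>lborel) < \<infinity>" .
      show "ennreal (dist (f (z0 + of_real (exp s) * cis a)) (f (z0 + of_real (exp s) * cis b)))
       \<le> (\<integral>\<^sup>+t\<in>{a..b}. tangential u v z0 (z0 + of_real (exp s) * cis t) * ennreal (exp s) \<partial>lborel) \<and>
     (\<integral>\<^sup>+t\<in>{a..b}. tangential u v z0 (z0 + of_real (exp s) * cis t) * ennreal (exp s) \<partial>lborel) < \<infinity>"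
        using 1 3 unfolding hn[symmetric] by (simp add: g_def ex dist_norm norm_minus_commute)
    qed
  qed
qed

section \<open>The modulus of circle families\<close>

lemma emeasure_hausdorff1_singleton: "emeasure hausdorff1 {p} = 0"
proof -
  have "hausdorff1_outer {p} \<le> 0"
  proof (rule hausdorff1_outer_leI)
    fix \<delta> :: real assume "0 < \<delta>"
    then show "hausdorff1_pre \<delta> {p} \<le> 0"
      using hausdorff1_pre_le[of "{p}" "\<lambda>_. {p}" \<delta>] by simp
  qed
  moreover have "{p} \<in> sets hausdorff1" by (rule borel_imp_hausdorff1) simp
  ultimately show ?thesis by (simp add: emeasure_hausdorff1)
qed

lemma emeasure_count_space_singleton_le:
  assumes "inj_on \<gamma> A"
  shows "emeasure (count_space UNIV) {t \<in> A. \<gamma> t = w} = indicator (\<gamma> ` A) w"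
proof (cases "w \<in> \<gamma> ` A")
  case True
  then obtain t where t: "t \<in> A" "\<gamma> t = w" by blast
  then have "{t \<in> A. \<gamma> t = w} = {t}" using assms by (auto simp: inj_on_def)
  then show ?thesis using True by simp
next
  case False
  then have e: "{t \<in> A. \<gamma> t = w} = {}" by blast
  show ?thesis unfolding e using False by simp
qed

lemma length_integral_inj:
  assumes inj: "inj_on k A" and \<gamma>: "\<And>t. t \<in> A \<Longrightarrow> \<gamma> t = Some (k t)"
  shows "length_integral (A, \<gamma>) \<rho> = (\<integral>\<^sup>+w\<in>k ` A. \<rho> w \<partial>hausdorff1)"
proof -
  have "{t \<in> A. \<gamma> t = Some w} = {t \<in> A. k t = w}" for w using \<gamma> by auto
  then show ?thesis by (simp add: length_integral_def emeasure_count_space_singleton_le[OF inj])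
qed

lemma length_integral_circle_in:
  assumes r: "0 < r" and \<Omega>: "\<And>z. Some z \<in> D \<longleftrightarrow> z \<in> \<Omega>"
  shows "length_integral (circle_in D z0 r) \<rho> = (\<integral>\<^sup>+w\<in>\<Omega> \<inter> sphere z0 r. \<rho> w \<partial>hausdorff1)"
proof -
  let ?A = "{t \<in> sphere 0 1. Some (z0 + of_real r * t) \<in> D}"
  have inj: "inj_on (\<lambda>t. z0 + of_real r * t) ?A" using r by (auto simp: inj_on_def)
  have im: "(\<lambda>t. z0 + of_real r * t) ` ?A = \<Omega> \<inter> sphere z0 r"
  proof (intro antisym subsetI)
    fix w assume w: "w \<in> \<Omega> \<inter> sphere z0 r"
    let ?t = "(w - z0) / of_real r"
    have "w = z0 + of_real r * ?t" using r by simp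
    moreover have "?t \<in> sphere 0 1" using w r by (simp add: norm_divide dist_norm norm_minus_commute)
    ultimately show "w \<in> (\<lambda>t. z0 + of_real r * t) ` ?A" using w \<Omega> by (intro image_eqI[of _ _ ?t]) auto
  qed (use r \<Omega> in \<open>auto simp: dist_norm norm_mult\<close>)
  show ?thesis unfolding circle_in_def by (subst length_integral_inj[OF inj], rule refl, simp only: im)
qed

lemma length_integral_image_circle_in:
  assumes r: "0 < r" and \<Omega>: "\<And>z. Some z \<in> D \<longleftrightarrow> z \<in> \<Omega>" and inj: "inj_on F \<Omega>"
    and f: "\<And>z. z \<in> \<Omega> \<Longrightarrow> f (Some z) = Some (F z)"
  shows "length_integral (dashed_image f (circle_in D z0 r)) \<rho> = (\<integral>\<^sup>+w\<in>F ` (\<Omega> \<inter> sphere z0 r). \<rho> w \<partial>hausdorff1)"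
proof -
  let ?A = "{t \<in> sphere 0 1. Some (z0 + of_real r * t) \<in> D}"
  have inj': "inj_on (\<lambda>t. F (z0 + of_real r * t)) ?A"
  proof (rule inj_onI)
    fix x y assume "x \<in> ?A" "y \<in> ?A" "F (z0 + of_real r * x) = F (z0 + of_real r * y)"
    then have "z0 + of_real r * x = z0 + of_real r * y" using inj_onD[OF inj] \<Omega> by blast
    then show "x = y" using r by simp
  qed
  have im: "(\<lambda>t. z0 + of_real r * t) ` ?A = \<Omega> \<inter> sphere z0 r"
  proof (intro antisym subsetI)
    fix w assume w: "w \<in> \<Omega> \<inter> sphere z0 r"
    let ?t = "(w - z0) / of_real r"
    have "w = z0 + of_real r * ?t" using r by simp
    moreover have "?t \<in> sphere 0 1" using w r by (simp add: norm_divide dist_norm norm_minus_commute)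
    ultimately show "w \<in> (\<lambda>t. z0 + of_real r * t) ` ?A" using w \<Omega> by (intro image_eqI[of _ _ ?t]) auto
  qed (use r \<Omega> in \<open>auto simp: dist_norm norm_mult\<close>)
  have im': "(\<lambda>t. F (z0 + of_real r * t)) ` ?A = F ` (\<Omega> \<inter> sphere z0 r)"
    unfolding im[symmetric] by (simp add: image_image)
  have "length_integral (?A, f \<circ> (\<lambda>t. Some (z0 + of_real r * t))) \<rho> = (\<integral>\<^sup>+w\<in>(\<lambda>t. F (z0 + of_real r * t)) ` ?A. \<rho> w \<partial>hausdorff1)"
    by (rule length_integral_inj[OF inj']) (use f \<Omega> in auto)
  then show ?thesis unfolding circle_in_def dashed_image_def im' prod.case .
qed

lemma modulus_mono: "\<Gamma> \<subseteq> \<Gamma>' \<Longrightarrow> modulus \<Gamma> \<le> modulus \<Gamma>'"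
  unfolding modulus_def by (rule INF_superset_mono) (auto simp: adm_def)

text \<open>The density that is infinite on the union of these circles, a plane null set, is admissible.\<close>
lemma modulus_null_radii:
  assumes N: "N \<in> null_sets lborel" and \<Omega>: "open \<Omega>" "\<And>z. Some z \<in> D \<longleftrightarrow> z \<in> \<Omega>"
    and ne: "\<And>s. s \<in> M \<Longrightarrow> s \<in> N \<and> \<Omega> \<inter> sphere z0 (exp s) \<noteq> {}"
  shows "modulus ((\<lambda>s. circle_in D z0 (exp s)) ` M) = 0"
proof -
  have [measurable]: "N \<in> sets borel" using N by (simp add: null_sets_def)
  define \<rho> where "\<rho> z = (\<infinity> :: ennreal) * indicator N (ln (norm (z - z0)))" for z
  have \<rho>m [measurable]: "\<rho> \<in> borel_measurable borel" unfolding \<rho>_def[abs_def] by measurable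
  have 0: "(\<integral>\<^sup>+z. (\<rho> z)\<^sup>2 \<partial>lborel) = 0"
  proof -
    \<comment> \<open>In the logarithmic chart the exceptional circles become points with real part
      in \<open>N\<close>, a null set by Fubini. The differentiable map \<open>?\<Phi>\<close>
      preserves null sets, and what the chart omits lies on the horizontal line through
      \<open>z0\<close>.\<close>
    let ?E = "{w \<in> strip. Re w \<in> N}"
    have E [measurable]: "?E \<in> sets borel" using borel_open[OF open_strip] by measurable
    have ReN: "Re -` N \<in> sets (lborel :: complex measure)"
      using measurable_sets_borel[of Re borel N] by simp
    have "emeasure lborel ?E \<le> emeasure lborel (Re -` N)" using ReN by (intro emeasure_mono) auto
    also have "\<dots> = (\<integral>\<^sup>+w. indicator N (Re w) \<partial>lborel)"
      using nn_integral_indicator[OF ReN] by (simp add: indicator_def vimage_def)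
    also have "\<dots> = (\<integral>\<^sup>+x. \<integral>\<^sup>+y. indicator N (Re (Complex x y)) \<partial>lborel \<partial>lborel)"
      by (rule nn_integral_complex_iterated(1)) measurable
    also have "\<dots> = 0"
    proof (subst nn_integral_0_iff_AE)
      have "AE x in lborel. x \<notin> N" using N by (rule AE_not_in)
      then show "AE x in lborel. (\<integral>\<^sup>+y. indicator N (Re (Complex x y)) \<partial>lborel) = (0 :: ennreal)"
        by eventually_elim simp
    qed simp
    finally have E0: "emeasure lborel ?E = 0" by simp
    let ?\<Phi> = "\<lambda>w. z0 + exp w"
    have "negligible ?E" using E0 E by (simp add: negligible_iff_null_sets null_sets_def)
    moreover have "?\<Phi> differentiable_on ?E"
      using has_derivative_shift_exp unfolding differentiable_on_def differentiable_def by blast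
    ultimately have n1: "negligible (?\<Phi> ` ?E)"
      by (intro negligible_differentiable_image_negligible) auto
    have n2: "negligible {z. Im z = Im z0}"
      using negligible_standard_hyperplane[of "\<i>::complex" "Im z0"] by (simp add: Basis_complex_def)
    have sub: "{z. \<rho> z \<noteq> 0} \<subseteq> ?\<Phi> ` ?E \<union> {z. Im z = Im z0}"
    proof
      fix z assume "z \<in> {z. \<rho> z \<noteq> 0}"
      then have zN: "ln (norm (z - z0)) \<in> N" by (auto simp: \<rho>_def indicator_def split: if_splits)
      show "z \<in> ?\<Phi> ` ?E \<union> {z. Im z = Im z0}"
      proof (cases "z - z0 \<in> \<real>\<^sub>\<le>\<^sub>0")
        case True
        then show ?thesis by (auto simp: complex_nonpos_Reals_iff)
      next
        case False
        then have L: "Ln (z - z0) \<in> strip" "exp (Ln (z - z0)) = z - z0" and "z - z0 \<noteq> 0" using Ln_in_strip by auto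
        then have "Re (Ln (z - z0)) \<in> N" using zN by (simp add: Re_Ln)
        then have "Ln (z - z0) \<in> ?E" using L by simp
        moreover have "z = ?\<Phi> (Ln (z - z0))" using L by simp
        ultimately show ?thesis by blast
      qed
    qed
    have "negligible {z. \<rho> z \<noteq> 0}" using negligible_subset[OF negligible_Un[OF n1 n2] sub] .
    then have "AE z in lebesgue. \<rho> z = 0"
      by (intro AE_I[where N="{z. \<rho> z \<noteq> 0}"]) (auto simp: negligible_iff_null_sets null_sets_def)
    then have "AE z in lborel. \<rho> z = 0" by (simp add: AE_completion_iff)
    then have "(\<integral>\<^sup>+z. (\<rho> z)\<^sup>2 \<partial>lborel) = (\<integral>\<^sup>+z. 0 \<partial>(lborel :: complex measure))"
      by (intro nn_integral_cong_AE) auto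
    then show ?thesis by simp
  qed
  have "\<rho> \<in> adm ((\<lambda>s. circle_in D z0 (exp s)) ` M)"
    unfolding adm_def
  proof (intro CollectI conjI ballI)
    show "\<rho> \<in> borel_measurable borel" by (rule \<rho>m)
    fix c assume "c \<in> (\<lambda>s. circle_in D z0 (exp s)) ` M"
    then obtain s where s: "s \<in> M" "c = circle_in D z0 (exp s)" by blast
    let ?r = "exp s"
    obtain p where p: "p \<in> \<Omega>" "p \<in> sphere z0 ?r" using ne[OF s(1)] by blast
    let ?\<gamma> = "\<lambda>t. z0 + of_real ?r * cis t"
    let ?I = "{-pi<..<pi} \<inter> ?\<gamma> -` \<Omega>"
    have oI: "open ?I"
      by (intro open_Int open_greaterThanLessThan open_vimage[OF \<Omega>(1)]) (intro continuous_intros)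
    have "?I \<noteq> {}"
    proof -
      have "p = ?\<gamma> (Arg (p - z0))"
        using p rcis_cmod_Arg[of "p - z0"] by (simp add: rcis_def dist_norm norm_minus_commute)
      then have pv: "Arg (p - z0) \<in> ?\<gamma> -` \<Omega>" using p by simp
      have "open (?\<gamma> -` \<Omega>)" by (rule open_vimage[OF \<Omega>(1)]) (intro continuous_intros)
      then obtain e where e: "0 < e" "ball (Arg (p - z0)) e \<subseteq> ?\<gamma> -` \<Omega>" using pv open_contains_ball by blast
      \<comment> \<open>If \<open>p\<close> lies on the slit, its angle is \<open>pi\<close>, which
        is not in the open interval. The angle is therefore lowered a little, by less than its
        distance to \<open>-pi\<close> and by less than \<open>e\<close>.\<close>
      define t where "t = Arg (p - z0) - min (e/2) ((Arg (p - z0) + pi) / 2)"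
      have t: "t \<in> ball (Arg (p - z0)) e" "-pi < t" "t < pi"
        using Arg_bounded[of "p - z0"] e by (auto simp: t_def dist_real_def min_def field_simps)
      then have "t \<in> {-pi<..<pi}" by simp
      moreover have "t \<in> ?\<gamma> -` \<Omega>" by (rule subsetD[OF e(2) t(1)])
      ultimately show ?thesis by blast
    qed
    \<comment> \<open>A nonempty open set of angles has positive measure, which makes the integral
      of the constant \<open>\<infinity>\<close> over it infinite.\<close>
    then have I0: "emeasure lborel ?I \<noteq> 0"
      using oI open_not_negligible[of ?I] by (auto simp: negligible_iff_null_sets null_sets_def)
    have "?I \<in> sets lborel" using oI by simp
    have ge: "(\<integral>\<^sup>+t\<in>{-pi<..pi}. (\<rho> (?\<gamma> t) * indicator \<Omega> (?\<gamma> t)) * ennreal ?r \<partial>lborel)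
       \<le> (\<integral>\<^sup>+w\<in>sphere z0 ?r. (\<rho> w * indicator \<Omega> w) \<partial>hausdorff1)"
      by (rule nn_integral_hausdorff1_circle_ge) (use borel_open[OF \<Omega>(1)] in measurable)
    have "\<infinity> * emeasure lborel ?I = (\<integral>\<^sup>+t. \<infinity> * indicator ?I t \<partial>lborel)"
      using \<open>?I \<in> sets lborel\<close> by (simp add: nn_integral_cmult_indicator)
    also have "\<dots> \<le> (\<integral>\<^sup>+t\<in>{-pi<..pi}. (\<rho> (?\<gamma> t) * indicator \<Omega> (?\<gamma> t)) * ennreal ?r \<partial>lborel)"
    proof (rule nn_integral_mono)
      fix t
      have "\<rho> (?\<gamma> t) = \<infinity>" using ne[OF s(1)] by (simp add: \<rho>_def norm_mult)
      then show "\<infinity> * indicator ?I t \<le> (\<rho> (?\<gamma> t) * indicator \<Omega> (?\<gamma> t)) * ennreal ?r * indicator {-pi<..pi} t"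
        by (auto simp: indicator_def ennreal_top_mult)
    qed
    also note ge
    also have "(\<integral>\<^sup>+w\<in>sphere z0 ?r. (\<rho> w * indicator \<Omega> w) \<partial>hausdorff1) = length_integral c \<rho>"
      unfolding s(2) length_integral_circle_in[OF exp_gt_zero \<Omega>(2)]
      by (intro nn_integral_cong) (auto simp: indicator_def)
    finally show "1 \<le> length_integral c \<rho>" using I0 by (simp add: ennreal_top_mult top_unique)
  qed
  then have "modulus ((\<lambda>s. circle_in D z0 (exp s)) ` M) \<le> (\<integral>\<^sup>+z. (\<rho> z)\<^sup>2 \<partial>lborel)"
    unfolding modulus_def by (rule INF_lower)
  then show ?thesis using 0 by simp
qed

text \<open>Two one-sided comparisons meet in the angle: the length integral of the image is at most
  the integral over the angle, and this is at most the length integral over the circle. The open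
  interval of angles misses the angle \<open>pi\<close>, whose image is a single point and has
  length zero.\<close>

lemma length_integral_pullback:
  fixes F :: "complex \<Rightarrow> complex" and g :: "complex \<Rightarrow> ennreal" and \<rho> :: "complex \<Rightarrow> ennreal"
  assumes r: "0 < r" and \<Omega>: "open \<Omega>" and cont: "continuous_on \<Omega> F"
    and gm [measurable]: "g \<in> borel_measurable borel" and \<rho>m [measurable]: "\<rho> \<in> borel_measurable borel"
    and Fm [measurable]: "F \<in> borel_measurable borel"
    and ACL: "ACL_circle \<Omega> F g z0 r"
  shows "(\<integral>\<^sup>+w\<in>F ` (\<Omega> \<inter> sphere z0 r). \<rho> w \<partial>hausdorff1) \<le> (\<integral>\<^sup>+w\<in>\<Omega> \<inter> sphere z0 r. \<rho> (F w) * g w \<partial>hausdorff1)"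
proof -
  note arc = ACL[unfolded ACL_circle_def, rule_format]
  let ?\<gamma> = "\<lambda>t. z0 + of_real r * cis t"
  let ?I = "{-pi<..<pi} \<inter> ?\<gamma> -` \<Omega>"
  have c\<gamma>: "continuous_on S ?\<gamma>" for S by (intro continuous_intros)
  have [measurable]: "?\<gamma> \<in> borel_measurable borel" by (rule borel_measurable_continuous_onI[OF c\<gamma>])
  have [measurable]: "\<Omega> \<in> sets borel" using \<Omega> by simp
  have oI: "open ?I" by (intro open_Int open_greaterThanLessThan open_vimage[OF \<Omega>] c\<gamma>)
  have cI: "continuous_on ?I (\<lambda>t. F (?\<gamma> t))"
    by (rule continuous_on_compose2[OF cont c\<gamma>]) auto
  have gm': "(\<lambda>t. g (?\<gamma> t) * ennreal r) \<in> borel_measurable borel" by measurable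
  let ?K = "(\<lambda>t. F (?\<gamma> t)) ` ?I"
  have up: "(\<lambda>t. F (?\<gamma> t)) ` ?I \<in> sets borel"
    "(\<integral>\<^sup>+w\<in>?K. \<rho> w \<partial>hausdorff1) \<le> (\<integral>\<^sup>+t\<in>?I. \<rho> (F (?\<gamma> t)) * (g (?\<gamma> t) * ennreal r) \<partial>lborel)"
    by (rule nn_integral_hausdorff1_curve_le[OF oI cI gm' _ _ \<rho>m]; use arc in \<open>auto simp: subset_eq\<close>)+
  have sub: "F ` (\<Omega> \<inter> sphere z0 r) \<subseteq> ?K \<union> {F (?\<gamma> pi)}"
  proof
    fix w assume "w \<in> F ` (\<Omega> \<inter> sphere z0 r)"
    then obtain p where p: "p \<in> \<Omega>" "p \<in> sphere z0 r" "w = F p" by blast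
    have pA: "p = ?\<gamma> (Arg (p - z0))"
      using p rcis_cmod_Arg[of "p - z0"] by (simp add: rcis_def dist_norm norm_minus_commute)
    show "w \<in> ?K \<union> {F (?\<gamma> pi)}"
    proof (cases "Arg (p - z0) = pi")
      case True
      have "p = ?\<gamma> pi" using pA unfolding True .
      then show ?thesis using p(3) by simp
    next
      case False
      then have "Arg (p - z0) \<in> {-pi<..<pi}" using Arg_bounded[of "p - z0"] by auto
      moreover have "?\<gamma> (Arg (p - z0)) \<in> \<Omega>" unfolding pA[symmetric] by (rule p(1))
      ultimately have "Arg (p - z0) \<in> ?I" by (intro IntI vimageI2)
      then have "F (?\<gamma> (Arg (p - z0))) \<in> ?K" by (rule imageI)
      then show ?thesis unfolding pA[symmetric] p(3) by (rule UnI1)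
    qed
  qed
  note idm = measurable_ident_hausdorff1
  have \<rho>h: "\<rho> \<in> borel_measurable hausdorff1" using measurable_compose[OF idm \<rho>m] .
  have Kh: "?K \<in> sets hausdorff1" "{F (?\<gamma> pi)} \<in> sets hausdorff1" by (intro borel_imp_hausdorff1 up(1), intro borel_imp_hausdorff1) simp
  have "(\<integral>\<^sup>+w\<in>F ` (\<Omega> \<inter> sphere z0 r). \<rho> w \<partial>hausdorff1) \<le> (\<integral>\<^sup>+w. \<rho> w * indicator ?K w + \<rho> w * indicator {F (?\<gamma> pi)} w \<partial>hausdorff1)"
    using sub by (intro nn_integral_mono) (auto simp: indicator_def)
  also have "\<dots> = (\<integral>\<^sup>+w\<in>?K. \<rho> w \<partial>hausdorff1) + (\<integral>\<^sup>+w\<in>{F (?\<gamma> pi)}. \<rho> w \<partial>hausdorff1)"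
    by (rule nn_integral_add) (intro borel_measurable_times_ennreal \<rho>h borel_measurable_indicator Kh)+
  also have "(\<integral>\<^sup>+w\<in>{F (?\<gamma> pi)}. \<rho> w \<partial>hausdorff1) = 0"
    using emeasure_hausdorff1_singleton Kh(2) by (intro nn_integral_null_set) (simp add: null_sets_def)
  also have "(\<integral>\<^sup>+w\<in>?K. \<rho> w \<partial>hausdorff1) + 0 \<le> (\<integral>\<^sup>+t\<in>?I. \<rho> (F (?\<gamma> t)) * (g (?\<gamma> t) * ennreal r) \<partial>lborel)"
    using up(2) by simp
  also have "\<dots> \<le> (\<integral>\<^sup>+t\<in>{-pi<..pi}. (\<rho> (F (?\<gamma> t)) * g (?\<gamma> t) * indicator \<Omega> (?\<gamma> t)) * ennreal r \<partial>lborel)"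
    by (intro nn_integral_mono) (auto simp: indicator_def mult_ac)
  also have "\<dots> \<le> (\<integral>\<^sup>+w\<in>sphere z0 r. (\<rho> (F w) * g w * indicator \<Omega> w) \<partial>hausdorff1)"
    by (rule nn_integral_hausdorff1_circle_ge[OF r]) measurable
  also have "\<dots> = (\<integral>\<^sup>+w\<in>\<Omega> \<inter> sphere z0 r. \<rho> (F w) * g w \<partial>hausdorff1)"
    by (intro nn_integral_cong) (auto simp: indicator_def)
  finally show ?thesis .
qed

text \<open>All that is used of the distortion of the map is contained in \<open>arc\<close> and
  \<open>area\<close>; in this form the argument serves a finite centre and the composition with the
  inversion alike.\<close>

theorem lower_modulus_inequality:
  fixes F :: "complex \<Rightarrow> complex" and g Q :: "complex \<Rightarrow> ennreal"
  assumes \<Omega>: "open \<Omega>" "\<And>z. Some z \<in> D \<longleftrightarrow> z \<in> \<Omega>"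
    and cont: "continuous_on \<Omega> F" and inj: "inj_on F \<Omega>"
    and Fm [measurable]: "F \<in> borel_measurable borel" and gm [measurable]: "g \<in> borel_measurable borel"
    and f: "\<And>z. z \<in> \<Omega> \<Longrightarrow> f (Some z) = Some (F z)"
    and arc: "AE s in lborel. ACL_circle \<Omega> F g z0 (exp s)"
    and area: "\<And>\<rho>. \<rho> \<in> borel_measurable borel \<Longrightarrow> (\<integral>\<^sup>+z\<in>\<Omega>. (\<rho> (F z) * g z)\<^sup>2 / Q z \<partial>lebesgue) \<le> (\<integral>\<^sup>+z. (\<rho> z)\<^sup>2 \<partial>lborel)"
    and \<epsilon>: "0 < \<epsilon>"
  shows "(INF \<rho>\<in>ext_adm (circle_family D z0 \<epsilon> \<epsilon>0).
       \<integral>\<^sup>+z\<in>{z. z \<in> \<Omega> \<and> \<epsilon> < dist z z0 \<and> dist z z0 < \<epsilon>0}. ((\<rho> z)\<^sup>2 / Q z) \<partial>lebesgue)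
     \<le> modulus (dashed_image f ` circle_family D z0 \<epsilon> \<epsilon>0)"
  unfolding modulus_def
proof (rule INF_greatest)
  fix \<rho>' assume \<rho>': "\<rho>' \<in> adm (dashed_image f ` circle_family D z0 \<epsilon> \<epsilon>0)"
  then have \<rho>'m [measurable]: "\<rho>' \<in> borel_measurable borel" by (simp add: adm_def)
  have [measurable]: "\<Omega> \<in> sets borel" using \<Omega> by simp
  define \<rho> where "\<rho> z = \<rho>' (F z) * g z" for z
  have \<rho>m [measurable]: "\<rho> \<in> borel_measurable borel" unfolding \<rho>_def[abs_def] by measurable
  have len1: "1 \<le> (\<integral>\<^sup>+w\<in>F ` (\<Omega> \<inter> sphere z0 r). \<rho>' w \<partial>hausdorff1)" if r: "\<epsilon> < r" "r < \<epsilon>0" for r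
  proof -
    have r0: "0 < r" using r \<epsilon> by simp
    have "dashed_image f (circle_in D z0 r) \<in> dashed_image f ` circle_family D z0 \<epsilon> \<epsilon>0"
      using r by (auto simp: circle_family_def)
    then have "1 \<le> length_integral (dashed_image f (circle_in D z0 r)) \<rho>'" using \<rho>' by (auto simp: adm_def)
    also have "length_integral (dashed_image f (circle_in D z0 r)) \<rho>' = (\<integral>\<^sup>+w\<in>F ` (\<Omega> \<inter> sphere z0 r). \<rho>' w \<partial>hausdorff1)"
      by (rule length_integral_image_circle_in[OF r0 \<Omega>(2) inj]) (rule f)
    finally show ?thesis .
  qed
  obtain N where N: "N \<in> null_sets (lborel :: real measure)" and good: "\<And>s. s \<notin> N \<Longrightarrow> ACL_circle \<Omega> F g z0 (exp s)"
    by (rule AE_E3[OF arc]) simp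
  let ?M = "{s. s \<in> N \<and> \<epsilon> < exp s \<and> exp s < \<epsilon>0}"
  have bad: "{\<gamma> \<in> circle_family D z0 \<epsilon> \<epsilon>0. \<not> 1 \<le> length_integral \<gamma> \<rho>} \<subseteq> (\<lambda>s. circle_in D z0 (exp s)) ` ?M"
  proof
    fix \<gamma> assume "\<gamma> \<in> {\<gamma> \<in> circle_family D z0 \<epsilon> \<epsilon>0. \<not> 1 \<le> length_integral \<gamma> \<rho>}"
    then obtain r where r: "\<epsilon> < r" "r < \<epsilon>0" "\<gamma> = circle_in D z0 r" and not: "\<not> 1 \<le> length_integral \<gamma> \<rho>"
      by (auto simp: circle_family_def)
    have r0: "0 < r" using r \<epsilon> by simp
    have er: "exp (ln r) = r" using r0 by simp
    have "ln r \<in> N"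
    proof (rule ccontr)
      assume "ln r \<notin> N"
      from good[OF this, unfolded er]
      have "(\<integral>\<^sup>+w\<in>F ` (\<Omega> \<inter> sphere z0 r). \<rho>' w \<partial>hausdorff1) \<le> (\<integral>\<^sup>+w\<in>\<Omega> \<inter> sphere z0 r. \<rho>' (F w) * g w \<partial>hausdorff1)"
        by (rule length_integral_pullback[OF r0 \<Omega>(1) cont gm \<rho>'m Fm])
      then have "1 \<le> length_integral \<gamma> \<rho>"
        unfolding r(3) length_integral_circle_in[OF r0 \<Omega>(2)] \<rho>_def using len1[OF r(1,2)] by (rule order_trans[rotated])
      then show False using not by simp
    qed
    then show "\<gamma> \<in> (\<lambda>s. circle_in D z0 (exp s)) ` ?M"
      using r er by (intro image_eqI[of _ _ "ln r"]) simp_all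
  qed
  \<comment> \<open>On a circle that misses \<open>\<Omega>\<close> every density has length
    integral \<open>0\<close>. Such a circle does not occur, since \<open>\<rho>'\<close> is
    admissible and gives its image a length integral of at least \<open>1\<close>.\<close>
  have ne: "s \<in> N \<and> \<Omega> \<inter> sphere z0 (exp s) \<noteq> {}" if "s \<in> ?M" for s
  proof
    show "s \<in> N" using that by simp
    show "\<Omega> \<inter> sphere z0 (exp s) \<noteq> {}"
    proof
      assume "\<Omega> \<inter> sphere z0 (exp s) = {}"
      then have "(\<integral>\<^sup>+w\<in>F ` (\<Omega> \<inter> sphere z0 (exp s)). \<rho>' w \<partial>hausdorff1) = 0" by simp
      then show False using len1[of "exp s"] that by simp
    qed
  qed
  have "modulus {\<gamma> \<in> circle_family D z0 \<epsilon> \<epsilon>0. \<not> 1 \<le> length_integral \<gamma> \<rho>} = 0"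
  proof -
    have "modulus ((\<lambda>s. circle_in D z0 (exp s)) ` ?M) = 0"
      by (rule modulus_null_radii[OF N \<Omega>]) (rule ne)
    then show ?thesis using modulus_mono[OF bad] by simp
  qed
  then have adm: "\<rho> \<in> ext_adm (circle_family D z0 \<epsilon> \<epsilon>0)"
    unfolding ext_adm_def using \<rho>m by (auto intro: measurable_completion)
  have "(INF \<rho>\<in>ext_adm (circle_family D z0 \<epsilon> \<epsilon>0).
       \<integral>\<^sup>+z\<in>{z. z \<in> \<Omega> \<and> \<epsilon> < dist z z0 \<and> dist z z0 < \<epsilon>0}. ((\<rho> z)\<^sup>2 / Q z) \<partial>lebesgue)
     \<le> (\<integral>\<^sup>+z\<in>{z. z \<in> \<Omega> \<and> \<epsilon> < dist z z0 \<and> dist z z0 < \<epsilon>0}. ((\<rho> z)\<^sup>2 / Q z) \<partial>lebesgue)"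
    by (rule INF_lower[OF adm])
  also have "\<dots> \<le> (\<integral>\<^sup>+z\<in>\<Omega>. (\<rho>' (F z) * g z)\<^sup>2 / Q z \<partial>lebesgue)"
    unfolding \<rho>_def by (intro nn_integral_mono) (auto simp: indicator_def)
  also have "\<dots> \<le> (\<integral>\<^sup>+z. (\<rho>' z)\<^sup>2 \<partial>lborel)" by (rule area[OF \<rho>'m])
  finally show "(INF \<rho>\<in>ext_adm (circle_family D z0 \<epsilon> \<epsilon>0).
       \<integral>\<^sup>+z\<in>{z. z \<in> \<Omega> \<and> \<epsilon> < dist z z0 \<and> dist z z0 < \<epsilon>0}. ((\<rho> z)\<^sup>2 / Q z) \<partial>lebesgue)
     \<le> (\<integral>\<^sup>+z. (\<rho>' z)\<^sup>2 \<partial>lborel)" .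
qed

section \<open>Dilatation and area\<close>

text \<open>The operator norm varies by at most the sum of the changes of the two columns.
  Continuity is what makes the dilatation of Borel columns a Borel function.\<close>

lemma continuous_on_onorm_lin_of: "continuous_on UNIV (\<lambda>p. onorm (lin_of (fst p) (snd p)))"
proof -
  have le: "onorm (lin_of a b) \<le> onorm (lin_of a' b') + (norm (a - a') + norm (b - b'))" for a b a' b'
  proof -
    have "lin_of a b = (\<lambda>h. lin_of a' b' h + lin_of (a - a') (b - b') h)" by (auto simp: lin_of_def algebra_simps)
    then have "onorm (lin_of a b) \<le> onorm (lin_of a' b') + onorm (lin_of (a - a') (b - b'))"
      using onorm_triangle[OF bounded_linear_lin_of bounded_linear_lin_of] by metis
    then show ?thesis using onorm_lin_of_le[of "a - a'" "b - b'"] by linarith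
  qed
  show ?thesis
  proof (rule continuous_at_imp_continuous_on, intro ballI)
    fix p :: "complex \<times> complex"
    have "((\<lambda>q. onorm (lin_of (fst q) (snd q)) - onorm (lin_of (fst p) (snd p))) \<longlongrightarrow> 0) (at p)"
    proof (rule Lim_null_comparison)
      show "\<forall>\<^sub>F q in at p. norm (onorm (lin_of (fst q) (snd q)) - onorm (lin_of (fst p) (snd p))) \<le> norm (fst q - fst p) + norm (snd q - snd p)"
      proof (intro always_eventually allI)
        fix q show "norm (onorm (lin_of (fst q) (snd q)) - onorm (lin_of (fst p) (snd p))) \<le> norm (fst q - fst p) + norm (snd q - snd p)"
          using le[of "fst q" "snd q" "fst p" "snd p"] le[of "fst p" "snd p" "fst q" "snd q"]
          by (simp add: norm_minus_commute abs_le_iff)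
      qed
      have "((\<lambda>q. norm (fst q - fst p) + norm (snd q - snd p)) \<longlongrightarrow> norm (fst p - fst p) + norm (snd p - snd p)) (at p)"
        by (intro tendsto_intros)
      then show "((\<lambda>q. norm (fst q - fst p) + norm (snd q - snd p)) \<longlongrightarrow> 0) (at p)" by simp
    qed
    then show "isCont (\<lambda>p. onorm (lin_of (fst p) (snd p))) p"
      unfolding isCont_def by (simp add: LIM_zero_iff)
  qed
qed

lemma borel_measurable_onorm_lin_of:
  assumes "u \<in> borel_measurable M" "v \<in> borel_measurable M"
  shows "(\<lambda>z. onorm (lin_of (u z) (v z))) \<in> borel_measurable M"
  using measurable_compose[OF borel_measurable_Pair[OF assms] borel_measurable_continuous_onI[OF continuous_on_onorm_lin_of]]
  by simp

lemma det2_lin_of: "det2 (lin_of a b) = Re a * Im b - Im a * Re b"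
  by (simp add: det2_def lin_of_def)

text \<open>The value of \<open>dilatation\<close> at a point where the differential is \<open>lin_of a b\<close> and satisfies the
  distortion inequality.\<close>
definition lin_dilatation :: "complex \<Rightarrow> complex \<Rightarrow> ennreal" where
  "lin_dilatation a b = (if det2 (lin_of a b) > 0 then ennreal ((onorm (lin_of a b))\<^sup>2 / det2 (lin_of a b)) else 1)"

lemma borel_measurable_lin_dilatation:
  assumes [measurable]: "u \<in> borel_measurable M" "v \<in> borel_measurable M"
  shows "(\<lambda>z. lin_dilatation (u z) (v z)) \<in> borel_measurable M"
proof -
  note [measurable] = borel_measurable_onorm_lin_of[OF assms]
  show ?thesis unfolding lin_dilatation_def det2_lin_of by measurable
qed

text \<open>A square is nonnegative and \<open>K\<close> is positive, so the determinant cannot be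
  negative; if it is zero, the inequality leaves only the zero map.\<close>

lemma distortion_point:
  assumes K: "1 \<le> (K::real)" "(onorm (lin_of a b))\<^sup>2 \<le> K * det2 (lin_of a b)"
  shows "0 \<le> det2 (lin_of a b)" and "det2 (lin_of a b) = 0 \<Longrightarrow> lin_of a b = (\<lambda>_. 0)"
    and "lin_dilatation a b < \<infinity>"
proof -
  have "0 \<le> K * det2 (lin_of a b)" using K(2) zero_le_power2 order_trans by blast
  then show "0 \<le> det2 (lin_of a b)" using K(1) by (simp add: zero_le_mult_iff)
  show "lin_of a b = (\<lambda>_. 0)" if "det2 (lin_of a b) = 0"
  proof -
    have "(onorm (lin_of a b))\<^sup>2 \<le> 0" using K(2) that by simp
    then have "onorm (lin_of a b) = 0" by simp
    then show ?thesis using onorm_eq_0[OF bounded_linear_lin_of] by (auto simp: fun_eq_iff)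
  qed
  show "lin_dilatation a b < \<infinity>" by (simp add: lin_dilatation_def)
qed

lemma dilatation_eq:
  assumes d: "(f has_derivative lin_of a b) (at z)"
    and K: "1 \<le> (K::real)" "(onorm (lin_of a b))\<^sup>2 \<le> K * det2 (lin_of a b)"
  shows "dilatation f z = lin_dilatation a b"
proof -
  have fd: "frechet_derivative f (at z) = lin_of a b" using frechet_derivative_at[OF d] by simp
  have "f differentiable at z" using d by (auto simp: differentiable_def)
  then show ?thesis
    using distortion_point[OF K] by (auto simp: dilatation_def fd lin_dilatation_def Let_def)
qed

lemma dilatation_pos: "0 < dilatation f z"
proof (cases "f differentiable at z")
  case True
  let ?L = "frechet_derivative f (at z)"
  have bl: "bounded_linear ?L" using True frechet_derivative_works has_derivative_bounded_linear by blast
  have "0 < (onorm ?L)\<^sup>2 / det2 ?L" if "0 < det2 ?L"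
  proof -
    have "onorm ?L \<noteq> 0"
    proof
      assume "onorm ?L = 0"
      then have "?L = (\<lambda>_. 0)" using onorm_eq_0[OF bl] by (auto simp: fun_eq_iff)
      then have "det2 ?L = 0" by (simp add: det2_def)
      then show False using that by simp
    qed
    then show ?thesis using that by simp
  qed
  then show ?thesis using True by (auto simp: dilatation_def Let_def)
qed (simp add: dilatation_def)

text \<open>A vector of norm at most \<open>1\<close> is stretched by at most the operator norm,
  whose square divided by the dilatation is exactly the Jacobian. In the degenerate case the
  differential is zero, and so is its product with \<open>x\<close>, even if \<open>x\<close> is
  infinite.\<close>

lemma area_pointwise:
  assumes K: "1 \<le> (K::real)" "(onorm (lin_of a b))\<^sup>2 \<le> K * det2 (lin_of a b)"
    and e: "norm e \<le> 1"
  shows "(x * ennreal (norm (lin_of a b e)))\<^sup>2 / lin_dilatation a b \<le> x\<^sup>2 * ennreal \<bar>det2 (lin_of a b)\<bar>"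
proof (cases "det2 (lin_of a b) > 0")
  case True
  let ?d = "det2 (lin_of a b)" and ?n = "onorm (lin_of a b)"
  have "?n \<noteq> 0"
  proof
    assume "?n = 0"
    then have "lin_of a b = (\<lambda>_. 0)" using onorm_eq_0[OF bounded_linear_lin_of] by (auto simp: fun_eq_iff)
    then have "?d = 0" by (simp add: det2_def)
    then show False using True by simp
  qed
  moreover have n0: "0 \<le> ?n" by (rule onorm_pos_le[OF bounded_linear_lin_of])
  ultimately have n: "0 < ?n" by simp
  have "norm (lin_of a b e) \<le> ?n * norm e" by (rule onorm[OF bounded_linear_lin_of])
  also have "\<dots> \<le> ?n" using e n by simp
  finally have le: "norm (lin_of a b e) \<le> ?n" .
  have "(x * ennreal (norm (lin_of a b e)))\<^sup>2 / lin_dilatation a b \<le> (x * ennreal ?n)\<^sup>2 / ennreal (?n\<^sup>2 / ?d)"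
    using True le by (simp add: lin_dilatation_def) (intro divide_right_mono_ennreal power_mono mult_left_mono ennreal_leI, auto)
  also have "\<dots> = x\<^sup>2 * (ennreal (?n\<^sup>2) / ennreal (?n\<^sup>2 / ?d))"
    using n0 by (simp add: power_mult_distrib ennreal_power ennreal_times_divide)
  also have "ennreal (?n\<^sup>2) / ennreal (?n\<^sup>2 / ?d) = ennreal ?d"
    using n True by (subst divide_ennreal) auto
  finally show ?thesis using True by simp
next
  case False
  then have "lin_of a b = (\<lambda>_. 0)" using distortion_point[OF K] by (intro distortion_point(2)[OF K]) linarith
  then show ?thesis by simp
qed

text \<open>The part of \<open>\<Omega>\<close> outside \<open>S\<close> is null and contributes
  nothing on the left, whatever area its image has; on the right the image of \<open>S\<close> is
  simply enlarged to the plane. Hence no condition on the images of null sets enters.\<close>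

lemma area_inequality:
  fixes F :: "complex \<Rightarrow> complex" and F' :: "complex \<Rightarrow> complex \<Rightarrow> complex"
  assumes S: "S \<in> sets lebesgue" "S \<subseteq> \<Omega>" "AE z in lebesgue. z \<in> \<Omega> \<longrightarrow> z \<in> S"
    and d: "\<And>z. z \<in> S \<Longrightarrow> (F has_derivative F' z) (at z)" and inj: "inj_on F S"
    and \<rho> [measurable]: "\<rho> \<in> borel_measurable borel"
    and le: "\<And>z. z \<in> S \<Longrightarrow> (\<rho> (F z) * g z)\<^sup>2 / Q z \<le> (\<rho> (F z))\<^sup>2 * ennreal \<bar>det2 (F' z)\<bar>"
  shows "(\<integral>\<^sup>+z\<in>\<Omega>. (\<rho> (F z) * g z)\<^sup>2 / Q z \<partial>lebesgue) \<le> (\<integral>\<^sup>+z. (\<rho> z)\<^sup>2 \<partial>lborel)"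
proof -
  have "(\<integral>\<^sup>+z\<in>\<Omega>. (\<rho> (F z) * g z)\<^sup>2 / Q z \<partial>lebesgue) \<le> (\<integral>\<^sup>+z\<in>S. (\<rho> (F z))\<^sup>2 * ennreal \<bar>det2 (F' z)\<bar> \<partial>lebesgue)"
  proof (rule nn_integral_mono_AE)
    show "AE z in lebesgue. (\<rho> (F z) * g z)\<^sup>2 / Q z * indicator \<Omega> z
      \<le> (\<rho> (F z))\<^sup>2 * ennreal \<bar>det2 (F' z)\<bar> * indicator S z"
      using S(3)
    proof eventually_elim
      case (elim z)
      then show ?case using le[of z] S(2) by (cases "z \<in> S") (auto simp: indicator_def)
    qed
  qed
  also have "\<dots> = (\<integral>\<^sup>+w\<in>F ` S. (\<rho> w)\<^sup>2 \<partial>lebesgue)"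
    by (rule nn_integral_differentiable_image(1)[OF S(1) has_derivative_at_withinI[OF d] inj]) measurable
  also have "\<dots> \<le> (\<integral>\<^sup>+w. (\<rho> w)\<^sup>2 \<partial>lebesgue)" by (intro nn_integral_mono) (auto simp: indicator_def)
  also have "\<dots> = (\<integral>\<^sup>+w. (\<rho> w)\<^sup>2 \<partial>lborel)" by (rule nn_integral_completion)
  finally show ?thesis .
qed

text \<open>Changing a function on a negligible set changes its preimages by negligible sets, which
  are Lebesgue measurable. The values of \<open>dilatation\<close> are accessible only off such a
  set.\<close>

lemma measurable_lebesgue_on_AE_eq:
  fixes q0 q :: "complex \<Rightarrow> ennreal"
  assumes \<Omega>: "\<Omega> \<in> sets lebesgue" and q0: "q0 \<in> borel_measurable lebesgue"
    and N: "negligible N" and eq: "\<And>z. z \<in> \<Omega> - N \<Longrightarrow> q z = q0 z"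
  shows "q \<in> borel_measurable (lebesgue_on \<Omega>)"
proof (rule measurableI)
  fix A :: "ennreal set" assume A: "A \<in> sets borel"
  have S: "q0 -` A \<inter> \<Omega> \<in> sets lebesgue"
    using measurable_sets[OF q0 A] \<Omega> by (auto simp: space_restrict_space)
  have "q -` A \<inter> \<Omega> \<in> sets lebesgue"
  proof (rule sets_negligible_symdiff[OF S])
    have "(q0 -` A \<inter> \<Omega> - q -` A \<inter> \<Omega>) \<union> (q -` A \<inter> \<Omega> - q0 -` A \<inter> \<Omega>) \<subseteq> N"
      using eq by fastforce
    then show "negligible ((q0 -` A \<inter> \<Omega> - q -` A \<inter> \<Omega>) \<union> (q -` A \<inter> \<Omega> - q0 -` A \<inter> \<Omega>))"
      using N negligible_subset by blast
  qed
  then show "q -` A \<inter> space (lebesgue_on \<Omega>) \<in> sets (lebesgue_on \<Omega>)"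
    using \<Omega> by (auto simp: sets_restrict_space_iff)
qed simp

text \<open>\<open>N\<close> unites the exceptional sets of differentiability, of the distortion
  inequality and of the choice of Borel representatives. The statement about circles remains general
  in the centre: it is used at \<open>z0\<close> and, for the point at infinity, at
  \<open>0\<close>.\<close>

lemma finite_distortion_data:
  assumes D: "open D" and fd: "finite_distortion_homeo D f"
  obtains f0 u v K N where "f0 \<in> borel_measurable borel" "u \<in> borel_measurable borel" "v \<in> borel_measurable borel"
    and "continuous_on D f" "inj_on f D" "\<And>z. z \<in> D \<Longrightarrow> f0 z = f z"
    and "negligible N" and "\<And>z :: complex. 1 \<le> (K z :: real)"
    and "\<And>z. z \<in> D - N \<Longrightarrow> (f has_derivative lin_of (u z) (v z)) (at z)"
    and "\<And>z. z \<in> D - N \<Longrightarrow> (onorm (lin_of (u z) (v z)))\<^sup>2 \<le> K z * det2 (lin_of (u z) (v z))"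
    and "\<And>z0. AE s in lborel. ACL_circle D f0 (tangential u v z0) z0 (exp s)"
proof -
  from fd obtain g0 u1 v1 K where h: "homeomorphism D (f ` D) f g0" and W: "W11loc D f u1 v1" and K1: "\<And>z. 1 \<le> K z"
    and KD: "AE z\<in>D in lebesgue. (onorm (lin_of (u1 z) (v1 z)))\<^sup>2 \<le> K z * det2 (lin_of (u1 z) (v1 z))"
    unfolding finite_distortion_homeo_def by blast
  have cont: "continuous_on D f" using h by (simp add: homeomorphism_def)
  have inj: "inj_on f D" using h by (metis homeomorphism_apply1 inj_on_inverseI)
  \<comment> \<open>The extension by zero turns a map continuous on \<open>D\<close> into a Borel
    function on the plane.\<close>
  define f0 where "f0 z = indicator D z *\<^sub>R f z" for z
  have f0m: "f0 \<in> borel_measurable borel"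
    unfolding f0_def[abs_def] by (rule borel_measurable_continuous_on_indicator) (use D cont in auto)
  have f0e: "f0 z = f z" if "z \<in> D" for z using that by (simp add: f0_def)
  have f0c: "continuous_on D f0" using continuous_on_eq[OF cont] f0e by simp
  obtain u where u: "u \<in> borel_measurable borel" "AE z in lborel. z \<in> D \<longrightarrow> u1 z = u z"
    "\<And>C. compact C \<Longrightarrow> C \<subseteq> D \<Longrightarrow> set_integrable lborel C u"
    using locally_integrable_borel[OF D, of u1] W unfolding W11loc_def by blast
  obtain v where v: "v \<in> borel_measurable borel" "AE z in lborel. z \<in> D \<longrightarrow> v1 z = v z"
    "\<And>C. compact C \<Longrightarrow> C \<subseteq> D \<Longrightarrow> set_integrable lborel C v"
    using locally_integrable_borel[OF D, of v1] W unfolding W11loc_def by blast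
  have wu: "weak_borel D 1 f0 u"
    by (rule weak_derivative_borel[OF D _ f0m f0e u(1,2)]) (use W in \<open>simp add: W11loc_def\<close>)
  have wv: "weak_borel D \<i> f0 v"
    by (rule weak_derivative_borel[OF D _ f0m f0e v(1,2)]) (use W in \<open>simp add: W11loc_def\<close>)
  have sD: "open (swap -` D)"
    by (rule open_vimage[OF D]) (simp add: swap_def[abs_def] Complex_eq, intro continuous_intros)
  have sc: "continuous_on UNIV swap" unfolding swap_def[abs_def] Complex_eq by (intro continuous_intros)
  have V: "AE x in lborel. ACL_vertical D f0 v x"
    unfolding ACL_vertical_def
    by (rule weak_vertical_ACL[OF D weak_borel_imp_vertical[OF wv] f0m v(1) f0c]) (rule v(3))
  have H: "AE y in lborel. ACL_vertical (swap -` D) (f0 \<circ> swap) (u \<circ> swap) y"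
    unfolding ACL_vertical_def
  proof (rule weak_vertical_ACL[OF sD weak_borel_imp_horizontal[OF wu f0m u(1)]])
    show "f0 \<circ> swap \<in> borel_measurable borel" "u \<circ> swap \<in> borel_measurable borel"
      using f0m u(1) by (auto intro: measurable_comp[OF borel_measurable_swap])
    show "continuous_on (swap -` D) (f0 \<circ> swap)"
      by (rule continuous_on_compose[OF continuous_on_subset[OF sc]]) (auto intro: continuous_on_subset[OF f0c])
    fix C assume C: "compact C" "C \<subseteq> swap -` D"
    have "compact (swap ` C)" using C(1) continuous_on_subset[OF sc] by (intro compact_continuous_image) auto
    moreover have "swap ` C \<subseteq> D" using C(2) by auto
    ultimately have "set_integrable lborel (swap ` C) u" by (rule u(3))
    then have "integrable (distr lborel borel swap) (\<lambda>z. indicator (swap ` C) z *\<^sub>R u z)"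
      unfolding set_integrable_def
      by (subst distr_lborel_eqI[OF borel_measurable_swap nn_integral_swap]) auto
    then have "integrable lborel (\<lambda>z. indicator (swap ` C) (swap z) *\<^sub>R u (swap z))"
      by (rule integrable_distr[rotated]) simp
    moreover have "indicator (swap ` C) (swap z) = (indicator C z :: real)" for z
    proof -
      have "swap z \<in> swap ` C \<longleftrightarrow> z \<in> C" by (metis image_iff swap_simps(3))
      then show ?thesis by (simp add: indicator_def)
    qed
    ultimately show "set_integrable lborel C (u \<circ> swap)" by (simp add: set_integrable_def o_def)
  qed
  have inj0: "inj_on f0 D" using inj f0e by (simp add: inj_on_def)
  have dA: "AE z in lborel. z \<in> D \<longrightarrow> (f0 has_derivative lin_of (u z) (v z)) (at z)"
    by (rule AE_has_derivative_ACL_homeo[OF D f0c inj0 u(1) v(1) _ _ V H]) (use u(3) v(3) in blast)+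
  have KA: "AE z in lborel. z \<in> D \<longrightarrow> (onorm (lin_of (u1 z) (v1 z)))\<^sup>2 \<le> K z * det2 (lin_of (u1 z) (v1 z))"
    using KD by (simp add: AE_completion_iff)
  have "AE z in lborel. z \<in> D \<longrightarrow> (f has_derivative lin_of (u z) (v z)) (at z) \<and> (onorm (lin_of (u z) (v z)))\<^sup>2 \<le> K z * det2 (lin_of (u z) (v z))"
    using dA KA u(2) v(2)
  proof eventually_elim
    case (elim z)
    show ?case
    proof (intro impI conjI)
      assume z: "z \<in> D"
      show "(f has_derivative lin_of (u z) (v z)) (at z)"
        by (rule has_derivative_transform_within_open[OF _ D z f0e]) (use elim(1) z in blast)
      show "(onorm (lin_of (u z) (v z)))\<^sup>2 \<le> K z * det2 (lin_of (u z) (v z))" using elim(2-4) z by simp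
    qed
  qed
  then obtain N where N: "N \<in> null_sets (lborel :: complex measure)"
    "\<And>z. z \<in> space lborel - N \<Longrightarrow> z \<in> D \<longrightarrow> (f has_derivative lin_of (u z) (v z)) (at z) \<and> (onorm (lin_of (u z) (v z)))\<^sup>2 \<le> K z * det2 (lin_of (u z) (v z))"
    by (rule AE_E3) blast
  have "negligible N" using N(1) by (simp add: negligible_iff_null_sets null_sets_completionI)
  have circ: "AE s in lborel. ACL_circle D f0 (tangential u v z0) z0 (exp s)" for z0
    by (rule circle_ACL[OF D f0m f0c u(1) v(1) _ _ wu wv]) (use u(3) v(3) in blast)+
  show ?thesis
  proof (rule that[of f0 u v N K])
    show "f0 \<in> borel_measurable borel" "u \<in> borel_measurable borel" "v \<in> borel_measurable borel" by (fact f0m u(1) v(1))+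
    show "continuous_on D f" "inj_on f D" "negligible N" by fact+
    show "f0 z = f z" if "z \<in> D" for z using that by (rule f0e)
    show "1 \<le> K z" for z by (rule K1)
    show "(f has_derivative lin_of (u z) (v z)) (at z)" if "z \<in> D - N" for z using N(2)[of z] that by simp
    show "(onorm (lin_of (u z) (v z)))\<^sup>2 \<le> K z * det2 (lin_of (u z) (v z))" if "z \<in> D - N" for z using N(2)[of z] that by simp
    show "AE s in lborel. ACL_circle D f0 (tangential u v z0) z0 (exp s)" for z0 by (rule circ)
  qed
qed

section \<open>Inversion in the unit circle\<close>

text \<open>This is \<open>z / |z|^2\<close>, the finite part of \<open>circle_inversion\<close>.
  The convention \<open>inverse 0 = 0\<close> makes it an involution of the whole plane.\<close>

definition inv_conj :: "complex \<Rightarrow> complex" where "inv_conj z = inverse (cnj z)"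

lemma circle_inversion_Some: "circle_inversion (Some z) = (if z = 0 then None else Some (inv_conj z))"
proof (cases "z = 0")
  case False
  have "inv_conj z = z /\<^sub>R (norm z)\<^sup>2"
    using False complex_norm_square[of z] by (simp add: inv_conj_def scaleR_conv_of_real field_simps)
  then show ?thesis using False by (simp add: circle_inversion_def)
qed (simp add: circle_inversion_def)

lemma circle_inversion_None: "circle_inversion None = Some 0"
  by (simp add: circle_inversion_def)

lemma inv_conj_simps [simp]: "inv_conj (inv_conj z) = z" "inv_conj z = 0 \<longleftrightarrow> z = 0" "norm (inv_conj z) = inverse (norm z)"
  by (auto simp: inv_conj_def norm_inverse)

lemma circle_inversion_involution: "circle_inversion (circle_inversion p) = p"
  by (cases p) (auto simp: circle_inversion_Some circle_inversion_None)

lemma continuous_on_inv_conj: "continuous_on (- {0}) inv_conj"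
  unfolding inv_conj_def[abs_def] by (intro continuous_intros) auto

lemma openin_ext_plane_Some: "openin ext_plane (Some ` U) \<longleftrightarrow> open U"
proof
  assume "openin ext_plane (Some ` U)"
  then have "openin euclidean {z \<in> topspace euclidean. Some z \<in> Some ` U}"
    using openin_continuous_map_preimage[OF continuous_map_Some] unfolding ext_plane_def by blast
  moreover have "{z \<in> topspace euclidean. Some z \<in> Some ` U} = U" by auto
  ultimately show "open U" by simp
next
  assume "open U"
  then show "openin ext_plane (Some ` U)" unfolding ext_plane_def openin_Alexandroff_compactification by auto
qed

lemma openin_ext_plane_None: "compact C \<Longrightarrow> openin ext_plane (insert None (Some ` (- C)))"
  unfolding ext_plane_def openin_Alexandroff_compactification
  by (rule disjI2) (auto intro!: exI[of _ C] simp: compact_imp_closed)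

lemma topspace_ext_plane [simp]: "topspace ext_plane = UNIV"
  by (simp add: ext_plane_def notin_range_Some UNIV_option_conv)

lemma open_inv_conj_preimage:
  assumes "open U"
  shows "open {z. z \<noteq> 0 \<and> inv_conj z \<in> U}"
proof -
  have "open (- {0} \<inter> inv_conj -` U)"
    using continuous_on_open_vimage[of "- {0}" inv_conj] continuous_on_inv_conj assms by (simp add: Int_commute open_Compl)
  moreover have "- {0} \<inter> inv_conj -` U = {z. z \<noteq> 0 \<and> inv_conj z \<in> U}" by auto
  ultimately show ?thesis by simp
qed

text \<open>Open sets of the extended plane are open plane sets or complements of compact plane
  sets. The preimage is of the second kind exactly when the given set contains the point
  \<open>0\<close>, and it contains \<open>0\<close> exactly when the given set contains
  infinity.\<close>

lemma continuous_map_circle_inversion: "continuous_map ext_plane ext_plane circle_inversion"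
  unfolding continuous_map_def
proof (intro conjI allI impI)
  fix V assume "openin ext_plane V"
  then consider (1) U where "open U" "V = Some ` U" | (2) C where "compact C" "V = insert None (Some ` (- C))"
    unfolding ext_plane_def openin_Alexandroff_compactification by (auto simp: Compl_eq_Diff_UNIV)
  then have "openin ext_plane (circle_inversion -` V)"
  proof cases
    case 1
    let ?A = "{z. z \<noteq> 0 \<and> inv_conj z \<in> U}"
    have oA: "open ?A" by (rule open_inv_conj_preimage[OF 1(1)])
    show ?thesis
    proof (cases "0 \<in> U")
      case False
      have "circle_inversion -` V = Some ` ?A"
      proof (intro set_eqI)
        fix p show "p \<in> circle_inversion -` V \<longleftrightarrow> p \<in> Some ` ?A"
          using False 1(2) by (cases p) (auto simp: circle_inversion_Some circle_inversion_None split: if_splits)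
      qed
      then show ?thesis using oA by (simp add: openin_ext_plane_Some)
    next
      case True
      then obtain e where e: "0 < e" "ball 0 e \<subseteq> U" using 1 open_contains_ball by blast
      \<comment> \<open>The inversion sends the outside of the disc of radius \<open>1/e\<close>
        into the disc of radius \<open>e\<close>, which lies in \<open>U\<close>; this bounds the
        complement of the preimage and makes it compact.\<close>
      have sub: "- ?A \<subseteq> cball 0 (1/e)"
      proof
        fix z assume z: "z \<in> - ?A"
        show "z \<in> cball 0 (1/e)"
        proof (cases "z = 0")
          case False
          then have "inv_conj z \<notin> U" using z by auto
          then have "inv_conj z \<notin> ball 0 e" using e(2) by blast
          then have "e \<le> inverse (norm z)" by simp
          then show ?thesis using False e by (simp add: field_simps)
        qed (use e in simp)
      qed
      have "compact (- ?A)"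
        unfolding compact_eq_bounded_closed using bounded_subset[OF bounded_cball sub] closed_Compl[OF oA] by simp
      then have "openin ext_plane (insert None (Some ` (- (- ?A))))" by (rule openin_ext_plane_None)
      moreover have "circle_inversion -` V = insert None (Some ` (- (- ?A)))"
      proof (intro set_eqI)
        fix p show "p \<in> circle_inversion -` V \<longleftrightarrow> p \<in> insert None (Some ` (- (- ?A)))"
          using True 1(2) by (cases p) (auto simp: circle_inversion_Some circle_inversion_None split: if_splits)
      qed
      ultimately show ?thesis by simp
    qed
  next
    case 2
    let ?A = "{z. z \<noteq> 0 \<and> inv_conj z \<in> - C}"
    have oA: "open ?A" by (rule open_inv_conj_preimage) (use 2 in \<open>simp add: compact_imp_closed open_Compl\<close>)
    have vim: "p \<in> circle_inversion -` V \<longleftrightarrow> (case p of None \<Rightarrow> 0 \<notin> C | Some z \<Rightarrow> z = 0 \<or> z \<in> ?A)" for p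
      using 2(2) by (cases p) (auto simp: circle_inversion_Some circle_inversion_None)
    show ?thesis
    proof (cases "0 \<in> C")
      case True
      obtain M where M: "0 < M" "\<And>w. w \<in> C \<Longrightarrow> norm w \<le> M" using 2(1) by (meson bounded_pos compact_imp_bounded)
      have "ball 0 (1/M) \<subseteq> insert 0 ?A"
      proof
        fix z :: complex assume z: "z \<in> ball 0 (1/M)"
        show "z \<in> insert 0 ?A"
        proof (cases "z = 0")
          case False
          then have "M < norm (inv_conj z)" using z M by (simp add: field_simps)
          then have "inv_conj z \<notin> C" using M(2) by (meson leD)
          then show ?thesis using False by simp
        qed simp
      qed
      then have eq: "insert 0 ?A = ?A \<union> ball 0 (1/M)" using M by auto
      have "open (insert 0 ?A)" unfolding eq using oA open_ball by (rule open_Un)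
      moreover have "circle_inversion -` V = Some ` (insert 0 ?A)"
      proof (intro set_eqI)
        fix p show "p \<in> circle_inversion -` V \<longleftrightarrow> p \<in> Some ` (insert 0 ?A)"
          unfolding vim using True by (cases p) auto
      qed
      ultimately show ?thesis by (simp only: openin_ext_plane_Some)
    next
      case False
      have "compact (inv_conj ` C)"
        using False 2(1) by (intro compact_continuous_image continuous_on_subset[OF continuous_on_inv_conj]) auto
      then have "openin ext_plane (insert None (Some ` (- (inv_conj ` C))))" by (rule openin_ext_plane_None)
      moreover have "circle_inversion -` V = insert None (Some ` (- (inv_conj ` C)))"
      proof (intro set_eqI)
        fix p
        have im: "z \<in> inv_conj ` C \<longleftrightarrow> inv_conj z \<in> C" for z
          by (auto intro: image_eqI[of _ _ "inv_conj z"])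
        have i0: "inv_conj 0 = 0" by simp
        show "p \<in> circle_inversion -` V \<longleftrightarrow> p \<in> insert None (Some ` (- (inv_conj ` C)))"
          unfolding vim using False im by (cases p) (auto simp: image_iff i0)
      qed
      ultimately show ?thesis by simp
    qed
  qed
  then show "openin ext_plane {x \<in> topspace ext_plane. circle_inversion x \<in> V}" by (simp add: vimage_def)
qed simp

text \<open>Away from infinity the extended plane has the topology of the plane, so continuity can
  be tested after composition with \<open>Some\<close>.\<close>

lemma continuous_map_from_Some:
  assumes D: "open D" and c: "continuous_map (top_of_set D) Y (h \<circ> Some)"
  shows "continuous_map (subtopology ext_plane (Some ` D)) Y h"
  unfolding continuous_map_def
proof (intro conjI allI impI)
  have ts: "topspace (subtopology ext_plane (Some ` D)) = Some ` D" by simp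
  show "h \<in> topspace (subtopology ext_plane (Some ` D)) \<rightarrow> topspace Y"
    unfolding ts using continuous_map_funspace[OF c] by auto
  fix U assume "openin Y U"
  then have "openin (top_of_set D) {z \<in> D. (h \<circ> Some) z \<in> U}" using openin_continuous_map_preimage[OF c] by simp
  then have "open {z \<in> D. h (Some z) \<in> U}" using openin_open_eq[OF D] by simp
  then have o: "openin ext_plane (Some ` {z \<in> D. h (Some z) \<in> U})" by (simp add: openin_ext_plane_Some)
  have "{p \<in> Some ` D. h p \<in> U} = Some ` {z \<in> D. h (Some z) \<in> U} \<inter> Some ` D" by auto
  then show "openin (subtopology ext_plane (Some ` D)) {p \<in> topspace (subtopology ext_plane (Some ` D)). h p \<in> U}"
    unfolding ts openin_subtopology using o by blast
qed

lemma homeomorphic_map_option: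
  assumes D: "open D" and D': "open D'" and h: "homeomorphism D D' f g"
  shows "homeomorphic_map (subtopology ext_plane (Some ` D)) (subtopology ext_plane (Some ` D')) (map_option f)"
proof -
  have c: "continuous_map (subtopology ext_plane (Some ` D)) (subtopology ext_plane (Some ` D')) (map_option f)"
    if D: "open D" and cf: "continuous_on D f" and im: "f ` D \<subseteq> D'" for D D' and f :: "complex \<Rightarrow> complex"
  proof -
    have "continuous_map (top_of_set D) euclidean f" using cf by simp
    from continuous_map_compose[OF this continuous_map_Some]
    have "continuous_map (top_of_set D) ext_plane (map_option f \<circ> Some)" by (simp add: ext_plane_def o_def)
    then have "continuous_map (subtopology ext_plane (Some ` D)) ext_plane (map_option f)" by (rule continuous_map_from_Some[OF D])
    then show ?thesis using im by (auto simp: continuous_map_in_subtopology)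
  qed
  have "homeomorphic_maps (subtopology ext_plane (Some ` D)) (subtopology ext_plane (Some ` D')) (map_option f) (map_option g)"
    unfolding homeomorphic_maps_def
    using c[OF D, of f D'] c[OF D', of g D] h by (auto simp: homeomorphism_def)
  then show ?thesis by (rule homeomorphic_maps_imp_map)
qed

lemma ext_domain_Some:
  assumes "open D" "connected D" "D \<noteq> {}"
  shows "ext_domain (Some ` D)"
proof -
  have "connectedin euclidean D" using assms(2) by simp
  then have "connectedin ext_plane (Some ` D)"
    unfolding ext_plane_def by (rule connectedin_continuous_map_image[OF continuous_map_Some])
  then show ?thesis using assms by (simp add: ext_domain_def openin_ext_plane_Some)
qed

lemma circle_inversion_vimage: "circle_inversion -` S = circle_inversion ` S"
proof (intro antisym subsetI)
  fix p assume "p \<in> circle_inversion -` S"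
  then have "circle_inversion (circle_inversion p) \<in> circle_inversion ` S" by simp
  then show "p \<in> circle_inversion ` S" by (simp only: circle_inversion_involution)
qed (auto simp: circle_inversion_involution)

lemma ext_domain_circle_inversion:
  assumes "ext_domain S"
  shows "ext_domain (circle_inversion -` S)"
proof -
  have "openin ext_plane {p \<in> topspace ext_plane. circle_inversion p \<in> S}"
    using assms by (intro openin_continuous_map_preimage[OF continuous_map_circle_inversion]) (simp add: ext_domain_def)
  then have o: "openin ext_plane (circle_inversion -` S)" by (simp add: vimage_def)
  have c: "connectedin ext_plane (circle_inversion ` S)"
    using assms by (intro connectedin_continuous_map_image[OF continuous_map_circle_inversion]) (simp add: ext_domain_def)
  have "circle_inversion ` S \<noteq> {}" using assms by (simp add: ext_domain_def)
  then show ?thesis using o c by (simp add: ext_domain_def circle_inversion_vimage)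
qed

lemma homeomorphic_map_circle_inversion:
  "homeomorphic_map (subtopology ext_plane (circle_inversion -` S)) (subtopology ext_plane S) circle_inversion"
proof -
  have "homeomorphic_maps (subtopology ext_plane (circle_inversion -` S)) (subtopology ext_plane S) circle_inversion circle_inversion"
    unfolding homeomorphic_maps_def continuous_map_in_subtopology
    by (auto simp: circle_inversion_involution intro: continuous_map_from_subtopology[OF continuous_map_circle_inversion])
  then show ?thesis by (rule homeomorphic_maps_imp_map)
qed

section \<open>The inequality at finite points and at infinity\<close>

text \<open>\<open>\<Omega>\<close> is the finite part of \<open>D\<close>; after an inversion
  \<open>D\<close> may contain infinity, while all analytic conditions concern the plane map
  \<open>F\<close> only.\<close>

lemma lower_Q_homeo_finiteI:
  fixes F :: "complex \<Rightarrow> complex" and g q :: "complex \<Rightarrow> ennreal"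
  assumes top: "ext_domain D" "ext_domain (f ` D)" "homeomorphic_map (subtopology ext_plane D) (subtopology ext_plane (f ` D)) f"
      "Some z0 \<in> ext_plane closure_of D"
    and \<Omega>: "open \<Omega>" "\<And>z. Some z \<in> D \<longleftrightarrow> z \<in> \<Omega>"
    and cont: "continuous_on \<Omega> F" and inj: "inj_on F \<Omega>"
    and m: "F \<in> borel_measurable borel" "g \<in> borel_measurable borel" "q \<in> borel_measurable borel"
    and f: "\<And>z. z \<in> \<Omega> \<Longrightarrow> f (Some z) = Some (F z)"
    and arc: "AE s in lborel. ACL_circle \<Omega> F g z0 (exp s)"
    and N: "negligible N" and Q0: "\<And>p. p \<in> D \<Longrightarrow> 0 < Q p"
    and Q: "\<And>z. z \<in> \<Omega> - N \<Longrightarrow> Q (Some z) = q z" "\<And>z. z \<in> \<Omega> - N \<Longrightarrow> q z < \<infinity>"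
    and d: "\<And>z. z \<in> \<Omega> - N \<Longrightarrow> (F has_derivative F' z) (at z)"
    and le: "\<And>z x. z \<in> \<Omega> - N \<Longrightarrow> (x * g z)\<^sup>2 / q z \<le> x\<^sup>2 * ennreal \<bar>det2 (F' z)\<bar>"
  shows "lower_Q_homeo_finite D f Q z0"
proof -
  have \<Omega>s: "\<Omega> \<in> sets lebesgue" using \<Omega>(1) by simp
  have Ns: "N \<in> null_sets lebesgue" using N by (simp add: negligible_iff_null_sets)
  have AEN: "AE z in lebesgue. z \<notin> N" using AE_not_in[OF Ns] .
  have S: "\<Omega> - N \<in> sets lebesgue" using \<Omega>s Ns by (simp add: null_setsD2 sets.Diff)
  have eqD: "{z. Some z \<in> D} = \<Omega>" using \<Omega>(2) by auto
  have qm: "(\<lambda>z. Q (Some z)) \<in> borel_measurable (lebesgue_on \<Omega>)"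
    by (rule measurable_lebesgue_on_AE_eq[OF \<Omega>s _ N Q(1)]) (use measurable_completion[of q lborel borel] m(3) in simp)
  have fin: "AE z\<in>\<Omega> in lebesgue. Q (Some z) < \<infinity>"
    using AEN
  proof eventually_elim
    case (elim z)
    then show ?case by (metis DiffI Q)
  qed
  have main: "(INF \<rho>\<in>ext_adm (circle_family D z0 \<epsilon> \<epsilon>0).
       \<integral>\<^sup>+z\<in>{z. z \<in> \<Omega> \<and> \<epsilon> < dist z z0 \<and> dist z z0 < \<epsilon>0}. ((\<rho> z)\<^sup>2 / Q (Some z)) \<partial>lebesgue)
     \<le> modulus (dashed_image f ` circle_family D z0 \<epsilon> \<epsilon>0)" if "0 < \<epsilon>" for \<epsilon> \<epsilon>0
  proof (rule lower_modulus_inequality[OF \<Omega> cont inj m(1,2) f arc _ that])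
    fix \<rho> :: "complex \<Rightarrow> ennreal" assume \<rho>: "\<rho> \<in> borel_measurable borel"
    show "(\<integral>\<^sup>+z\<in>\<Omega>. (\<rho> (F z) * g z)\<^sup>2 / Q (Some z) \<partial>lebesgue) \<le> (\<integral>\<^sup>+z. (\<rho> z)\<^sup>2 \<partial>lborel)"
    proof (rule area_inequality[OF S _ _ d _ \<rho>])
      show "AE z in lebesgue. z \<in> \<Omega> \<longrightarrow> z \<in> \<Omega> - N" using AEN by eventually_elim simp
      show "inj_on F (\<Omega> - N)" using inj by (rule inj_on_subset) simp
      show "(\<rho> (F z) * g z)\<^sup>2 / Q (Some z) \<le> (\<rho> (F z))\<^sup>2 * ennreal \<bar>det2 (F' z)\<bar>" if "z \<in> \<Omega> - N" for z
        using le[OF that] Q(1)[OF that] by simp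
    qed simp_all
  qed simp_all
  show ?thesis
    unfolding lower_Q_homeo_finite_def eqD
  proof (intro conjI allI impI ballI)
    fix \<epsilon> \<epsilon>0 :: real assume "0 < \<epsilon>"
    from main[OF this, of \<epsilon>0] show "(INF \<rho>\<in>ext_adm (circle_family D z0 \<epsilon> \<epsilon>0).
       \<integral>\<^sup>+z\<in>{z. Some z \<in> D \<and> \<epsilon> < dist z z0 \<and> dist z z0 < \<epsilon>0}. ((\<rho> z)\<^sup>2 / Q (Some z)) \<partial>lebesgue)
     \<le> modulus (dashed_image f ` circle_family D z0 \<epsilon> \<epsilon>0)" by (simp add: \<Omega>(2))
  qed (use top Q0 qm fin in auto)
qed

section \<open>The conformal factor of the inversion and both types of centres\<close>

lemma has_derivative_inv_conj:
  assumes "z \<noteq> 0"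
  shows "(inv_conj has_derivative (\<lambda>h. - ((inv_conj z)\<^sup>2 * cnj h))) (at z)"
proof -
  have c: "(cnj has_derivative cnj) (at z)" by (rule bounded_linear.has_derivative[OF bounded_linear_cnj has_derivative_ident])
  have "((\<lambda>x. inverse (cnj x)) has_derivative (\<lambda>h. - (inverse (cnj z) * cnj h * inverse (cnj z)))) (at z)"
    by (rule Deriv.has_derivative_inverse) (use assms c in simp_all)
  then show ?thesis by (simp add: inv_conj_def[abs_def] power2_eq_square mult_ac)
qed

text \<open>The inversion reverses orientation, so the determinant changes sign; therefore the area
  estimates are stated with its absolute value.\<close>

lemma det2_lin_of_cnj: "det2 (\<lambda>h. lin_of a b (- (c * cnj h))) = - (norm c)\<^sup>2 * det2 (lin_of a b)"
  unfolding det2_lin_of cmod_power2 by (simp add: det2_def lin_of_def power2_eq_square algebra_simps)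

lemma borel_measurable_inv_conj: "inv_conj \<in> borel_measurable borel"
proof -
  have "cnj \<in> borel_measurable borel" by (intro borel_measurable_continuous_onI continuous_intros)
  then show ?thesis unfolding inv_conj_def[abs_def] by measurable
qed

lemma borel_measurable_tangential:
  assumes "u \<in> borel_measurable borel" "v \<in> borel_measurable borel"
  shows "tangential u v z0 \<in> borel_measurable borel"
proof -
  note [measurable] = assms
  show ?thesis unfolding tangential_def[abs_def] lin_of_def sgn_div_norm by measurable
qed

lemma inv_conj_exp_cis: "inv_conj (of_real (exp s) * cis t) = of_real (exp (- s)) * cis t"
  by (simp add: inv_conj_def exp_minus cis_cnj)

lemma AE_lborel_uminus:
  assumes "AE s in lborel. P (s::real)" shows "AE s in lborel. P (- s)"
proof -
  have "AE s in distr lborel borel uminus. P s" by (subst lborel_distr_uminus) (rule assms)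
  then show ?thesis by (rule AE_distrD[rotated]) simp
qed

lemma lower_Q_homeo_Some:
  assumes D: "open D" "connected D" "D \<noteq> {}" and fd: "finite_distortion_homeo D f"
    and z0: "Some z0 \<in> ext_plane closure_of (Some ` D)"
  shows "lower_Q_homeo_finite (Some ` D) (map_option f) (\<lambda>p. dilatation f (the p)) z0"
proof (rule finite_distortion_data[OF D(1) fd])
  fix f0 u v K N
  assume m: "f0 \<in> borel_measurable borel" "u \<in> borel_measurable borel" "v \<in> borel_measurable borel"
    and cont: "continuous_on D f" and inj: "inj_on f D" and f0: "\<And>z. z \<in> D \<Longrightarrow> f0 z = f z"
    and N: "negligible N" and K: "\<And>z :: complex. 1 \<le> (K z :: real)"
    and d: "\<And>z. z \<in> D - N \<Longrightarrow> (f has_derivative lin_of (u z) (v z)) (at z)"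
    and KD: "\<And>z. z \<in> D - N \<Longrightarrow> (onorm (lin_of (u z) (v z)))\<^sup>2 \<le> K z * det2 (lin_of (u z) (v z))"
    and circ: "\<And>z0. AE s in lborel. ACL_circle D f0 (tangential u v z0) z0 (exp s)"
  obtain h where h: "homeomorphism D (f ` D) f h" using fd unfolding finite_distortion_homeo_def by blast
  have ofD: "open (f ` D)" by (rule invariance_of_domain[OF cont D(1) inj])
  have im: "map_option f ` Some ` D = Some ` f ` D" by (simp add: image_image)
  show ?thesis
  proof (rule lower_Q_homeo_finiteI[where \<Omega>=D and F=f0 and N=N and F'="\<lambda>z. lin_of (u z) (v z)" and q="\<lambda>z. lin_dilatation (u z) (v z)"
        and g="tangential u v z0"])
    show "ext_domain (Some ` D)" by (rule ext_domain_Some[OF D])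
    show "ext_domain (map_option f ` Some ` D)" unfolding im
      by (rule ext_domain_Some[OF ofD connected_continuous_image[OF cont D(2)]]) (use D(3) in simp)
    show "homeomorphic_map (subtopology ext_plane (Some ` D)) (subtopology ext_plane (map_option f ` Some ` D)) (map_option f)"
      unfolding im by (rule homeomorphic_map_option[OF D(1) ofD h])
    show "continuous_on D f0" using continuous_on_eq[OF cont] f0 by simp
    show "inj_on f0 D" using inj f0 by (simp add: inj_on_def)
    show "map_option f (Some z) = Some (f0 z)" if "z \<in> D" for z using f0[OF that] by simp
    show "tangential u v z0 \<in> borel_measurable borel"
      by (rule borel_measurable_tangential[OF m(2,3)])
    show "(\<lambda>z. lin_dilatation (u z) (v z)) \<in> borel_measurable borel" by (rule borel_measurable_lin_dilatation[OF m(2,3)])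
    show "dilatation f (the (Some z)) = lin_dilatation (u z) (v z)" if "z \<in> D - N" for z
      using dilatation_eq[OF d[OF that] K KD[OF that]] by simp
    show "lin_dilatation (u z) (v z) < \<infinity>" if "z \<in> D - N" for z by (rule distortion_point(3)[OF K KD[OF that]])
    show "(f0 has_derivative lin_of (u z) (v z)) (at z)" if "z \<in> D - N" for z
      by (rule has_derivative_transform_within_open[OF d[OF that] D(1)]) (use that f0 in auto)
    show "(x * tangential u v z0 z)\<^sup>2 / lin_dilatation (u z) (v z) \<le> x\<^sup>2 * ennreal \<bar>det2 (lin_of (u z) (v z))\<bar>"
      if "z \<in> D - N" for z x
      unfolding tangential_def by (rule area_pointwise[OF K KD[OF that]]) (simp add: norm_mult norm_sgn)
  qed (use D(1) z0 m(1) N circ[of z0] in \<open>auto simp: dilatation_pos\<close>)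
qed

lemma lower_Q_homeo_None:
  assumes D: "open D" "connected D" "D \<noteq> {}" and fd: "finite_distortion_homeo D f"
    and z0: "None \<in> ext_plane closure_of (Some ` D)"
  shows "lower_Q_homeo_finite (circle_inversion -` Some ` D) (map_option f \<circ> circle_inversion)
    ((\<lambda>p. dilatation f (the p)) \<circ> circle_inversion) 0"
proof (rule finite_distortion_data[OF D(1) fd])
  fix f0 u v K N
  assume m: "f0 \<in> borel_measurable borel" "u \<in> borel_measurable borel" "v \<in> borel_measurable borel"
    and cont: "continuous_on D f" and inj: "inj_on f D" and f0: "\<And>z. z \<in> D \<Longrightarrow> f0 z = f z"
    and N: "negligible N" and K: "\<And>z :: complex. 1 \<le> (K z :: real)"
    and d: "\<And>z. z \<in> D - N \<Longrightarrow> (f has_derivative lin_of (u z) (v z)) (at z)"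
    and KD: "\<And>z. z \<in> D - N \<Longrightarrow> (onorm (lin_of (u z) (v z)))\<^sup>2 \<le> K z * det2 (lin_of (u z) (v z))"
    and circ: "\<And>z0. AE s in lborel. ACL_circle D f0 (tangential u v z0) z0 (exp s)"
  obtain h where h: "homeomorphism D (f ` D) f h" using fd unfolding finite_distortion_homeo_def by blast
  have ofD: "open (f ` D)" by (rule invariance_of_domain[OF cont D(1) inj])
  have im: "map_option f ` Some ` D = Some ` f ` D" by (simp add: image_image)
  let ?X = "circle_inversion -` Some ` D"
  have iX: "circle_inversion ` ?X = Some ` D"
    by (simp add: circle_inversion_vimage image_image circle_inversion_involution)
  have im': "(map_option f \<circ> circle_inversion) ` ?X = Some ` f ` D"
    unfolding image_comp[symmetric] iX im ..
  define \<Omega> where "\<Omega> = {z. z \<noteq> 0 \<and> inv_conj z \<in> D}"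
  \<comment> \<open>The inversion is differentiable away from \<open>0\<close>, so this point is
    removed before the null set is transported. Nothing is lost, because \<open>inv_conj z\<close>
    is nonzero for \<open>z\<close> in \<open>\<Omega>\<close>.\<close>
  define N' where "N' = inv_conj ` (N - {0})"
  have \<Omega>D: "z \<noteq> 0" "inv_conj z \<in> D" "f0 (inv_conj z) = f (inv_conj z)" if "z \<in> \<Omega>" for z
    using that f0 by (auto simp: \<Omega>_def)
  have \<Omega>N: "inv_conj z \<in> D - N" if "z \<in> \<Omega> - N'" for z
  proof -
    have "inv_conj z \<notin> N"
    proof
      assume "inv_conj z \<in> N"
      then have "inv_conj (inv_conj z) \<in> N'" using that unfolding N'_def by (intro imageI) (simp add: \<Omega>_def)
      then show False using that by simp
    qed
    then show ?thesis using that by (simp add: \<Omega>_def)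
  qed
  have N': "negligible N'"
    unfolding N'_def
  proof (rule negligible_differentiable_image_negligible[OF order_refl])
    show "negligible (N - {0})" using N by (rule negligible_diff)
    show "inv_conj differentiable_on N - {0}"
      unfolding differentiable_on_def
      by (auto intro: differentiable_at_withinI differentiableI has_derivative_inv_conj)
  qed
  have \<Omega>o: "open \<Omega>" unfolding \<Omega>_def by (rule open_inv_conj_preimage[OF D(1)])
  have contf0: "continuous_on D f0" using continuous_on_eq[OF cont] f0 by simp
  \<comment> \<open>\<open>(inverse (norm z))\<^sup>2\<close> is the linear scale of the
    anticonformal inversion: lengths are multiplied by it and areas by its square, which leaves the
    dilatation unchanged.\<close>
  define g where "g z = tangential u v 0 (inv_conj z) * ennreal ((inverse (norm z))\<^sup>2)" for z
  define F' where "F' z h = lin_of (u (inv_conj z)) (v (inv_conj z)) (- ((inv_conj z)\<^sup>2 * cnj h))" for z h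
  have exp2: "ennreal ((inverse (exp s))\<^sup>2) * ennreal (exp s) = ennreal (exp (- s))" for s :: real
    by (simp add: ennreal_mult[symmetric] exp_minus power2_eq_square)
  show ?thesis
  proof (rule lower_Q_homeo_finiteI[where \<Omega>=\<Omega> and F="f0 \<circ> inv_conj" and N=N' and F'=F' and g=g
        and q="\<lambda>z. lin_dilatation (u (inv_conj z)) (v (inv_conj z))"])
    show "ext_domain ?X" by (rule ext_domain_circle_inversion[OF ext_domain_Some[OF D]])
    show "ext_domain ((map_option f \<circ> circle_inversion) ` ?X)" unfolding im'
      by (rule ext_domain_Some[OF ofD connected_continuous_image[OF cont D(2)]]) (use D(3) in simp)
    show "homeomorphic_map (subtopology ext_plane ?X) (subtopology ext_plane ((map_option f \<circ> circle_inversion) ` ?X)) (map_option f \<circ> circle_inversion)"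
      unfolding im' by (rule homeomorphic_map_compose[OF homeomorphic_map_circle_inversion homeomorphic_map_option[OF D(1) ofD h]])
    show "Some 0 \<in> ext_plane closure_of ?X"
      using continuous_map_image_closure_subset[OF continuous_map_circle_inversion, of "Some ` D"] z0
      unfolding circle_inversion_vimage by (metis circle_inversion_None image_subset_iff)
    show "Some z \<in> ?X \<longleftrightarrow> z \<in> \<Omega>" for z by (auto simp: \<Omega>_def circle_inversion_Some)
    show "continuous_on \<Omega> (f0 \<circ> inv_conj)"
      by (rule continuous_on_compose[OF continuous_on_subset[OF continuous_on_inv_conj]])
        (auto simp: \<Omega>_def intro: continuous_on_subset[OF contf0])
    show "inj_on (f0 \<circ> inv_conj) \<Omega>"
    proof (rule inj_onI)
      fix x y assume xy: "x \<in> \<Omega>" "y \<in> \<Omega>" "(f0 \<circ> inv_conj) x = (f0 \<circ> inv_conj) y"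
      then have "inv_conj x = inv_conj y" using inj_onD[OF inj] \<Omega>D by simp
      then have "inv_conj (inv_conj x) = inv_conj (inv_conj y)" by (rule arg_cong)
      then show "x = y" by simp
    qed
    show "f0 \<circ> inv_conj \<in> borel_measurable borel" by (rule measurable_comp[OF borel_measurable_inv_conj m(1)])
    show "g \<in> borel_measurable borel"
    proof -
      note [measurable] = measurable_compose[OF borel_measurable_inv_conj borel_measurable_tangential[OF m(2,3), of 0]]
      show ?thesis unfolding g_def[abs_def] by measurable
    qed
    show "(\<lambda>z. lin_dilatation (u (inv_conj z)) (v (inv_conj z))) \<in> borel_measurable borel"
      by (rule measurable_compose[OF borel_measurable_inv_conj borel_measurable_lin_dilatation[OF m(2,3)]])
    show "(map_option f \<circ> circle_inversion) (Some z) = Some ((f0 \<circ> inv_conj) z)" if "z \<in> \<Omega>" for z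
      using \<Omega>D[OF that] by (simp add: circle_inversion_Some)
    show "0 < ((\<lambda>p. dilatation f (the p)) \<circ> circle_inversion) p" for p by (simp add: dilatation_pos)
    show "((\<lambda>p. dilatation f (the p)) \<circ> circle_inversion) (Some z) = lin_dilatation (u (inv_conj z)) (v (inv_conj z))" if "z \<in> \<Omega> - N'" for z
      using dilatation_eq[OF d[OF \<Omega>N[OF that]] K KD[OF \<Omega>N[OF that]]] \<Omega>D(1)[of z] that by (simp add: circle_inversion_Some)
    show "lin_dilatation (u (inv_conj z)) (v (inv_conj z)) < \<infinity>" if "z \<in> \<Omega> - N'" for z
      by (rule distortion_point(3)[OF K KD[OF \<Omega>N[OF that]]])
    show "(f0 \<circ> inv_conj has_derivative F' z) (at z)" if "z \<in> \<Omega> - N'" for z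
    proof -
      have "(f0 has_derivative lin_of (u (inv_conj z)) (v (inv_conj z))) (at (inv_conj z))"
        by (rule has_derivative_transform_within_open[OF d[OF \<Omega>N[OF that]] D(1)]) (use \<Omega>D[of z] that f0 in auto)
      from diff_chain_at[OF has_derivative_inv_conj this] \<Omega>D(1)[of z] that show ?thesis
        by (simp add: F'_def[abs_def] o_def)
    qed
    show "(x * g z)\<^sup>2 / lin_dilatation (u (inv_conj z)) (v (inv_conj z)) \<le> x\<^sup>2 * ennreal \<bar>det2 (F' z)\<bar>" if "z \<in> \<Omega> - N'" for z x
    proof -
      let ?a = "u (inv_conj z)" and ?b = "v (inv_conj z)" and ?r = "ennreal ((inverse (norm z))\<^sup>2)"
      have "((x * ?r) * ennreal (norm (lin_of ?a ?b (\<i> * sgn (inv_conj z)))))\<^sup>2 / lin_dilatation ?a ?b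
          \<le> (x * ?r)\<^sup>2 * ennreal \<bar>det2 (lin_of ?a ?b)\<bar>"
        by (rule area_pointwise[OF K KD[OF \<Omega>N[OF that]]]) (simp add: norm_mult norm_sgn)
      moreover have "\<bar>det2 (F' z)\<bar> = ((inverse (norm z))\<^sup>2)\<^sup>2 * \<bar>det2 (lin_of ?a ?b)\<bar>"
        unfolding F'_def[abs_def] det2_lin_of_cnj by (simp add: abs_mult norm_power)
      ultimately show ?thesis
        by (simp add: g_def tangential_def mult_ac power_mult_distrib ennreal_mult ennreal_power)
    qed
    show "AE s in lborel. ACL_circle \<Omega> (f0 \<circ> inv_conj) g 0 (exp s)"
      \<comment> \<open>The inversion sends the circle of radius \<open>exp s\<close> to that of
        radius \<open>exp (- s)\<close> and keeps angles; the reflection of a null set of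
        \<open>s\<close> is again a null set.\<close>
      using AE_lborel_uminus[OF circ[of 0]]
    proof eventually_elim
      case (elim s)
      have ge: "g (of_real (exp s) * cis t) * ennreal (exp s) = tangential u v 0 (of_real (exp (- s)) * cis t) * ennreal (exp (- s))" for t
        unfolding g_def inv_conj_exp_cis by (simp add: norm_mult mult.assoc exp2)
      have \<Omega>e: "of_real (exp s) * cis t \<in> \<Omega> \<longleftrightarrow> of_real (exp (- s)) * cis t \<in> D" for t
        unfolding \<Omega>_def mem_Collect_eq inv_conj_exp_cis by simp
      show ?case
        using elim unfolding ACL_circle_def add_0 ge \<Omega>e o_def inv_conj_exp_cis .
    qed
  qed (fact \<Omega>o N')+
qed

theorem theorem3p1:
  fixes D :: "complex set" and f :: "complex \<Rightarrow> complex" and z0 :: "complex option"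
  assumes "open D" and "connected D" and "D \<noteq> {}"
    and "finite_distortion_homeo D f"
    and "z0 \<in> ext_plane closure_of (Some ` D)"
  shows "lower_Q_homeo (Some ` D) (map_option f) (\<lambda>p. dilatation f (the p)) z0"
proof (cases z0)
  case None
  then show ?thesis using lower_Q_homeo_None[OF assms(1-4)] assms(5) by (simp add: lower_Q_homeo_def)
next
  case (Some w)
  then show ?thesis using lower_Q_homeo_Some[OF assms(1-4)] assms(5) by (simp add: lower_Q_homeo_def)
qed

end
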